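(* Let $\alpha_1,\dots,\alpha_n\in\mathbb{R}^2$, let $\gamma\in BV(\mathbb{S}^1;\{\alpha_1,\dots,\alpha_n\})$ be a function with a finite number of jump points, let $r>0$, and let $u:B_r\to\mathbb{R}^2$ be given by $u(x)=\gamma(x/|x|)$ for a.e. $x\in B_r$. Then $$\overline{\mathcal A}_{BV}(u,B_r)=\pi r^2+r\,L(\gamma)+\overline P(\gamma).$$
   Context: $B_r$ is the open disk of radius $r$ centred at the origin of $\mathbb{R}^2$, $\mathbb{S}^1=\partial B_1$. $L(\gamma):=|\dot\gamma|(\mathbb{S}^1)$ is the total variation of $\gamma$ on $\mathbb{S}^1$ (the sum of the sizes of its jumps). For $v\in C^1(B_r;\mathbb{R}^2)$, $\mathcal A(v,B_r)=\int_{B_r}\sqrt{1+|\nabla v|^2+|Jv|^2}\,dx$, $Jv=\det\nabla v$, $|\nabla v|$ the Frobenius norm. Strict $BV$ convergence means $L^1$ convergence together with convergence of the total variations. $\overline{\mathcal A}_{BV}(u,B_r)=\inf\{\liminf_k\mathcal A(u_k,B_r):u_k\in C^1(B_r;\mathbb{R}^2),\ u_k\to u\text{ strictly }BV(B_r;\mathbb{R}^2)\}$. For $\varphi\in\mathrm{Lip}(\mathbb{S}^1;\mathbb{R}^2)$, $P(\varphi)=\inf\{\int_{B_1}|Jv|\,dx:v\in\mathrm{Lip}(B_1;\mathbb{R}^2),\ v_{|\partial B_1}=\varphi\}$, and for $\gamma\in BV(\mathbb{S}^1;\mathbb{R}^2)$, $\overline P(\gamma)=\inf\{\liminf_kP(\varphi_k):\varphi_k\in\mathrm{Lip}(\mathbb{S}^1;\mathbb{R}^2),\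 \varphi_k\to\gamma\text{ strictly }BV(\mathbb{S}^1;\mathbb{R}^2)\}$. *)

theory Defs
  imports "HOL-Analysis.Analysis"
begin

definition C1_on :: "'a::real_normed_vector set \<Rightarrow> ('a \<Rightarrow> 'b::real_normed_vector) \<Rightarrow> bool" where
  "C1_on S f \<longleftrightarrow>
     (\<exists>f' :: 'a \<Rightarrow> 'a \<Rightarrow>\<^sub>L 'b.
        (\<forall>x\<in>S. (f has_derivative blinfun_apply (f' x)) (at x)) \<and> continuous_on S f')"

definition row_div :: "(real^'n \<Rightarrow> real^'n^'m) \<Rightarrow> real^'n \<Rightarrow> real^'m" where
  "row_div \<phi> x = (\<chi> i. \<Sum>j\<in>UNIV. frechet_derivative \<phi> (at x) (axis j 1) $ i $ j)"

definition BV_test :: "(real^'n) set \<Rightarrow> (real^'n \<Rightarrow> real^'n^'m) set" where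
  "BV_test \<Omega> = {\<phi>. C1_on UNIV \<phi> \<and> compact (closure {x. \<phi> x \<noteq> 0}) \<and>
                    closure {x. \<phi> x \<noteq> 0} \<subseteq> \<Omega> \<and> (\<forall>x. norm (\<phi> x) \<le> 1)}"

text \<open>The total variation \<open>|Du|(\<Omega>)\<close> of an integrable \<open>u\<close>, in its dual form. The norm on
  matrices is the Frobenius norm. Since \<open>\<phi> = 0\<close> is a test field, truncating negative values
  by \<open>ennreal\<close> does not change the supremum.\<close>

definition total_variation :: "(real^'n) set \<Rightarrow> (real^'n \<Rightarrow> real^'m) \<Rightarrow> ennreal" where
  "total_variation \<Omega> u =
     (SUP \<phi>\<in>BV_test \<Omega>. ennreal (LINT x|lebesgue_on \<Omega>. u x \<bullet> row_div \<phi> x))"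

definition BV :: "(real^'n) set \<Rightarrow> (real^'n \<Rightarrow> real^'m) set" where
  "BV \<Omega> = {u. integrable (lebesgue_on \<Omega>) u \<and> total_variation \<Omega> u < \<infinity>}"

definition strict_BV_conv ::
  "(real^'n) set \<Rightarrow> (nat \<Rightarrow> real^'n \<Rightarrow> real^'m) \<Rightarrow> (real^'n \<Rightarrow> real^'m) \<Rightarrow> bool" where
  "strict_BV_conv \<Omega> w u \<longleftrightarrow>
     (\<forall>k. w k \<in> BV \<Omega>) \<and> u \<in> BV \<Omega> \<and>
     (\<lambda>k. LINT x|lebesgue_on \<Omega>. norm (w k x - u x)) \<longlonglongrightarrow> 0 \<and>
     (\<lambda>k. total_variation \<Omega> (w k)) \<longlonglongrightarrow> total_variation \<Omega> u"

definition grad :: "(real^2 \<Rightarrow> real^2) \<Rightarrow> real^2 \<Rightarrow> real^2^2" where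
  "grad v x = matrix (frechet_derivative v (at x))"

definition area :: "(real^2 \<Rightarrow> real^2) \<Rightarrow> (real^2) set \<Rightarrow> ennreal" where
  "area v \<Omega> =
     (\<integral>\<^sup>+ x. ennreal (sqrt (1 + (norm (grad v x))\<^sup>2 + (det (grad v x))\<^sup>2)) \<partial>lebesgue_on \<Omega>)"

definition relaxed_area :: "(real^2 \<Rightarrow> real^2) \<Rightarrow> (real^2) set \<Rightarrow> ennreal" where
  "relaxed_area u \<Omega> =
     (INF w\<in>{w. (\<forall>k. C1_on \<Omega> (w k)) \<and> strict_BV_conv \<Omega> w u}. liminf (\<lambda>k. area (w k) \<Omega>))"

text \<open>A function on the circle is a function on the plane of which only the values on
  \<open>sphere 0 1\<close> matter. Integrals with respect to arc length are written in the angle, and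
  test functions on the circle are \<open>2\<pi>\<close>-periodic functions of the angle.
  Integrability, variation and jump points do not see changes on null sets of the circle.\<close>

definition circ :: "real \<Rightarrow> real^2" where
  "circ t = vector [cos t, sin t]"

definition circle_test :: "(real \<Rightarrow> real^2) set" where
  "circle_test = {\<psi>. C1_on UNIV \<psi> \<and> (\<forall>t. \<psi> (t + 2 * pi) = \<psi> t) \<and> (\<forall>t. norm (\<psi> t) \<le> 1)}"

definition circle_variation :: "(real^2 \<Rightarrow> real^2) \<Rightarrow> ennreal" where
  "circle_variation \<gamma> =
     (SUP \<psi>\<in>circle_test.
        ennreal (LINT t|lebesgue_on {0..2 * pi}. \<gamma> (circ t) \<bullet> vector_derivative \<psi> (at t)))"

definition circle_BV :: "(real^2 \<Rightarrow> real^2) set" where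
  "circle_BV = {\<gamma>. integrable (lebesgue_on {0..2 * pi}) (\<lambda>t. \<gamma> (circ t)) \<and>
                    circle_variation \<gamma> < \<infinity>}"

definition circle_strict_conv ::
  "(nat \<Rightarrow> real^2 \<Rightarrow> real^2) \<Rightarrow> (real^2 \<Rightarrow> real^2) \<Rightarrow> bool" where
  "circle_strict_conv \<phi> \<gamma> \<longleftrightarrow>
     (\<forall>k. \<phi> k \<in> circle_BV) \<and> \<gamma> \<in> circle_BV \<and>
     (\<lambda>k. LINT t|lebesgue_on {0..2 * pi}. norm (\<phi> k (circ t) - \<gamma> (circ t))) \<longlonglongrightarrow> 0 \<and>
     (\<lambda>k. circle_variation (\<phi> k)) \<longlonglongrightarrow> circle_variation \<gamma>"

text \<open>Approximate jump points: the one-sided approximate limits exist and differ.\<close>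

definition circle_jump_points :: "(real^2 \<Rightarrow> real^2) \<Rightarrow> (real^2) set" where
  "circle_jump_points \<gamma> = {circ t | t. \<exists>a b. a \<noteq> b \<and>
     ((\<lambda>\<rho>. (LINT s|lebesgue_on {t - \<rho>..t}. norm (\<gamma> (circ s) - a)) / \<rho>) \<longlongrightarrow> 0) (at_right 0) \<and>
     ((\<lambda>\<rho>. (LINT s|lebesgue_on {t..t + \<rho>}. norm (\<gamma> (circ s) - b)) / \<rho>) \<longlongrightarrow> 0) (at_right 0)}"

text \<open>A Lipschitz map on the open disk has a unique continuous extension to the closed disk;
  its boundary values are expressed as limits from inside. By Rademacher's theorem
  \<open>grad v x\<close> is the derivative at almost every \<open>x\<close>.\<close>

definition plateau_competitors :: "(real^2 \<Rightarrow> real^2) \<Rightarrow> (real^2 \<Rightarrow> real^2) set" where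
  "plateau_competitors \<phi> =
     {v. (\<exists>C. C-lipschitz_on (ball 0 1) v) \<and>
         (\<forall>x\<in>sphere 0 1. (v \<longlongrightarrow> \<phi> x) (at x within ball 0 1))}"

definition plateau :: "(real^2 \<Rightarrow> real^2) \<Rightarrow> ennreal" where
  "plateau \<phi> =
     (INF v\<in>plateau_competitors \<phi>. \<integral>\<^sup>+ x. ennreal \<bar>det (grad v x)\<bar> \<partial>lebesgue_on (ball 0 1))"

definition relaxed_plateau :: "(real^2 \<Rightarrow> real^2) \<Rightarrow> ennreal" where
  "relaxed_plateau \<gamma> =
     (INF \<phi>\<in>{\<phi>. (\<forall>k. \<exists>C. C-lipschitz_on (sphere 0 1) (\<phi> k)) \<and> circle_strict_conv \<phi> \<gamma>}.
        liminf (\<lambda>k. plateau (\<phi> k)))"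

end

theory Submission
  imports Defs
begin

text \<open>
  After a change on a null set, \<open>\<gamma>\<close> is a \<open>2\<pi>\<close>-periodic function \<open>f\<close> of the angle with finitely many values,
  and \<open>u\<close> is \<open>f\<close> of the polar angle, with total variation \<open>r L(\<gamma>)\<close>.

  Upper bound: given Lipschitz loops \<open>\<phi>\<close> converging strictly to \<open>\<gamma>\<close>, place a nearly optimal competitor
  for \<open>P(\<phi>)\<close> in a tiny disk and extend it by \<open>\<phi>(x/|x|)\<close> outside. Since
  \<open>sqrt (1 + |G|\<^sup>2 + J\<^sup>2) \<le> 1 + |G| + |J|\<close>, the area is at most \<open>\<pi> r\<^sup>2 + r L(\<phi>) + P(\<phi>)\<close> up to a
  small error, which survives mollification.

  Lower bound: let \<open>w\<close> converge strictly to \<open>u\<close>. By strict convergence the variation of \<open>w\<close> cannot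
  concentrate on a thin annulus, so an averaging argument finds a circle of radius at most \<open>\<delta>\<close> on
  which \<open>w\<close> converges strictly to \<open>\<gamma>\<close>, and the Jacobian of \<open>w\<close> inside it is at least \<open>P\<close> of the trace.
  Outside the disk of radius \<open>\<delta>\<close>, test \<open>Dw\<close> with a field supported in a thin angular sector set that
  carries almost all of the variation of \<open>f\<close>: on the sectors the integrand is at least the norm of the
  gradient and off them at least 1, which gives \<open>r L(\<gamma>) + \<pi> r\<^sup>2\<close> in the limit.
\<close>

text \<open>A loop of bounded variation with finitely many values has a derivative carried by
  finitely many angles. Cutting a test function off away from them costs nothing; this makes the
  sector set as thin as desired and lets gradient, constant and Jacobian be collected on disjoint
  sets. The obstacle is the trace on the small circle: \<open>relaxed_plateau\<close> asks for
  strict convergence, so the variation of the trace and its L1 distance to \<open>\<gamma>\<close>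
  must be controlled on the same circle. Both enter one integral over the radii, the distance with a
  weight that tends to infinity so slowly that its product with the distance on the disk still tends
  to 0. A radius where the integrand is at most slightly above its mean serves both purposes, and
  lower semicontinuity supplies the reverse inequality for the variations. In the upper bound the
  mollifier is a mean over small squares: its partial derivatives are averaged difference quotients,
  bounded by the Lipschitz constant and, by Rademacher's theorem, convergent almost everywhere, so
  the gradient and Jacobian integrals pass to the limit by dominated convergence.\<close>

lemmas HK_integrable_diff = Henstock_Kurzweil_Integration.integrable_diff
lemmas HK_integral_combine = Henstock_Kurzweil_Integration.integral_combine
lemmas HK_integral_diff = Henstock_Kurzweil_Integration.integral_diff

abbreviation disk_int :: "real => (real^2 => ennreal) => ennreal" where
  "disk_int r h \<equiv> \<integral>\<^sup>+x\<in>ball 0 r. h x \<partial>lborel"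

text \<open>The open interval is the one on which polar coordinates are injective;
  \<open>nn_integral_open_closed_interval\<close> restores the endpoints.\<close>

abbreviation arc_int :: "(real => ennreal) => ennreal" where
  "arc_int h \<equiv> \<integral>\<^sup>+t\<in>{0<..<2*pi}. h t \<partial>lborel"

abbreviation loop_pair :: "(real => 'a::euclidean_space) => (real => 'a) => real" where
  "loop_pair f g \<equiv> integral {0..2*pi} (\<lambda>t. f t \<bullet> g t)"

abbreviation borel_fun :: "('a::topological_space => 'b::topological_space) set" where
  "borel_fun \<equiv> borel_measurable borel"

section \<open>Coordinates of the plane and iterated integrals\<close>

definition pt :: "real => real => real^2" where
  "pt x y = vector [x, y]"

lemma pt_nth [simp]: "pt x y $ 1 = x" "pt x y $ 2 = y"
  by (simp_all add: pt_def)

lemma pt_eta [simp]: "pt (z $ 1) (z $ 2) = z"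
  by (simp add: vec_eq_iff forall_2)

lemma pt_eq_iff [simp]: "pt a b = pt c d \<longleftrightarrow> a = c \<and> b = d"
  by (auto simp: vec_eq_iff forall_2)

lemma pt_add: "pt a b + pt c d = pt (a + c) (b + d)"
  by (simp add: vec_eq_iff forall_2)

lemma pt_diff: "pt a b - pt c d = pt (a - c) (b - d)"
  by (simp add: vec_eq_iff forall_2)

lemma pt_scaleR: "k *\<^sub>R pt a b = pt (k * a) (k * b)"
  by (simp add: vec_eq_iff forall_2)

lemma pt_conv_axis: "pt x y = x *\<^sub>R axis 1 1 + y *\<^sub>R axis 2 1"
  by (simp add: vec_eq_iff forall_2 axis_def)

lemma continuous_on_pt [continuous_intros]:
  "continuous_on S f ==> continuous_on S g ==> continuous_on S (\<lambda>x. pt (f x) (g x))"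
  unfolding pt_conv_axis by (intro continuous_intros)

lemma borel_measurable_pt [measurable]:
  assumes [measurable]: "f \<in> borel_measurable M" "g \<in> borel_measurable M"
  shows "(\<lambda>x. pt (f x) (g x)) \<in> borel_measurable M"
  unfolding pt_conv_axis by measurable

lemma borel_measurable_nth2 [measurable]: "(\<lambda>x::real^2. x $ i) \<in> borel_fun"
  by (intro borel_measurable_continuous_onI continuous_intros)

lemma norm_real2: "norm (z :: real^2) = sqrt ((z $ 1)\<^sup>2 + (z $ 2)\<^sup>2)"
  by (simp add: norm_vec_def L2_set_def sum_2)

lemma Basis_real2: "(Basis :: (real^2) set) = {axis 1 1, axis 2 1}"
  by (auto simp: Basis_vec_def exhaust_2) (metis exhaust_2)

lemma prod_Basis_real2: "(\<Prod>b\<in>Basis. f b) = f (axis 1 1 :: real^2) * f (axis 2 1)"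
  by (simp add: Basis_real2 axis_eq_axis)

lemma mem_box_real2: "z \<in> box l u \<longleftrightarrow> l $ 1 < z $ 1 \<and> z $ 1 < u $ 1 \<and> l $ 2 < z $ 2 \<and> z $ 2 < (u::real^2) $ 2"
  by (auto simp: mem_box_cart forall_2)

lemma mem_cbox_real2: "z \<in> cbox l u \<longleftrightarrow> l $ 1 \<le> z $ 1 \<and> z $ 1 \<le> u $ 1 \<and> l $ 2 \<le> z $ 2 \<and> z $ 2 \<le> (u::real^2) $ 2"
  by (auto simp: mem_box_cart forall_2)

text \<open>Lebesgue measure is determined by its values on boxes, and \<open>pt\<close> turns a
  product of intervals into a box. Every iterated integral in the plane rests on this
  identity.\<close>

lemma lborel_real2: "lborel = distr (lborel \<Otimes>\<^sub>M lborel) borel (\<lambda>p. pt (fst p) (snd p))"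
proof (rule lborel_eqI)
  fix l u :: "real^2"
  assume lu: "\<And>b. b \<in> Basis ==> l \<bullet> b \<le> u \<bullet> b"
  have le: "l $ 1 \<le> u $ 1" "l $ 2 \<le> u $ 2"
    using lu[of "axis 1 1"] lu[of "axis 2 1"] by (auto simp: Basis_real2 inner_axis)
  have "emeasure (distr (lborel \<Otimes>\<^sub>M lborel) borel (\<lambda>p. pt (fst p) (snd p))) (box l u)
      = emeasure (lborel \<Otimes>\<^sub>M lborel) ((\<lambda>p. pt (fst p) (snd p)) -` box l u \<inter> space (lborel \<Otimes>\<^sub>M lborel))"
    by (intro emeasure_distr) auto
  also have "(\<lambda>p. pt (fst p) (snd p)) -` box l u \<inter> space (lborel \<Otimes>\<^sub>M lborel) = {l$1<..<u$1} \<times> {l$2<..<u$2}"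
    by (auto simp: space_pair_measure mem_box_real2)
  also have "emeasure (lborel \<Otimes>\<^sub>M lborel) \<dots> = emeasure lborel {l$1<..<u$1} * emeasure lborel {l$2<..<u$2}"
    by (intro lborel.emeasure_pair_measure_Times) auto
  also have "\<dots> = ennreal (\<Prod>b\<in>Basis. (u - l) \<bullet> b)"
    using le by (simp add: prod_Basis_real2 inner_axis ennreal_mult')
  finally show "emeasure (distr (lborel \<Otimes>\<^sub>M lborel) borel (\<lambda>p. pt (fst p) (snd p))) (box l u) = (\<Prod>b\<in>Basis. (u - l) \<bullet> b)" .
qed auto

lemma nn_integral_real2:
  assumes [measurable]: "g \<in> borel_fun"
  shows "(\<integral>\<^sup>+z. g z \<partial>lborel) = (\<integral>\<^sup>+x. \<integral>\<^sup>+y. g (pt x y) \<partial>lborel \<partial>lborel)"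
proof -
  have "(\<integral>\<^sup>+z. g z \<partial>lborel) = (\<integral>\<^sup>+p. g (pt (fst p) (snd p)) \<partial>(lborel \<Otimes>\<^sub>M lborel))"
    by (subst lborel_real2) (auto intro!: nn_integral_distr)
  also have "\<dots> = (\<integral>\<^sup>+x. \<integral>\<^sup>+y. g (pt x y) \<partial>lborel \<partial>lborel)"
    by (subst lborel.nn_integral_fst[symmetric]) auto
  finally show ?thesis .
qed

lemma nn_integral_real2':
  assumes [measurable]: "g \<in> borel_fun"
  shows "(\<integral>\<^sup>+z. g z \<partial>lborel) = (\<integral>\<^sup>+y. \<integral>\<^sup>+x. g (pt x y) \<partial>lborel \<partial>lborel)"
proof -
  have "(\<integral>\<^sup>+z. g z \<partial>lborel) = (\<integral>\<^sup>+x. \<integral>\<^sup>+y. g (pt x y) \<partial>lborel \<partial>lborel)"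
    by (rule nn_integral_real2) fact
  also have "\<dots> = (\<integral>\<^sup>+y. \<integral>\<^sup>+x. g (pt x y) \<partial>lborel \<partial>lborel)"
    by (rule lborel_pair.Fubini') auto
  finally show ?thesis .
qed

lemma lborel_integral_real2:
  fixes g :: "real^2 => 'b::{banach, second_countable_topology}"
  assumes g: "integrable lborel g"
  shows "(LINT z|lborel. g z) = (LINT x|lborel. LINT y|lborel. g (pt x y))"
    and "(LINT z|lborel. g z) = (LINT y|lborel. LINT x|lborel. g (pt x y))"
proof -
  have [measurable]: "g \<in> borel_fun"
    using g by auto
  have int: "integrable (lborel \<Otimes>\<^sub>M lborel) (\<lambda>p. g (pt (fst p) (snd p)))"
    using g by (subst (asm) lborel_real2) (auto simp: integrable_distr_eq)
  have eq: "(LINT z|lborel. g z) = (LINT p|(lborel \<Otimes>\<^sub>M lborel). g (pt (fst p) (snd p)))"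
    by (subst lborel_real2) (auto intro!: integral_distr)
  show "(LINT z|lborel. g z) = (LINT x|lborel. LINT y|lborel. g (pt x y))"
    unfolding eq using lborel_pair.integral_fst'[OF int] by simp
  show "(LINT z|lborel. g z) = (LINT y|lborel. LINT x|lborel. g (pt x y))"
    unfolding eq using lborel_pair.integral_fst'[OF int]  lborel_pair.Fubini_integral[of "\<lambda>x y. g (pt x y)"] int by (simp add: split_beta')
qed

section \<open>Polar coordinates\<close>

lemma circ_nth [simp]: "circ t $ 1 = cos t" "circ t $ 2 = sin t"
  by (simp_all add: circ_def)

lemma circ_conv_pt: "circ t = pt (cos t) (sin t)"
  by (simp add: vec_eq_iff forall_2)

lemma norm_circ [simp]: "norm (circ t) = 1"
  by (simp add: norm_real2)

lemma circ_periodic [simp]: "circ (t + 2 * pi) = circ t"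
  by (simp add: circ_conv_pt)

lemma continuous_on_circ [continuous_intros]:
  fixes f :: "'a::t2_space => real"
  shows "continuous_on S f ==> continuous_on S (\<lambda>x. circ (f x))"
  unfolding circ_conv_pt by (intro continuous_on_pt continuous_on_cos continuous_on_sin)

lemma borel_measurable_circ [measurable]:
  "f \<in> borel_measurable M ==> (\<lambda>x. circ (f x)) \<in> borel_measurable M"
  unfolding circ_conv_pt by measurable

text \<open>This branch of the argument jumps across the positive first axis. Periodic functions of
  it do not see the jump; \<open>angle_branch\<close> makes that precise.\<close>

definition angle :: "real^2 => real" where
  "angle z = Arg2pi (Complex (z $ 1) (z $ 2))"

lemma angle_bounds: "0 \<le> angle z" "angle z < 2 * pi"
  by (auto simp: angle_def Arg2pi)

lemma circ_angle: "norm z *\<^sub>R circ (angle z) = z"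
  using cos_Arg2pi[of "Complex (z $ 1) (z $ 2)"] sin_Arg2pi[of "Complex (z $ 1) (z $ 2)"]
  by (simp add: vec_eq_iff forall_2 angle_def norm_real2 cmod_def)

lemma angle_circ:
  assumes "\<rho> > 0" "0 \<le> t" "t < 2 * pi"
  shows "angle (\<rho> *\<^sub>R circ t) = t"
  unfolding angle_def
  by (rule Arg2pi_unique[OF _ assms])
     (simp add: complex_eq_iff Re_exp Im_exp)

text \<open>\<open>Arg2pi\<close> is continuous off the closed half-line of nonnegative reals and 0
  on it, so it is a Borel patch of two continuous functions.\<close>

lemma borel_measurable_angle [measurable]: "angle \<in> borel_fun"
proof -
  have cl: "closed (\<real>\<^sub>\<ge>\<^sub>0 :: complex set)" by (rule closed_nonneg_Reals_complex)
  have "(\<lambda>z. if z \<in> \<real>\<^sub>\<ge>\<^sub>0 then 0 else Arg2pi z) \<in> borel_fun"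
  proof (rule borel_measurable_continuous_on_if)
    show "(\<real>\<^sub>\<ge>\<^sub>0 :: complex set) \<in> sets borel" using cl by (rule borel_closed)
    show "continuous_on (- \<real>\<^sub>\<ge>\<^sub>0) Arg2pi"
      by (auto simp: continuous_on_eq_continuous_at open_Compl continuous_at_Arg2pi)
  qed auto
  also have "(\<lambda>z. if z \<in> \<real>\<^sub>\<ge>\<^sub>0 then 0 else Arg2pi z) = Arg2pi"
    using Arg2pi_eq_0 by (auto simp: complex_nonneg_Reals_iff complex_is_Real_iff fun_eq_iff)
  finally have [measurable]: "Arg2pi \<in> borel_fun" .
  have [measurable]: "(\<lambda>z::real^2. Complex (z $ 1) (z $ 2)) \<in> borel_fun"
    unfolding complex_eq by (intro borel_measurable_continuous_onI continuous_intros)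
  show ?thesis
    unfolding angle_def[abs_def] by measurable
qed

lemma has_derivative_polar:
  "((\<lambda>z::real^2. (z $ 1) *\<^sub>R circ (z $ 2)) has_derivative
     (\<lambda>h. h $ 1 *\<^sub>R circ (x $ 2) + (x $ 1 * h $ 2) *\<^sub>R pt (- sin (x $ 2)) (cos (x $ 2)))) (at x within S)"
proof -
  have nth: "((\<lambda>z::real^2. z $ i) has_derivative (\<lambda>h. h $ i)) (at x within S)" for i
    by (rule bounded_linear_imp_has_derivative) (rule bounded_linear_vec_nth)
  show ?thesis
    unfolding circ_conv_pt pt_conv_axis
    by (auto intro!: derivative_eq_intros nth simp: algebra_simps)
qed

text \<open>It suffices that the image under the polar map of the measure with density
  \<open>\<rho>\<close> agrees with Lebesgue measure on Borel subsets of the disk, and this is the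
  change of variables theorem for indicators.\<close>

lemma nn_integral_polar:
  assumes [measurable]: "g \<in> borel_fun"
  shows "disk_int r (\<lambda>z. g z) =
    (\<integral>\<^sup>+\<rho>\<in>{0<..<r}. (arc_int (\<lambda>t. ennreal \<rho> * g (\<rho> *\<^sub>R circ t))) \<partial>lborel)"
proof -
  define S where "S = box (pt 0 0) (pt r (2*pi))"
  define p where "p = (\<lambda>z::real^2. (z $ 1) *\<^sub>R circ (z $ 2))"
  define p' where "p' = (\<lambda>(x::real^2) (h::real^2). h $ 1 *\<^sub>R circ (x $ 2) + (x $ 1 * h $ 2) *\<^sub>R pt (- sin (x $ 2)) (cos (x $ 2)))"
  \<comment> \<open>The open box has an image that misses the nonnegative half-axis; the whole axis
    \<open>N\<close> is a null set containing what is missed.\<close>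
  define N where "N = {z::real^2. z $ 2 = 0}"
  have S: "S \<in> sets lebesgue" "S \<in> sets borel"
    by (auto simp: S_def)
  have memS: "x \<in> S \<longleftrightarrow> 0 < x $ 1 \<and> x $ 1 < r \<and> 0 < x $ 2 \<and> x $ 2 < 2 * pi" for x
    by (auto simp: S_def mem_box_real2)
  have der: "(p has_derivative p' x) (at x within S)" for x
    unfolding p_def p'_def by (rule has_derivative_polar)
  have det: "det (matrix (p' x)) = x $ 1" for x
  proof -
    have "x $ 1 * (cos (x $ 2))\<^sup>2 + x $ 1 * (sin (x $ 2))\<^sup>2 = x $ 1"
      by (simp flip: distrib_left)
    then show ?thesis
      by (simp add: det_2 matrix_def p'_def axis_def power2_eq_square algebra_simps)
  qed
  have inj: "inj_on p S"
  proof (rule inj_onI)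
    fix x y assume xy: "x \<in> S" "y \<in> S" "p x = p y"
    have "x $ 1 = y $ 1"
      using arg_cong[OF xy(3), of norm] xy(1,2) by (simp add: p_def memS)
    moreover have "x $ 2 = y $ 2"
      using arg_cong[OF xy(3), of angle] xy(1,2) by (simp add: p_def memS angle_circ)
    ultimately show "x = y"
      by (simp add: vec_eq_iff forall_2)
  qed
  have img: "p ` S \<subseteq> ball 0 r" "ball 0 r - N \<subseteq> p ` S"
  proof -
    show "p ` S \<subseteq> ball 0 r"
      by (auto simp: p_def memS dist_norm)
    show "ball 0 r - N \<subseteq> p ` S"
    proof
      fix z assume z: "z \<in> ball 0 r - N"
      have "z \<noteq> 0" using z by (auto simp: N_def)
      have "angle z \<noteq> 0"
      proof
        assume "angle z = 0"
        then have "z = norm z *\<^sub>R circ 0" using circ_angle[of z] by simp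
        then have "z $ 2 = 0" by (metis circ_nth(2) scaleR_zero_right sin_zero vector_scaleR_component real_scaleR_def mult_zero_right)
        then show False using z by (auto simp: N_def)
      qed
      then have "pt (norm z) (angle z) \<in> S"
        using z \<open>z \<noteq> 0\<close> angle_bounds[of z] by (auto simp: memS dist_norm less_le)
      moreover have "p (pt (norm z) (angle z)) = z"
        by (simp add: p_def circ_angle)
      ultimately show "z \<in> p ` S" by force
    qed
  qed
  have pm [measurable]: "p \<in> borel_fun"
    unfolding p_def by measurable
  have negN: "negligible N"
    unfolding N_def by (rule negligible_standard_hyperplane_cart)
  define M where "M = distr (density lborel (\<lambda>x. indicator S x * ennreal (x $ 1))) borel p"
  have eq: "emeasure M A = emeasure lborel (A \<inter> ball 0 r)" if A: "A \<in> sets borel" for A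
  proof -
    \<comment> \<open>The change of variables theorem speaks of vector-valued functions, so the
      indicator is given values in \<open>real^1\<close>.\<close>
    define f where "f = (\<lambda>x. vec (indicator A x) :: real^1)"
    have f_nth: "f x $ 1 = indicator A x" for x by (simp add: f_def)
    have lm: "A \<inter> ball 0 r \<in> lmeasurable"
      using A by (intro fmeasurable_Int_fmeasurable[of "ball 0 r" lebesgue "A", unfolded Int_commute[of _ A]] lmeasurable_ball) auto
    let ?m = "measure lebesgue (A \<inter> ball 0 r)"
    have "(indicator (A \<inter> ball 0 r) has_integral ?m) (UNIV :: (real^2) set)"
      using lm lmeasurable_iff_has_integral by blast
    moreover have "(\<lambda>x. if x \<in> ball 0 r then indicator A x else 0) = (indicator (A \<inter> ball 0 r) :: real^2 => real)"
      by (auto simp: indicator_def fun_eq_iff)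
    ultimately have "((\<lambda>x. indicator A x :: real) has_integral ?m) (ball 0 r)"
      by (subst has_integral_restrict_UNIV[symmetric]) simp
    then have 1: "((\<lambda>x. indicator A x :: real) has_integral ?m) (p ` S)"
      by (rule has_integral_spike_set_eq[THEN iffD1, rotated -1])
         (use img negN in \<open>auto intro!: negligible_subset[OF negN]\<close>)
    have 2: "(f has_integral vec ?m) (p ` S)"
      unfolding has_integral_componentwise_iff[of f]
      using 1 by (auto simp: Basis_vec_def inner_axis f_def)
    have 3: "f absolutely_integrable_on (p ` S)"
      by (rule nonnegative_absolutely_integrable)
         (use 2 in \<open>auto simp: Basis_vec_def inner_axis f_def\<close>)
    have "(\<lambda>x. \<bar>det (matrix (p' x))\<bar> *\<^sub>R f (p x)) absolutely_integrable_on S \<and>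
        integral S (\<lambda>x. \<bar>det (matrix (p' x))\<bar> *\<^sub>R f (p x)) = vec ?m"
      using has_absolute_integral_change_of_variables[OF S(1) der inj, of f "vec ?m"] 2 3
      by (auto dest: integral_unique)
    then have "((\<lambda>x. \<bar>det (matrix (p' x))\<bar> *\<^sub>R f (p x)) has_integral vec ?m) S"
      using has_integral_iff set_lebesgue_integral_eq_integral(1) by blast
    from has_integral_linear[OF this bounded_linear_vec_nth[of 1]]
    have 4: "((\<lambda>x. \<bar>x $ 1\<bar> * indicator A (p x)) has_integral ?m) S"
      by (simp add: o_def det f_nth)
    have "emeasure M A = (\<integral>\<^sup>+x. indicator S x * ennreal (x $ 1) * indicator (p -` A) x \<partial>lborel)"
      unfolding M_def using A S measurable_sets[OF pm A] by (subst emeasure_distr) (auto simp: emeasure_density)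
    also have "\<dots> = (\<integral>\<^sup>+x. ennreal (indicator S x * (\<bar>x $ 1\<bar> * indicator A (p x))) \<partial>lborel)"
      by (intro nn_integral_cong) (auto simp: indicator_def memS)
    also have "\<dots> = ennreal ?m"
      using nn_integral_has_integral_lebesgue[OF _ 4] by simp
    also have "\<dots> = emeasure lborel (A \<inter> ball 0 r)"
    proof -
      have "A \<inter> ball 0 r \<in> sets lborel" using A by auto
      moreover have "emeasure lborel (A \<inter> ball 0 r) \<noteq> \<infinity>"
        using emeasure_bounded_finite[of "A \<inter> ball 0 r"] by (simp add: bounded_Int less_top)
      ultimately show ?thesis
        using emeasure_eq_ennreal_measure[of lborel "A \<inter> ball 0 r"] measure_completion[of "A \<inter> ball 0 r" lborel] by (simp add: )
    qed
    finally show ?thesis .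
  qed
  have Meq: "M = density lborel (indicator (ball 0 r))"
  proof (rule measure_eqI)
    show "sets M = sets (density lborel (indicator (ball 0 r)))"
      by (simp add: M_def)
    fix A assume "A \<in> sets M"
    then have A: "A \<in> sets borel" by (simp add: M_def)
    have "emeasure (density lborel (indicator (ball 0 r))) A = (\<integral>\<^sup>+x. indicator (A \<inter> ball 0 r) x \<partial>lborel)"
      using A by (subst emeasure_density)
        (auto intro!: nn_integral_cong borel_measurable_indicator simp: indicator_inter_arith mult.commute simp del: nn_integral_indicator)
    also have "\<dots> = emeasure lborel (A \<inter> ball 0 r)"
      using A by (intro nn_integral_indicator) auto
    finally show "emeasure M A = emeasure (density lborel (indicator (ball 0 r))) A"
      using eq[OF A] by simp
  qed
  have "disk_int r (\<lambda>z. g z) = integral\<^sup>N M g"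
    unfolding Meq by (subst nn_integral_density) (auto simp: mult.commute intro!: borel_measurable_indicator)
  also have "\<dots> = (\<integral>\<^sup>+x. indicator S x * ennreal (x $ 1) * g (p x) \<partial>lborel)"
    unfolding M_def using S by (subst nn_integral_distr) (auto simp: nn_integral_density)
  also have "\<dots> = (\<integral>\<^sup>+x. \<integral>\<^sup>+y. indicator S (pt x y) * ennreal x * g (p (pt x y)) \<partial>lborel \<partial>lborel)"
    using S by (subst nn_integral_real2) auto
  also have "\<dots> = (\<integral>\<^sup>+\<rho>\<in>{0<..<r}. (arc_int (\<lambda>t. ennreal \<rho> * g (\<rho> *\<^sub>R circ t))) \<partial>lborel)"
    by (intro nn_integral_cong)
       (auto simp: nn_integral_multc[symmetric] memS p_def indicator_def intro!: nn_integral_cong)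
  finally show ?thesis .
qed

section \<open>Rademacher's theorem in the plane\<close>

lemma AE_lborel_negligible: "negligible N ==> AE x in lborel. x \<notin> N"
  using AE_completion_iff[of "\<lambda>x. x \<notin> N" lborel] AE_not_in[of N lebesgue]
  by (simp add: negligible_iff_null_sets)

text \<open>Adding \<open>(C + 1) * x\<close> turns \<open>f\<close> into an increasing
  homeomorphism \<open>F\<close> that is Lipschitz in both directions. Its inverse pushes Lebesgue
  measure forward to an absolutely continuous measure, and the Radon-Nikodym density of that measure
  is the derivative of \<open>F\<close> wherever its averages converge.\<close>

lemma lipschitz_real_derivative:
  fixes f :: "real => real"
  assumes lip: "C-lipschitz_on UNIV f"
  obtains N d where "negligible N" "\<And>x. x \<notin> N ==> (f has_real_derivative d x) (at x)"
    "\<And>a b. a \<le> b ==> (d has_integral (f b - f a)) {a..b}"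
proof -
  have C: "C \<ge> 0" using lip by (rule lipschitz_on_nonneg)
  define F where "F = (\<lambda>x. f x + (C + 1) * x)"
  have lipf: "\<bar>f x - f y\<bar> \<le> C * \<bar>x - y\<bar>" for x y
    using lipschitz_onD[OF lip, of x y] by (simp add: dist_real_def)
  have lipF: "\<bar>F x - F y\<bar> \<le> (2 * C + 1) * \<bar>x - y\<bar>" for x y
  proof -
    have "F x - F y = (f x - f y) + (C + 1) * (x - y)" by (simp add: F_def algebra_simps)
    then have "\<bar>F x - F y\<bar> \<le> \<bar>f x - f y\<bar> + (C + 1) * \<bar>x - y\<bar>"
      using abs_triangle_ineq[of "f x - f y" "(C + 1) * (x - y)"] C by (simp add: abs_mult)
    then show ?thesis using lipf[of x y] by (simp add: algebra_simps)
  qed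
  have incr: "F y - F x \<ge> y - x" if "x \<le> y" for x y
    using lipf[of x y] that by (simp add: F_def algebra_simps abs_if split: if_splits)
  have contF: "continuous_on UNIV F"
  proof (rule lipschitz_on_continuous_on)
    show "(2 * C + 1)-lipschitz_on UNIV F"
      using lipF C by (auto intro!: lipschitz_onI simp: dist_real_def)
  qed
  have sm: "strict_mono F"
    using incr by (intro strict_monoI) (smt (verit))
  then have injF: "inj F" by (rule strict_mono_imp_inj_on)
  have surjF: "surj F"
  proof -
    have "\<exists>x. F x = y" for y
    proof -
      let ?a = "- \<bar>y - F 0\<bar>" and ?b = "\<bar>y - F 0\<bar>"
      have "F ?a \<le> y" "y \<le> F ?b"
        using incr[of ?a 0] incr[of 0 ?b] by auto
      then have "\<exists>x\<ge>?a. x \<le> ?b \<and> F x = y"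
        using contF by (intro IVT') (auto intro: continuous_on_subset)
      then show ?thesis by auto
    qed
    then show ?thesis by (metis surjI surj_def)
  qed
  define G where "G = inv F"
  have GF [simp]: "G (F x) = x" and FG [simp]: "F (G y) = y" for x y
    using injF surjF by (auto simp: G_def surj_f_inv_f)
  have monoG: "mono G"
    by (rule monoI) (metis FG sm strict_mono_less_eq)
  have measG [measurable]: "G \<in> borel_fun"
    using monoG by (rule borel_measurable_mono)
  have vimG: "G -` A = F ` A" for A
    by (auto simp: image_iff) (metis FG)
  \<comment> \<open>The measure of a set under \<open>\<mu>\<close> is the length of its image under
    \<open>F\<close>; Lipschitz images of null sets are null.\<close>
  define \<mu> where "\<mu> = distr lborel borel G"
  have ac: "absolutely_continuous lborel \<mu>"
  proof (unfold absolutely_continuous_def, rule subsetI)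
    fix A :: "real set" assume A: "A \<in> null_sets lborel"
    then have "negligible A"
      by (simp add: negligible_iff_null_sets null_sets_completionI)
    then have "negligible (F ` A)"
      using lipF by (intro negligible_locally_Lipschitz_image[of A F]) 
        (auto intro!: exI[of _ UNIV] exI[of _ "2 * C + 1"])
    moreover have FA: "F ` A \<in> sets borel"
      using measurable_sets[OF measG, of A] A by (simp add: vimG[symmetric] null_sets_def)
    ultimately have "emeasure lborel (F ` A) = 0"
      using null_sets_completion_iff[of "F ` A" lborel] by (simp add: negligible_iff_null_sets null_setsD1)
    then show "A \<in> null_sets \<mu>"
      using A FA by (auto simp: null_sets_def \<mu>_def emeasure_distr vimG)
  qed
  obtain h where hm [measurable]: "h \<in> borel_fun" and h: "density lborel h = \<mu>"
    using sigma_finite_measure.Radon_Nikodym[OF sigma_finite_lborel ac] by (auto simp: \<mu>_def)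
  have hint: "(\<integral>\<^sup>+x\<in>{a..b}. h x \<partial>lborel) = ennreal (F b - F a)" if "a \<le> b" for a b
  proof -
    have "(\<integral>\<^sup>+x\<in>{a..b}. h x \<partial>lborel) = emeasure \<mu> {a..b}"
      unfolding h[symmetric] by (subst emeasure_density) auto
    also have "\<dots> = emeasure lborel (F ` {a..b})"
      by (simp add: \<mu>_def emeasure_distr vimG)
    also have "F ` {a..b} = {F a..F b}"
    proof -
      have "x \<in> F ` {a..b}" if "F a \<le> x" "x \<le> F b" for x
        using that monoD[OF monoG, of "F a" x] monoD[OF monoG, of x "F b"]
        by (intro image_eqI[of _ _ "G x"]) auto
      then show ?thesis
        using sm by (auto simp: strict_mono_less_eq)
    qed
    finally show ?thesis using that incr[OF that] by simp
  qed
  have hfin: "AE x in lborel. h x \<noteq> \<infinity>"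
  proof -
    have *: "AE x in lborel. x \<in> {- real n..real n} \<longrightarrow> h x \<noteq> \<infinity>" for n
    proof -
      have "(\<integral>\<^sup>+x. h x * indicator {- real n..real n} x \<partial>lborel) \<noteq> \<infinity>"
        by (subst hint) auto
      then have "AE x in lborel. h x * indicator {- real n..real n} x \<noteq> \<infinity>"
        by (intro nn_integral_PInf_AE) auto
      then show ?thesis by eventually_elim (auto simp: indicator_def)
    qed
    then have "AE x in lborel. \<forall>n. x \<in> {- real n..real n} \<longrightarrow> h x \<noteq> \<infinity>"
      using * unfolding AE_all_countable by blast
    then show ?thesis
    proof eventually_elim
      case (elim x)
      obtain n where "\<bar>x\<bar> \<le> real n" using real_arch_simple by blast
      then show ?case using elim by (auto simp: abs_le_iff)
    qed
  qed
  define k where "k = (\<lambda>x. enn2real (h x))"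
  have km [measurable]: "k \<in> borel_fun"
    unfolding k_def by measurable
  have kint: "(k has_integral (F b - F a)) {a..b}" if "a \<le> b" for a b
  proof -
    have "(\<integral>\<^sup>+x. ennreal (k x * indicator {a..b} x) \<partial>lborel) = (\<integral>\<^sup>+x\<in>{a..b}. h x \<partial>lborel)"
      using hfin by (intro nn_integral_cong_AE) (auto elim!: eventually_mono simp: k_def indicator_def less_top)
    also have "\<dots> = ennreal (F b - F a)"
      using hint[OF that] .
    finally have "((\<lambda>x. k x * indicator {a..b} x) has_integral (F b - F a)) UNIV"
      using incr[OF that] that by (intro nn_integral_has_integral) (auto simp: k_def)
    moreover have "(\<lambda>x. if x \<in> {a..b} then k x else 0) = (\<lambda>x. k x * indicator {a..b} x)"
      by auto
    ultimately show ?thesis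
      by (subst has_integral_restrict_UNIV[symmetric]) simp
  qed
  have kon: "k integrable_on cbox a b" for a b
    using kint[of a b] by (cases "a \<le> b") (auto simp: integrable_on_def)
  obtain N1 where N1: "negligible N1"
    "\<And>x e. \<lbrakk>x \<notin> N1; 0 < e\<rbrakk> \<Longrightarrow>  \<exists>d>0. \<forall>h. 0 < h \<and> h < d \<longrightarrow>
                 norm(integral (cbox x (x + h *\<^sub>R One)) k /\<^sub>R h ^ DIM(real) - k x) < e"
    using integrable_ccontinuous_explicit[OF kon] by blast
  \<comment> \<open>The averages above extend to the right of the point; the reflected density
    provides those to the left.\<close>
  have kon': "(\<lambda>x. k (- x)) integrable_on cbox a b" for a b
    using kon[of "-b" "-a"] Henstock_Kurzweil_Integration.integrable_reflect_real[where f=k and a="-b" and b="-a"] by simp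
  obtain N2 where N2: "negligible N2"
    "\<And>x e. \<lbrakk>x \<notin> N2; 0 < e\<rbrakk> \<Longrightarrow>  \<exists>d>0. \<forall>h. 0 < h \<and> h < d \<longrightarrow>
                 norm(integral (cbox x (x + h *\<^sub>R One)) (\<lambda>x. k (-x)) /\<^sub>R h ^ DIM(real) - k (-x)) < e"
    using integrable_ccontinuous_explicit[OF kon'] by blast
  have derF: "(F has_real_derivative k x) (at x)" if x: "x \<notin> N1" "- x \<notin> N2" for x
    unfolding DERIV_def LIM_eq
  proof (intro allI impI)
    fix e :: real assume e: "e > 0"
    obtain d1 where d1: "d1 > 0" "\<And>h. 0 < h ==> h < d1 ==> \<bar>(F (x + h) - F x) / h - k x\<bar> < e"
    proof -
      obtain d where "d > 0" and d: "\<And>h. 0 < h ==> h < d ==> norm(integral (cbox x (x + h *\<^sub>R One)) k /\<^sub>R h ^ DIM(real) - k x) < e"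
        using N1(2)[OF x(1) e] by blast
      have "\<bar>(F (x + h) - F x) / h - k x\<bar> < e" if "0 < h" "h < d" for h
        using d[OF that] integral_unique[OF kint[of x "x + h"]] that by (simp add: divide_inverse_commute)
      then show ?thesis using that \<open>d > 0\<close> by blast
    qed
    obtain d2 where d2: "d2 > 0" "\<And>h. 0 < h ==> h < d2 ==> \<bar>(F x - F (x - h)) / h - k x\<bar> < e"
    proof -
      obtain d where "d > 0" and d: "\<And>h. 0 < h ==> h < d ==> norm(integral (cbox (-x) (-x + h *\<^sub>R One)) (\<lambda>x. k (-x)) /\<^sub>R h ^ DIM(real) - k (- (- x))) < e"
        using N2(2)[OF x(2) e] by blast
      have "\<bar>(F x - F (x - h)) / h - k x\<bar> < e" if "0 < h" "h < d" for h
      proof -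
        have "integral {-x..- (x - h)} (\<lambda>x. k (-x)) = integral {x - h..x} k"
          by (rule Henstock_Kurzweil_Integration.integral_reflect_real)
        then show ?thesis
          using d[OF that] integral_unique[OF kint[of "x - h" "x"]] that by (simp add: divide_inverse_commute)
      qed
      then show ?thesis using that \<open>d > 0\<close> by blast
    qed
    show "\<exists>s>0. \<forall>h. h \<noteq> 0 \<and> norm (h - 0) < s \<longrightarrow> norm ((F (x + h) - F x) / h - k x) < e"
    proof (intro exI[of _ "min d1 d2"] conjI allI impI)
      fix h :: real assume h: "h \<noteq> 0 \<and> norm (h - 0) < min d1 d2"
      show "norm ((F (x + h) - F x) / h - k x) < e"
      proof (cases "h > 0")
        case True then show ?thesis using d1(2)[of h] h by simp
      next
        case False
        have "(F (x + h) - F x) / h = (F x - F (x - (-h))) / (-h)"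
          using h by (simp add: field_simps)
        then show ?thesis using d2(2)[of "-h"] h False by simp
      qed
    qed (use d1 d2 in auto)
  qed
  show ?thesis
  proof (rule that)
    show "negligible (N1 \<union> uminus ` N2)"
      using N1(1) N2(1)
      by (intro negligible_Un negligible_differentiable_image_negligible) (auto intro!: derivative_intros)
    fix x assume "x \<notin> N1 \<union> uminus ` N2"
    then have x: "x \<notin> N1" "- x \<notin> N2" by (auto simp: image_iff)
    have "((\<lambda>x. F x - (C + 1) * x) has_real_derivative k x - (C + 1)) (at x)"
      by (auto intro!: derivative_eq_intros derF x)
    then show "(f has_real_derivative k x - (C + 1)) (at x)"
      by (simp add: F_def)
  next
    fix a b :: real assume ab: "a \<le> b"
    have "((\<lambda>x. k x - (C + 1)) has_integral (F b - F a) - (C + 1) * (b - a)) {a..b}"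
      using has_integral_diff[OF kint[OF ab] has_integral_const_real[where c="C + 1" and a=a and b=b]] ab by (simp add: algebra_simps)
    then show "((\<lambda>x. k x - (C + 1)) has_integral (f b - f a)) {a..b}"
      by (simp add: F_def algebra_simps)
  qed
qed

text \<open>The derivative is named by a formula so that, in the plane, the partial derivatives are
  Borel in both variables jointly; a derivative chosen separately on each line would not be. The
  clipping to \<open>[- C, C]\<close> provides a bound also where the difference quotients diverge
  and \<open>lim\<close> is arbitrary.\<close>

lemma lipschitz_difference_quotient_integral:
  fixes f :: "real => real"
  assumes lip: "C-lipschitz_on UNIV f"
  defines "d \<equiv> \<lambda>x. max (- C) (min C (lim (\<lambda>n. (f (x + inverse (Suc n)) - f x) /\<^sub>R inverse (Suc n))))"
  assumes "a \<le> b"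
  shows "(d has_integral (f b - f a)) {a..b}"
proof -
  obtain N d' where N: "negligible N" "\<And>x. x \<notin> N ==> (f has_real_derivative d' x) (at x)"
    "\<And>a b. a \<le> b ==> (d' has_integral (f b - f a)) {a..b}"
    using lipschitz_real_derivative[OF lip] by metis
  have "d x = d' x" if "x \<notin> N" for x
  proof -
    have *: "((\<lambda>h. (f (x + h) - f x) / h) \<longlongrightarrow> d' x) (at 0)"
      using N(2)[OF that] by (simp add: DERIV_def)
    have "(\<lambda>n. (f (x + inverse (real (Suc n))) - f x) / inverse (real (Suc n))) \<longlonglongrightarrow> d' x"
      by (rule filterlim_compose[OF *])
        (auto simp: filterlim_at simp del: of_nat_Suc intro!: LIMSEQ_inverse_real_of_nat)
    then have "(\<lambda>n. (f (x + inverse (real (Suc n))) - f x) /\<^sub>R inverse (real (Suc n))) \<longlonglongrightarrow> d' x"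
      by (simp only: real_scaleR_def divide_inverse mult.commute[of "_ - _"])
    then have 1: "lim (\<lambda>n. (f (x + inverse (real (Suc n))) - f x) /\<^sub>R inverse (real (Suc n))) = d' x"
      by (rule limI)
    have "\<bar>d' x\<bar> \<le> C"
    proof (rule tendsto_upperbound[OF tendsto_rabs[OF *]])
      show "\<forall>\<^sub>F h in at 0. \<bar>(f (x + h) - f x) / h\<bar> \<le> C"
        using lipschitz_onD[OF lip] by (intro eventually_at_filter[THEN iffD2] always_eventually)
          (auto simp: dist_real_def abs_divide divide_le_eq, (metis add_diff_cancel_left' UNIV_I)+)
    qed simp
    with 1 show ?thesis by (simp add: d_def)
  qed
  then show ?thesis
    using has_integral_spike[OF N(1) _ N(3)[OF \<open>a \<le> b\<close>]] by blast
qed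

text \<open>From the origin to \<open>y\<close> runs a path with one horizontal and one vertical
  segment along which the partial derivative contributes at most \<open>2 * \<epsilon> * h\<close>.
  Both lines are found by Chebyshev's inequality within \<open>\<epsilon> * h\<close> of where they
  ought to be, and the Lipschitz bound pays for the two displacements.\<close>

lemma lipschitz_small_gradient:
  fixes q g1 g2 :: "real^2 => real"
  assumes lip: "K-lipschitz_on UNIV q" and q0: "q 0 = 0"
    and [measurable]: "g1 \<in> borel_fun" "g2 \<in> borel_fun"
    and ftc1: "\<And>a b y. a \<le> b ==> ((\<lambda>s. g1 (pt s y)) has_integral (q (pt b y) - q (pt a y))) {a..b}"
    and ftc2: "\<And>a b x. a \<le> b ==> ((\<lambda>s. g2 (pt x s)) has_integral (q (pt x b) - q (pt x a))) {a..b}"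
    and h: "h > 0" and \<epsilon>: "0 < \<epsilon>" "\<epsilon> \<le> 1"
    and small1: "(\<integral>\<^sup>+z\<in>cbox 0 (pt h h). ennreal \<bar>g1 z\<bar> \<partial>lborel) \<le> ennreal (\<epsilon>\<^sup>2 * h\<^sup>2)"
    and small2: "(\<integral>\<^sup>+z\<in>cbox 0 (pt h h). ennreal \<bar>g2 z\<bar> \<partial>lborel) \<le> ennreal (\<epsilon>\<^sup>2 * h\<^sup>2)"
    and y: "y \<in> cbox 0 (pt h h)"
  shows "\<bar>q y\<bar> \<le> (4 + 2 * K) * \<epsilon> * h"
proof -
  have K: "K \<ge> 0" using lip by (rule lipschitz_on_nonneg)
  \<comment> \<open>Were the inner integral larger than \<open>2 * \<epsilon> * h\<close> on an
    interval of length \<open>\<epsilon> * h\<close>, the double integral would be at least twice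
    its assumed bound.\<close>
  have pick: "\<exists>t\<in>{c..c + \<epsilon> * h}. G t \<le> ennreal (2 * \<epsilon> * h)"
    if c: "0 \<le> c" "c + \<epsilon> * h \<le> h" and G: "(\<integral>\<^sup>+t\<in>{0..h}. G t \<partial>lborel) \<le> ennreal (\<epsilon>\<^sup>2 * h\<^sup>2)" for c and G :: "real => ennreal"
  proof (rule ccontr)
    assume n: "\<not> ?thesis"
    have "ennreal (2 * \<epsilon>\<^sup>2 * h\<^sup>2) = (\<integral>\<^sup>+t. ennreal (2 * \<epsilon> * h) * indicator {c..c + \<epsilon> * h} t \<partial>lborel)"
      using h \<epsilon> by (subst nn_integral_cmult_indicator) (auto simp: ennreal_mult[symmetric] power2_eq_square algebra_simps)
    also have "\<dots> \<le> (\<integral>\<^sup>+t\<in>{0..h}. G t \<partial>lborel)"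
      using n c by (intro nn_integral_mono) (auto simp: indicator_def not_le less_imp_le)
    also have "\<dots> \<le> ennreal (\<epsilon>\<^sup>2 * h\<^sup>2)" by fact
    finally have "2 * \<epsilon>\<^sup>2 * h\<^sup>2 \<le> \<epsilon>\<^sup>2 * h\<^sup>2"
      by (subst (asm) ennreal_le_iff) auto
    moreover have "\<epsilon>\<^sup>2 * h\<^sup>2 > 0" using h \<epsilon> by simp
    ultimately show False by linarith
  qed
  have bound: "\<bar>P b - P a\<bar> \<le> B"
    if ab: "0 \<le> a" "0 \<le> b" "a \<le> h" "b \<le> h" and P: "\<And>a b. a \<le> b ==> (p has_integral (P b - P a)) {a..b}"
    and B: "(\<integral>\<^sup>+s\<in>{0..h}. ennreal \<bar>p s\<bar> \<partial>lborel) \<le> ennreal B" "B \<ge> 0"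
    and [measurable]: "p \<in> borel_fun" for a b P B and p :: "real => real"
  proof -
    have main: "\<bar>P b - P a\<bar> \<le> B" if ab: "0 \<le> a" "a \<le> b" "b \<le> h" for a b
    proof -
      have "(\<integral>\<^sup>+s. ennreal (\<bar>p s\<bar> * indicator {a..b} s) \<partial>lborel) \<le> (\<integral>\<^sup>+s\<in>{0..h}. ennreal \<bar>p s\<bar> \<partial>lborel)"
        using ab by (intro nn_integral_mono) (auto simp: indicator_def)
      also have "\<dots> \<le> ennreal B" by fact
      finally have "(\<integral>\<^sup>+s. ennreal (\<bar>p s\<bar> * indicator {a..b} s) \<partial>lborel) \<le> ennreal B" .
      then obtain r where r: "r \<ge> 0" "(\<integral>\<^sup>+s. ennreal (\<bar>p s\<bar> * indicator {a..b} s) \<partial>lborel) = ennreal r" "r \<le> B"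
        using le_ennreal_iff[OF B(2)] by blast
      have "((\<lambda>s. \<bar>p s\<bar> * indicator {a..b} s) has_integral r) UNIV"
        using r by (intro nn_integral_has_integral) auto
      moreover have "(\<lambda>x. if x \<in> {a..b} then \<bar>p x\<bar> else 0) = (\<lambda>x. \<bar>p x\<bar> * indicator {a..b} x)"
        by auto
      ultimately have i: "((\<lambda>s. \<bar>p s\<bar>) has_integral r) {a..b}"
        by (subst has_integral_restrict_UNIV[symmetric]) simp
      have "norm (integral {a..b} p) \<le> integral {a..b} (\<lambda>s. \<bar>p s\<bar>)"
        using i P[OF ab(2)] by (intro integral_norm_bound_integral) (auto simp: has_integral_integrable)
      then show ?thesis using integral_unique[OF i] integral_unique[OF P[OF ab(2)]] r by simp
    qed
    show ?thesis
      using main[of a b] main[of b a] ab by (cases "a \<le> b") (auto simp: abs_minus_commute)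
  qed
  have lipq: "\<bar>q z - q w\<bar> \<le> K * norm (z - w)" for z w
    using lipschitz_onD[OF lip, of z w] by (simp add: dist_norm)
  have eh: "\<epsilon> * h \<le> h" using h \<epsilon> by simp
  have y': "0 \<le> y $ 1" "y $ 1 \<le> h" "0 \<le> y $ 2" "y $ 2 \<le> h"
    using y by (auto simp: mem_cbox_real2)
  have c0: "cbox 0 (pt h h) = {z. z $ 1 \<in> {0..h} \<and> z $ 2 \<in> {0..h}}"
    by (auto simp: mem_cbox_real2)
  have "(\<integral>\<^sup>+t\<in>{0..h}. (\<integral>\<^sup>+s\<in>{0..h}. ennreal \<bar>g1 (pt s t)\<bar> \<partial>lborel) \<partial>lborel) =
      (\<integral>\<^sup>+z\<in>cbox 0 (pt h h). ennreal \<bar>g1 z\<bar> \<partial>lborel)"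
    by (subst nn_integral_real2') (auto simp: nn_integral_multc[symmetric] c0 indicator_def intro!: nn_integral_cong)
  then obtain y2 where y2: "y2 \<in> {0..0 + \<epsilon> * h}" "(\<integral>\<^sup>+s\<in>{0..h}. ennreal \<bar>g1 (pt s y2)\<bar> \<partial>lborel) \<le> ennreal (2 * \<epsilon> * h)"
    using pick[of 0 "\<lambda>t. \<integral>\<^sup>+s\<in>{0..h}. ennreal \<bar>g1 (pt s t)\<bar> \<partial>lborel"] small1 eh by auto
  have I2: "(\<integral>\<^sup>+t\<in>{0..h}. (\<integral>\<^sup>+s\<in>{0..h}. ennreal \<bar>g2 (pt t s)\<bar> \<partial>lborel) \<partial>lborel) =
      (\<integral>\<^sup>+z\<in>cbox 0 (pt h h). ennreal \<bar>g2 z\<bar> \<partial>lborel)"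
    by (subst nn_integral_real2) (auto simp: nn_integral_multc[symmetric] c0 indicator_def intro!: nn_integral_cong)
  \<comment> \<open>Shifted to the left where necessary, so that the interval of length
    \<open>\<epsilon> * h\<close> stays in \<open>[0, h]\<close> and still contains
    \<open>y $ 1\<close>.\<close>
  define c where "c = min (y $ 1) (h - \<epsilon> * h)"
  have c: "0 \<le> c" "c + \<epsilon> * h \<le> h" "c \<le> y $ 1" "y $ 1 \<le> c + \<epsilon> * h"
    using y' eh h \<epsilon> mult_nonneg_nonneg[of \<epsilon> h] by (auto simp: c_def min_def)
  obtain s where s: "s \<in> {c..c + \<epsilon> * h}" "(\<integral>\<^sup>+t\<in>{0..h}. ennreal \<bar>g2 (pt s t)\<bar> \<partial>lborel) \<le> ennreal (2 * \<epsilon> * h)"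
    using pick[of c "\<lambda>t. \<integral>\<^sup>+s\<in>{0..h}. ennreal \<bar>g2 (pt t s)\<bar> \<partial>lborel"] small2 c I2 by auto
  have s': "0 \<le> s" "s \<le> h" "0 \<le> y2" "y2 \<le> h" using s y2 c eh by auto
  have 1: "\<bar>q (pt s y2) - q (pt 0 y2)\<bar> \<le> 2 * \<epsilon> * h"
    using s' h \<epsilon> by (intro bound[where p="\<lambda>s. g1 (pt s y2)" and P="\<lambda>s. q (pt s y2)", OF _ _ _ _ ftc1 y2(2)]) auto
  have 2: "\<bar>q (pt s (y $ 2)) - q (pt s y2)\<bar> \<le> 2 * \<epsilon> * h"
    using s' y' h \<epsilon> by (intro bound[where p="\<lambda>t. g2 (pt s t)" and P="\<lambda>t. q (pt s t)", OF _ _ _ _ ftc2 s(2)]) auto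
  have 3: "\<bar>q (pt 0 y2)\<bar> \<le> K * (\<epsilon> * h)"
  proof -
    have "\<bar>q (pt 0 y2)\<bar> \<le> K * norm (pt 0 y2)"
      using lipq[of "pt 0 y2" 0] q0 by simp
    also have "\<dots> \<le> K * (\<epsilon> * h)"
      using y2 K by (intro mult_left_mono) (auto simp: norm_real2)
    finally show ?thesis .
  qed
  have 4: "\<bar>q y - q (pt s (y $ 2))\<bar> \<le> K * (\<epsilon> * h)"
  proof -
    have "norm (y - pt s (y $ 2)) = \<bar>y $ 1 - s\<bar>" by (simp add: norm_real2)
    then have "\<bar>q y - q (pt s (y $ 2))\<bar> \<le> K * \<bar>y $ 1 - s\<bar>"
      using lipq[of y "pt s (y $ 2)"] by simp
    also have "\<dots> \<le> K * (\<epsilon> * h)"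
      using s c K by (intro mult_left_mono) auto
    finally show ?thesis .
  qed
  have "\<bar>q y\<bar> \<le> 2 * (2 * \<epsilon> * h) + 2 * (K * (\<epsilon> * h))"
    using 1 2 3 4 by linarith
  also have "\<dots> = (4 + 2 * K) * \<epsilon> * h" by (simp add: algebra_simps)
  finally show ?thesis .
qed

lemma bounded_borel_integrable_on:
  fixes g :: "'a::euclidean_space => 'b::euclidean_space"
  assumes [measurable]: "g \<in> borel_fun" and S: "S \<in> sets borel" "bounded S" and B: "\<And>x. norm (g x) \<le> B"
  shows "set_integrable lborel S g" "g integrable_on S"
proof -
  show "set_integrable lborel S g"
    unfolding set_integrable_def
  proof (rule integrableI_bounded_set_indicator)
    show "emeasure lborel S < \<infinity>" using emeasure_bounded_finite[OF S(2)] by simp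
    show "AE x in lborel. x \<in> S \<longrightarrow> norm (g x) \<le> B" using B by simp
  qed (use S in simp_all)
  then show "g integrable_on S"
    by (rule set_borel_integral_eq_integral)
qed

lemma One_real2: "(One :: real^2) = pt 1 1"
  by (simp add: Basis_real2 axis_eq_axis pt_conv_axis)

section \<open>Lebesgue points in the four quadrants\<close>

lemma nn_integral_translate:
  fixes c :: "'a::euclidean_space"
  assumes [measurable]: "F \<in> borel_fun"
  shows "(\<integral>\<^sup>+x. F (c + x) \<partial>lborel) = (\<integral>\<^sup>+x. F x \<partial>lborel)"
proof -
  have "(\<integral>\<^sup>+x. F x \<partial>lborel) = (\<integral>\<^sup>+x. F x \<partial>distr lborel borel ((+) c))"
    by (simp add: lborel_distr_plus)
  then show ?thesis by (simp add: nn_integral_distr)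
qed

text \<open>For \<open>\<sigma>\<close> and \<open>\<tau>\<close> equal to 1 or -1 these are the
  identity, the reflections in the axes and the point reflection. The averages of the
  differentiation theorem extend from a point to the upper right only; composing with these four
  maps covers a full neighbourhood.\<close>

definition sgn_pt :: "real => real => real^2 => real^2" where
  "sgn_pt \<sigma> \<tau> z = pt (\<sigma> * z $ 1) (\<tau> * z $ 2)"

lemma sgn_pt_nth [simp]: "sgn_pt \<sigma> \<tau> z $ 1 = \<sigma> * z $ 1" "sgn_pt \<sigma> \<tau> z $ 2 = \<tau> * z $ 2"
  by (simp_all add: sgn_pt_def)

lemma borel_measurable_sgn_pt [measurable]: "sgn_pt \<sigma> \<tau> \<in> borel_fun"
  unfolding sgn_pt_def[abs_def] by measurable

lemma sgn_pt_add: "sgn_pt \<sigma> \<tau> (y + z) = sgn_pt \<sigma> \<tau> y + sgn_pt \<sigma> \<tau> z"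
  by (simp add: sgn_pt_def pt_add algebra_simps)

lemma sgn_pt_involution: "\<sigma> * \<sigma> = 1 ==> \<tau> * \<tau> = 1 ==> sgn_pt \<sigma> \<tau> (sgn_pt \<sigma> \<tau> z) = z"
  by (simp add: sgn_pt_def vec_eq_iff forall_2 mult.assoc[symmetric])

lemma linear_sgn_pt: "linear (sgn_pt \<sigma> \<tau>)"
  by (intro linearI) (auto simp: sgn_pt_def pt_add pt_scaleR algebra_simps)

text \<open>The differentiation theorem is applied to the distance of \<open>g\<close> from each
  rational \<open>c\<close>, which discards countably many null sets. Off their union, a rational
  \<open>c\<close> close to \<open>g x\<close> turns convergence of the averages into the Lebesgue
  point property at \<open>x\<close>.\<close>

lemma lebesgue_points_quadrant:
  fixes g :: "real^2 => real"
  assumes [measurable]: "g \<in> borel_fun" and B: "\<And>x. \<bar>g x\<bar> \<le> B"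
    and \<sigma>: "\<sigma> * \<sigma> = 1" "\<tau> * \<tau> = (1::real)"
  obtains N where "negligible N"
    "\<And>x \<epsilon>. x \<notin> N ==> \<epsilon> > 0 ==> \<exists>d>0. \<forall>h. 0 < h \<and> h < d \<longrightarrow>
       (\<integral>\<^sup>+y\<in>cbox 0 (pt h h). ennreal \<bar>g (x + sgn_pt \<sigma> \<tau> y) - g x\<bar> \<partial>lborel) \<le> ennreal (\<epsilon> * h\<^sup>2)"
proof -
  let ?T = "sgn_pt \<sigma> \<tau>"
  define G where "G = (\<lambda>c y. \<bar>g (?T y) - c\<bar>)"
  have Gm [measurable]: "G c \<in> borel_fun" for c
    unfolding G_def by measurable
  have Gb: "norm (G c y) \<le> B + \<bar>c\<bar>" for c y
    using B[of "?T y"] by (auto simp: G_def)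
  have Gint: "set_integrable lborel (cbox a b) (G c)" "G c integrable_on cbox a b" for a b c
    by (rule bounded_borel_integrable_on[OF Gm _ _ Gb]; simp)+
  have "\<exists>N. negligible N \<and> (\<forall>x e. x \<notin> N \<and> 0 < e \<longrightarrow> (\<exists>d>0. \<forall>h. 0 < h \<and> h < d \<longrightarrow>
                 norm (integral (cbox x (x + h *\<^sub>R One)) (G c) /\<^sub>R h ^ DIM(real^2) - G c x) < e))" for c
    using integrable_ccontinuous_explicit[OF Gint(2)] by metis
  then obtain N where N: "\<And>c. negligible (N c)"
    and NG: "\<And>c x e. x \<notin> N c ==> 0 < e ==> \<exists>d>0. \<forall>h. 0 < h \<and> h < d \<longrightarrow>
                 norm (integral (cbox x (x + h *\<^sub>R One)) (G c) /\<^sub>R h ^ DIM(real^2) - G c x) < e"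
    by metis
  \<comment> \<open>\<open>N c\<close> belongs to the reflected function, so its points have to be
    reflected back.\<close>
  define M where "M = (\<Union>c\<in>\<rat>. ?T ` N c)"
  have "negligible M"
    unfolding M_def using N
    by (intro negligible_countable_Union countable_image countable_rat)
       (auto intro!: negligible_differentiable_image_negligible linear_imp_differentiable_on linear_sgn_pt)
  moreover have "\<exists>d>0. \<forall>h. 0 < h \<and> h < d \<longrightarrow>
       (\<integral>\<^sup>+y\<in>cbox 0 (pt h h). ennreal \<bar>g (x + ?T y) - g x\<bar> \<partial>lborel) \<le> ennreal (\<epsilon> * h\<^sup>2)"
    if x: "x \<notin> M" and \<epsilon>: "\<epsilon> > 0" for x \<epsilon>
  proof -
    obtain c where c: "c \<in> \<rat>" "g x < c" "c < g x + \<epsilon> / 4"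
      using Rats_dense_in_real[of "g x" "g x + \<epsilon> / 4"] \<epsilon> by auto
    have "?T x \<notin> N c"
      using x c sgn_pt_involution[OF \<sigma>, of x] unfolding M_def by (metis UN_I image_eqI)
    then obtain d where d: "d > 0" "\<And>h. 0 < h ==> h < d ==>
        norm (integral (cbox (?T x) (?T x + h *\<^sub>R One)) (G c) /\<^sub>R h ^ DIM(real^2) - G c (?T x)) < \<epsilon> / 4"
      using NG[of "?T x" c "\<epsilon> / 4"] \<epsilon> by auto
    show ?thesis
    proof (intro exI[of _ d] conjI allI impI d(1))
      fix h assume h: "0 < h \<and> h < d"
      let ?I = "integral (cbox (?T x) (?T x + pt h h)) (G c)"
      have "G c (?T x) < \<epsilon> / 4"
        using c by (simp add: G_def sgn_pt_involution[OF \<sigma>])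
      moreover have "?I / h\<^sup>2 - G c (?T x) < \<epsilon> / 4"
      proof -
        have "DIM(real^2) = 2" by simp
        then have "\<bar>?I /\<^sub>R h\<^sup>2 - G c (?T x)\<bar> < \<epsilon> / 4"
          using d(2)[of h] h unfolding One_real2 pt_scaleR real_norm_def by (simp only: mult_1_right)
        then have "?I /\<^sub>R h\<^sup>2 - G c (?T x) < \<epsilon> / 4" by (rule abs_less_iff[THEN iffD1, THEN conjunct1])
        then show ?thesis by (simp only: divide_inverse_commute real_scaleR_def)
      qed
      ultimately have "?I / h\<^sup>2 \<le> \<epsilon> / 2" by linarith
      then have I: "?I \<le> \<epsilon> / 2 * h\<^sup>2"
        using h by (simp add: divide_le_eq)
      have "(\<integral>\<^sup>+y\<in>cbox 0 (pt h h). ennreal (G c (?T x + y)) \<partial>lborel)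
          = (\<integral>\<^sup>+y\<in>cbox (?T x) (?T x + pt h h). ennreal (G c y) \<partial>lborel)"
        by (subst nn_integral_translate[where c="?T x", symmetric])
           (auto intro!: nn_integral_cong simp: indicator_def mem_cbox_real2)
      also have "\<dots> = (\<integral>\<^sup>+y. ennreal (indicator (cbox (?T x) (?T x + pt h h)) y *\<^sub>R G c y) \<partial>lborel)"
        by (intro nn_integral_cong) (auto simp: indicator_def)
      also have "\<dots> = ennreal ?I"
        using Gint(1)[of "?T x" "?T x + pt h h" c] set_borel_integral_eq_integral(2)[OF Gint(1)[of "?T x" "?T x + pt h h" c]]
        by (subst nn_integral_eq_integral) (auto simp: set_integrable_def set_lebesgue_integral_def G_def)
      finally have 1: "(\<integral>\<^sup>+y\<in>cbox 0 (pt h h). ennreal (G c (?T x + y)) \<partial>lborel) = ennreal ?I" .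
      have "(\<integral>\<^sup>+y\<in>cbox 0 (pt h h). ennreal \<bar>g (x + ?T y) - g x\<bar> \<partial>lborel)
         \<le> (\<integral>\<^sup>+y. ennreal (G c (?T x + y)) * indicator (cbox 0 (pt h h)) y + ennreal (\<epsilon> / 4) * indicator (cbox 0 (pt h h)) y \<partial>lborel)"
      proof (rule nn_integral_mono)
        fix y :: "real^2"
        have "\<bar>g (x + ?T y) - g x\<bar> \<le> G c (?T x + y) + \<epsilon> / 4"
          using c by (simp add: G_def sgn_pt_add sgn_pt_involution[OF \<sigma>])
        then have "ennreal \<bar>g (x + ?T y) - g x\<bar> \<le> ennreal (G c (?T x + y)) + ennreal (\<epsilon> / 4)"
          using \<epsilon> ennreal_leI[of _ "G c (?T x + y) + \<epsilon> / 4"] ennreal_plus[of "G c (?T x + y)" "\<epsilon> / 4"]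
          by (simp add: G_def)
        then show "ennreal \<bar>g (x + ?T y) - g x\<bar> * indicator (cbox 0 (pt h h)) y \<le>
           ennreal (G c (?T x + y)) * indicator (cbox 0 (pt h h)) y + ennreal (\<epsilon> / 4) * indicator (cbox 0 (pt h h)) y"
          by (auto simp: indicator_def)
      qed
      also have "\<dots> = ennreal ?I + ennreal (\<epsilon> / 4) * emeasure lborel (cbox 0 (pt h h))"
        by (subst nn_integral_add) (auto simp: 1 nn_integral_cmult_indicator)
      also have "emeasure lborel (cbox 0 (pt h h)) = ennreal (h * h)"
        using h by (subst emeasure_lborel_cbox) (auto simp: Basis_real2 axis_eq_axis inner_axis)
      also have "ennreal ?I + ennreal (\<epsilon> / 4) * ennreal (h * h) \<le> ennreal (\<epsilon> / 2 * h\<^sup>2) + ennreal (\<epsilon> / 4 * h\<^sup>2)"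
        using I \<epsilon> by (intro add_mono ennreal_leI) (auto simp: ennreal_mult[symmetric] power2_eq_square)
      also have "\<dots> \<le> ennreal (\<epsilon> * h\<^sup>2)"
        using \<epsilon> by (subst ennreal_plus[symmetric]) (auto intro!: ennreal_leI simp: algebra_simps)
      finally show "(\<integral>\<^sup>+y\<in>cbox 0 (pt h h). ennreal \<bar>g (x + ?T y) - g x\<bar> \<partial>lborel) \<le> ennreal (\<epsilon> * h\<^sup>2)" .
    qed
  qed
  ultimately show ?thesis by (rule that)
qed

text \<open>The fundamental theorem along a line after a reflection and the subtraction of a linear
  part, in the shape needed for the remainder of the first-order expansion.\<close>

lemma has_integral_sgn:
  fixes F g :: "real => real"
  assumes \<sigma>: "\<sigma> * \<sigma> = 1" and ab: "a \<le> b" and F: "\<And>a b. a \<le> b ==> (g has_integral (F b - F a)) {a..b}"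
  shows "((\<lambda>s. \<sigma> * (g (c + \<sigma> * s) - A)) has_integral (F (c + \<sigma> * b) - \<sigma> * A * b - (F (c + \<sigma> * a) - \<sigma> * A * a))) {a..b}"
proof -
  have "\<sigma> = 1 \<or> \<sigma> = -1"
    using \<sigma> square_eq_1_iff[of \<sigma>] by blast
  then have 1: "((\<lambda>s. \<sigma> * g (c + \<sigma> * s)) has_integral (F (c + \<sigma> * b) - F (c + \<sigma> * a))) {a..b}"
  proof
    assume s: "\<sigma> = 1"
    have "((\<lambda>s. g (1 *\<^sub>R s + c)) has_integral (F (c + b) - F (c + a)) /\<^sub>R 1 ^ DIM(real)) (cbox ((c + a - c) /\<^sub>R 1) ((c + b - c) /\<^sub>R 1))"
      using ab F[of "c + a" "c + b"] by (intro has_integral_affinity') auto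
    then show ?thesis by (simp add: s add.commute)
  next
    assume s: "\<sigma> = -1"
    have "((\<lambda>s. g (1 *\<^sub>R s + c)) has_integral (F (c - a) - F (c - b)) /\<^sub>R 1 ^ DIM(real)) (cbox ((c - b - c) /\<^sub>R 1) ((c - a - c) /\<^sub>R 1))"
      using ab F[of "c - b" "c - a"] by (intro has_integral_affinity') auto
    then have "((\<lambda>s. g (s + c)) has_integral (F (c - a) - F (c - b))) {- b..- a}"
      by simp
    then have "((\<lambda>s. g (- s + c)) has_integral (F (c - a) - F (c - b))) {a..b}"
      by (subst (asm) has_integral_reflect_real[symmetric]) simp
    then have "((\<lambda>s. - g (- s + c)) has_integral - (F (c - a) - F (c - b))) {a..b}"
      by (rule has_integral_neg)
    then show ?thesis by (simp add: s add.commute)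
  qed
  have 2: "((\<lambda>s. \<sigma> * A) has_integral \<sigma> * A * (b - a)) {a..b}"
    using has_integral_const_real[where c="\<sigma> * A" and a=a and b=b] ab by (simp add: mult.commute)
  from has_integral_diff[OF 1 2] show ?thesis by (simp add: algebra_simps)
qed

text \<open>At a common Lebesgue point of both partial derivatives the remainder of the first-order
  expansion is Lipschitz, vanishes at the base point and has partial derivatives that are small in
  mean on small squares. By \<open>lipschitz_small_gradient\<close> it is small compared with the
  distance, one quadrant at a time.\<close>

theorem rademacher_real:
  fixes f :: "real^2 => real"
  assumes lip: "K-lipschitz_on UNIV f"
  obtains g1 g2 where "g1 \<in> borel_fun" "g2 \<in> borel_fun"
    "AE x in lborel. (f has_derivative (\<lambda>z. g1 x * z $ 1 + g2 x * z $ 2)) (at x)"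
proof -
  have K: "K \<ge> 0" using lip by (rule lipschitz_on_nonneg)
  have lipf: "\<bar>f z - f w\<bar> \<le> K * norm (z - w)" for z w
    using lipschitz_onD[OF lip, of z w] by (simp add: dist_norm)
  have [measurable]: "f \<in> borel_fun"
    using lipschitz_on_continuous_on[OF lip] by (rule borel_measurable_continuous_onI)
  define g1 where "g1 = (\<lambda>z. max (- K) (min K (lim (\<lambda>n. (f (z + pt (inverse (Suc n)) 0) - f z) /\<^sub>R inverse (Suc n)))))"
  define g2 where "g2 = (\<lambda>z. max (- K) (min K (lim (\<lambda>n. (f (z + pt 0 (inverse (Suc n))) - f z) /\<^sub>R inverse (Suc n)))))"
  have [measurable]: "g1 \<in> borel_fun" "g2 \<in> borel_fun"
    unfolding g1_def g2_def by (intro borel_measurable_max borel_measurable_min borel_measurable_lim_metric; measurable)+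
  have gb: "\<bar>g1 x\<bar> \<le> K" "\<bar>g2 x\<bar> \<le> K" for x
    using K by (auto simp: g1_def g2_def)
  have ftc1: "((\<lambda>s. g1 (pt s y)) has_integral (f (pt b y) - f (pt a y))) {a..b}" if "a \<le> b" for a b y
  proof -
    have "K-lipschitz_on UNIV (\<lambda>s. f (pt s y))"
      using K lipf[of "pt _ y" "pt _ y"] by (intro lipschitz_onI) (auto simp: dist_real_def norm_real2 pt_diff)
    from lipschitz_difference_quotient_integral[OF this that]
    show ?thesis by (simp add: g1_def pt_add)
  qed
  have ftc2: "((\<lambda>s. g2 (pt x s)) has_integral (f (pt x b) - f (pt x a))) {a..b}" if "a \<le> b" for a b x
  proof -
    have "K-lipschitz_on UNIV (\<lambda>s. f (pt x s))"
      using K lipf[of "pt x _" "pt x _"] by (intro lipschitz_onI) (auto simp: dist_real_def norm_real2 pt_diff)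
    from lipschitz_difference_quotient_integral[OF this that]
    show ?thesis by (simp add: g2_def pt_add)
  qed
  define P where "P = (\<lambda>g \<sigma> \<tau> N. negligible N \<and> (\<forall>x \<epsilon>. x \<notin> N \<longrightarrow> \<epsilon> > 0 \<longrightarrow> (\<exists>d>0. \<forall>h. 0 < h \<and> h < d \<longrightarrow>
       (\<integral>\<^sup>+y\<in>cbox 0 (pt h h). ennreal \<bar>g (x + sgn_pt \<sigma> \<tau> y) - g x\<bar> \<partial>lborel) \<le> ennreal (\<epsilon> * h\<^sup>2))))"
  have exP: "\<exists>N. P g \<sigma> \<tau> N"
    if "g \<in> {g1, g2}" "\<sigma> \<in> {1, -1}" "\<tau> \<in> {1, -1}" for g \<sigma> \<tau>
  proof -
    have 1: "g \<in> borel_fun" "\<And>x. \<bar>g x\<bar> \<le> K" "\<sigma> * \<sigma> = 1" "\<tau> * \<tau> = 1"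
      using that gb by auto
    show ?thesis
      unfolding P_def by (rule lebesgue_points_quadrant[OF 1]) blast
  qed
  define N where "N = (\<lambda>g \<sigma> \<tau>. SOME N. P g \<sigma> \<tau> N)"
  have PN: "P g \<sigma> \<tau> (N g \<sigma> \<tau>)" if "g \<in> {g1, g2}" "\<sigma> \<in> {1, -1}" "\<tau> \<in> {1, -1}" for g \<sigma> \<tau>
    using someI_ex[OF exP[OF that]] by (simp only: N_def)
  have N: "negligible (N g \<sigma> \<tau>)"
    "\<And>x \<epsilon>. x \<notin> N g \<sigma> \<tau> ==> \<epsilon> > 0 ==> \<exists>d>0. \<forall>h. 0 < h \<and> h < d \<longrightarrow>
       (\<integral>\<^sup>+y\<in>cbox 0 (pt h h). ennreal \<bar>g (x + sgn_pt \<sigma> \<tau> y) - g x\<bar> \<partial>lborel) \<le> ennreal (\<epsilon> * h\<^sup>2)"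
    if "g \<in> {g1, g2}" "\<sigma> \<in> {1, -1}" "\<tau> \<in> {1, -1}" for g \<sigma> \<tau>
    using PN[OF that] unfolding P_def by blast+
  define M where "M = (\<Union>g\<in>{g1, g2}. \<Union>\<sigma>\<in>{1, -1}. \<Union>\<tau>\<in>{1, -1}. N g \<sigma> \<tau>)"
  have negM: "negligible M"
    unfolding M_def using N(1) by (intro negligible_Union) auto
  have der: "(f has_derivative (\<lambda>z. g1 x * z $ 1 + g2 x * z $ 2)) (at x)" if x: "x \<notin> M" for x
  proof -
    let ?L = "\<lambda>z::real^2. g1 x * z $ 1 + g2 x * z $ 2"
    have lin: "bounded_linear ?L"
      by (intro bounded_linear_add bounded_linear_const_mult bounded_linear_vec_nth)
    have Lb: "\<bar>?L z\<bar> \<le> 2 * K * norm z" for z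
    proof -
      have "\<bar>?L z\<bar> \<le> K * norm z + K * norm z"
        using gb[of x] component_le_norm_cart[of z 1] component_le_norm_cart[of z 2] K
        by (intro order_trans[OF abs_triangle_ineq] add_mono) (auto simp: abs_mult intro!: mult_mono)
      then show ?thesis by simp
    qed
    \<comment> \<open>The constant of \<open>lipschitz_small_gradient\<close> for the remainder,
      whose Lipschitz constant is \<open>3 * K\<close>: one \<open>K\<close> from \<open>f\<close>
      and two from its linear part.\<close>
    define E where "E = 4 + 2 * (3 * K)"
    have E: "E > 0" using K by (simp add: E_def)
    have quad: "\<exists>d>0. \<forall>y h. 0 < h \<and> h < d \<and> y \<in> cbox 0 (pt h h) \<longrightarrow>
        \<bar>f (x + sgn_pt \<sigma> \<tau> y) - f x - ?L (sgn_pt \<sigma> \<tau> y)\<bar> \<le> E * \<epsilon> * h"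
      if \<sigma>: "\<sigma> \<in> {1, -1}" "\<tau> \<in> {1, -1}" and \<epsilon>: "0 < \<epsilon>" "\<epsilon> \<le> 1" for \<sigma> \<tau> \<epsilon> :: real
    proof -
      let ?T = "sgn_pt \<sigma> \<tau>"
      have \<sigma>': "\<sigma> * \<sigma> = 1" "\<tau> * \<tau> = 1" "\<bar>\<sigma>\<bar> = 1" "\<bar>\<tau>\<bar> = 1" using \<sigma> by auto
      have x12: "x \<notin> N g1 \<sigma> \<tau>" "x \<notin> N g2 \<sigma> \<tau>" using x \<sigma> by (auto simp: M_def)
      obtain d1 where d1: "d1 > 0" "\<And>h. 0 < h ==> h < d1 ==>
         (\<integral>\<^sup>+y\<in>cbox 0 (pt h h). ennreal \<bar>g1 (x + ?T y) - g1 x\<bar> \<partial>lborel) \<le> ennreal (\<epsilon>\<^sup>2 * h\<^sup>2)"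
        using N(2)[of g1 \<sigma> \<tau> x "\<epsilon>\<^sup>2"] x12 \<sigma> \<epsilon> by auto
      obtain d2 where d2: "d2 > 0" "\<And>h. 0 < h ==> h < d2 ==>
         (\<integral>\<^sup>+y\<in>cbox 0 (pt h h). ennreal \<bar>g2 (x + ?T y) - g2 x\<bar> \<partial>lborel) \<le> ennreal (\<epsilon>\<^sup>2 * h\<^sup>2)"
        using N(2)[of g2 \<sigma> \<tau> x "\<epsilon>\<^sup>2"] x12 \<sigma> \<epsilon> by auto
      define q where "q = (\<lambda>y. f (x + ?T y) - f x - ?L (?T y))"
      define k1 where "k1 = (\<lambda>y. \<sigma> * (g1 (x + ?T y) - g1 x))"
      define k2 where "k2 = (\<lambda>y. \<tau> * (g2 (x + ?T y) - g2 x))"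
      have [measurable]: "k1 \<in> borel_fun" "k2 \<in> borel_fun"
        unfolding k1_def k2_def by measurable
      have nT: "norm (?T z) = norm z" for z
        using \<sigma>'(1,2)[folded power2_eq_square] by (simp add: norm_real2 power_mult_distrib)
      have Td: "?T z - ?T w = ?T (z - w)" for z w
        using linear_diff[OF linear_sgn_pt[of \<sigma> \<tau>]] by simp
      have qlip: "(3 * K)-lipschitz_on UNIV q"
      proof (rule lipschitz_onI)
        fix z w :: "real^2"
        have "q z - q w = (f (x + ?T z) - f (x + ?T w)) - ?L (?T (z - w))"
          by (simp add: q_def algebra_simps)
        also have "\<bar>\<dots>\<bar> \<le> \<bar>f (x + ?T z) - f (x + ?T w)\<bar> + \<bar>?L (?T (z - w))\<bar>"
          by (rule abs_triangle_ineq4)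
        also have "\<dots> \<le> K * norm (z - w) + 2 * K * norm (z - w)"
          using lipf[of "x + ?T z" "x + ?T w"] Lb[of "?T (z - w)"] by (simp only: add_diff_cancel_left Td nT add_mono)
        finally show "dist (q z) (q w) \<le> 3 * K * dist z w"
          by (simp add: dist_real_def dist_norm algebra_simps)
      qed (use K in simp)
      have qftc1: "((\<lambda>s. k1 (pt s y)) has_integral (q (pt b y) - q (pt a y))) {a..b}" if "a \<le> b" for a b y
      proof -
        have p: "x + ?T (pt s y) = pt (x $ 1 + \<sigma> * s) (x $ 2 + \<tau> * y)" for s
          by (simp add: vec_eq_iff forall_2)
        have "((\<lambda>s. \<sigma> * (g1 (pt (x $ 1 + \<sigma> * s) (x $ 2 + \<tau> * y)) - g1 x)) has_integral
           (f (pt (x $ 1 + \<sigma> * b) (x $ 2 + \<tau> * y)) - \<sigma> * g1 x * b - (f (pt (x $ 1 + \<sigma> * a) (x $ 2 + \<tau> * y)) - \<sigma> * g1 x * a))) {a..b}"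
          using that by (intro has_integral_sgn[where F="\<lambda>s. f (pt s (x $ 2 + \<tau> * y))" and g="\<lambda>s. g1 (pt s (x $ 2 + \<tau> * y))", OF \<sigma>'(1)] ftc1)
        then show ?thesis
          by (simp add: k1_def q_def p algebra_simps)
      qed
      have qftc2: "((\<lambda>s. k2 (pt y s)) has_integral (q (pt y b) - q (pt y a))) {a..b}" if "a \<le> b" for a b y
      proof -
        have p: "x + ?T (pt y s) = pt (x $ 1 + \<sigma> * y) (x $ 2 + \<tau> * s)" for s
          by (simp add: vec_eq_iff forall_2)
        have "((\<lambda>s. \<tau> * (g2 (pt (x $ 1 + \<sigma> * y) (x $ 2 + \<tau> * s)) - g2 x)) has_integral
           (f (pt (x $ 1 + \<sigma> * y) (x $ 2 + \<tau> * b)) - \<tau> * g2 x * b - (f (pt (x $ 1 + \<sigma> * y) (x $ 2 + \<tau> * a)) - \<tau> * g2 x * a))) {a..b}"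
          using that by (intro has_integral_sgn[where F="\<lambda>s. f (pt (x $ 1 + \<sigma> * y) s)" and g="\<lambda>s. g2 (pt (x $ 1 + \<sigma> * y) s)", OF \<sigma>'(2)] ftc2)
        then show ?thesis
          by (simp add: k2_def q_def p algebra_simps)
      qed
      have q0: "q 0 = 0"
        using linear_0[OF linear_sgn_pt[of \<sigma> \<tau>]] by (simp add: q_def)
      show ?thesis
      proof (intro exI[of _ "min d1 d2"] conjI allI impI)
        fix y h assume h: "0 < h \<and> h < min d1 d2 \<and> y \<in> cbox 0 (pt h h)"
        have "\<bar>q y\<bar> \<le> (4 + 2 * (3 * K)) * \<epsilon> * h"
          using h d1(2)[of h] d2(2)[of h] \<sigma>' \<epsilon>
          by (intro lipschitz_small_gradient[OF qlip q0 _ _ qftc1 qftc2]) (auto simp: k1_def k2_def abs_mult)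
        then show "\<bar>f (x + ?T y) - f x - ?L (?T y)\<bar> \<le> E * \<epsilon> * h"
          by (simp add: q_def E_def)
      qed (use d1 d2 in auto)
    qed
    show ?thesis
      unfolding has_derivative_at_alt
    proof (intro conjI allI impI lin)
      fix e :: real assume e: "e > 0"
      define \<epsilon> where "\<epsilon> = min 1 (e / E)"
      have \<epsilon>: "0 < \<epsilon>" "\<epsilon> \<le> 1" using e E by (auto simp: \<epsilon>_def)
      have Ee: "E * \<epsilon> \<le> e" using E by (auto simp: \<epsilon>_def min_def field_simps)
      define Q where "Q = (\<lambda>\<sigma> \<tau> d. d > 0 \<and> (\<forall>y h. 0 < h \<and> h < d \<and> y \<in> cbox 0 (pt h h) \<longrightarrow>
        \<bar>f (x + sgn_pt \<sigma> \<tau> y) - f x - ?L (sgn_pt \<sigma> \<tau> y)\<bar> \<le> E * \<epsilon> * h))"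
      have exQ: "\<exists>d. Q \<sigma> \<tau> d" if "\<sigma> \<in> {1, -1}" "\<tau> \<in> {1, -1}" for \<sigma> \<tau>
        using quad[OF that \<epsilon>] by (simp only: Q_def)
      define D where "D = (\<lambda>\<sigma> \<tau>. SOME d. Q \<sigma> \<tau> d)"
      have QD: "Q \<sigma> \<tau> (D \<sigma> \<tau>)" if "\<sigma> \<in> {1, -1}" "\<tau> \<in> {1, -1}" for \<sigma> \<tau>
        using someI_ex[OF exQ[OF that]] by (simp only: D_def)
      have D: "D \<sigma> \<tau> > 0"
        "\<And>y h. 0 < h ==> h < D \<sigma> \<tau> ==> y \<in> cbox 0 (pt h h) ==>
          \<bar>f (x + sgn_pt \<sigma> \<tau> y) - f x - ?L (sgn_pt \<sigma> \<tau> y)\<bar> \<le> E * \<epsilon> * h"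
        if "\<sigma> \<in> {1, -1}" "\<tau> \<in> {1, -1}" for \<sigma> \<tau>
        using QD[OF that] unfolding Q_def by blast+
      let ?d = "min (min (D 1 1) (D 1 (-1))) (min (D (-1) 1) (D (-1) (-1)))"
      show "\<exists>d>0. \<forall>y. norm (y - x) < d \<longrightarrow> norm (f y - f x - ?L (y - x)) \<le> e * norm (y - x)"
      proof (intro exI[of _ ?d] conjI allI impI)
        fix y assume y: "norm (y - x) < ?d"
        show "norm (f y - f x - ?L (y - x)) \<le> e * norm (y - x)"
        proof (cases "y = x")
          case False
          define z where "z = y - x"
          \<comment> \<open>The signs select the map that carries \<open>z\<close> into the closed
            first quadrant.\<close>
          define \<sigma> :: real where "\<sigma> = (if z $ 1 \<ge> 0 then 1 else -1)"
          define \<tau> :: real where "\<tau> = (if z $ 2 \<ge> 0 then 1 else -1)"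
          have \<sigma>: "\<sigma> \<in> {1, -1}" "\<tau> \<in> {1, -1}" by (auto simp: \<sigma>_def \<tau>_def)
          have nz: "0 < norm z" "norm z < D \<sigma> \<tau>"
            using False y by (auto simp: z_def \<sigma>_def \<tau>_def)
          have c: "sgn_pt \<sigma> \<tau> z \<in> cbox 0 (pt (norm z) (norm z))"
            using component_le_norm_cart[of z 1] component_le_norm_cart[of z 2]
            by (auto simp: mem_cbox_real2 \<sigma>_def \<tau>_def)
          have "sgn_pt \<sigma> \<tau> (sgn_pt \<sigma> \<tau> z) = z"
            using \<sigma> by (intro sgn_pt_involution) auto
          then have "\<bar>f (x + z) - f x - ?L z\<bar> \<le> E * \<epsilon> * norm z"
            using D(2)[OF \<sigma> nz c] by simp
          also have "\<dots> \<le> e * norm z" using Ee by (intro mult_right_mono) auto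
          finally show ?thesis by (simp add: z_def)
        qed simp
      qed (use D(1) in auto)
    qed
  qed
  show ?thesis
  proof (rule that)
    show "AE x in lborel. (f has_derivative (\<lambda>z. g1 x * z $ 1 + g2 x * z $ 2)) (at x)"
      using AE_lborel_negligible[OF negM] by eventually_elim (rule der)
  qed fact+
qed

section \<open>Variation of loops\<close>

text \<open>The supremum of \<open>circle_variation\<close> for a function of the angle itself, so
  that it applies to averages and traces that are not composed with \<open>circ\<close>.\<close>

definition cvf :: "(real => real^2) => ennreal" where
  "cvf f = (SUP \<psi>\<in>circle_test. ennreal (LINT t|lebesgue_on {0..2 * pi}. f t \<bullet> vector_derivative \<psi> (at t)))"

lemma circle_variation_eq_cvf: "circle_variation \<gamma> = cvf (\<lambda>t. \<gamma> (circ t))"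
  by (simp add: circle_variation_def cvf_def)

text \<open>Borel, bounded and periodic everywhere, not only almost everywhere: all integrals over
  bounded intervals then exist, as Lebesgue and as Henstock-Kurzweil integrals, and shifts need no
  exceptional sets.\<close>

definition loop :: "(real => 'a::euclidean_space) => bool" where
  "loop f \<longleftrightarrow> f \<in> borel_fun \<and> (\<exists>B. \<forall>t. norm (f t) \<le> B) \<and> (\<forall>t. f (t + 2 * pi) = f t)"

lemma loopD:
  assumes "loop f"
  shows "f \<in> borel_fun" "f (t + 2 * pi) = f t"
  using assms by (auto simp: loop_def)

lemma loop_bound:
  assumes "loop f"
  obtains B where "\<And>t. norm (f t) \<le> B" "B \<ge> 0"
  using assms unfolding loop_def by (meson norm_ge_zero order_trans)

lemma loop_shift: "loop f ==> loop (\<lambda>t. f (t + s))"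
proof -
  assume f: "loop f"
  have "f (t + 2 * pi + s) = f (t + s)" for t
    using loopD(2)[OF f, of "t + s"] by (simp add: algebra_simps)
  then show ?thesis
    using f unfolding loop_def by auto
qed

lemma periodic_floor:
  fixes f :: "real => 'a"
  assumes "\<And>t. f (t + 2 * pi) = f t"
  shows "f (t - 2 * pi * of_int k) = f t"
proof (induction k rule: int_induct[where k=0])
  case (step1 i)
  then show ?case using assms[of "t - 2 * pi * of_int (i + 1)"] by (simp add: algebra_simps)
next
  case (step2 i)
  then show ?case using assms[of "t - 2 * pi * of_int i"] by (simp add: algebra_simps)
qed simp

lemma reduce_mod_2pi:
  fixes t :: real
  obtains k :: int where "0 \<le> t - 2 * pi * of_int k" "t - 2 * pi * of_int k < 2 * pi"
proof
  have "of_int \<lfloor>t / (2 * pi)\<rfloor> \<le> t / (2 * pi)" "t / (2 * pi) < of_int \<lfloor>t / (2 * pi)\<rfloor> + 1"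
    by linarith+
  then have "of_int \<lfloor>t / (2 * pi)\<rfloor> * (2 * pi) \<le> t" "t < (of_int \<lfloor>t / (2 * pi)\<rfloor> + 1) * (2 * pi)"
    by (simp_all only: pos_le_divide_eq pos_divide_less_eq mult_pos_pos pi_gt_zero zero_less_numeral)
  then show "0 \<le> t - 2 * pi * of_int \<lfloor>t / (2 * pi)\<rfloor>" "t - 2 * pi * of_int \<lfloor>t / (2 * pi)\<rfloor> < 2 * pi"
    by (simp_all add: algebra_simps)
qed

lemma continuous_periodic_loop:
  fixes f :: "real => 'a::euclidean_space"
  assumes f: "continuous_on UNIV f" and per: "\<And>t. f (t + 2 * pi) = f t"
  shows "loop f"
proof -
  have "bounded (f ` {0..2*pi})"
    by (intro compact_imp_bounded compact_continuous_image) (use f in \<open>auto intro: continuous_on_subset\<close>)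
  then obtain B where B: "\<And>t. 0 \<le> t ==> t \<le> 2 * pi ==> norm (f t) \<le> B"
    unfolding bounded_iff by (metis atLeastAtMost_iff image_eqI)
  have "norm (f t) \<le> B" for t
  proof -
    obtain k :: int where "0 \<le> t - 2 * pi * of_int k" "t - 2 * pi * of_int k < 2 * pi"
      by (rule reduce_mod_2pi)
    then show ?thesis using B[of "t - 2 * pi * of_int k"] periodic_floor[of f t k, OF per] by simp
  qed
  then show ?thesis
    using f per by (auto simp: loop_def intro: borel_measurable_continuous_onI)
qed

lemma loop_integrable:
  fixes f :: "real => 'a::euclidean_space"
  assumes "loop f"
  shows "f integrable_on {a..b}" "set_integrable lborel {a..b} f"
proof -
  obtain B where B: "\<And>t. norm (f t) \<le> B" using loop_bound[OF assms] by blast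
  show "f integrable_on {a..b}" "set_integrable lborel {a..b} f"
    by (rule bounded_borel_integrable_on[OF loopD(1)[OF assms] _ _ B]; simp)+
qed

lemma lint_eq_integral:
  fixes F :: "'a::euclidean_space => 'b::euclidean_space"
  assumes "set_integrable lborel S F" "S \<in> sets borel"
  shows "integrable (lebesgue_on S) F" "(LINT t|lebesgue_on S. F t) = integral S F"
proof -
  have "set_integrable lebesgue S F"
    using assms unfolding set_integrable_def by (simp add: integrable_completion)
  then show 1: "integrable (lebesgue_on S) F"
    using assms by (simp add: integrable_restrict_space set_integrable_def)
  then show "(LINT t|lebesgue_on S. F t) = integral S F"
    using assms by (intro lebesgue_integral_eq_integral) auto
qed

lemma loop_inner:
  assumes "loop f" "loop g"
  shows "loop (\<lambda>t. f t \<bullet> g t)"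
proof -
  obtain B C where B: "\<And>t. norm (f t) \<le> B" and C: "\<And>t. norm (g t) \<le> C" and "B \<ge> 0"
    using loop_bound assms by metis
  then have "norm (f t \<bullet> g t) \<le> B * C" for t
    using Cauchy_Schwarz_ineq2[of "f t" "g t"] by (smt (verit) mult_mono norm_ge_zero real_norm_def)
  then show ?thesis
    using assms unfolding loop_def by (auto intro!: borel_measurable_inner)
qed

lemma loop_norm_diff:
  assumes "loop f" "loop g"
  shows "loop (\<lambda>t. norm (f t - g t))" "loop (\<lambda>t. f t - g t)"
proof -
  obtain B C where B: "\<And>t. norm (f t) \<le> B" and C: "\<And>t. norm (g t) \<le> C"
    using loop_bound assms by metis
  then have b: "norm (f t - g t) \<le> B + C" for t
    using norm_triangle_ineq4[of "f t" "g t"] by (smt (verit))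
  then have "norm (norm (f t - g t)) \<le> B + C" for t by simp
  with b show "loop (\<lambda>t. norm (f t - g t))" "loop (\<lambda>t. f t - g t)"
    using assms unfolding loop_def by (auto)
qed

lemma loop_const: "loop (\<lambda>t. c)"
  unfolding loop_def by auto

lemma loop_norm: "loop f ==> loop (\<lambda>t. norm (f t))"
  using loop_norm_diff(1)[OF _ loop_const[of 0]] by simp

lemma loop_scaleR:
  assumes "loop f" shows "loop (\<lambda>t. c *\<^sub>R f t)"
proof -
  obtain B where B: "\<And>t. norm (f t) \<le> B" using loop_bound assms by metis
  then have "norm (c *\<^sub>R f t) \<le> \<bar>c\<bar> * B" for t
    by (simp add: mult_left_mono)
  then show ?thesis
    using assms unfolding loop_def by (auto simp del: norm_scaleR)
qed

lemma has_vector_derivative_shift_real: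
  fixes f :: "real => 'a::real_normed_vector"
  assumes "(f has_vector_derivative D) (at (t + c))"
  shows "((\<lambda>s. f (s + c)) has_vector_derivative D) (at t)"
proof -
  have "((\<lambda>s. s + c) has_vector_derivative 1) (at t)"
    by (auto intro!: derivative_eq_intros simp: has_vector_derivative_def)
  from vector_diff_chain_at[OF this assms] show ?thesis by (simp add: o_def)
qed

lemma circle_testI:
  assumes der: "\<And>t. (\<psi> has_vector_derivative D t) (at t)" and "continuous_on UNIV D"
    and "\<And>t. \<psi> (t + 2 * pi) = \<psi> t" "\<And>t. norm (\<psi> t) \<le> 1"
  shows "\<psi> \<in> circle_test"
proof -
  have "(\<psi> has_derivative blinfun_apply (blinfun_scaleR_left (D t))) (at t)" for t
    using der[of t] by (simp add: has_vector_derivative_def)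
  moreover have "continuous_on UNIV (\<lambda>t. blinfun_scaleR_left (D t))"
    by (rule bounded_linear.continuous_on[OF bounded_linear_blinfun_scaleR_left assms(2)])
  ultimately have "C1_on UNIV \<psi>"
    unfolding C1_on_def by (intro exI[of _ "\<lambda>t. blinfun_scaleR_left (D t)"]) simp
  then show ?thesis
    using assms(3,4) by (simp add: circle_test_def)
qed

lemma circle_testD:
  assumes "\<psi> \<in> circle_test"
  obtains D where "\<And>t. (\<psi> has_vector_derivative D t) (at t)" "continuous_on UNIV D"
    "\<And>t. vector_derivative \<psi> (at t) = D t" "loop D" "loop \<psi>" "continuous_on UNIV \<psi>" 
    "\<And>t. \<psi> (t + 2 * pi) = \<psi> t" "\<And>t. norm (\<psi> t) \<le> 1"
proof -
  obtain P :: "real => real \<Rightarrow>\<^sub>L (real^2)" where P: "\<And>x. (\<psi> has_derivative blinfun_apply (P x)) (at x)" "continuous_on UNIV P"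
    and per: "\<And>t. \<psi> (t + 2 * pi) = \<psi> t" and n: "\<And>t. norm (\<psi> t) \<le> 1"
    using assms by (auto simp: circle_test_def C1_on_def)
  define D where "D = (\<lambda>t. blinfun_apply (P t) 1)"
  have der: "(\<psi> has_vector_derivative D t) (at t)" for t
  proof -
    have "blinfun_apply (P t) = (\<lambda>x. x *\<^sub>R D t)"
      unfolding D_def by (rule ext) (metis blinfun.scaleR_right mult.right_neutral real_scaleR_def)
    then show ?thesis using P(1)[of t] by (simp add: has_vector_derivative_def)
  qed
  have cD: "continuous_on UNIV D"
    unfolding D_def using P(2) by (intro continuous_intros)
  have cpsi: "continuous_on UNIV \<psi>"
    using der by (auto intro!: continuous_at_imp_continuous_on has_vector_derivative_continuous)
  have perD: "D (t + 2 * pi) = D t" for t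
  proof -
    have "((\<lambda>s. \<psi> (s + 2 * pi)) has_vector_derivative D (t + 2 * pi)) (at t)"
      by (rule has_vector_derivative_shift_real[OF der])
    then show ?thesis
      using der[of t] per vector_derivative_unique_at by (simp add: fun_eq_iff)
  qed
  show ?thesis
    by (rule that[OF der cD _ continuous_periodic_loop[OF cD perD] continuous_periodic_loop[OF cpsi per] cpsi per n])
       (rule vector_derivative_at[OF der])
qed

lemma loop_integral_lint:
  assumes "loop f" "loop D"
  shows "(LINT t|lebesgue_on {0..2*pi}. f t \<bullet> D t) = loop_pair f D"
  by (rule lint_eq_integral) (auto intro: loop_integrable loop_inner assms)

lemma cvf_upper:
  assumes f: "loop f" and \<psi>: "\<And>t. (\<psi> has_vector_derivative D t) (at t)" "continuous_on UNIV D"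
    "\<And>t. \<psi> (t + 2 * pi) = \<psi> t" "\<And>t. norm (\<psi> t) \<le> 1"
  shows "ennreal (loop_pair f D) \<le> cvf f"
proof -
  have t: "\<psi> \<in> circle_test" by (rule circle_testI[OF \<psi>])
  obtain D' where D': "\<And>t. (\<psi> has_vector_derivative D' t) (at t)" "\<And>t. vector_derivative \<psi> (at t) = D' t" "loop D'"
    using circle_testD[OF t] by metis
  have "D' = D" using D'(1) \<psi>(1) vector_derivative_unique_at by blast
  then have "ennreal (loop_pair f D) = ennreal (LINT t|lebesgue_on {0..2 * pi}. f t \<bullet> vector_derivative \<psi> (at t))"
    using D' loop_integral_lint[OF f D'(3)] by simp
  also have "\<dots> \<le> cvf f" unfolding cvf_def using t by (rule SUP_upper)
  finally show ?thesis .
qed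

lemma cvf_least:
  assumes f: "loop f" and le: "\<And>\<psi> D. \<psi> \<in> circle_test ==> (\<And>t. (\<psi> has_vector_derivative D t) (at t)) ==> continuous_on UNIV D ==> loop D ==> loop \<psi>
    ==> continuous_on UNIV \<psi> ==> (\<And>t. \<psi> (t + 2 * pi) = \<psi> t) ==> (\<And>t. norm (\<psi> t) \<le> 1) ==>
     ennreal (loop_pair f D) \<le> L"
  shows "cvf f \<le> L"
  unfolding cvf_def
proof (rule SUP_least)
  fix \<psi> :: "real => real^2" assume t: "\<psi> \<in> circle_test"
  obtain D where D: "\<And>t. (\<psi> has_vector_derivative D t) (at t)" "continuous_on UNIV D"
    "\<And>t. vector_derivative \<psi> (at t) = D t" "loop D" "loop \<psi>" "continuous_on UNIV \<psi>" 
    "\<And>t. \<psi> (t + 2 * pi) = \<psi> t" "\<And>t. norm (\<psi> t) \<le> 1"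
    using circle_testD[OF t] by blast
  show "ennreal (LINT t|lebesgue_on {0..2 * pi}. f t \<bullet> vector_derivative \<psi> (at t)) \<le> L"
    unfolding D(3) loop_integral_lint[OF f D(4)] by (rule le[OF t D(1,2,4-8)])
qed

section \<open>Translations and difference quotients of loops\<close>

lemma integral_shift_real:
  fixes f :: "real => 'a::euclidean_space"
  shows "integral {a..b} (\<lambda>t. f (t + s)) = integral {a + s..b + s} f"
  using integral_shift_Icc_real[of a b f s] by (simp add: o_def add.commute)

lemma loop_integral_shift:
  fixes f :: "real => 'a::euclidean_space"
  assumes f: "loop f" and s: "\<bar>s\<bar> \<le> 2 * pi"
  shows "integral {0..2*pi} (\<lambda>t. f (t + s)) = integral {0..2*pi} f"
proof -
  have main: "integral {s..2*pi + s} f = integral {0..2*pi} f" if "0 \<le> s" "s \<le> 2 * pi" for s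
  proof -
    have "integral {s..2*pi + s} f = integral {s..2*pi} f + integral {2*pi..2*pi + s} f"
      using that by (intro HK_integral_combine[symmetric] loop_integrable f) auto
    also have "integral {2*pi..2*pi + s} f = integral {0..s} f"
      using integral_shift_real[of 0 s f "2*pi"] loop_integrable(1)[OF f] loopD(2)[OF f] by (simp add: add.commute)
    also have "integral {s..2*pi} f + integral {0..s} f = integral {0..2*pi} f"
      using that by (subst add.commute) (intro HK_integral_combine loop_integrable f, auto)
    finally show ?thesis .
  qed
  show ?thesis
  proof (cases "s \<ge> 0")
    case True
    then show ?thesis using main[of s] s by (simp add: integral_shift_real loop_integrable(1)[OF f])
  next
    case False
    have "integral {0..2*pi} (\<lambda>t. f (t + s)) = integral {s..2*pi + s} f"
      by (simp add: integral_shift_real loop_integrable(1)[OF f])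
    also have "\<dots> = integral {s..2*pi + s} (\<lambda>t. f (t + 2 * pi))"
      by (simp add: loopD(2)[OF f])
    also have "\<dots> = integral {s + 2 * pi..2*pi + (s + 2*pi)} f"
      by (simp add: integral_shift_real add.assoc loop_integrable(1)[OF f])
    also have "\<dots> = integral {0..2*pi} f" using main[of "s + 2 * pi"] False s by simp
    finally show ?thesis .
  qed
qed

lemma continuous_primitive:
  fixes \<psi> :: "real => 'a::euclidean_space"
  assumes c: "continuous_on UNIV \<psi>"
  obtains \<Phi> where "\<And>t. (\<Phi> has_vector_derivative \<psi> t) (at t)"
proof
  define \<Phi> where "\<Phi> = (\<lambda>t. if t \<ge> 0 then integral {0..t} \<psi> else - integral {t..0} \<psi>)"
  have int: "\<psi> integrable_on {a..b}" for a b
    using c by (intro integrable_continuous_real) (rule continuous_on_subset, auto)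
  have eq: "\<Phi> t = integral {-a..t} \<psi> - integral {-a..0} \<psi>" if "a > 0" "t > - a" for a t :: real
    using that HK_integral_combine[of "-a" 0 t \<psi>] HK_integral_combine[of "-a" t 0 \<psi>] int
    by (auto simp: \<Phi>_def algebra_simps)
  fix t :: real
  define a where "a = \<bar>t\<bar> + 1"
  have "((\<lambda>u. integral {-a..u} \<psi>) has_vector_derivative \<psi> t) (at t within {-a..a})"
    by (rule integral_has_vector_derivative) (use c in \<open>auto intro: continuous_on_subset simp: a_def\<close>)
  then have "((\<lambda>u. integral {-a..u} \<psi>) has_vector_derivative \<psi> t) (at t)"
    by (subst (asm) at_within_interior) (auto simp: a_def)
  then have "((\<lambda>u. integral {-a..u} \<psi> - integral {-a..0} \<psi>) has_vector_derivative \<psi> t - 0) (at t)"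
    by (rule has_vector_derivative_diff) (rule has_vector_derivative_const)
  then have "(\<Phi> has_vector_derivative \<psi> t - 0) (at t)"
    by (rule has_vector_derivative_transform_within_open[of _ _ _ "{-a<..}"])
       (use eq[of a] in \<open>auto simp: a_def\<close>)
  then show "(\<Phi> has_vector_derivative \<psi> t) (at t)" by simp
qed

text \<open>Pairing the difference quotient of \<open>f\<close> with \<open>\<psi>\<close> is
  pairing \<open>f\<close> with the derivative of minus the average of \<open>\<psi>\<close> over
  the preceding interval of length \<open>h\<close>, and that average is again an admissible test
  function.\<close>

lemma cvf_difference_quotient_test:
  assumes f: "loop f" and h: "0 < h" "h \<le> 2 * pi" and \<psi>: "continuous_on UNIV \<psi>" "\<And>t. \<psi> (t + 2 * pi) = \<psi> t" "\<And>t. norm (\<psi> t) \<le> 1"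
  shows "ennreal (integral {0..2*pi} (\<lambda>t. (f (t + h) - f t) \<bullet> \<psi> t)) \<le> ennreal h * cvf f"
proof -
  \<comment> \<open>The primitive need not be periodic; only its increments over length
    \<open>h\<close> enter, and these are.\<close>
  obtain \<Phi> where \<Phi>: "\<And>t. (\<Phi> has_vector_derivative \<psi> t) (at t)"
    using continuous_primitive[OF \<psi>(1)] by blast
  have lp: "loop \<psi>" by (rule continuous_periodic_loop[OF \<psi>(1,2)])
  have int: "(\<psi> has_integral (\<Phi> b - \<Phi> a)) {a..b}" if "a \<le> b" for a b
    using that \<Phi> by (intro fundamental_theorem_of_calculus) (auto intro: has_vector_derivative_at_within)
  define \<Psi> where "\<Psi> = (\<lambda>t. (- 1 / h) *\<^sub>R (\<Phi> t - \<Phi> (t + (- h))))"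
  define D where "D = (\<lambda>t. (- 1 / h) *\<^sub>R (\<psi> t - \<psi> (t + (- h))))"
  have chain: "((\<lambda>s. \<Phi> (s + c)) has_vector_derivative \<psi> (t + c)) (at t)" for c t
    by (rule has_vector_derivative_shift_real[OF \<Phi>])
  have der: "(\<Psi> has_vector_derivative D t) (at t)" for t
    unfolding \<Psi>_def D_def
    by (intro has_vector_derivative_diff chain \<Phi> bounded_linear.has_vector_derivative[OF bounded_linear_scaleR_right])
  have cD: "continuous_on UNIV D"
    unfolding D_def by (intro continuous_intros continuous_on_compose2[OF \<psi>(1)]) auto
  have \<Phi>i: "\<Phi> t - \<Phi> (t + (- h)) = integral {t - h..t} \<psi>" for t
    using integral_unique[OF int[of "t - h" t]] h by simp
  have per: "\<Psi> (t + 2 * pi) = \<Psi> t" for t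
  proof -
    have "integral {t + 2 * pi - h..t + 2 * pi} \<psi> = integral {t - h..t} (\<lambda>t. \<psi> (t + 2 * pi))"
      by (simp add: integral_shift_real loop_integrable(1)[OF lp] algebra_simps)
    then show ?thesis unfolding \<Psi>_def \<Phi>i by (simp add: \<psi>(2))
  qed
  have n: "norm (\<Psi> t) \<le> 1" for t
  proof -
    have "norm (\<Phi> t - \<Phi> (t + (- h))) \<le> 1 * (t - (t - h))"
      unfolding \<Phi>i using h \<psi>(3) by (intro integral_bound) (auto intro: continuous_on_subset[OF \<psi>(1)])
    then show ?thesis using h by (simp add: \<Psi>_def divide_le_eq)
  qed
  have le: "ennreal (loop_pair f D) \<le> cvf f"
    by (rule cvf_upper[OF f der cD per n])
  have l1: "loop (\<lambda>t. f t \<bullet> \<psi> t)" "loop (\<lambda>t. f t \<bullet> \<psi> (t + (- h)))" "loop (\<lambda>t. f (t + h) \<bullet> \<psi> t)"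
    by (intro loop_inner loop_shift lp f)+
  have sh: "integral {0..2*pi} (\<lambda>t. f (t + h) \<bullet> \<psi> t) = integral {0..2*pi} (\<lambda>t. f t \<bullet> \<psi> (t + (- h)))"
    using loop_integral_shift[OF l1(2), of h] h by simp
  have "loop_pair f D = integral {0..2*pi} (\<lambda>t. (1 / h) * (f t \<bullet> \<psi> (t + (- h)) - f t \<bullet> \<psi> t))"
    by (simp add: D_def inner_diff_right algebra_simps)
  also have "\<dots> = (1 / h) * (integral {0..2*pi} (\<lambda>t. f t \<bullet> \<psi> (t + (- h))) - loop_pair f \<psi>)"
    by (simp only: Henstock_Kurzweil_Integration.integral_mult_right HK_integral_diff loop_integrable(1)[OF l1(1)] loop_integrable(1)[OF l1(2)])
  also have "\<dots> = (1 / h) * integral {0..2*pi} (\<lambda>t. (f (t + h) - f t) \<bullet> \<psi> t)"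
    unfolding sh[symmetric] inner_diff_left
    by (simp only: HK_integral_diff loop_integrable(1)[OF l1(1)] loop_integrable(1)[OF l1(3)])
  finally have eq: "integral {0..2*pi} (\<lambda>t. (f (t + h) - f t) \<bullet> \<psi> t) = h * loop_pair f D"
    using h by simp
  show ?thesis
    unfolding eq using h le by (simp add: ennreal_mult' mult_left_mono)
qed

text \<open>The continuous function \<open>g t /\<^sub>R (norm (g t) + e)\<close> has norm at most 1
  and recovers the norm of the difference \<open>g\<close> up to \<open>e\<close>.\<close>

lemma cvf_difference_quotient:
  assumes f: "loop f" "continuous_on UNIV f" and h: "0 < h" "h \<le> 2 * pi"
  shows "ennreal (integral {0..2*pi} (\<lambda>t. norm (f (t + h) - f t))) \<le> ennreal h * cvf f"
proof -
  define g where "g = (\<lambda>t. f (t + h) - f t)"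
  have gc: "continuous_on UNIV g"
    unfolding g_def by (intro continuous_intros continuous_on_compose2[OF f(2)] f(2)) auto
  have gp: "g (t + 2 * pi) = g t" for t
    using loopD(2)[OF f(1), of t] loopD(2)[OF f(1), of "t + h"] by (simp add: g_def algebra_simps)
  have gl: "loop g" by (rule continuous_periodic_loop[OF gc gp])
  have *: "ennreal (integral {0..2*pi} (\<lambda>t. norm (g t))) \<le> ennreal h * cvf f + ennreal \<epsilon>" if \<epsilon>: "\<epsilon> > 0" for \<epsilon>
  proof -
    \<comment> \<open>Integrated over a period, a loss of \<open>e\<close> at each point amounts to
      \<open>\<epsilon>\<close>.\<close>
    define e where "e = \<epsilon> / (2 * pi)"
    have e: "e > 0" using \<epsilon> by (simp add: e_def)
    define \<psi> where "\<psi> = (\<lambda>t. g t /\<^sub>R (norm (g t) + e))"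
    have pos: "norm (g t) + e > 0" for t using e by (simp add: add_nonneg_pos)
    have \<psi>c: "continuous_on UNIV \<psi>"
      unfolding \<psi>_def using pos by (intro continuous_intros gc) (metis less_irrefl)
    have \<psi>p: "\<psi> (t + 2 * pi) = \<psi> t" for t by (simp add: \<psi>_def gp)
    have \<psi>n: "norm (\<psi> t) \<le> 1" for t
      using pos[of t] e by (simp add: \<psi>_def divide_inverse_commute[symmetric] divide_le_eq abs_of_pos)
    have ge: "norm (g t) - e \<le> g t \<bullet> \<psi> t" for t
    proof -
      have "g t \<bullet> \<psi> t = (norm (g t))\<^sup>2 / (norm (g t) + e)"
        by (simp add: \<psi>_def power2_norm_eq_inner divide_inverse)
      moreover have "(norm (g t) - e) * (norm (g t) + e) \<le> (norm (g t))\<^sup>2"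
        by (simp add: algebra_simps power2_eq_square)
      ultimately show ?thesis using pos[of t] by (simp add: pos_le_divide_eq)
    qed
    have l: "loop (\<lambda>t. norm (g t))" by (rule loop_norm[OF gl])
    have l2: "loop (\<lambda>t. g t \<bullet> \<psi> t)" by (intro loop_inner gl continuous_periodic_loop \<psi>c \<psi>p)
    have "integral {0..2*pi} (\<lambda>t. norm (g t)) - \<epsilon> = integral {0..2*pi} (\<lambda>t. norm (g t) - e)"
      by (subst HK_integral_diff) (auto intro: loop_integrable l simp: e_def)
    also have "\<dots> \<le> loop_pair g \<psi>"
      by (rule integral_le[OF integrable_diff[OF loop_integrable(1)[OF l] loop_integrable(1)[OF loop_const]] loop_integrable(1)[OF l2] ge])
    finally have "ennreal (integral {0..2*pi} (\<lambda>t. norm (g t))) \<le> ennreal (loop_pair g \<psi> + \<epsilon>)"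
      by (intro ennreal_leI) simp
    also have "\<dots> \<le> ennreal (loop_pair g \<psi>) + ennreal \<epsilon>"
      using \<epsilon> by (cases "loop_pair g \<psi> \<ge> 0") 
        (auto simp: ennreal_plus[symmetric] ennreal_neg simp del: ennreal_plus intro!: ennreal_leI)
    also have "ennreal (loop_pair g \<psi>) \<le> ennreal h * cvf f"
      using cvf_difference_quotient_test[OF f(1) h \<psi>c \<psi>p \<psi>n] by (simp only: g_def)
    finally show ?thesis by (simp add: add_right_mono)
  qed
  have "ennreal (integral {0..2*pi} (\<lambda>t. norm (g t))) \<le> ennreal h * cvf f"
    by (rule ennreal_le_epsilon) (rule *)
  then show ?thesis by (simp only: g_def)
qed

section \<open>Steklov averages and the variation along chains of points\<close>

definition steklov :: "real => (real => 'a::euclidean_space) => real => 'a" where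
  "steklov h f t = integral {t..t + h} f /\<^sub>R h"

lemma steklov_shift: "steklov h f t = integral {0..h} (\<lambda>s. f (s + t)) /\<^sub>R h"
  by (simp add: steklov_def integral_shift_real add.commute)

text \<open>Sliding the window from \<open>a\<close> to \<open>b\<close> adds
  \<open>[a + h, b + h]\<close> and removes \<open>[a, b]\<close>. Increments of the average are
  thus integrals of difference quotients of \<open>f\<close>, which
  \<open>cvf_difference_quotient\<close> controls.\<close>

lemma steklov_diff:
  fixes f :: "real => 'a::euclidean_space"
  assumes f: "loop f" and ab: "a \<le> b" and h: "h > 0"
  shows "steklov h f b - steklov h f a = integral {a..b} (\<lambda>t. f (t + h) - f t) /\<^sub>R h"
proof -
  note i = loop_integrable(1)[OF f]
  have "integral {a..b} f + integral {b..b + h} f = integral {a..a + h} f + integral {a + h..b + h} f"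
    using ab h i by (simp add: HK_integral_combine)
  then have "integral {b..b + h} f - integral {a..a + h} f = integral {a + h..b + h} f - integral {a..b} f"
    by (simp add: algebra_simps)
  also have "integral {a + h..b + h} f = integral {a..b} (\<lambda>t. f (t + h))" by (simp add: integral_shift_real)
  also have "integral {a..b} (\<lambda>t. f (t + h)) - integral {a..b} f = integral {a..b} (\<lambda>t. f (t + h) - f t)"
    by (intro HK_integral_diff[symmetric] loop_integrable(1)[OF loop_shift[OF f]] i)
  finally show ?thesis by (simp add: steklov_def flip: scaleR_diff_right)
qed

lemma steklov_lipschitz:
  fixes f :: "real => 'a::euclidean_space"
  assumes f: "loop f" and B: "\<And>t. norm (f t) \<le> B" and h: "h > 0"
  shows "(2 * B / h)-lipschitz_on UNIV (steklov h f)"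
proof -
  have B0: "B \<ge> 0" using B norm_ge_zero order_trans by blast
  have main: "norm (steklov h f b - steklov h f a) \<le> 2 * B / h * (b - a)" if "a \<le> b" for a b
  proof -
    have "norm (integral {a..b} (\<lambda>t. f (t + h) - f t)) \<le> integral {a..b} (\<lambda>t. 2 * B)"
    proof (rule integral_norm_bound_integral)
      show "(\<lambda>t. f (t + h) - f t) integrable_on {a..b}"
        by (rule integrable_diff[OF loop_integrable(1)[OF loop_shift[OF f]] loop_integrable(1)[OF f]])
      show "norm (f (t + h) - f t) \<le> 2 * B" for t
        using B[of t] B[of "t + h"] norm_triangle_ineq4[of "f (t + h)" "f t"] by linarith
    qed auto
    also have "\<dots> = 2 * B * (b - a)" using that by simp
    finally have "norm (integral {a..b} (\<lambda>t. f (t + h) - f t)) / h \<le> 2 * B * (b - a) / h"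
      using h by (intro divide_right_mono) auto
    then show ?thesis using h unfolding steklov_diff[OF f that h] by (simp add: divide_inverse_commute)
  qed
  show ?thesis
  proof (rule lipschitz_onI)
    fix x y :: real
    show "dist (steklov h f x) (steklov h f y) \<le> 2 * B / h * dist x y"
      using main[of x y] main[of y x] by (cases "x \<le> y") (auto simp: dist_norm dist_real_def norm_minus_commute)
  qed (use B0 h in auto)
qed

lemma steklov_loop:
  fixes f :: "real => 'a::euclidean_space"
  assumes f: "loop f" and h: "h > 0"
  shows "loop (steklov h f)" "continuous_on UNIV (steklov h f)"
proof -
  obtain B where B: "\<And>t. norm (f t) \<le> B" using loop_bound[OF f] by blast
  show c: "continuous_on UNIV (steklov h f)"
    by (rule lipschitz_on_continuous_on[OF steklov_lipschitz[OF f B h]])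
  have "steklov h f (t + 2 * pi) = steklov h f t" for t
    using loopD(2)[OF f] by (simp add: steklov_shift add.assoc[symmetric])
  then show "loop (steklov h f)" by (rule continuous_periodic_loop[OF c])
qed

lemma steklov_bound:
  fixes f :: "real => 'a::euclidean_space"
  assumes f: "loop f" and B: "\<And>t. norm (f t) \<le> B" and h: "h > 0"
  shows "norm (steklov h f t) \<le> B"
proof -
  have "norm (integral {t..t + h} f) \<le> integral {t..t + h} (\<lambda>t. B)"
  proof (rule integral_norm_bound_integral)
    show "f integrable_on {t..t + h}" by (rule loop_integrable(1)[OF f])
    show "(\<lambda>t. B) integrable_on {t..t + h}" by (rule integrable_const_ivl)
  qed (use B in simp_all)
  also have "integral {t..t + h} (\<lambda>t. B) = h * B" using h by simp
  finally have "norm (integral {t..t + h} f) / h \<le> B"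
    using h by (simp only: pos_divide_le_eq mult.commute)
  then show ?thesis using h by (simp add: steklov_def divide_inverse_commute)
qed

text \<open>By Fubini, pairing the average with \<open>D\<close> is the mean over \<open>s\<close>
  in \<open>[0, h]\<close> of the pairings of the translates of \<open>f\<close> with
  \<open>D\<close>, and each of these is at most the variation of \<open>f\<close>. Lipschitz loops
  therefore approximate \<open>f\<close> without exceeding its variation.\<close>

lemma cvf_steklov_le:
  assumes f: "loop f" and h: "0 < h" "h \<le> 2 * pi"
  shows "cvf (steklov h f) \<le> cvf f"
proof (cases "cvf f = \<infinity>")
  case False
  then obtain L where L: "L \<ge> 0" "cvf f = ennreal L" by (cases "cvf f") auto
  show ?thesis
  proof (rule cvf_least[OF steklov_loop(1)[OF f h(1)]])
    fix \<psi> D :: "real => real^2"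
    assume \<psi>: "\<And>t. (\<psi> has_vector_derivative D t) (at t)" "continuous_on UNIV D" "loop D"
      "\<And>t. \<psi> (t + 2 * pi) = \<psi> t" "\<And>t. norm (\<psi> t) \<le> 1"
    obtain B where B: "\<And>t. norm (f t) \<le> B" "B \<ge> 0" using loop_bound[OF f] by blast
    obtain C where C: "\<And>t. norm (D t) \<le> C" "C \<ge> 0" using loop_bound[OF \<psi>(3)] by blast
    have [measurable]: "f \<in> borel_fun" "D \<in> borel_fun"
      using loopD(1) f \<psi>(3) by auto
    define K where "K = (\<lambda>(t, s). indicator ({0..2*pi} \<times> {0..h}) (t, s) *\<^sub>R (f (s + t) \<bullet> D t))"
    have Kint: "integrable (lborel \<Otimes>\<^sub>M lborel) K"
      unfolding K_def split_beta' prod.collapse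
    proof (rule integrableI_bounded_set_indicator)
      show "{0..2*pi} \<times> {0..h} \<in> sets (lborel \<Otimes>\<^sub>M lborel :: (real \<times> real) measure)" by measurable
      show "emeasure (lborel \<Otimes>\<^sub>M lborel) ({0..2*pi} \<times> {0..h}) < \<infinity>"
        using h by (subst lborel.emeasure_pair_measure_Times) (auto simp: ennreal_mult_less_top)
      show "AE p in lborel \<Otimes>\<^sub>M lborel. p \<in> {0..2*pi} \<times> {0..h} \<longrightarrow> norm (f (snd p + fst p) \<bullet> D (fst p)) \<le> B * C"
      proof (intro AE_I2 impI)
        fix p :: "real \<times> real"
        show "norm (f (snd p + fst p) \<bullet> D (fst p)) \<le> B * C"
          using Cauchy_Schwarz_ineq2[of "f (snd p + fst p)" "D (fst p)"] B C
          by (smt (verit) mult_mono norm_ge_zero real_norm_def)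
      qed
    qed measurable
    have in1: "(LINT s|lborel. K (t, s)) = indicator {0..2*pi} t *\<^sub>R (h * (steklov h f t \<bullet> D t))" for t
    proof -
      have si: "set_integrable lborel {0..h} (\<lambda>s. f (s + t) \<bullet> D t)"
      proof (rule bounded_borel_integrable_on(1))
        show "norm (f (s + t) \<bullet> D t) \<le> B * C" for s
          using Cauchy_Schwarz_ineq2[of "f (s + t)" "D t"] B C
          by (smt (verit) mult_mono norm_ge_zero real_norm_def)
      qed auto
      have "(LINT s|lborel. K (t, s)) = (LINT s|lborel. indicator {0..2*pi} t *\<^sub>R (indicator {0..h} s *\<^sub>R (f (s + t) \<bullet> D t)))"
        by (intro Bochner_Integration.integral_cong) (auto simp: K_def indicator_def)
      also have "\<dots> = indicator {0..2*pi} t *\<^sub>R (LINT s:{0..h}|lborel. f (s + t) \<bullet> D t)"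
        by (simp add: set_lebesgue_integral_def)
      also have "(LINT s:{0..h}|lborel. f (s + t) \<bullet> D t) = integral {0..h} (\<lambda>s. f (s + t) \<bullet> D t)"
        by (rule set_borel_integral_eq_integral(2)[OF si])
      also have "\<dots> = integral {0..h} (\<lambda>s. f (s + t)) \<bullet> D t"
        using integral_linear[OF loop_integrable(1)[OF loop_shift[OF f]] bounded_linear_inner_left[of "D t"]] by (simp add: o_def)
      also have "\<dots> = h * (steklov h f t \<bullet> D t)"
        using h by (simp add: steklov_shift)
      finally show ?thesis .
    qed
    define J where "J = (\<lambda>s. integral {0..2*pi} (\<lambda>t. f (t + s) \<bullet> D t))"
    have in2: "(LINT t|lborel. K (t, s)) = indicator {0..h} s *\<^sub>R J s" for s
    proof -
      have l: "loop (\<lambda>t. f (t + s) \<bullet> D t)" by (intro loop_inner loop_shift f \<psi>)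
      have "(LINT t|lborel. K (t, s)) = (LINT t|lborel. indicator {0..h} s *\<^sub>R (indicator {0..2*pi} t *\<^sub>R (f (t + s) \<bullet> D t)))"
        by (intro Bochner_Integration.integral_cong) (auto simp: K_def indicator_def add.commute)
      also have "\<dots> = indicator {0..h} s *\<^sub>R (LINT t:{0..2*pi}|lborel. f (t + s) \<bullet> D t)"
        by (simp add: set_lebesgue_integral_def)
      also have "(LINT t:{0..2*pi}|lborel. f (t + s) \<bullet> D t) = J s"
        unfolding J_def by (rule set_borel_integral_eq_integral(2)[OF loop_integrable(2)[OF l]])
      finally show ?thesis .
    qed
    \<comment> \<open>Translating the loop by \<open>s\<close> amounts to translating the test
      function by \<open>- s\<close>, which stays admissible.\<close>
    have J: "J s \<le> L" if "s \<in> {0..h}" for s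
    proof -
      have l: "loop (\<lambda>t. f t \<bullet> D (t + (- s)))" by (intro loop_inner loop_shift f \<psi>)
      have "J s = integral {0..2*pi} (\<lambda>t. f t \<bullet> D (t + (- s)))"
        using loop_integral_shift[OF l, of s] that h by (simp add: J_def)
      also have "ennreal \<dots> \<le> cvf f"
      proof (rule cvf_upper[OF f])
        show "((\<lambda>t. \<psi> (t + (- s))) has_vector_derivative D (t + (- s))) (at t)" for t
          by (rule has_vector_derivative_shift_real[OF \<psi>(1)])
        show "continuous_on UNIV (\<lambda>t. D (t + - s))"
          by (intro continuous_on_compose2[OF \<psi>(2)] continuous_intros) auto
        show "\<psi> (t + 2 * pi + - s) = \<psi> (t + - s)" for t
          using \<psi>(4)[of "t - s"] by (simp add: algebra_simps)
      qed (rule \<psi>(5))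
      finally have "ennreal (J s) \<le> ennreal L" using L by simp
      then show ?thesis using L by (simp add: ennreal_le_iff)
    qed
    have "h * integral {0..2*pi} (\<lambda>t. steklov h f t \<bullet> D t) = h * (LINT t:{0..2*pi}|lborel. steklov h f t \<bullet> D t)"
      using set_borel_integral_eq_integral(2)[OF loop_integrable(2)[OF loop_inner[OF steklov_loop(1)[OF f h(1)] \<psi>(3)], of 0 "2*pi"]] by simp
    also have "\<dots> = (LINT t|lborel. h * (indicator {0..2*pi} t *\<^sub>R (steklov h f t \<bullet> D t)))"
      unfolding set_lebesgue_integral_def by (rule integral_mult_right_zero[symmetric])
    also have "\<dots> = (LINT t|lborel. LINT s|lborel. K (t, s))"
      unfolding in1 by (intro Bochner_Integration.integral_cong) auto
    also have "\<dots> = (LINT s|lborel. LINT t|lborel. K (t, s))"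
      using lborel_pair.Fubini_integral[of "\<lambda>t s. K (t, s)"] Kint by simp
    also have "\<dots> = (LINT s:{0..h}|lborel. J s)"
      unfolding in2 by (simp add: set_lebesgue_integral_def)
    also have "\<dots> \<le> (LINT s:{0..h}|lborel. L)"
    proof (rule set_integral_mono)
      show "set_integrable lborel {0..h} J"
        using lborel_pair.integrable_snd[of "\<lambda>t s. K (t, s)"] Kint unfolding in2 set_integrable_def by simp
      show "set_integrable lborel {0..h} (\<lambda>s. L)"
        by (rule bounded_borel_integrable_on(1)[where B="\<bar>L\<bar>"]) auto
    qed (rule J)
    also have "\<dots> = h * L" using h by (simp add: set_lebesgue_integral_def)
    finally have "integral {0..2*pi} (\<lambda>t. steklov h f t \<bullet> D t) \<le> L" using h by simp
    then show "ennreal (integral {0..2*pi} (\<lambda>t. steklov h f t \<bullet> D t)) \<le> cvf f"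
      unfolding L(2) by (rule ennreal_leI)
  qed
qed simp

lemma steklov_tendsto_continuous:
  fixes f :: "real => 'a::euclidean_space"
  assumes f: "loop f" "continuous_on UNIV f"
  shows "(\<lambda>k. steklov (inverse (Suc k)) f t) \<longlonglongrightarrow> f t"
proof (rule LIMSEQ_I)
  fix e :: real assume e: "e > 0"
  have "isCont f t" using f(2) by (simp add: continuous_on_eq_continuous_at)
  then obtain d where d: "d > 0" "\<And>s. \<bar>s - t\<bar> < d ==> norm (f s - f t) < e / 2"
    using e unfolding continuous_at_eps_delta by (metis dist_norm dist_real_def half_gt_zero)
  obtain n where n: "inverse (real (Suc n)) < d" using reals_Archimedean[OF d(1)] by blast
  have "norm (steklov (inverse (Suc k)) f t - f t) < e" if "k \<ge> n" for k
  proof -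
    define h where "h = inverse (real (Suc k))"
    have h: "h > 0" "h < d" using n that by (auto simp: h_def intro!: le_less_trans[OF _ n] le_imp_inverse_le simp del: of_nat_Suc)
    have c: "integral {t..t + h} (\<lambda>s. f t) = h *\<^sub>R f t" using h by simp
    have "norm (integral {t..t + h} (\<lambda>s. f s - f t)) \<le> integral {t..t + h} (\<lambda>s. e / 2)"
    proof (rule integral_norm_bound_integral)
      show "(\<lambda>s. f s - f t) integrable_on {t..t + h}"
        by (rule integrable_diff[OF loop_integrable(1)[OF f(1)] integrable_const_ivl])
      show "(\<lambda>s. e / 2) integrable_on {t..t + h}" by (rule integrable_const_ivl)
      show "norm (f s - f t) \<le> e / 2" if "s \<in> {t..t + h}" for s
        using d(2)[of s] that h by fastforce
    qed
    also have "integral {t..t + h} (\<lambda>s. f s - f t) = h *\<^sub>R (steklov h f t - f t)"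
      unfolding steklov_def HK_integral_diff[OF loop_integrable(1)[OF f(1)] integrable_const_ivl] c
      using h by (simp add: scaleR_diff_right)
    also have "integral {t..t + h} (\<lambda>s. e / 2) = h * (e / 2)" using h by simp
    finally have "norm (steklov h f t - f t) \<le> e / 2" using h by simp
    then show ?thesis using e by (simp add: h_def)
  qed
  then show "\<exists>n0. \<forall>n\<ge>n0. norm (steklov (inverse (Suc n)) f t - f t) < e" by blast
qed

lemma steklov_tendsto_AE:
  fixes f :: "real => 'a::euclidean_space"
  assumes f: "loop f"
  shows "\<exists>N. negligible N \<and> (\<forall>t. t \<notin> N \<longrightarrow> (\<lambda>k. steklov (inverse (Suc k)) f t) \<longlonglongrightarrow> f t)"
proof -
  have "f integrable_on cbox a b" for a b using loop_integrable(1)[OF f] by simp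
  then obtain N where N: "negligible N" "\<And>x e. \<lbrakk>x \<notin> N; 0 < e\<rbrakk> \<Longrightarrow> \<exists>d>0. \<forall>h. 0 < h \<and> h < d \<longrightarrow>
       norm(integral (cbox x (x + h *\<^sub>R One)) f /\<^sub>R h ^ DIM(real) - f x) < e"
    using integrable_ccontinuous_explicit by blast
  have "(\<lambda>k. steklov (inverse (Suc k)) f t) \<longlonglongrightarrow> f t" if t: "t \<notin> N" for t
  proof (rule LIMSEQ_I)
    fix e :: real assume e: "e > 0"
    obtain d where d: "d > 0" "\<And>h. 0 < h ==> h < d ==> norm(integral (cbox t (t + h *\<^sub>R One)) f /\<^sub>R h ^ DIM(real) - f t) < e"
      using N(2)[OF t e] by blast
    obtain n where n: "inverse (real (Suc n)) < d" using reals_Archimedean[OF d(1)] by blast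
    have "norm (steklov (inverse (Suc k)) f t - f t) < e" if "k \<ge> n" for k
    proof -
      have "inverse (real (Suc k)) < d"
        using that by (auto intro!: le_less_trans[OF _ n] le_imp_inverse_le simp del: of_nat_Suc)
      then show ?thesis using d(2)[of "inverse (real (Suc k))"] by (simp add: steklov_def)
    qed
    then show "\<exists>n0. \<forall>n\<ge>n0. norm (steklov (inverse (Suc n)) f t - f t) < e" by blast
  qed
  with N(1) show ?thesis by blast
qed

lemma sum_integral_combine:
  fixes g :: "real => real" and s :: "nat => real"
  assumes g: "\<And>a b. g integrable_on {a..b}" and s: "\<And>i. i < n ==> s i \<le> s (Suc i)"
  shows "s 0 \<le> s n \<and> (\<Sum>i<n. integral {s i..s (Suc i)} g) = integral {s 0..s n} g"
  using s
proof (induction n)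
  case (Suc n)
  then have "s 0 \<le> s n" "s n \<le> s (Suc n)" "(\<Sum>i<n. integral {s i..s (Suc i)} g) = integral {s 0..s n} g" by auto
  then show ?case
    using HK_integral_combine[of "s 0" "s n" "s (Suc n)" g] g by auto
qed simp

lemma inverse_Suc_le: "inverse (real (Suc k)) \<le> 2 * pi" "inverse (real (Suc k)) > 0"
proof -
  have "inverse (real (Suc k)) \<le> inverse 1"
    by (rule le_imp_inverse_le) auto
  then show "inverse (real (Suc k)) \<le> 2 * pi" using pi_gt3 by simp
qed simp

text \<open>For each \<open>h\<close> the increments of the Steklov average along the chain add up
  to at most the integral of the norm of the difference quotient over a period, hence to at most
  \<open>L\<close>. Continuity of \<open>f\<close> lets \<open>h\<close> tend to 0 at every
  point.\<close>

lemma chain_variation_continuous: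
  assumes f: "loop f" "continuous_on UNIV f" and L: "cvf f \<le> ennreal L" "L \<ge> 0"
    and s: "\<And>i. i < n ==> s i \<le> s (Suc i)" "0 \<le> s 0" "s n \<le> 2 * pi"
  shows "(\<Sum>i<n. norm (f (s (Suc i)) - f (s i))) \<le> L"
proof (rule LIMSEQ_le_const2)
  show "(\<lambda>k. \<Sum>i<n. norm (steklov (inverse (Suc k)) f (s (Suc i)) - steklov (inverse (Suc k)) f (s i)))
    \<longlonglongrightarrow> (\<Sum>i<n. norm (f (s (Suc i)) - f (s i)))"
    by (intro tendsto_intros steklov_tendsto_continuous f)
  have "(\<Sum>i<n. norm (steklov h f (s (Suc i)) - steklov h f (s i))) \<le> L" if h: "0 < h" "h \<le> 2 * pi" for h
  proof -
    let ?g = "\<lambda>t. norm (f (t + h) - f t)"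
    have gl: "loop ?g" by (rule loop_norm_diff(1)[OF loop_shift[OF f(1)] f(1)])
    have "norm (steklov h f (s (Suc i)) - steklov h f (s i)) \<le> integral {s i..s (Suc i)} ?g / h" if "i < n" for i
    proof -
      have "norm (integral {s i..s (Suc i)} (\<lambda>t. f (t + h) - f t)) \<le> integral {s i..s (Suc i)} ?g"
      proof (rule integral_norm_bound_integral)
        show "(\<lambda>t. f (t + h) - f t) integrable_on {s i..s (Suc i)}"
          by (rule loop_integrable(1)[OF loop_norm_diff(2)[OF loop_shift[OF f(1)] f(1)]])
      qed (use loop_integrable(1)[OF gl] in simp_all)
      then show ?thesis
        unfolding steklov_diff[OF f(1) s(1)[OF that] h(1)] using h by (simp add: divide_inverse_commute)
    qed
    then have "(\<Sum>i<n. norm (steklov h f (s (Suc i)) - steklov h f (s i))) \<le> (\<Sum>i<n. integral {s i..s (Suc i)} ?g / h)"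
      by (intro sum_mono) auto
    also have "\<dots> = integral {s 0..s n} ?g / h"
      using sum_integral_combine[OF loop_integrable(1)[OF gl], of n s] s(1) by (simp add: sum_divide_distrib[symmetric])
    also have "\<dots> \<le> integral {0..2 * pi} ?g / h"
      using h s(2,3) loop_integrable(1)[OF gl] by (intro divide_right_mono integral_subset_le) auto
    also have "\<dots> \<le> L"
    proof -
      have "ennreal (integral {0..2 * pi} ?g) \<le> ennreal h * ennreal L"
        using cvf_difference_quotient[OF f h] L(1) by (rule order_trans[OF _ mult_left_mono]) auto
      then have "integral {0..2 * pi} ?g \<le> h * L"
        using h L(2) by (simp add: ennreal_mult[symmetric] ennreal_le_iff)
      then show ?thesis using h by (simp add: divide_le_eq mult.commute)
    qed
    finally show ?thesis .
  qed
  then show "\<exists>N. \<forall>k\<ge>N. (\<Sum>i<n. norm (steklov (inverse (Suc k)) f (s (Suc i)) - steklov (inverse (Suc k)) f (s i))) \<le> L"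
    using inverse_Suc_le by blast
qed

text \<open>\<open>cvf\<close> ignores null sets, so the sum is bounded only along points whose
  values the averages recover. The averages are continuous and have no larger variation, and the
  previous bound passes to the limit.\<close>

lemma chain_variation:
  assumes f: "loop f" and L: "cvf f \<le> ennreal L" "L \<ge> 0"
    and s: "\<And>i. i < n ==> s i \<le> s (Suc i)" "0 \<le> s 0" "s n \<le> 2 * pi"
    and lim: "\<And>i. i \<le> n ==> (\<lambda>k. steklov (inverse (Suc k)) f (s i)) \<longlonglongrightarrow> f (s i)"
  shows "(\<Sum>i<n. norm (f (s (Suc i)) - f (s i))) \<le> L"
proof (rule LIMSEQ_le_const2)
  show "(\<lambda>k. \<Sum>i<n. norm (steklov (inverse (Suc k)) f (s (Suc i)) - steklov (inverse (Suc k)) f (s i)))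
    \<longlonglongrightarrow> (\<Sum>i<n. norm (f (s (Suc i)) - f (s i)))"
    by (intro tendsto_sum tendsto_norm tendsto_diff lim) auto
  have "(\<Sum>i<n. norm (steklov (inverse (Suc k)) f (s (Suc i)) - steklov (inverse (Suc k)) f (s i))) \<le> L" for k
    using cvf_steklov_le[OF f inverse_Suc_le(2,1), of k] L
    by (intro chain_variation_continuous steklov_loop f inverse_Suc_le s) auto
  then show "\<exists>N. \<forall>k\<ge>N. (\<Sum>i<n. norm (steklov (inverse (Suc k)) f (s (Suc i)) - steklov (inverse (Suc k)) f (s i))) \<le> L"
    by blast
qed

section \<open>Loops with finitely many values\<close>

lemma finite_separation:
  assumes "finite (S :: 'a::real_normed_vector set)"
  obtains d where "d > 0" "\<And>x y. x \<in> S ==> y \<in> S ==> x \<noteq> y ==> d \<le> norm (x - y)"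
proof
  let ?D = "insert 1 ((\<lambda>(x, y). norm (x - y)) ` {(x, y) \<in> S \<times> S. x \<noteq> y})"
  have fin: "finite ?D" using assms by (auto intro!: finite_imageI intro: finite_subset[of _ "S \<times> S"])
  show "Min ?D > 0" using fin by (subst Min_gr_iff) auto
  show "Min ?D \<le> norm (x - y)" if "x \<in> S" "y \<in> S" "x \<noteq> y" for x y
    using fin that by (intro Min_le) auto
qed

text \<open>The counting function \<open>N x\<close> below is the largest number of value changes of \<open>f\<close> along
  Lebesgue points up to \<open>x\<close>. It is monotone and bounded, and \<open>f\<close> is constant a.e. on
  each of its level sets, which are intervals.\<close>

lemma piecewise_constant_structure:
  fixes f :: "real => real^2"
  assumes f: "loop f" "finite (range f)" and L: "cvf f \<noteq> \<infinity>"
  obtains T where "finite T" "T \<subseteq> {0..2*pi}"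
    "\<And>\<eta> D. (\<And>t. (\<eta> has_vector_derivative D t) (at t)) ==> continuous_on UNIV D ==> (\<And>t. t \<in> T ==> \<eta> t = 0) ==>
      loop_pair f D = 0"
proof -
  obtain L where L: "L \<ge> 0" "cvf f \<le> ennreal L" using L by (cases "cvf f") auto
  obtain Z where Z: "negligible Z" "\<And>t. t \<notin> Z ==> (\<lambda>k. steklov (inverse (Suc k)) f t) \<longlonglongrightarrow> f t"
    using steklov_tendsto_AE[OF f(1)] by blast
  obtain d where d: "d > 0" "\<And>x y. x \<in> range f ==> y \<in> range f ==> x \<noteq> y ==> d \<le> norm (x - y)"
    using finite_separation[OF f(2)] by blast
  define E where "E = {0..2*pi} - Z"
  define chain where "chain = (\<lambda>n x (s::nat => real). (\<forall>i<n. s i < s (Suc i)) \<and> (\<forall>i\<le>n. s i \<in> E) \<and> s n \<le> x \<and> (\<forall>i<n. f (s i) \<noteq> f (s (Suc i))))"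
  define A where "A = (\<lambda>x. {n. \<exists>s. chain n x s})"
  \<comment> \<open>Each change of value costs at least \<open>d\<close> in variation, so no chain
    has more than \<open>L / d\<close> steps.\<close>
  define M where "M = nat \<lceil>L / d\<rceil>"
  have AM: "A x \<subseteq> {..M}" for x
  proof
    fix n assume "n \<in> A x"
    then obtain s where s: "chain n x s" by (auto simp: A_def)
    have "real n * d = (\<Sum>i<n. d)" by simp
    also have "\<dots> \<le> (\<Sum>i<n. norm (f (s (Suc i)) - f (s i)))"
      using s unfolding chain_def by (intro sum_mono d) (auto dest: not_sym)
    also have "\<dots> \<le> L"
    proof (rule chain_variation[OF f(1) L(2,1)])
      show "s i \<le> s (Suc i)" if "i < n" for i using s that by (auto simp: chain_def intro: less_imp_le)
      have "s 0 \<in> E" "s n \<in> E" using s by (auto simp: chain_def)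
      then show "0 \<le> s 0" "s n \<le> 2 * pi" by (auto simp: E_def)
      show "(\<lambda>k. steklov (inverse (Suc k)) f (s i)) \<longlonglongrightarrow> f (s i)" if "i \<le> n" for i
        using s that by (intro Z(2)) (auto simp: chain_def E_def)
    qed
    finally have "real n \<le> L / d" using d by (simp add: pos_le_divide_eq)
    then show "n \<in> {..M}" unfolding M_def by (simp add: le_nat_iff le_ceiling_iff)
  qed
  have finA: "finite (A x)" for x using AM by (rule finite_subset) simp
  \<comment> \<open>The inserted 0 serves those \<open>x\<close> up to which there is no point of
    \<open>E\<close>, and hence no chain at all.\<close>
  define N where "N = (\<lambda>x. Max (insert 0 (A x)))"
  have NM: "N x \<le> M" for x
    using AM[of x] finA[of x] unfolding N_def by (subst Max_le_iff) auto
  have leN: "n \<le> N x" if "chain n x s" for n x s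
    unfolding N_def using that finA by (intro Max_ge) (auto simp: A_def)
  have monoN: "N x \<le> N y" if "x \<le> y" for x y
  proof -
    have "A x \<subseteq> A y" using that by (auto simp: A_def chain_def)
    then show ?thesis unfolding N_def using finA by (intro Max_mono) auto
  qed
  have inN: "\<exists>s. chain (N x) x s" if "x \<in> E" for x
  proof -
    have "chain 0 x (\<lambda>_. x)" using that by (simp add: chain_def)
    then have eq: "insert 0 (A x) = A x" by (auto simp: A_def)
    have "Max (insert 0 (A x)) \<in> insert 0 (A x)" using finA[of x] by (intro Max_in) auto
    then have "N x \<in> A x" by (simp only: N_def eq)
    then show ?thesis by (simp add: A_def)
  qed
  have ext: "chain (Suc n) y (s(Suc n := y))" if "chain n x s" "x \<le> y" "y \<in> E" "f (s n) \<noteq> f y" for n x y s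
  proof -
    have "s n < y" using that by (metis chain_def less_le order_trans)
    then show ?thesis using that by (auto simp: chain_def less_Suc_eq_le le_Suc_eq less_Suc_eq)
  qed
  \<comment> \<open>A longest chain up to \<open>x\<close> ends with the value \<open>f x\<close>,
    since otherwise \<open>x\<close> itself would prolong it. If \<open>f y\<close> were different,
    \<open>y\<close> would prolong it, against \<open>N x = N y\<close>.\<close>
  have const: "f x = f y" if c: "x \<in> E" "y \<in> E" "x \<le> y" "N x = N y" for x y
  proof -
    obtain s where s: "chain (N x) x s" using inN[OF c(1)] by blast
    have 1: "f (s (N x)) = f x"
    proof (rule ccontr)
      assume "f (s (N x)) \<noteq> f x"
      from leN[OF ext[OF s order_refl c(1) this]] show False by simp
    qed
    show ?thesis
    proof (rule ccontr)
      assume "f x \<noteq> f y"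
      then have "f (s (N x)) \<noteq> f y" using 1 by simp
      from leN[OF ext[OF s c(3,2) this]] c(4) show False by simp
    qed
  qed
  define J where "J = (\<lambda>m. {x \<in> {0..2*pi}. N x = m})"
  define a where "a = (\<lambda>m. Inf (J m))"
  define b where "b = (\<lambda>m. Sup (J m))"
  have bdd: "bdd_below (J m)" "bdd_above (J m)" for m
    by (auto intro!: bdd_belowI[of _ 0] bdd_aboveI[of _ "2*pi"] simp: J_def)
  have Jsub: "J m \<subseteq> {a m..b m}" for m
    using bdd[of m] by (auto simp: a_def b_def intro: cInf_lower cSup_upper)
  \<comment> \<open>Monotonicity of \<open>N\<close> makes the level set contain the open interval
    between its bounds; whether the ends belong to it does not affect integrals.\<close>
  have Jsup: "{a m<..<b m} \<subseteq> J m" if c: "J m \<noteq> {}" for m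
  proof
    fix x assume x: "x \<in> {a m<..<b m}"
    obtain y where y: "y \<in> J m" "y < x" using x c bdd[of m] by (auto simp: a_def cInf_less_iff)
    obtain z where z: "z \<in> J m" "x < z" using x c bdd[of m] by (auto simp: b_def less_cSup_iff)
    have "N y \<le> N x" "N x \<le> N z" using y z by (auto intro!: monoN)
    then show "x \<in> J m" using y z by (auto simp: J_def)
  qed
  define T where "T = (a ` {m \<in> {..M}. J m \<noteq> {}}) \<union> (b ` {m \<in> {..M}. J m \<noteq> {}})"
  show ?thesis
  proof (rule that)
    show "finite T" by (simp add: T_def)
    have "a m \<in> {0..2*pi}" "b m \<in> {0..2*pi}" if c: "J m \<noteq> {}" for m
    proof -
      obtain x where "x \<in> J m" using c by blast
      then have "x \<in> {a m..b m}" "x \<in> {0..2*pi}" using Jsub[of m] by (auto simp: J_def)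
      moreover have "a m \<ge> 0" "b m \<le> 2 * pi"
        using c unfolding a_def b_def by (auto intro!: cInf_greatest cSup_least simp: J_def)
      ultimately show "a m \<in> {0..2*pi}" "b m \<in> {0..2*pi}" by auto
    qed
    then show "T \<subseteq> {0..2*pi}" unfolding T_def by blast
    fix \<eta> D :: "real => real^2"
    assume \<eta>: "\<And>t. (\<eta> has_vector_derivative D t) (at t)" "continuous_on UNIV D" "\<And>t. t \<in> T ==> \<eta> t = 0"
    \<comment> \<open>On a level set \<open>f\<close> is almost everywhere a constant
      \<open>v\<close>, and \<open>\<eta>\<close> vanishes at both ends of the interval, so the
      fundamental theorem gives 0.\<close>
    have piece: "((\<lambda>t. f t \<bullet> D t) has_integral 0) (J m)" if m: "m \<le> M" for m
    proof (cases "J m = {}")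
      case False
      have ab: "a m \<le> b m" using False Jsub[of m] by fastforce
      \<comment> \<open>A level set without points of \<open>E\<close> lies in the null set
        \<open>Z\<close>, and any value serves.\<close>
      define v where "v = (if J m \<inter> E = {} then 0 else f (SOME t. t \<in> J m \<inter> E))"
      have v: "f t = v" if "t \<in> J m \<inter> E" for t
      proof -
        define u where "u = (SOME t. t \<in> J m \<inter> E)"
        have u: "u \<in> J m \<inter> E" unfolding u_def by (rule someI[where P="\<lambda>t. t \<in> J m \<inter> E", OF that])
        have "f t = f u"
        proof (cases "t \<le> u")
          case True
          then show ?thesis using const[of t u] u that by (auto simp: J_def)
        next
          case False
          then show ?thesis using const[of u t] u that by (auto simp: J_def)
        qed
        moreover have "v = f u" using that by (auto simp: v_def u_def)
        ultimately show ?thesis by simp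
      qed
      have "a m \<in> T" "b m \<in> T" using m False by (auto simp: T_def)
      then have z: "\<eta> (a m) = 0" "\<eta> (b m) = 0" using \<eta>(3) by auto
      have "(D has_integral (\<eta> (b m) - \<eta> (a m))) {a m..b m}"
        using ab \<eta>(1) by (intro fundamental_theorem_of_calculus) (auto intro: has_vector_derivative_at_within)
      from has_integral_linear[OF this bounded_linear_inner_right[of v]]
      have "((\<lambda>t. v \<bullet> D t) has_integral 0) {a m..b m}" by (simp add: o_def z)
      moreover have "((\<lambda>t. v \<bullet> D t) has_integral 0) {a m..b m} \<longleftrightarrow> ((\<lambda>t. v \<bullet> D t) has_integral 0) (J m)"
      proof (rule has_integral_spike_set_eq)
        have n: "negligible {a m, b m}" by simp
        have "x \<in> {a m, b m}" if "x \<in> {a m..b m} - J m" for x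
          using Jsup[OF False] that by (cases "x = a m"; cases "x = b m") (auto simp: subset_iff less_le)
        then show "negligible {x \<in> {a m..b m} - J m. v \<bullet> D x \<noteq> 0}"
          by (intro negligible_subset[OF n]) blast
        show "negligible {x \<in> J m - {a m..b m}. v \<bullet> D x \<noteq> 0}"
          using Jsub[of m] by (intro negligible_subset[OF n]) blast
      qed
      ultimately have "((\<lambda>t. v \<bullet> D t) has_integral 0) (J m)" by blast
      then show ?thesis
      proof (rule has_integral_spike[OF Z(1), rotated])
        show "f t \<bullet> D t = v \<bullet> D t" if "t \<in> J m - Z" for t
          using v[of t] that by (auto simp: E_def J_def)
      qed
    qed simp
    have "((\<lambda>t. f t \<bullet> D t) has_integral (\<Sum>m\<in>{..M}. 0)) (\<Union>m\<in>{..M}. J m)"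
      using piece by (intro has_integral_UN) (auto simp: pairwise_def J_def intro!: negligible_subset[OF negligible_empty])
    moreover have "(\<Union>m\<in>{..M}. J m) = {0..2*pi}"
      using NM by (auto simp: J_def)
    ultimately show "loop_pair f D = 0"
      by (simp add: integral_unique)
  qed
qed

text \<open>Fatou's lemma for the difference quotients, whose integrals over a period are at most
  \<open>cvf f\<close>. Only this inequality is needed, to bound the gradient of homogeneous
  extensions.\<close>

lemma nn_integral_derivative_le_cvf:
  assumes f: "loop f" "continuous_on UNIV f" and D: "AE t in lborel. (f has_vector_derivative D t) (at t)"
  shows "(\<integral>\<^sup>+t\<in>{0..2*pi}. ennreal (norm (D t)) \<partial>lborel) \<le> cvf f"
proof -
  define h where "h = (\<lambda>k. inverse (real (Suc k)))"
  have h: "h k > 0" "h k \<le> 2 * pi" for k using inverse_Suc_le by (auto simp: h_def)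
  define q where "q = (\<lambda>k t. norm (f (t + h k) - f t))"
  have ql: "loop (q k)" for k unfolding q_def by (rule loop_norm_diff(1)[OF loop_shift[OF f(1)] f(1)])
  have [measurable]: "q k \<in> borel_fun" for k using loopD(1)[OF ql] .
  have lim: "(\<lambda>k. ennreal (q k t / h k)) \<longlonglongrightarrow> ennreal (norm (D t))" if "(f has_vector_derivative D t) (at t)" for t
  proof -
    have "((\<lambda>y. norm (f y - f t - (y - t) *\<^sub>R D t) / norm (y - t)) \<longlongrightarrow> 0) (at t)"
      using that by (simp add: has_vector_derivative_def has_derivative_iff_norm)
    moreover have "filterlim (\<lambda>k. t + h k) (at t) sequentially"
    proof -
      have "(\<lambda>k. t + h k) \<longlonglongrightarrow> t + 0" unfolding h_def by (intro tendsto_intros LIMSEQ_inverse_real_of_nat)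
      then show ?thesis using h by (auto simp: filterlim_at less_imp_neq[symmetric] intro!: always_eventually)
    qed
    ultimately have z: "(\<lambda>k. norm (f (t + h k) - f t - h k *\<^sub>R D t) / h k) \<longlonglongrightarrow> 0"
      using filterlim_compose[of "\<lambda>y. norm (f y - f t - (y - t) *\<^sub>R D t) / norm (y - t)"] h by (fastforce simp: abs_of_pos)
    have "\<bar>q k t / h k - norm (D t)\<bar> \<le> norm (f (t + h k) - f t - h k *\<^sub>R D t) / h k" for k
    proof -
      have "\<bar>norm (f (t + h k) - f t) - norm (h k *\<^sub>R D t)\<bar> \<le> norm (f (t + h k) - f t - h k *\<^sub>R D t)"
        by (rule norm_triangle_ineq3)
      then have "\<bar>q k t - h k * norm (D t)\<bar> / h k \<le> norm (f (t + h k) - f t - h k *\<^sub>R D t) / h k"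
        using h[of k] by (intro divide_right_mono) (auto simp: q_def)
      moreover have "\<bar>q k t - h k * norm (D t)\<bar> / h k = \<bar>q k t / h k - norm (D t)\<bar>"
      proof -
        have "q k t / h k - norm (D t) = (q k t - h k * norm (D t)) / h k"
          using h(1)[of k] by (simp add: diff_divide_distrib)
        then show ?thesis using h(1)[of k] by (simp add: abs_divide)
      qed
      ultimately show ?thesis by simp
    qed
    then have "(\<lambda>k. q k t / h k - norm (D t)) \<longlonglongrightarrow> 0"
      by (intro Lim_null_comparison[OF _ z]) (auto intro!: always_eventually)
    then have "(\<lambda>k. q k t / h k) \<longlonglongrightarrow> norm (D t)" by (simp add: LIM_zero_iff)
    then show ?thesis by (rule tendsto_ennrealI)
  qed
  have "(\<integral>\<^sup>+t\<in>{0..2*pi}. ennreal (norm (D t)) \<partial>lborel) = (\<integral>\<^sup>+t. liminf (\<lambda>k. ennreal (q k t / h k) * indicator {0..2*pi} t) \<partial>lborel)"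
  proof (rule nn_integral_cong_AE, use D in eventually_elim)
    case (elim t)
    have "(\<lambda>k. ennreal (q k t / h k) * indicator {0..2*pi} t) \<longlonglongrightarrow> ennreal (norm (D t)) * indicator {0..2*pi} t"
      using lim[OF elim] by (auto simp: indicator_def)
    then show ?case by (simp add: lim_imp_Liminf)
  qed
  also have "\<dots> \<le> liminf (\<lambda>k. \<integral>\<^sup>+t\<in>{0..2*pi}. ennreal (q k t / h k) \<partial>lborel)"
    by (rule nn_integral_liminf) measurable
  also have "\<dots> \<le> liminf (\<lambda>k. cvf f)"
  proof (rule Liminf_mono, rule always_eventually, rule allI)
    fix k
    have "(\<integral>\<^sup>+t\<in>{0..2*pi}. ennreal (q k t / h k) \<partial>lborel) = (\<integral>\<^sup>+t. ennreal (1 / h k) * ennreal (indicator {0..2*pi} t *\<^sub>R q k t) \<partial>lborel)"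
      using h[of k] by (intro nn_integral_cong) (auto simp: indicator_def q_def ennreal_mult[symmetric])
    also have "\<dots> = ennreal (1 / h k) * (\<integral>\<^sup>+t. ennreal (indicator {0..2*pi} t *\<^sub>R q k t) \<partial>lborel)"
      by (rule nn_integral_cmult) measurable
    also have "(\<integral>\<^sup>+t. ennreal (indicator {0..2*pi} t *\<^sub>R q k t) \<partial>lborel) = ennreal (integral {0..2*pi} (q k))"
      using loop_integrable(2)[OF ql, of 0 "2*pi" k] set_borel_integral_eq_integral(2)[OF loop_integrable(2)[OF ql, of 0 "2*pi" k]]
      by (subst nn_integral_eq_integral) (auto simp: set_integrable_def set_lebesgue_integral_def q_def)
    also have "ennreal (1 / h k) * ennreal (integral {0..2*pi} (q k)) \<le> ennreal (1 / h k) * (ennreal (h k) * cvf f)"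
      using cvf_difference_quotient[OF f h] unfolding q_def by (intro mult_left_mono) auto
    also have "\<dots> = cvf f"
      using h[of k] by (simp add: mult.assoc[symmetric] ennreal_mult[symmetric])
    finally show "(\<integral>\<^sup>+t\<in>{0..2*pi}. ennreal (q k t / h k) \<partial>lborel) \<le> cvf f" .
  qed
  finally show ?thesis by (simp add: Liminf_const)
qed

lemma loop_integral_by_parts:
  fixes f \<psi> :: "real => 'a::euclidean_space"
  assumes f: "\<And>t. (f has_vector_derivative f' t) (at t)" "\<And>t. f (t + 2 * pi) = f t"
    and \<psi>: "\<And>t. (\<psi> has_vector_derivative \<psi>' t) (at t)" "\<And>t. \<psi> (t + 2 * pi) = \<psi> t"
    and l: "loop f" "loop f'" "loop \<psi>" "loop \<psi>'"
  shows "loop_pair f \<psi>' = - loop_pair f' \<psi>"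
proof -
  have der: "((\<lambda>t. f t \<bullet> \<psi> t) has_vector_derivative (f t \<bullet> \<psi>' t + f' t \<bullet> \<psi> t)) (at t)" for t
    by (rule bounded_bilinear.has_vector_derivative[OF bounded_bilinear_inner f(1) \<psi>(1)])
  have "((\<lambda>t. f t \<bullet> \<psi>' t + f' t \<bullet> \<psi> t) has_integral (f (2*pi) \<bullet> \<psi> (2*pi) - f 0 \<bullet> \<psi> 0)) {0..2*pi}"
    using der by (intro fundamental_theorem_of_calculus) (auto intro: has_vector_derivative_at_within)
  then have "integral {0..2*pi} (\<lambda>t. f t \<bullet> \<psi>' t + f' t \<bullet> \<psi> t) = 0"
    using f(2)[of 0] \<psi>(2)[of 0] by (simp add: integral_unique)
  then show ?thesis
    by (subst (asm) Henstock_Kurzweil_Integration.integral_add) (auto intro!: loop_integrable loop_inner l)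
qed

section \<open>Cutoffs and test functions concentrated near finitely many angles\<close>

lemma has_real_derivative_max_0_square:
  "((\<lambda>s. (max 0 s)\<^sup>2) has_real_derivative 2 * max 0 s) (at s)" for s :: real
proof -
  consider "s < 0" | "s > 0" | "s = 0" by linarith
  then show ?thesis
  proof cases
    case 1
    have "((\<lambda>s. 0) has_real_derivative 0) (at s)" by simp
    then have "((\<lambda>s. (max 0 s)\<^sup>2) has_real_derivative 0) (at s)"
      by (rule has_field_derivative_transform_within_open[where S="{..<0}"]) (use 1 in auto)
    then show ?thesis using 1 by simp
  next
    case 2
    have "((\<lambda>s. s\<^sup>2) has_real_derivative 2 * s) (at s)" by (auto intro!: derivative_eq_intros)
    then have "((\<lambda>s. (max 0 s)\<^sup>2) has_real_derivative 2 * s) (at s)"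
      by (rule has_field_derivative_transform_within_open[where S="{0<..}"]) (use 2 in auto)
    then show ?thesis using 2 by simp
  next
    case 3
    have "((\<lambda>h. (max 0 h)\<^sup>2 / h) \<longlongrightarrow> 0) (at (0::real))"
    proof (rule Lim_null_comparison)
      show "\<forall>\<^sub>F h in at (0::real). norm ((max 0 h)\<^sup>2 / h) \<le> \<bar>h\<bar>"
        by (rule always_eventually) (auto simp: max_def power2_eq_square abs_mult)
      show "((\<lambda>h. \<bar>h\<bar>) \<longlongrightarrow> 0) (at (0::real))" by (intro tendsto_rabs_zero tendsto_ident_at)
    qed
    then show ?thesis using 3 by (simp add: DERIV_def)
  qed
qed

text \<open>An explicit step from 1 on \<open>s \<le> 0\<close> to 0 on \<open>s \<ge> 1\<close>. It
  is continuously differentiable because squares of positive parts are, and the two squares in the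
  denominator never vanish together.\<close>

definition cutoff :: "real => real" where
  "cutoff s = (max 0 (1 - s))\<^sup>2 / ((max 0 (1 - s))\<^sup>2 + (max 0 s)\<^sup>2)"

definition cutoff' :: "real => real" where
  "cutoff' s = (- (2 * max 0 (1 - s)) * ((max 0 (1 - s))\<^sup>2 + (max 0 s)\<^sup>2) -
     (max 0 (1 - s))\<^sup>2 * (- (2 * max 0 (1 - s)) + 2 * max 0 s)) /
     (((max 0 (1 - s))\<^sup>2 + (max 0 s)\<^sup>2) * ((max 0 (1 - s))\<^sup>2 + (max 0 s)\<^sup>2))"

lemma cutoff_denom_pos: "(max 0 (1 - s))\<^sup>2 + (max 0 s)\<^sup>2 > (0::real)"
proof (cases "s > 0")
  case True then show ?thesis by (intro add_nonneg_pos) auto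
next
  case False then show ?thesis by (intro add_pos_nonneg) auto
qed

lemma cutoff_derivative: "(cutoff has_real_derivative cutoff' s) (at s)"
proof -
  have 1: "((\<lambda>s. (max 0 (1 - s))\<^sup>2) has_real_derivative - (2 * max 0 (1 - s))) (at s)"
  proof -
    have "((\<lambda>s. 1 - s) has_real_derivative -1) (at s)" by (auto intro!: derivative_eq_intros)
    from DERIV_chain'[OF this has_real_derivative_max_0_square[of "1 - s"]]
    show ?thesis by simp
  qed
  show ?thesis
    unfolding cutoff_def[abs_def] cutoff'_def using cutoff_denom_pos[of s]
    by (intro DERIV_divide DERIV_add 1 has_real_derivative_max_0_square) auto
qed

lemma cutoff_continuous: "continuous_on UNIV cutoff'" "continuous_on UNIV cutoff"
proof -
  show "continuous_on UNIV cutoff'"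
    unfolding cutoff'_def[abs_def] using cutoff_denom_pos
    by (intro continuous_intros) (metis less_irrefl mult_eq_0_iff)
  show "continuous_on UNIV cutoff"
    using cutoff_derivative DERIV_isCont by (auto simp: continuous_on_eq_continuous_at)
qed

lemma cutoff_le: "s \<le> 0 ==> cutoff s = 1" and cutoff_ge: "s \<ge> 1 ==> cutoff s = 0"
  by (auto simp: cutoff_def)

lemma cutoff_bounds: "0 \<le> cutoff s" "cutoff s \<le> 1"
  using cutoff_denom_pos[of s] by (auto simp: cutoff_def divide_le_eq)

text \<open>The product of \<open>1 - cos (t - \<tau>)\<close> over \<open>\<tau>\<close> in
  \<open>T\<close>; its zeros are the translates of \<open>T\<close> by multiples of
  \<open>2 * pi\<close>.\<close>

lemma periodic_zero_function:
  assumes "finite T"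
  obtains p p' :: "real => real" where "\<And>t. (p has_real_derivative p' t) (at t)" "continuous_on UNIV p'"
    "\<And>t. p (t + 2 * pi) = p t" "\<And>t. p t \<ge> 0" "\<And>\<tau>. \<tau> \<in> T ==> p \<tau> = 0" "countable {t. p t = 0}"
proof -
  have "\<exists>p p' :: real => real. (\<forall>t. (p has_real_derivative p' t) (at t)) \<and> continuous_on UNIV p' \<and>
    (\<forall>t. p (t + 2 * pi) = p t) \<and> (\<forall>t. p t \<ge> 0) \<and> (\<forall>\<tau>\<in>T. p \<tau> = 0) \<and> countable {t. p t = 0}"
    using assms
  proof (induction T rule: finite_induct)
    case empty
    show ?case by (rule exI[of _ "\<lambda>t. 1"], rule exI[of _ "\<lambda>t. 0"]) auto
  next
    case (insert \<tau> T)
    then obtain p p' :: "real => real" where p: "\<And>t. (p has_real_derivative p' t) (at t)" "continuous_on UNIV p'"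
      "\<And>t. p (t + 2 * pi) = p t" "\<And>t. p t \<ge> 0" "\<And>\<tau>. \<tau> \<in> T ==> p \<tau> = 0" "countable {t. p t = 0}"
      by metis
    have pc: "continuous_on UNIV p"
      using p(1) DERIV_isCont by (auto simp: continuous_on_eq_continuous_at)
    have "{t. 1 - cos (t - \<tau>) = 0} \<subseteq> (\<lambda>n. \<tau> + real n * 2 * pi) ` UNIV \<union> (\<lambda>n. \<tau> - real n * 2 * pi) ` UNIV"
    proof
      fix t assume "t \<in> {t. 1 - cos (t - \<tau>) = 0}"
      then have "cos (t - \<tau>) = 1" by simp
      then have "(\<exists>n::nat. t - \<tau> = real n * 2 * pi) \<or> (\<exists>n::nat. t - \<tau> = - (real n * 2 * pi))"
        unfolding cos_one_2pi .
      then show "t \<in> (\<lambda>n. \<tau> + real n * 2 * pi) ` UNIV \<union> (\<lambda>n. \<tau> - real n * 2 * pi) ` UNIV"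
        by (auto simp: image_iff algebra_simps)
    qed
    then have c: "countable {t. 1 - cos (t - \<tau>) = 0}"
      by (rule countable_subset) auto
    have "{t. p t * (1 - cos (t - \<tau>)) = 0} = {t. p t = 0} \<union> {t. 1 - cos (t - \<tau>) = 0}" by auto
    then have r1: "countable {t. p t * (1 - cos (t - \<tau>)) = 0}" using c p(6) by simp
    have r2: "((\<lambda>t. p t * (1 - cos (t - \<tau>))) has_real_derivative p' t * (1 - cos (t - \<tau>)) + p t * sin (t - \<tau>)) (at t)" for t
      using p(1)[of t] by (auto intro!: derivative_eq_intros simp: algebra_simps)
    have r3: "continuous_on UNIV (\<lambda>t. p' t * (1 - cos (t - \<tau>)) + p t * sin (t - \<tau>))"
      by (intro continuous_intros p pc)
    have r4: "p (t + 2 * pi) * (1 - cos (t + 2 * pi - \<tau>)) = p t * (1 - cos (t - \<tau>))" for t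
    proof -
      have "t + 2 * pi - \<tau> = (t - \<tau>) + 2 * pi" by simp
      then show ?thesis by (simp only: p(3) cos_periodic)
    qed
    have r5: "p t * (1 - cos (t - \<tau>)) \<ge> 0" for t using p(4)[of t] by (intro mult_nonneg_nonneg) auto
    have r6: "p \<tau>' * (1 - cos (\<tau>' - \<tau>)) = 0" if "\<tau>' \<in> insert \<tau> T" for \<tau>' using that p(5) by auto
    show ?case
      by (rule exI[of _ "\<lambda>t. p t * (1 - cos (t - \<tau>))"],
          rule exI[of _ "\<lambda>t. p' t * (1 - cos (t - \<tau>)) + p t * sin (t - \<tau>)"])
         (intro conjI allI ballI r1 r2 r3 r4 r5 r6)
  qed
  then show ?thesis using that by blast
qed

text \<open>A nearly optimal test function is multiplied by a cutoff that is 1 around the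
  exceptional angles \<open>T\<close> and 0 outside a small neighbourhood of the zeros of
  \<open>p\<close>. The part removed vanishes on \<open>T\<close>, so
  \<open>piecewise_constant_structure\<close> makes its pairing with \<open>f\<close> zero and
  nothing is lost.\<close>

lemma concentrated_test:
  fixes f :: "real => real^2"
  assumes f: "loop f" "finite (range f)" and fin: "cvf f \<noteq> \<infinity>" and c: "ennreal c < cvf f" and \<epsilon>: "\<epsilon> > 0"
  obtains \<psi> D Z where "\<And>t. (\<psi> has_vector_derivative D t) (at t)" "continuous_on UNIV D"
    "\<And>t. \<psi> (t + 2 * pi) = \<psi> t" "\<And>t. norm (\<psi> t) \<le> 1" "loop \<psi>" "loop D"
    "Z \<in> sets borel" "Z \<subseteq> {0..2*pi}" "emeasure lborel Z \<le> ennreal \<epsilon>" "\<And>t. t \<in> {0..2*pi} - Z ==> \<psi> t = 0"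
    "c \<le> loop_pair f D"
proof -
  obtain \<psi>0 where \<psi>0: "\<psi>0 \<in> circle_test" "ennreal c < ennreal (LINT t|lebesgue_on {0..2 * pi}. f t \<bullet> vector_derivative \<psi>0 (at t))"
    using c unfolding cvf_def less_SUP_iff by blast
  obtain D0 where D0: "\<And>t. (\<psi>0 has_vector_derivative D0 t) (at t)" "continuous_on UNIV D0"
    "\<And>t. vector_derivative \<psi>0 (at t) = D0 t" "loop D0" "loop \<psi>0" "continuous_on UNIV \<psi>0" 
    "\<And>t. \<psi>0 (t + 2 * pi) = \<psi>0 t" "\<And>t. norm (\<psi>0 t) \<le> 1"
    using circle_testD[OF \<psi>0(1)] by blast
  have c0: "c \<le> loop_pair f D0"
    using \<psi>0(2) unfolding D0(3) loop_integral_lint[OF f(1) D0(4)]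
    by (metis ennreal_leI leD leI less_imp_le)
  obtain T where T: "finite T" "T \<subseteq> {0..2*pi}"
    "\<And>\<eta> D. (\<And>t. (\<eta> has_vector_derivative D t) (at t)) ==> continuous_on UNIV D ==> (\<And>t. t \<in> T ==> \<eta> t = 0) ==>
      loop_pair f D = 0"
    using piecewise_constant_structure[OF f fin] by blast
  obtain p p' :: "real => real" where p: "\<And>t. (p has_real_derivative p' t) (at t)" "continuous_on UNIV p'"
    "\<And>t. p (t + 2 * pi) = p t" "\<And>t. p t \<ge> 0" "\<And>\<tau>. \<tau> \<in> T ==> p \<tau> = 0" "countable {t. p t = 0}"
    using periodic_zero_function[OF T(1)] by blast
  have pc: "continuous_on UNIV p"
    using p(1) DERIV_isCont by (auto simp: continuous_on_eq_continuous_at)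
  then have [measurable]: "p \<in> borel_fun" by (rule borel_measurable_continuous_onI)
  \<comment> \<open>The cutoff will vanish in \<open>[0, 2*pi]\<close> off one of these sets. They
    decrease to zeros of \<open>p\<close>, a countable set, so their measures tend to 0.\<close>
  define W where "W = (\<lambda>n::nat. {t \<in> {0..2*pi}. p t < 2 * inverse (Suc n)})"
  have Wm: "W n \<in> sets borel" for n unfolding W_def by measurable
  have "(\<lambda>n. emeasure lborel (W n)) \<longlonglongrightarrow> emeasure lborel (\<Inter>n. W n)"
  proof (rule Lim_emeasure_decseq)
    show "range W \<subseteq> sets lborel" using Wm by auto
    show "decseq W"
    proof (rule decseq_SucI, rule subsetI)
      fix n t assume t: "t \<in> W (Suc n)"
      have "inverse (real (Suc (Suc n))) \<le> inverse (real (Suc n))" by (rule le_imp_inverse_le) auto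
      moreover have "t \<in> {0..2*pi}" "p t < 2 * inverse (real (Suc (Suc n)))"
        using t unfolding W_def by blast+
      ultimately show "t \<in> W n" unfolding W_def mem_Collect_eq by linarith
    qed
    show "emeasure lborel (W i) \<noteq> \<infinity>" for i
    proof -
      have "bounded (W i)" unfolding W_def by (rule bounded_subset[of "{0..2*pi}"]) auto
      then show ?thesis using emeasure_bounded_finite[of "W i"] by simp
    qed
  qed
  moreover have "emeasure lborel (\<Inter>n. W n) = 0"
  proof -
    have "(\<Inter>n. W n) \<subseteq> {t. p t = 0}"
    proof
      fix t assume t: "t \<in> (\<Inter>n. W n)"
      have "p t \<le> 0"
      proof (rule LIMSEQ_le_const)
        show "(\<lambda>n. 2 * inverse (real (Suc n))) \<longlonglongrightarrow> 0"
          using tendsto_mult_left[OF LIMSEQ_inverse_real_of_nat, of 2] by simp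
        show "\<exists>N. \<forall>n\<ge>N. p t \<le> 2 * inverse (real (Suc n))"
          using t by (intro exI[of _ 0]) (auto simp: W_def intro: less_imp_le simp del: of_nat_Suc)
      qed
      then show "t \<in> {t. p t = 0}" using p(4)[of t] by simp
    qed
    then show ?thesis using p(6) by (intro emeasure_lborel_countable) (rule countable_subset)
  qed
  ultimately have "(\<lambda>n. emeasure lborel (W n)) \<longlonglongrightarrow> 0" by simp
  then have "\<forall>\<^sub>F n in sequentially. emeasure lborel (W n) < ennreal \<epsilon>"
    using \<epsilon> by (intro order_tendstoD(2)) auto
  then obtain n where n: "emeasure lborel (W n) < ennreal \<epsilon>" by (auto simp: eventually_sequentially)
  define e where "e = inverse (real (Suc n))"
  have e: "e > 0" by (simp add: e_def)
  \<comment> \<open>Equal to 1 where \<open>p t \<le> e\<close>, in particular on \<open>T\<close>,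
    and to 0 where \<open>p t \<ge> 2 * e\<close>, that is, off \<open>W n\<close>.\<close>
  define \<zeta> where "\<zeta> = (\<lambda>t. cutoff (p t / e - 1))"
  define \<zeta>' where "\<zeta>' = (\<lambda>t. cutoff' (p t / e - 1) * (p' t / e))"
  have \<zeta>d: "(\<zeta> has_real_derivative \<zeta>' t) (at t)" for t
    unfolding \<zeta>_def \<zeta>'_def
    by (rule DERIV_chain'[where f="\<lambda>t. p t / e - 1" and g=cutoff])
       (use p(1)[of t] cutoff_derivative e in \<open>auto intro!: derivative_eq_intros\<close>)
  have \<zeta>'c: "continuous_on UNIV \<zeta>'"
    unfolding \<zeta>'_def using e by (intro continuous_intros p pc continuous_on_compose2[OF cutoff_continuous(1)]) auto
  have \<zeta>c: "continuous_on UNIV \<zeta>"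
    using \<zeta>d DERIV_isCont by (auto simp: continuous_on_eq_continuous_at)
  define \<psi> where "\<psi> = (\<lambda>t. \<zeta> t *\<^sub>R \<psi>0 t)"
  define D where "D = (\<lambda>t. \<zeta> t *\<^sub>R D0 t + \<zeta>' t *\<^sub>R \<psi>0 t)"
  have \<psi>d: "(\<psi> has_vector_derivative D t) (at t)" for t
    unfolding \<psi>_def D_def by (rule has_vector_derivative_scaleR[OF \<zeta>d D0(1)])
  have Dc: "continuous_on UNIV D"
    unfolding D_def by (intro continuous_intros \<zeta>'c \<zeta>c D0)
  have \<psi>p: "\<psi> (t + 2 * pi) = \<psi> t" for t by (simp add: \<psi>_def \<zeta>_def p D0)
  have t1: "\<psi> \<in> circle_test"
  proof (rule circle_testI[OF \<psi>d Dc \<psi>p])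
    fix t
    have "norm (\<psi> t) \<le> 1 * 1"
      unfolding \<psi>_def norm_scaleR \<zeta>_def using cutoff_bounds[of "p t / e - 1"] D0(8)[of t] by (intro mult_mono) auto
    then show "norm (\<psi> t) \<le> 1" by simp
  qed
  obtain D' where D': "\<And>t. (\<psi> has_vector_derivative D' t) (at t)" "continuous_on UNIV D'"
    "\<And>t. vector_derivative \<psi> (at t) = D' t" "loop D'" "loop \<psi>" "continuous_on UNIV \<psi>" 
    "\<And>t. \<psi> (t + 2 * pi) = \<psi> t" "\<And>t. norm (\<psi> t) \<le> 1"
    using circle_testD[OF t1] by blast
  have "D' = D" using \<psi>d D'(1) vector_derivative_unique_at by blast
  with D' have lD: "loop D" by simp
  have "integral {0..2*pi} (\<lambda>t. f t \<bullet> (D0 t - D t)) = 0"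
  proof (rule T(3))
    show "((\<lambda>t. \<psi>0 t - \<psi> t) has_vector_derivative (D0 t - D t)) (at t)" for t
      by (rule has_vector_derivative_diff[OF D0(1) \<psi>d])
    show "continuous_on UNIV (\<lambda>t. D0 t - D t)" by (intro continuous_intros D0 Dc)
    show "\<psi>0 t - \<psi> t = 0" if "t \<in> T" for t
      using p(5)[OF that] by (simp add: \<psi>_def \<zeta>_def cutoff_le)
  qed
  then have "loop_pair f D0 = loop_pair f D"
    unfolding inner_diff_right
    by (subst (asm) HK_integral_diff[OF loop_integrable(1)[OF loop_inner[OF f(1) D0(4)]] loop_integrable(1)[OF loop_inner[OF f(1) lD]]]) simp
  then have c1: "c \<le> loop_pair f D" using c0 by simp
  have zero: "\<psi> t = 0" if "t \<in> {0..2*pi} - W n" for t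
  proof -
    have "p t \<ge> 2 * e" using that by (auto simp: W_def e_def simp del: of_nat_Suc)
    then have "p t / e - 1 \<ge> 1" using e by (simp add: pos_le_divide_eq)
    then show ?thesis by (simp add: \<psi>_def \<zeta>_def cutoff_ge)
  qed
  show ?thesis
    by (rule that[OF \<psi>d Dc \<psi>p D'(8) D'(5) lD Wm _ less_imp_le[OF n] zero c1]) (auto simp: W_def)
qed

text \<open>A Borel version is taken in each coordinate, values outside \<open>V\<close> are
  replaced by 0, and reduction modulo \<open>2 * pi\<close> makes the result periodic. The
  replacement is what puts 0 into the range, which stays finite.\<close>

lemma loop_representative:
  fixes g :: "real => real^2"
  assumes g: "integrable (lebesgue_on {0..2*pi}) g" and V: "finite V" "AE t in lebesgue_on {0..2*pi}. g t \<in> V"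
  obtains f where "loop f" "range f \<subseteq> insert 0 V" "AE t in lborel. t \<in> {0..2*pi} \<longrightarrow> g t = f t"
proof -
  have "g \<in> borel_measurable (lebesgue_on {0..2*pi})" using g by auto
  then have m: "(\<lambda>t. if t \<in> {0..2*pi} then g t else 0) \<in> borel_measurable lebesgue"
    by (subst borel_measurable_if) auto
  have ex: "\<exists>h\<in>borel_measurable lborel. (AE t in lborel. (if t \<in> {0..2*pi} then g t else 0) $ i = h t)" for i
    using m by (intro completion_ex_borel_measurable_real) (auto intro!: borel_measurable_continuous_on[where f="\<lambda>x. x $ i"] continuous_intros)
  have "\<forall>i. \<exists>h. h \<in> borel_measurable lborel \<and> (AE t in lborel. (if t \<in> {0..2*pi} then g t else 0) $ i = h t)"
    using ex by blast
  from choice[OF this] obtain h where h': "\<forall>i. h i \<in> borel_measurable lborel \<and> (AE t in lborel. (if t \<in> {0..2*pi} then g t else 0) $ i = h i t)" ..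
  have h: "h i \<in> borel_fun" "AE t in lborel. (if t \<in> {0..2*pi} then g t else 0) $ i = h i t" for i
    using h'[rule_format, of i] by simp_all
  define k where "k = (\<lambda>t. pt (h 1 t) (h 2 t))"
  have [measurable]: "h i \<in> borel_fun" for i by (rule h)
  have km [measurable]: "k \<in> borel_fun" unfolding k_def by measurable
  define l where "l = (\<lambda>t. if k t \<in> V then k t else 0)"
  have Vm: "V \<in> sets borel" using V(1) by (intro borel_closed finite_imp_closed)
  have lm [measurable]: "l \<in> borel_fun"
    unfolding l_def using Vm by measurable
  define f where "f = (\<lambda>t. l (t - 2 * pi * of_int \<lfloor>t / (2 * pi)\<rfloor>))"
  have fm: "f \<in> borel_fun" unfolding f_def by measurable
  have lr: "l t \<in> insert 0 V" for t by (auto simp: l_def)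
  have per: "f (t + 2 * pi) = f t" for t
  proof -
    have "(t + 2 * pi) / (2 * pi) = t / (2 * pi) + 1" by (simp add: add_divide_distrib)
    then show ?thesis unfolding f_def by (simp add: algebra_simps)
  qed
  have fr: "range f \<subseteq> insert 0 V" unfolding f_def using lr by blast
  then have "finite (range f)" using V(1) finite_subset[OF fr] by simp
  then have "bounded (range f)" by (rule finite_imp_bounded)
  then have "\<exists>B. \<forall>t. norm (f t) \<le> B" by (auto simp: bounded_iff)
  then have 1: "loop f" using fm per by (simp add: loop_def)
  have V': "AE t in lborel. t \<in> {0..2*pi} \<longrightarrow> g t \<in> V"
    using V(2) by (subst (asm) AE_restrict_space_iff) (auto simp: AE_completion_iff)
  \<comment> \<open>At \<open>2 * pi\<close> the periodic function repeats its value at 0, which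
    \<open>g\<close> need not do.\<close>
  have "AE t in lborel. t \<notin> {2*pi}" by (rule AE_lborel_negligible) simp
  with h(2)[of 1] h(2)[of 2] V' have 2: "AE t in lborel. t \<in> {0..2*pi} \<longrightarrow> g t = f t"
  proof eventually_elim
    case (elim t)
    show ?case
    proof
      assume t: "t \<in> {0..2*pi}"
      then have "0 \<le> t / (2 * pi)" "t / (2 * pi) < 1" using elim(4) by (auto simp: divide_less_eq)
      then have "\<lfloor>t / (2 * pi)\<rfloor> = 0" by linarith
      moreover have "k t = g t" using elim t by (simp add: k_def vec_eq_iff forall_2)
      ultimately show "g t = f t" using elim t by (simp add: f_def l_def)
    qed
  qed
  show ?thesis by (rule that[OF 1 fr 2])
qed

section \<open>Approximation by Lipschitz maps on the circle\<close>

lemma steklov_L1: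
  fixes f :: "real => 'a::euclidean_space"
  assumes f: "loop f"
  shows "(\<lambda>k. integral {0..2*pi} (\<lambda>t. norm (steklov (inverse (Suc k)) f t - f t))) \<longlonglongrightarrow> 0"
proof -
  obtain B where B: "\<And>t. norm (f t) \<le> B" "B \<ge> 0" using loop_bound[OF f] by blast
  obtain N where N: "negligible N" "\<And>t. t \<notin> N ==> (\<lambda>k. steklov (inverse (Suc k)) f t) \<longlonglongrightarrow> f t"
    using steklov_tendsto_AE[OF f] by blast
  define u where "u = (\<lambda>k t. norm (steklov (inverse (real (Suc k))) f t - f t))"
  have ul: "loop (u k)" for k unfolding u_def by (intro loop_norm_diff steklov_loop f inverse_Suc_le)
  have [measurable]: "u k \<in> borel_fun" for k using loopD(1)[OF ul] .
  have "(\<lambda>k. LINT t|lborel. indicator {0..2*pi} t *\<^sub>R u k t) \<longlonglongrightarrow> (LINT t|(lborel :: real measure). 0 :: real)"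
  proof (rule integral_dominated_convergence[where w="\<lambda>t. indicator {0..2*pi} t *\<^sub>R (2 * B)"])
    show "integrable lborel (\<lambda>t::real. indicator {0..2*pi} t *\<^sub>R (2 * B))"
      using bounded_borel_integrable_on(1)[of "\<lambda>t::real. 2 * B" "{0..2*pi}" "2 * B"] B(2) by (simp add: set_integrable_def)
    show "AE t in lborel. (\<lambda>k. indicator {0..2*pi} t *\<^sub>R u k t) \<longlonglongrightarrow> 0"
      using AE_lborel_negligible[OF N(1)]
    proof eventually_elim
      case (elim t)
      have "(\<lambda>k. u k t) \<longlonglongrightarrow> norm (f t - f t)"
        unfolding u_def by (intro tendsto_intros N(2) elim)
      then show ?case by (simp add: indicator_def)
    qed
    show "AE t in lborel. norm (indicator {0..2*pi} t *\<^sub>R u k t) \<le> indicator {0..2*pi} t *\<^sub>R (2 * B)" for k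
    proof (intro AE_I2)
      fix t :: real
      have "u k t \<le> B + B" unfolding u_def
        by (rule order_trans[OF norm_triangle_ineq4]) (intro add_mono steklov_bound f B inverse_Suc_le)
      then show "norm (indicator {0..2*pi} t *\<^sub>R u k t) \<le> indicator {0..2*pi} t *\<^sub>R (2 * B)"
        by (auto simp: indicator_def u_def)
    qed
  qed simp_all
  then show ?thesis
    using set_borel_integral_eq_integral(2)[OF loop_integrable(2)[OF ul, of 0 "2*pi"]]
    unfolding u_def by (simp add: set_lebesgue_integral_def del: of_nat_Suc)
qed

text \<open>A crude form of Jordan's inequality, to compare arcs with chords. Up to
  \<open>pi / 3\<close> the derivative of \<open>sin x - x / 4\<close> is at least
  \<open>1 / 4\<close>; beyond, \<open>sin x \<ge> 1 / 2\<close> and \<open>x < 2\<close>.\<close>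

lemma abs_le_4_sin:
  assumes "0 \<le> x" "x \<le> pi / 2"
  shows "x \<le> 4 * sin x"
proof (cases "x \<le> pi / 3")
  case True
  have "sin 0 - 0 / 4 \<le> sin x - x / 4"
  proof (rule DERIV_nonneg_imp_nondecreasing[OF assms(1)])
    fix y assume y: "0 \<le> y" "y \<le> x"
    have "cos (pi / 3) \<le> cos y" using y True by (intro cos_monotone_0_pi_le) auto
    then have "cos y - 1 / 4 \<ge> 0" by (simp add: cos_60)
    moreover have "((\<lambda>x. sin x - x / 4) has_real_derivative cos y - 1 / 4) (at y)"
      by (auto intro!: derivative_eq_intros)
    ultimately show "\<exists>z. ((\<lambda>x. sin x - x / 4) has_real_derivative z) (at y) \<and> 0 \<le> z" by blast
  qed
  then show ?thesis by simp
next
  case False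
  have "sin (pi / 6) \<le> sin x" using False assms by (intro sin_monotone_2pi_le) auto
  then have "sin x \<ge> 1 / 2" by (simp add: sin_30)
  then show ?thesis using assms pi_less_4 by simp
qed

lemma norm_circ_diff: "norm (circ s - circ t) = 2 * \<bar>sin ((s - t) / 2)\<bar>"
proof -
  have "(norm (circ s - circ t))\<^sup>2 = (cos s - cos t)\<^sup>2 + (sin s - sin t)\<^sup>2"
    by (simp add: norm_real2)
  also have "\<dots> = 2 - 2 * cos (s - t)"
    using sin_cos_squared_add[of s] sin_cos_squared_add[of t] by (simp add: cos_diff power2_diff algebra_simps)
  also have "\<dots> = (2 * sin ((s - t) / 2))\<^sup>2"
  proof -
    have "cos (2 * ((s - t) / 2)) = 1 - 2 * (sin ((s - t) / 2))\<^sup>2" by (rule cos_double_sin)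
    moreover have "2 * ((s - t) / 2) = s - t" by simp
    ultimately have "cos (s - t) = 1 - 2 * (sin ((s - t) / 2))\<^sup>2" by (simp only:)
    then show ?thesis by (simp add: power_mult_distrib)
  qed
  finally have "\<bar>norm (circ s - circ t)\<bar> = \<bar>2 * sin ((s - t) / 2)\<bar>"
    by (simp only: power2_eq_iff abs_eq_iff power2_eq_iff)
  then show ?thesis by (simp add: abs_mult)
qed

text \<open>The shorter arc between two points is at most 4 times their distance. When the
  parameters differ by more than \<open>pi\<close>, periodicity replaces \<open>t\<close> by
  \<open>t + 2 * pi\<close> to reach the shorter arc.\<close>

lemma lipschitz_loop_sphere:
  fixes f :: "real => real^2"
  assumes lip: "C-lipschitz_on UNIV f" and per: "\<And>t. f (t + 2 * pi) = f t"
  shows "(4 * C)-lipschitz_on (sphere 0 1) (\<lambda>x. f (angle x))"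
proof -
  have C: "C \<ge> 0" using lip by (rule lipschitz_on_nonneg)
  have lipf: "norm (f s - f t) \<le> C * \<bar>s - t\<bar>" for s t
    using lipschitz_onD[OF lip, of s t] by (simp add: dist_norm dist_real_def)
  have aux: "2 * x \<le> 4 * (2 * \<bar>y\<bar>)" if "x \<le> 4 * y" for x y :: real
    using that by linarith
  have main: "norm (f s - f t) \<le> 4 * C * norm (circ s - circ t)" if st: "0 \<le> t" "t \<le> s" "s < 2 * pi" for s t
  proof (cases "s - t \<le> pi")
    case True
    have "(s - t) / 2 \<le> 4 * sin ((s - t) / 2)" using st True by (intro abs_le_4_sin) auto
    then have "s - t \<le> 4 * norm (circ s - circ t)" using aux[of "(s - t) / 2" "sin ((s - t) / 2)"] by (simp add: norm_circ_diff)
    then have "C * (s - t) \<le> C * (4 * norm (circ s - circ t))" using C by (rule mult_left_mono)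
    then show ?thesis using lipf[of s t] st by simp
  next
    case False
    have "(t + 2 * pi - s) / 2 \<le> 4 * sin ((t + 2 * pi - s) / 2)" using st False by (intro abs_le_4_sin) auto
    then have "t + 2 * pi - s \<le> 4 * norm (circ (t + 2 * pi) - circ s)"
      using aux[of "(t + 2 * pi - s) / 2" "sin ((t + 2 * pi - s) / 2)"] by (simp add: norm_circ_diff del: circ_periodic)
    then have "t + 2 * pi - s \<le> 4 * norm (circ s - circ t)"
      by (simp only: circ_periodic norm_minus_commute)
    then have "C * (t + 2 * pi - s) \<le> C * (4 * norm (circ s - circ t))" using C by (intro mult_left_mono) simp_all
    then show ?thesis using lipf[of s "t + 2 * pi"] st by (simp add: per)
  qed
  show ?thesis
  proof (rule lipschitz_onI)
    fix x y :: "real^2" assume "x \<in> sphere 0 1" "y \<in> sphere 0 1"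
    then have xy: "circ (angle x) = x" "circ (angle y) = y"
      using circ_angle[of x] circ_angle[of y] by auto
    show "dist (f (angle x)) (f (angle y)) \<le> 4 * C * dist x y"
      using main[of "angle x" "angle y"] main[of "angle y" "angle x"] angle_bounds[of x] angle_bounds[of y] xy
      by (cases "angle x \<le> angle y") (auto simp: dist_norm norm_minus_commute)
  qed (use C in simp)
qed

section \<open>Averages over small squares\<close>

lemma linear_real2:
  fixes z :: "real^2"
  assumes "linear L"
  shows "L z = z $ 1 *\<^sub>R L (pt 1 0) + z $ 2 *\<^sub>R L (pt 0 1)"
proof -
  have "z = z $ 1 *\<^sub>R pt 1 0 + z $ 2 *\<^sub>R pt 0 1" by (simp add: vec_eq_iff forall_2)
  then have "L z = L (z $ 1 *\<^sub>R pt 1 0 + z $ 2 *\<^sub>R pt 0 1)" by simp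
  then show ?thesis by (simp add: linear_add[OF assms] linear_scale[OF assms])
qed

text \<open>Differentiability in the full sense, with the values of the differential on the
  coordinate vectors as parameters, rather than mere existence of partial derivatives.\<close>

definition partials :: "(real^2 => 'b::real_normed_vector) => real^2 => 'b => 'b => bool" where
  "partials v x d1 d2 \<longleftrightarrow> (v has_derivative (\<lambda>z. z $ 1 *\<^sub>R d1 + z $ 2 *\<^sub>R d2)) (at x)"

lemma partialsI:
  fixes v :: "real^2 => 'b::real_normed_vector"
  assumes "(v has_derivative L) (at x)"
  shows "partials v x (L (pt 1 0)) (L (pt 0 1))"
proof -
  have "linear L" using assms by (rule has_derivative_linear)
  from linear_real2[OF this] have "L = (\<lambda>z. z $ 1 *\<^sub>R L (pt 1 0) + z $ 2 *\<^sub>R L (pt 0 1))" by (rule ext)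
  with assms show ?thesis by (simp add: partials_def)
qed

lemma partials_nth:
  fixes v :: "real^2 => 'b::real_normed_vector^'n"
  assumes "partials v x d1 d2" shows "partials (\<lambda>x. v x $ i) x (d1 $ i) (d2 $ i)"
  using bounded_linear.has_derivative[OF bounded_linear_vec_nth[of i] assms[unfolded partials_def]]
  by (simp add: partials_def)

lemma grad_partials:
  assumes "partials v x d1 d2"
  shows "grad v x = (\<chi> i j. if j = 1 then d1 $ i else d2 $ i)"
proof -
  have "frechet_derivative v (at x) = (\<lambda>z. z $ 1 *\<^sub>R d1 + z $ 2 *\<^sub>R d2)"
    using assms unfolding partials_def by (rule frechet_derivative_at[symmetric])
  then show ?thesis
    by (simp add: grad_def matrix_def vec_eq_iff forall_2 axis_def)
qed

lemma det_grad_partials: "partials v x d1 d2 ==> det (grad v x) = d1 $ 1 * d2 $ 2 - d2 $ 1 * d1 $ 2"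
  by (simp add: grad_partials det_2)

lemma norm_real2_sq: "(norm (z :: real^2))\<^sup>2 = (z $ 1)\<^sup>2 + (z $ 2)\<^sup>2"
  by (simp add: norm_real2)

lemma norm_mat2_sq: "(norm (A :: real^2^2))\<^sup>2 = (A $ 1 $ 1)\<^sup>2 + (A $ 1 $ 2)\<^sup>2 + (A $ 2 $ 1)\<^sup>2 + (A $ 2 $ 2)\<^sup>2"
  by (simp add: norm_vec_def[of A] L2_set_def sum_2 norm_real2)

lemma norm_grad_partials: "partials v x d1 d2 ==> norm (grad v x) = sqrt ((norm d1)\<^sup>2 + (norm d2)\<^sup>2)"
proof -
  assume p: "partials v x d1 d2"
  have "(norm (grad v x))\<^sup>2 = (norm d1)\<^sup>2 + (norm d2)\<^sup>2"
    by (simp add: norm_mat2_sq norm_real2_sq grad_partials[OF p])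
  then show ?thesis by (metis norm_ge_zero real_sqrt_unique)
qed

lemma C1_on_partials:
  fixes v :: "real^2 => 'b::real_normed_vector"
  assumes "C1_on S v"
  obtains d1 d2 where "\<And>x. x \<in> S ==> partials v x (d1 x) (d2 x)" "continuous_on S d1" "continuous_on S d2"
proof -
  obtain v' where v': "\<And>x. x \<in> S ==> (v has_derivative blinfun_apply (v' x)) (at x)" "continuous_on S v'"
    using assms by (auto simp: C1_on_def)
  show ?thesis
  proof (rule that)
    show "partials v x (blinfun_apply (v' x) (pt 1 0)) (blinfun_apply (v' x) (pt 0 1))" if "x \<in> S" for x
      by (rule partialsI[OF v'(1)[OF that]])
  qed (intro continuous_intros v')+
qed

lemma C1_onI_partials:
  fixes v :: "real^2 => 'b::real_normed_vector"
  assumes p: "\<And>x. x \<in> S ==> partials v x (d1 x) (d2 x)" and c: "continuous_on S d1" "continuous_on S d2"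
  shows "C1_on S v"
proof -
  define E :: "2 => (real^2) \<Rightarrow>\<^sub>L real" where "E = (\<lambda>i. Blinfun (\<lambda>z. z $ i))"
  have E: "blinfun_apply (E i) z = z $ i" for i z
    by (simp add: E_def bounded_linear_Blinfun_apply bounded_linear_vec_nth)
  define v' where "v' = (\<lambda>x. (blinfun_scaleR_left (d1 x) o\<^sub>L E 1) + (blinfun_scaleR_left (d2 x) o\<^sub>L E 2))"
  have "blinfun_apply (v' x) = (\<lambda>z. z $ 1 *\<^sub>R d1 x + z $ 2 *\<^sub>R d2 x)" for x
    by (simp add: v'_def fun_eq_iff blinfun.add_left E)
  moreover have "continuous_on S v'"
    unfolding v'_def
    by (intro continuous_intros bounded_linear.continuous_on[OF bounded_linear_blinfun_scaleR_left] c
        bounded_bilinear.continuous_on[OF bounded_bilinear_blinfun_compose])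
  ultimately show ?thesis
    using p unfolding C1_on_def partials_def by (intro exI[of _ v']) auto
qed

text \<open>The mollifier is the normalised indicator of a square with the point as lower left
  corner, because the partial derivatives of the mean are then integrals of differences across
  opposite sides: \<open>avg1\<close> and \<open>avg2\<close>.\<close>

definition avg :: "real => (real^2 => 'b::euclidean_space) => real^2 => 'b" where
  "avg h w x = integral {0..h} (\<lambda>a. integral {0..h} (\<lambda>b. w (x + pt a b))) /\<^sub>R h\<^sup>2"

definition avg1 :: "real => (real^2 => 'b::euclidean_space) => real^2 => 'b" where
  "avg1 h w x = integral {0..h} (\<lambda>b. w (x + pt h b) - w (x + pt 0 b)) /\<^sub>R h\<^sup>2"

definition avg2 :: "real => (real^2 => 'b::euclidean_space) => real^2 => 'b" where
  "avg2 h w x = integral {0..h} (\<lambda>a. w (x + pt a h) - w (x + pt a 0)) /\<^sub>R h\<^sup>2"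

lemma has_vector_derivative_moving_integral:
  fixes m :: "real => 'b::euclidean_space"
  assumes m: "continuous_on UNIV m" and h: "h > 0"
  shows "((\<lambda>p. integral {p..p + h} m) has_vector_derivative (m (p + h) - m p)) (at p)"
proof -
  obtain \<Phi> where \<Phi>: "\<And>t. (\<Phi> has_vector_derivative m t) (at t)"
    using continuous_primitive[OF m] by blast
  have "(m has_integral (\<Phi> (p + h) - \<Phi> p)) {p..p + h}" for p
    using h \<Phi> by (intro fundamental_theorem_of_calculus) (auto intro: has_vector_derivative_at_within)
  then have "(\<lambda>p. integral {p..p + h} m) = (\<lambda>p. \<Phi> (p + h) - \<Phi> p)"
    by (auto simp: integral_unique)
  then show ?thesis
    by (simp add: has_vector_derivative_diff has_vector_derivative_shift_real \<Phi>)
qed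

lemma continuous_integral_param:
  fixes F :: "'a::t2_space => real => 'b::euclidean_space"
  assumes "continuous_on UNIV (\<lambda>(x, b). F x b)"
  shows "continuous_on UNIV (\<lambda>x. integral {0..h} (F x))"
  using integral_continuous_on_param[of UNIV 0 h F] continuous_on_subset[OF assms] by simp

text \<open>In each variable the mean is a moving integral of a continuous function, after
  exchanging the order of integration for the second one. Continuity of both partial derivatives
  yields differentiability.\<close>

lemma avg_partials:
  fixes w :: "real^2 => 'b::euclidean_space"
  assumes w: "continuous_on UNIV w" and h: "h > 0"
  shows "partials (avg h w) x (avg1 h w x) (avg2 h w x)"
    "continuous_on UNIV (avg1 h w)" "continuous_on UNIV (avg2 h w)"
proof -
  have wc: "continuous_on A (\<lambda>z. w (g z))" if "continuous_on A g" for A :: "'z::t2_space set" and g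
    by (rule continuous_on_compose2[OF w that]) auto
  show c1: "continuous_on UNIV (avg1 h w)" and c2: "continuous_on UNIV (avg2 h w)"
    unfolding avg1_def[abs_def] avg2_def[abs_def]
    by (intro continuous_intros continuous_integral_param; simp add: split_beta'; intro continuous_intros wc)+
  define F where "F = (\<lambda>p q. avg h w (pt p q))"
  have int1: "F p q = integral {p..p + h} (\<lambda>a. integral {0..h} (\<lambda>b. w (pt a (q + b)))) /\<^sub>R h\<^sup>2" for p q
    using integral_shift_real[of 0 h "\<lambda>a. integral {0..h} (\<lambda>b. w (pt a (q + b)))" p]
    by (simp add: F_def avg_def pt_add add.commute)
  have swap: "integral {0..h} (\<lambda>a. integral {0..h} (\<lambda>b. w (pt p q + pt a b))) =
      integral {0..h} (\<lambda>b. integral {0..h} (\<lambda>a. w (pt p q + pt a b)))" for p q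
    using integral_swap_continuous[of 0 0 h h "\<lambda>a b. w (pt p q + pt a b)"]
    by (simp add: split_beta' wc continuous_intros)
  have int2: "F p q = integral {q..q + h} (\<lambda>b. integral {0..h} (\<lambda>a. w (pt (p + a) b))) /\<^sub>R h\<^sup>2" for p q
    using integral_shift_real[of 0 h "\<lambda>b. integral {0..h} (\<lambda>a. w (pt (p + a) b))" q]
    unfolding F_def avg_def swap by (simp add: pt_add add.commute)
  have d1: "((\<lambda>p. F p q) has_vector_derivative avg1 h w (pt p q)) (at p)" for p q
  proof -
    have "continuous_on UNIV (\<lambda>a. integral {0..h} (\<lambda>b. w (pt a (q + b))))"
      by (intro continuous_integral_param; simp add: split_beta'; intro continuous_intros wc)
    from bounded_linear.has_vector_derivative[OF bounded_linear_scaleR_right[of "inverse (h\<^sup>2)"] has_vector_derivative_moving_integral[OF this h, of p]]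
    have "((\<lambda>p. F p q) has_vector_derivative (integral {0..h} (\<lambda>b. w (pt (p + h) (q + b))) - integral {0..h} (\<lambda>b. w (pt p (q + b)))) /\<^sub>R h\<^sup>2) (at p)"
      unfolding int1 .
    also have "integral {0..h} (\<lambda>b. w (pt (p + h) (q + b))) - integral {0..h} (\<lambda>b. w (pt p (q + b))) =
        integral {0..h} (\<lambda>b. w (pt (p + h) (q + b)) - w (pt p (q + b)))"
      by (intro HK_integral_diff[symmetric] integrable_continuous_real wc continuous_intros)
    finally show ?thesis by (simp add: avg1_def pt_add)
  qed
  have d2: "((\<lambda>q. F p q) has_vector_derivative avg2 h w (pt p q)) (at q)" for p q
  proof -
    have "continuous_on UNIV (\<lambda>b. integral {0..h} (\<lambda>a. w (pt (p + a) b)))"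
      by (intro continuous_integral_param; simp add: split_beta'; intro continuous_intros wc)
    from bounded_linear.has_vector_derivative[OF bounded_linear_scaleR_right[of "inverse (h\<^sup>2)"] has_vector_derivative_moving_integral[OF this h, of q]]
    have "((\<lambda>q. F p q) has_vector_derivative (integral {0..h} (\<lambda>a. w (pt (p + a) (q + h))) - integral {0..h} (\<lambda>a. w (pt (p + a) q))) /\<^sub>R h\<^sup>2) (at q)"
      unfolding int2 .
    also have "integral {0..h} (\<lambda>a. w (pt (p + a) (q + h))) - integral {0..h} (\<lambda>a. w (pt (p + a) q)) =
        integral {0..h} (\<lambda>a. w (pt (p + a) (q + h)) - w (pt (p + a) q))"
      by (intro HK_integral_diff[symmetric] integrable_continuous_real wc continuous_intros)
    finally show ?thesis by (simp add: avg2_def pt_add)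
  qed
  have "((\<lambda>(p, q). F p q) has_derivative (\<lambda>(tp, tq). tp *\<^sub>R avg1 h w (pt p q) + blinfun_apply (blinfun_scaleR_left (avg2 h w (pt p q))) tq)) (at (p, q) within UNIV \<times> UNIV)" for p q
  proof (rule has_derivative_partialsI[where fy="\<lambda>p q. blinfun_scaleR_left (avg2 h w (pt p q))"])
    show "((\<lambda>p. F p q) has_derivative (\<lambda>tp. tp *\<^sub>R avg1 h w (pt p q))) (at p within UNIV)"
      using d1[of q p] by (simp add: has_vector_derivative_def)
    show "(F p has_derivative blinfun_apply (blinfun_scaleR_left (avg2 h w (pt p q)))) (at q within UNIV)" for p q
      using d2[of p q] by (simp add: has_vector_derivative_def)
    have "continuous_on UNIV (\<lambda>z. blinfun_scaleR_left (avg2 h w (pt (fst z) (snd z))))"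
      by (intro bounded_linear.continuous_on[OF bounded_linear_blinfun_scaleR_left] continuous_on_compose2[OF c2] continuous_intros) auto
    then show "continuous (at (p, q) within UNIV \<times> UNIV) (\<lambda>(p, q). blinfun_scaleR_left (avg2 h w (pt p q)))"
      by (simp add: continuous_on_eq_continuous_within split_beta')
  qed auto
  then have F: "((\<lambda>z. F (fst z) (snd z)) has_derivative (\<lambda>t. fst t *\<^sub>R avg1 h w (pt p q) + snd t *\<^sub>R avg2 h w (pt p q))) (at (p, q))" for p q
    by (simp add: split_beta')
  have "((\<lambda>x::real^2. (x $ 1, x $ 2)) has_derivative (\<lambda>z. (z $ 1, z $ 2))) (at x)"
    by (intro has_derivative_Pair bounded_linear_imp_has_derivative bounded_linear_vec_nth)
  from diff_chain_at[OF this F[of "x $ 1" "x $ 2"]]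
  show "partials (avg h w) x (avg1 h w x) (avg2 h w x)"
    by (simp add: partials_def o_def F_def)
qed

lemma avg_C1: "continuous_on UNIV w ==> h > 0 ==> C1_on UNIV (avg h w)"
  by (rule C1_onI_partials[OF avg_partials])

lemma integral_average_bound:
  fixes F :: "real => 'b::euclidean_space"
  assumes F: "continuous_on UNIV F" and h: "h > 0" and B: "\<And>b. b \<in> {0..h} ==> norm (F b - c) \<le> B"
  shows "norm (integral {0..h} F - h *\<^sub>R c) \<le> h * B"
proof -
  have i: "F integrable_on {0..h}" by (intro integrable_continuous_real continuous_on_subset[OF F]) auto
  have "norm (integral {0..h} (\<lambda>b. F b - c)) \<le> integral {0..h} (\<lambda>b. B)"
    using B by (intro integral_norm_bound_integral integrable_diff i integrable_const_ivl) auto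
  also have "integral {0..h} (\<lambda>b. F b - c) = integral {0..h} F - h *\<^sub>R c"
    using h by (subst HK_integral_diff[OF i integrable_const_ivl]) simp
  finally show ?thesis using h by simp
qed

lemma avg_bound:
  fixes w :: "real^2 => 'b::euclidean_space"
  assumes w: "continuous_on UNIV w" and h: "h > 0"
    and B: "\<And>a b. a \<in> {0..h} ==> b \<in> {0..h} ==> norm (w (x + pt a b) - c) \<le> B"
  shows "norm (avg h w x - c) \<le> B"
proof -
  have wc: "continuous_on A (\<lambda>z. w (g z))" if "continuous_on A g" for A :: "'z::t2_space set" and g
    by (rule continuous_on_compose2[OF w that]) auto
  have "norm (integral {0..h} (\<lambda>a. integral {0..h} (\<lambda>b. w (x + pt a b))) - h *\<^sub>R (h *\<^sub>R c)) \<le> h * (h * B)"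
  proof (rule integral_average_bound[OF _ h])
    show "continuous_on UNIV (\<lambda>a. integral {0..h} (\<lambda>b. w (x + pt a b)))"
      by (intro continuous_integral_param; simp add: split_beta'; intro continuous_intros wc)
    show "norm (integral {0..h} (\<lambda>b. w (x + pt a b)) - h *\<^sub>R c) \<le> h * B" if "a \<in> {0..h}" for a
      by (rule integral_average_bound[OF _ h B[OF that]]) (intro continuous_intros wc)
  qed
  moreover have "integral {0..h} (\<lambda>a. integral {0..h} (\<lambda>b. w (x + pt a b))) - h *\<^sub>R (h *\<^sub>R c) = h\<^sup>2 *\<^sub>R (avg h w x - c)"
    using h by (simp add: avg_def scaleR_diff_right) (simp add: power2_eq_square)
  ultimately have "h\<^sup>2 * norm (avg h w x - c) \<le> h\<^sup>2 * B" by (simp add: power2_eq_square)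
  then show ?thesis using h by simp
qed

lemma avg12_bound:
  fixes w :: "real^2 => 'b::euclidean_space"
  assumes w: "continuous_on UNIV w" and h: "h > 0"
  shows "(\<And>b. b \<in> {0..h} ==> norm (w (x + pt h b) - w (x + pt 0 b) - h *\<^sub>R c) \<le> h * B) ==> norm (avg1 h w x - c) \<le> B"
    and "(\<And>a. a \<in> {0..h} ==> norm (w (x + pt a h) - w (x + pt a 0) - h *\<^sub>R c) \<le> h * B) ==> norm (avg2 h w x - c) \<le> B"
proof -
  have wc: "continuous_on A (\<lambda>z. w (g z))" if "continuous_on A g" for A :: "'z::t2_space set" and g
    by (rule continuous_on_compose2[OF w that]) auto
  have gen: "norm (integral {0..h} F /\<^sub>R h\<^sup>2 - c) \<le> B"
    if F: "continuous_on UNIV F" "\<And>b. b \<in> {0..h} ==> norm (F b - h *\<^sub>R c) \<le> h * B" for F :: "real => 'b"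
  proof -
    have "norm (integral {0..h} F - h *\<^sub>R (h *\<^sub>R c)) \<le> h * (h * B)"
      by (rule integral_average_bound[OF F(1) h F(2)])
    moreover have "integral {0..h} F - h *\<^sub>R (h *\<^sub>R c) = h\<^sup>2 *\<^sub>R (integral {0..h} F /\<^sub>R h\<^sup>2 - c)"
      using h by (simp add: scaleR_diff_right) (simp add: power2_eq_square)
    ultimately have "h\<^sup>2 * norm (integral {0..h} F /\<^sub>R h\<^sup>2 - c) \<le> h\<^sup>2 * B" by (simp add: power2_eq_square)
    then show ?thesis using h by simp
  qed
  show "(\<And>b. b \<in> {0..h} ==> norm (w (x + pt h b) - w (x + pt 0 b) - h *\<^sub>R c) \<le> h * B) ==> norm (avg1 h w x - c) \<le> B"
    unfolding avg1_def by (rule gen) (intro continuous_intros wc)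
  show "(\<And>a. a \<in> {0..h} ==> norm (w (x + pt a h) - w (x + pt a 0) - h *\<^sub>R c) \<le> h * B) ==> norm (avg2 h w x - c) \<le> B"
    unfolding avg2_def by (rule gen) (intro continuous_intros wc)
qed

text \<open>The bound does not depend on \<open>h\<close>, as dominated convergence will
  require.\<close>

lemma avg12_lipschitz_bound:
  fixes w :: "real^2 => 'b::euclidean_space"
  assumes lip: "K-lipschitz_on UNIV w" and h: "h > 0"
  shows "norm (avg1 h w x) \<le> K" "norm (avg2 h w x) \<le> K"
proof -
  have c: "continuous_on UNIV w" using lip by (rule lipschitz_on_continuous_on)
  have l: "norm (w y - w z) \<le> K * norm (y - z)" for y z
    using lipschitz_onD[OF lip, of y z] by (simp add: dist_norm)
  have n: "norm (x + pt h b - (x + pt 0 b)) = h" "norm (x + pt b h - (x + pt b 0)) = h" for b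
    using h by (simp_all add: pt_diff norm_real2)
  have "norm (avg1 h w x - 0) \<le> K"
    using l[of "x + pt h b" "x + pt 0 b" for b, unfolded n] by (intro avg12_bound(1)[OF c h]) (simp add: mult.commute)
  then show "norm (avg1 h w x) \<le> K" by simp
  have "norm (avg2 h w x - 0) \<le> K"
    using l[of "x + pt b h" "x + pt b 0" for b, unfolded n] by (intro avg12_bound(2)[OF c h]) (simp add: mult.commute)
  then show "norm (avg2 h w x) \<le> K" by simp
qed

text \<open>At a point of differentiability the differences across the square equal \<open>h\<close>
  times the partial derivative up to an error small compared with \<open>h\<close>, although the
  segments involved do not pass through the point.\<close>

lemma avg12_tendsto:
  fixes w :: "real^2 => 'b::euclidean_space"
  assumes w: "continuous_on UNIV w" and p: "partials w x d1 d2"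
  shows "(\<lambda>k. avg1 (inverse (Suc k)) w x) \<longlonglongrightarrow> d1" "(\<lambda>k. avg2 (inverse (Suc k)) w x) \<longlonglongrightarrow> d2"
proof -
  have main: "\<exists>n. \<forall>k\<ge>n. norm (avg1 (inverse (Suc k)) w x - d1) < e \<and> norm (avg2 (inverse (Suc k)) w x - d2) < e"
    if e: "e > 0" for e
  proof -
    let ?L = "\<lambda>z::real^2. z $ 1 *\<^sub>R d1 + z $ 2 *\<^sub>R d2"
    \<comment> \<open>Points of the square are within \<open>2 * h\<close> of \<open>x\<close>, so
      each value is off by at most \<open>h * (e / 4)\<close> and a difference of two by
      \<open>h * (e / 2)\<close>.\<close>
    have "\<exists>d>0. \<forall>y. norm (y - x) < d \<longrightarrow> norm (w y - w x - ?L (y - x)) \<le> (e / 8) * norm (y - x)"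
      using has_derivative_at_alt[THEN iffD1, OF p[unfolded partials_def], THEN conjunct2, rule_format, of "e / 8"] e by simp
    then obtain d where d: "d > 0" "\<And>y. norm (y - x) < d ==> norm (w y - w x - ?L (y - x)) \<le> (e / 8) * norm (y - x)"
      by blast
    obtain n where n: "inverse (real (Suc n)) < d / 2" using reals_Archimedean[of "d / 2"] d(1) by auto
    have "norm (avg1 (inverse (Suc k)) w x - d1) < e \<and> norm (avg2 (inverse (Suc k)) w x - d2) < e" if "k \<ge> n" for k
    proof -
      define h where "h = inverse (real (Suc k))"
      have "inverse (real (Suc k)) \<le> inverse (real (Suc n))"
        using that by (intro le_imp_inverse_le) auto
      then have h: "h < d / 2" using n unfolding h_def by linarith
      have "h > 0" by (simp add: h_def)
      note h = this h
      have r: "norm (w (x + pt a b) - w x - (a *\<^sub>R d1 + b *\<^sub>R d2)) \<le> h * (e / 4)" if "a \<in> {0..h}" "b \<in> {0..h}" for a b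
      proof -
        have nn: "norm (pt a b) \<le> 2 * h"
          using norm_le_l1_cart[of "pt a b"] that by (simp add: sum_2)
        have "norm (x + pt a b - x) < d" using nn h by simp
        from d(2)[OF this] have "norm (w (x + pt a b) - w x - (a *\<^sub>R d1 + b *\<^sub>R d2)) \<le> e / 8 * norm (pt a b)" by simp
        also have "\<dots> \<le> e / 8 * (2 * h)" using nn e by (intro mult_left_mono) auto
        finally show ?thesis by (simp add: mult.commute)
      qed
      have "norm (avg1 h w x - d1) \<le> e / 2"
      proof (rule avg12_bound(1)[OF w h(1)])
        fix b assume b: "b \<in> {0..h}"
        have "w (x + pt h b) - w (x + pt 0 b) - h *\<^sub>R d1 =
          (w (x + pt h b) - w x - (h *\<^sub>R d1 + b *\<^sub>R d2)) - (w (x + pt 0 b) - w x - (0 *\<^sub>R d1 + b *\<^sub>R d2))" by simp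
        also have "norm \<dots> \<le> h * (e / 4) + h * (e / 4)"
          using h b by (intro order_trans[OF norm_triangle_ineq4] add_mono r) auto
        finally show "norm (w (x + pt h b) - w (x + pt 0 b) - h *\<^sub>R d1) \<le> h * (e / 2)" by (simp add: mult.commute)
      qed
      moreover have "norm (avg2 h w x - d2) \<le> e / 2"
      proof (rule avg12_bound(2)[OF w h(1)])
        fix a assume a: "a \<in> {0..h}"
        have "w (x + pt a h) - w (x + pt a 0) - h *\<^sub>R d2 =
          (w (x + pt a h) - w x - (a *\<^sub>R d1 + h *\<^sub>R d2)) - (w (x + pt a 0) - w x - (a *\<^sub>R d1 + 0 *\<^sub>R d2))" by simp
        also have "norm \<dots> \<le> h * (e / 4) + h * (e / 4)"
          using h a by (intro order_trans[OF norm_triangle_ineq4] add_mono r) auto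
        finally show "norm (w (x + pt a h) - w (x + pt a 0) - h *\<^sub>R d2) \<le> h * (e / 2)" by (simp add: mult.commute)
      qed
      ultimately show ?thesis using e by (simp add: h_def)
    qed
    then show ?thesis by blast
  qed
  show "(\<lambda>k. avg1 (inverse (Suc k)) w x) \<longlonglongrightarrow> d1"
    by (rule LIMSEQ_I) (use main in blast)
  show "(\<lambda>k. avg2 (inverse (Suc k)) w x) \<longlonglongrightarrow> d2"
    by (rule LIMSEQ_I) (use main in blast)
qed

lemma rademacher_partials:
  fixes w :: "real^2 => real^2"
  assumes lip: "K-lipschitz_on UNIV w"
  obtains d1 d2 where "d1 \<in> borel_fun" "d2 \<in> borel_fun"
    "AE x in lborel. partials w x (d1 x) (d2 x)"
proof -
  have "K-lipschitz_on UNIV (\<lambda>x. w x $ i)" for i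
  proof (rule lipschitz_onI)
    fix x y :: "real^2"
    have "dist (w x $ i) (w y $ i) \<le> dist (w x) (w y)" by (rule dist_vec_nth_le)
    also have "\<dots> \<le> K * dist x y" using lipschitz_onD[OF lip] by auto
    finally show "dist (w x $ i) (w y $ i) \<le> K * dist x y" .
  qed (rule lipschitz_on_nonneg[OF lip])
  note l = this
  obtain g1 g2 where g: "g1 \<in> borel_fun" "g2 \<in> borel_fun"
    "AE x in lborel. ((\<lambda>x. w x $ 1) has_derivative (\<lambda>z. g1 x * z $ 1 + g2 x * z $ 2)) (at x)"
    using rademacher_real[OF l[of 1]] by blast
  obtain k1 k2 where k: "k1 \<in> borel_fun" "k2 \<in> borel_fun"
    "AE x in lborel. ((\<lambda>x. w x $ 2) has_derivative (\<lambda>z. k1 x * z $ 1 + k2 x * z $ 2)) (at x)"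
    using rademacher_real[OF l[of 2]] by blast
  have [measurable]: "g1 \<in> borel_fun" "g2 \<in> borel_fun" "k1 \<in> borel_fun" "k2 \<in> borel_fun"
    by fact+
  show ?thesis
  proof (rule that)
    show "(\<lambda>x. pt (g1 x) (k1 x)) \<in> borel_fun" "(\<lambda>x. pt (g2 x) (k2 x)) \<in> borel_fun"
      by measurable
    show "AE x in lborel. partials w x (pt (g1 x) (k1 x)) (pt (g2 x) (k2 x))"
      using g(3) k(3)
    proof eventually_elim
      case (elim x)
      have "((\<lambda>x. (w x $ 1) *\<^sub>R pt 1 0 + (w x $ 2) *\<^sub>R pt 0 1) has_derivative
         (\<lambda>z. (g1 x * z $ 1 + g2 x * z $ 2) *\<^sub>R pt 1 0 + (k1 x * z $ 1 + k2 x * z $ 2) *\<^sub>R pt 0 1)) (at x)"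
        by (intro has_derivative_add has_derivative_scaleR_left elim)
      moreover have "(\<lambda>x. (w x $ 1) *\<^sub>R pt 1 0 + (w x $ 2) *\<^sub>R pt 0 1) = w"
        by (simp add: fun_eq_iff vec_eq_iff forall_2)
      moreover have "(\<lambda>z::real^2. (g1 x * z $ 1 + g2 x * z $ 2) *\<^sub>R pt 1 0 + (k1 x * z $ 1 + k2 x * z $ 2) *\<^sub>R pt 0 1) =
         (\<lambda>z. z $ 1 *\<^sub>R pt (g1 x) (k1 x) + z $ 2 *\<^sub>R pt (g2 x) (k2 x))"
        by (simp add: fun_eq_iff vec_eq_iff forall_2 mult.commute)
      ultimately show ?case by (simp add: partials_def)
    qed
  qed
qed

section \<open>Total variation on a disk\<close>

lemma partials_zero_open:
  fixes g :: "real^2 => 'b::real_normed_vector"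
  assumes "partials g x d1 d2" "open S" "x \<in> S" "\<And>y. y \<in> S ==> g y = 0"
  shows "d1 = 0" "d2 = 0"
proof -
  have "((\<lambda>y. 0) has_derivative (\<lambda>z. z $ 1 *\<^sub>R d1 + z $ 2 *\<^sub>R d2)) (at x)"
    using assms unfolding partials_def by (auto intro: has_derivative_transform_within_open)
  then have "(\<lambda>z::real^2. z $ 1 *\<^sub>R d1 + z $ 2 *\<^sub>R d2) = (\<lambda>z. 0)"
    using has_derivative_const has_derivative_unique by blast
  from fun_cong[OF this, of "pt 1 0"] fun_cong[OF this, of "pt 0 1"] show "d1 = 0" "d2 = 0" by simp_all
qed

lemma partials_vector_derivative:
  assumes "partials g (pt a b) d1 d2"
  shows "((\<lambda>t. g (pt t b)) has_vector_derivative d1) (at a)" "((\<lambda>t. g (pt a t)) has_vector_derivative d2) (at b)"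
proof -
  have 1: "((\<lambda>t. pt t b) has_derivative (\<lambda>t. pt t 0)) (at a)" for a b
    unfolding pt_conv_axis by (auto intro!: derivative_eq_intros)
  have 2: "((\<lambda>t. pt a t) has_derivative (\<lambda>t. pt 0 t)) (at b)" for a b
    unfolding pt_conv_axis by (auto intro!: derivative_eq_intros)
  show "((\<lambda>t. g (pt t b)) has_vector_derivative d1) (at a)"
    using diff_chain_at[OF 1 assms[unfolded partials_def]] by (simp add: o_def has_vector_derivative_def)
  show "((\<lambda>t. g (pt a t)) has_vector_derivative d2) (at b)"
    using diff_chain_at[OF 2 assms[unfolded partials_def]] by (simp add: o_def has_vector_derivative_def)
qed

text \<open>Integrating first in the direction of the derivative, the fundamental theorem leaves
  only boundary values taken outside the support.\<close>

lemma integral_partials_compact_support: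
  fixes g :: "real^2 => real"
  assumes p: "\<And>x. partials g x (d1 x) (d2 x)" and c: "continuous_on UNIV d1" "continuous_on UNIV d2"
    and z: "\<And>x. norm x \<ge> R ==> g x = 0"
  shows "integrable lborel d1" "integrable lborel d2" "(LINT x|lborel. d1 x) = 0" "(LINT x|lborel. d2 x) = 0"
proof -
  define Q where "Q = max R 0 + 1"
  have Q: "Q > 0" "Q > R" by (auto simp: Q_def)
  have z': "d1 x = 0" "d2 x = 0" if "norm x > R" for x
  proof -
    have "open {x::real^2. norm x > R}" by (intro open_Collect_less continuous_intros)
    from partials_zero_open[OF p this, of x] that z show "d1 x = 0" "d2 x = 0" by auto
  qed
  have int: "integrable lborel d" if "continuous_on UNIV d" "\<And>x. norm x > R ==> d x = 0" for d :: "real^2 => real"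
  proof -
    have "integrable lborel (\<lambda>x. indicator (cball 0 R) x *\<^sub>R d x)"
      by (rule borel_integrable_compact) (auto intro: continuous_on_subset[OF that(1)])
    also have "(\<lambda>x. indicator (cball 0 R) x *\<^sub>R d x) = d"
      using that(2) by (auto simp: indicator_def fun_eq_iff not_le)
    finally show ?thesis .
  qed
  show i: "integrable lborel d1" "integrable lborel d2" using int c z' by auto
  have n: "norm (pt a b) \<ge> \<bar>a\<bar>" "norm (pt a b) \<ge> \<bar>b\<bar>" for a b
    using component_le_norm_cart[of "pt a b" 1] component_le_norm_cart[of "pt a b" 2] by auto
  have inner: "(LINT t|lborel. D t) = 0"
    if "\<And>t. (G has_vector_derivative D t) (at t)" "continuous_on UNIV D" "\<And>t. \<bar>t\<bar> > R ==> D t = 0" "\<And>t. \<bar>t\<bar> > R ==> G t = 0"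
    for G D :: "real => real"
  proof -
    have "(LINT t|lborel. D t) = (LINT t|lborel. indicator {-Q..Q} t *\<^sub>R D t)"
    proof (rule Bochner_Integration.integral_cong[OF refl])
      fix t
      show "D t = indicator {-Q..Q} t *\<^sub>R D t"
        using that(3)[of t] Q by (cases "R < \<bar>t\<bar>") (auto simp: indicator_def)
    qed
    also have "\<dots> = G Q - G (-Q)"
      using that(1,2) Q by (intro integral_FTC_Icc) (auto intro: has_vector_derivative_at_within continuous_on_subset)
    also have "\<dots> = 0" using that(4)[of Q] that(4)[of "-Q"] Q by simp
    finally show ?thesis .
  qed
  have "(LINT x|lborel. d1 x) = (LINT y|lborel. LINT x|lborel. d1 (pt x y))"
    by (rule lborel_integral_real2(2)[OF i(1)])
  also have "\<dots> = (LINT y|(lborel::real measure). 0)"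
  proof (intro Bochner_Integration.integral_cong refl inner)
    fix y t :: real
    show "((\<lambda>t. g (pt t y)) has_vector_derivative d1 (pt t y)) (at t)"
      by (rule partials_vector_derivative(1)[OF p])
    show "continuous_on UNIV (\<lambda>t. d1 (pt t y))"
      by (intro continuous_on_compose2[OF c(1)] continuous_intros) auto
    assume "\<bar>t\<bar> > R"
    then have "norm (pt t y) > R" using n(1)[of t y] by linarith
    then show "d1 (pt t y) = 0" "g (pt t y) = 0" using z' z by auto
  qed
  finally show "(LINT x|lborel. d1 x) = 0" by simp
  have "(LINT x|lborel. d2 x) = (LINT x|lborel. LINT y|lborel. d2 (pt x y))"
    by (rule lborel_integral_real2(1)[OF i(2)])
  also have "\<dots> = (LINT y|(lborel::real measure). 0)"
  proof (intro Bochner_Integration.integral_cong refl inner)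
    fix y t :: real
    show "((\<lambda>t. g (pt y t)) has_vector_derivative d2 (pt y t)) (at t)"
      by (rule partials_vector_derivative(2)[OF p])
    show "continuous_on UNIV (\<lambda>t. d2 (pt y t))"
      by (intro continuous_on_compose2[OF c(2)] continuous_intros) auto
    assume "\<bar>t\<bar> > R"
    then have "norm (pt y t) > R" using n(2)[of t y] by linarith
    then show "d2 (pt y t) = 0" "g (pt y t) = 0" using z' z by auto
  qed
  finally show "(LINT x|lborel. d2 x) = 0" by simp
qed

section \<open>Test fields and integration by parts\<close>

lemma BV_test_data:
  fixes \<phi> :: "real^2 => real^2^2"
  assumes "\<phi> \<in> BV_test \<Omega>"
  obtains e1 e2 K where "\<And>x. partials \<phi> x (e1 x) (e2 x)" "continuous_on UNIV e1" "continuous_on UNIV e2"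
    "compact K" "K \<subseteq> \<Omega>" "\<And>x. x \<notin> K ==> \<phi> x = 0 \<and> e1 x = 0 \<and> e2 x = 0" "\<And>x. norm (\<phi> x) \<le> 1" "continuous_on UNIV \<phi>"
    "\<And>x. row_div \<phi> x = (\<chi> i. e1 x $ i $ 1 + e2 x $ i $ 2)"
proof -
  have \<phi>: "C1_on UNIV \<phi>" "compact (closure {x. \<phi> x \<noteq> 0})" "closure {x. \<phi> x \<noteq> 0} \<subseteq> \<Omega>" "\<And>x. norm (\<phi> x) \<le> 1"
    using assms by (auto simp: BV_test_def)
  obtain e1 e2 where e': "\<And>x. x \<in> UNIV ==> partials \<phi> x (e1 x) (e2 x)" "continuous_on UNIV e1" "continuous_on UNIV e2"
    using C1_on_partials[OF \<phi>(1)] by blast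
  note e = e'(1)[OF UNIV_I] e'(2,3)
  have z: "\<phi> x = 0 \<and> e1 x = 0 \<and> e2 x = 0" if x: "x \<notin> closure {x. \<phi> x \<noteq> 0}" for x
  proof -
    have o: "open (- closure {x. \<phi> x \<noteq> 0})" by (rule open_Compl) simp
    have zz: "\<phi> y = 0" if "y \<in> - closure {x. \<phi> x \<noteq> 0}" for y
      using that closure_subset[of "{x. \<phi> x \<noteq> 0}"] by auto
    have xx: "x \<in> - closure {x. \<phi> x \<noteq> 0}" using x by simp
    show ?thesis using zz[OF xx] partials_zero_open[OF e(1) o xx zz] by blast
  qed
  have c: "continuous_on UNIV \<phi>"
    using e(1) unfolding partials_def
    by (auto intro!: continuous_at_imp_continuous_on has_derivative_continuous)
  have rd: "row_div \<phi> x = (\<chi> i. e1 x $ i $ 1 + e2 x $ i $ 2)" for x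
  proof -
    have "frechet_derivative \<phi> (at x) = (\<lambda>z. z $ 1 *\<^sub>R e1 x + z $ 2 *\<^sub>R e2 x)"
      using e(1)[of x] unfolding partials_def by (rule frechet_derivative_at[symmetric])
    then show ?thesis by (simp add: row_div_def sum_2 axis_def vec_eq_iff)
  qed
  show ?thesis by (rule that[OF e \<phi>(2,3) z \<phi>(4) c rd])
qed

lemma set_integrable_compact_support:
  fixes F :: "'a::euclidean_space => 'b::euclidean_space"
  assumes "compact K" "K \<subseteq> \<Omega>" "continuous_on K F" "\<And>x. x \<in> \<Omega> - K ==> F x = 0" "\<Omega> \<in> sets borel"
  shows "set_integrable lborel \<Omega> F"
proof -
  have "(\<lambda>x. indicator \<Omega> x *\<^sub>R F x) = (\<lambda>x. indicator K x *\<^sub>R F x)"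
    using assms by (auto simp: fun_eq_iff indicator_def)
  then show ?thesis
    unfolding set_integrable_def using borel_integrable_compact[OF assms(1,3)] by simp
qed

lemma lint_lebesgue_on_lborel:
  fixes F :: "'a::euclidean_space => 'b::euclidean_space"
  assumes "set_integrable lborel \<Omega> F" "\<Omega> \<in> sets borel"
  shows "(LINT x|lebesgue_on \<Omega>. F x) = (LINT x:\<Omega>|lborel. F x)"
  using lint_eq_integral(2)[OF assms] set_borel_integral_eq_integral(2)[OF assms(1)] by simp

lemma inner_mat2: "(A :: real^2^2) \<bullet> B = A$1$1 * B$1$1 + A$1$2 * B$1$2 + A$2$1 * B$2$1 + A$2$2 * B$2$2"
  by (simp add: inner_vec_def sum_2)

lemma inner_real2: "(a :: real^2) \<bullet> b = a$1 * b$1 + a$2 * b$2"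
  by (simp add: inner_vec_def sum_2)

lemma continuous_on_grad:
  assumes "C1_on S w"
  shows "continuous_on S (grad w)"
proof -
  obtain d1 d2 where d: "\<And>x. x \<in> S ==> partials w x (d1 x) (d2 x)" "continuous_on S d1" "continuous_on S d2"
    using C1_on_partials[OF assms] by blast
  have "continuous_on S (\<lambda>x. \<chi> i. \<chi> j::2. if j = 1 then d1 x $ i else d2 x $ i)"
  proof -
    have h: "continuous_on S (\<lambda>x. if j = 1 then d1 x $ i else d2 x $ i)" for i j :: 2
      by (cases "j = 1") (auto intro!: continuous_intros d)
    show ?thesis by (intro continuous_on_vec_lambda h)
  qed
  then show ?thesis
    by (rule continuous_on_cong[THEN iffD1, rotated -1]) (auto simp: grad_partials[OF d(1)])
qed

text \<open>The inner product \<open>q1 j\<close> of \<open>w\<close> with column \<open>j\<close>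
  of \<open>\<phi>\<close> is extended by 0 outside the disk. It is continuously differentiable on
  the whole plane since \<open>\<phi>\<close> vanishes off a compact subset of the disk, and its
  derivative in direction \<open>j\<close> integrates to 0.\<close>

lemma row_div_by_parts:
  fixes w :: "real^2 => real^2"
  assumes w: "\<And>x. x \<in> ball 0 r ==> partials w x (d1 x) (d2 x)" "continuous_on (ball 0 r) d1" "continuous_on (ball 0 r) d2"
    and \<phi>: "\<phi> \<in> BV_test (ball 0 r)"
  shows "set_integrable lborel (ball 0 r) (\<lambda>x. grad w x \<bullet> \<phi> x)"
    "set_integrable lborel (ball 0 r) (\<lambda>x. w x \<bullet> row_div \<phi> x)"
    "(LINT x|lebesgue_on (ball 0 r). w x \<bullet> row_div \<phi> x) = - (LINT x|lebesgue_on (ball 0 r). grad w x \<bullet> \<phi> x)"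
proof -
  let ?\<Omega> = "ball (0::real^2) r"
  obtain e1 e2 K where e: "\<And>x. partials \<phi> x (e1 x) (e2 x)" "continuous_on UNIV e1" "continuous_on UNIV e2"
    and K: "compact K" "K \<subseteq> ?\<Omega>" "\<And>x. x \<notin> K ==> \<phi> x = 0 \<and> e1 x = 0 \<and> e2 x = 0"
    and n: "\<And>x. norm (\<phi> x) \<le> 1" "continuous_on UNIV \<phi>"
    and rd: "\<And>x. row_div \<phi> x = (\<chi> i. e1 x $ i $ 1 + e2 x $ i $ 2)"
    using BV_test_data[OF \<phi>] by blast
  have wc: "continuous_on ?\<Omega> w"
    using w(1) unfolding partials_def by (auto intro!: continuous_at_imp_continuous_on has_derivative_continuous)
  have sub: "continuous_on K F" if "continuous_on ?\<Omega> F" for F :: "real^2 => 'c::real_normed_vector"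
    using K(2) that continuous_on_subset by blast
  define q1 where "q1 = (\<lambda>j x. if x \<in> ?\<Omega> then w x $ 1 * \<phi> x $ 1 $ j + w x $ 2 * \<phi> x $ 2 $ j else 0)"
  define D where "D = (\<lambda>j d e x. if x \<in> ?\<Omega> then (d x :: real^2) $ 1 * \<phi> x $ 1 $ j + w x $ 1 * (e x :: real^2^2) $ 1 $ j
       + (d x $ 2 * \<phi> x $ 2 $ j + w x $ 2 * e x $ 2 $ j) else 0)"
  have oK: "open (- K)" using compact_imp_closed[OF K(1)] by (rule open_Compl)
  have part: "partials (q1 j) x (D j d1 e1 x) (D j d2 e2 x)" for j x
  proof (cases "x \<in> ?\<Omega>")
    case True
    note pw = partials_nth[OF w(1)[OF True], unfolded partials_def]
    note pp = partials_nth[OF partials_nth[OF e(1)], unfolded partials_def]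
    have "((\<lambda>x. w x $ 1 * \<phi> x $ 1 $ j + w x $ 2 * \<phi> x $ 2 $ j) has_derivative
      (\<lambda>z. z $ 1 *\<^sub>R D j d1 e1 x + z $ 2 *\<^sub>R D j d2 e2 x)) (at x)"
      using True by (auto intro!: derivative_eq_intros pw pp simp: D_def algebra_simps fun_eq_iff)
    then show ?thesis unfolding partials_def
      by (rule has_derivative_transform_within_open[OF _ open_ball True]) (simp add: q1_def)
  next
    case False
    then have x: "x \<in> - K" using K(2) by auto
    have "((\<lambda>x. 0) has_derivative (\<lambda>z::real^2. 0)) (at x)" by simp
    then have "(q1 j has_derivative (\<lambda>z::real^2. 0)) (at x)"
      by (rule has_derivative_transform_within_open[OF _ oK x]) (use K(3) in \<open>auto simp: q1_def\<close>)
    then show ?thesis using False by (simp add: partials_def D_def)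
  qed
  have cont: "continuous_on UNIV (D j d e)"
    if d: "continuous_on ?\<Omega> d" "continuous_on UNIV e" "\<And>x. x \<notin> K ==> e x = 0" for j d e
  proof -
    have "continuous_on ?\<Omega> (\<lambda>x. d x $ 1 * \<phi> x $ 1 $ j + w x $ 1 * e x $ 1 $ j + (d x $ 2 * \<phi> x $ 2 $ j + w x $ 2 * e x $ 2 $ j))"
      by (intro continuous_intros d wc continuous_on_subset[OF d(2)] continuous_on_subset[OF n(2)]) auto
    then have 1: "continuous_on ?\<Omega> (D j d e)"
      by (rule continuous_on_cong[THEN iffD1, rotated -1]) (auto simp: D_def)
    have "continuous_on (- K) (\<lambda>x. 0 :: real)" by simp
    then have 2: "continuous_on (- K) (D j d e)"
      by (rule continuous_on_cong[THEN iffD1, rotated -1]) (use d(3) K(3) in \<open>auto simp: D_def\<close>)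
    have "continuous_on (?\<Omega> \<union> - K) (D j d e)"
      by (rule continuous_on_open_Un[OF open_ball oK 1 2])
    moreover have "?\<Omega> \<union> - K = UNIV" using K(2) by auto
    ultimately show ?thesis by simp
  qed
  have c1: "continuous_on UNIV (D j d1 e1)" "continuous_on UNIV (D j d2 e2)" for j
    using K(3) by (auto intro!: cont w e)
  have z: "q1 j x = 0" if "norm x \<ge> r" for j x using that by (simp add: q1_def)
  note I = integral_partials_compact_support[OF part c1 z]
  have gc: "continuous_on ?\<Omega> (grad w)"
    by (rule continuous_on_grad[OF C1_onI_partials[OF w]])
  show s1: "set_integrable lborel ?\<Omega> (\<lambda>x. grad w x \<bullet> \<phi> x)"
    by (rule set_integrable_compact_support[OF K(1,2)])
       (auto intro!: continuous_intros sub gc continuous_on_subset[OF n(2)] simp: K(3))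
  show s2: "set_integrable lborel ?\<Omega> (\<lambda>x. w x \<bullet> row_div \<phi> x)"
  proof (rule set_integrable_compact_support[OF K(1,2)])
    show "continuous_on K (\<lambda>x. w x \<bullet> row_div \<phi> x)"
      unfolding rd by (intro continuous_intros sub wc continuous_on_vec_lambda continuous_on_subset[OF e(2)] continuous_on_subset[OF e(3)]) auto
  qed (auto simp: rd K(3) inner_real2)
  \<comment> \<open>The divergence of the field with components \<open>q1 1\<close> and
    \<open>q1 2\<close>; the product rule splits it into the two pairings.\<close>
  have "0 = (LINT x|lborel. D 1 d1 e1 x) + (LINT x|lborel. D 2 d2 e2 x)" by (simp add: I)
  also have "\<dots> = (LINT x|lborel. D 1 d1 e1 x + D 2 d2 e2 x)"
    by (rule Bochner_Integration.integral_add[OF I(1) I(2), symmetric])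
  also have "\<dots> = (LINT x|lborel. indicator ?\<Omega> x *\<^sub>R (w x \<bullet> row_div \<phi> x) + indicator ?\<Omega> x *\<^sub>R (grad w x \<bullet> \<phi> x))"
  proof (intro Bochner_Integration.integral_cong refl)
    fix x :: "real^2"
    show "D 1 d1 e1 x + D 2 d2 e2 x = indicator ?\<Omega> x *\<^sub>R (w x \<bullet> row_div \<phi> x) + indicator ?\<Omega> x *\<^sub>R (grad w x \<bullet> \<phi> x)"
      by (cases "x \<in> ?\<Omega>") (simp_all add: D_def rd inner_real2 inner_mat2 grad_partials[OF w(1)] algebra_simps)
  qed
  also have "\<dots> = (LINT x:?\<Omega>|lborel. w x \<bullet> row_div \<phi> x) + (LINT x:?\<Omega>|lborel. grad w x \<bullet> \<phi> x)"
    using s1 s2 unfolding set_integrable_def set_lebesgue_integral_def by (intro Bochner_Integration.integral_add)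
  finally show "(LINT x|lebesgue_on ?\<Omega>. w x \<bullet> row_div \<phi> x) = - (LINT x|lebesgue_on ?\<Omega>. grad w x \<bullet> \<phi> x)"
    using lint_lebesgue_on_lborel[OF s1] lint_lebesgue_on_lborel[OF s2] by simp
qed

lemma total_variation_le_grad:
  assumes "C1_on (ball 0 r) w"
  shows "total_variation (ball 0 r) w \<le> disk_int r (\<lambda>x. ennreal (norm (grad w x)))"
  unfolding total_variation_def
proof (rule SUP_least)
  fix \<phi> :: "real^2 => real^2^2" assume \<phi>: "\<phi> \<in> BV_test (ball 0 r)"
  obtain d1 d2 where d: "\<And>x. x \<in> ball 0 r ==> partials w x (d1 x) (d2 x)" "continuous_on (ball 0 r) d1" "continuous_on (ball 0 r) d2"
    using C1_on_partials[OF assms] by blast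
  note I = row_div_by_parts[OF d \<phi>]
  have n: "norm (\<phi> x) \<le> 1" for x using \<phi> by (auto simp: BV_test_def)
  have "(LINT x|lebesgue_on (ball 0 r). w x \<bullet> row_div \<phi> x) = - (LINT x:ball 0 r|lborel. grad w x \<bullet> \<phi> x)"
    using I(3) lint_lebesgue_on_lborel[OF I(1)] by simp
  also have "ennreal \<dots> \<le> ennreal (norm (LINT x:ball 0 r|lborel. grad w x \<bullet> \<phi> x))"
    by (intro ennreal_leI) simp
  also have "\<dots> \<le> (\<integral>\<^sup>+x. norm (indicator (ball 0 r) x *\<^sub>R (grad w x \<bullet> \<phi> x)) \<partial>lborel)"
    using I(1) unfolding set_lebesgue_integral_def set_integrable_def by (rule integral_norm_bound_ennreal)
  also have "\<dots> \<le> disk_int r (\<lambda>x. ennreal (norm (grad w x)))"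
  proof (rule nn_integral_mono)
    fix x :: "real^2"
    have "\<bar>grad w x \<bullet> \<phi> x\<bar> \<le> norm (grad w x) * norm (\<phi> x)" by (rule Cauchy_Schwarz_ineq2)
    also have "\<dots> \<le> norm (grad w x) * 1" using n by (intro mult_left_mono) auto
    finally show "ennreal (norm (indicator (ball 0 r) x *\<^sub>R (grad w x \<bullet> \<phi> x))) \<le> ennreal (norm (grad w x)) * indicator (ball 0 r) x"
      by (auto simp: indicator_def intro: ennreal_leI)
  qed
  finally show "ennreal (LINT x|lebesgue_on (ball 0 r). w x \<bullet> row_div \<phi> x) \<le> disk_int r (\<lambda>x. ennreal (norm (grad w x)))" .
qed

text \<open>The row divergence is continuous with compact support, hence bounded, so the pairing is
  continuous for L1 convergence.\<close>

lemma tendsto_test_lint: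
  fixes w :: "nat => real^2 => real^2"
  assumes int: "\<And>k. integrable (lebesgue_on (ball 0 r)) (w k)" "integrable (lebesgue_on (ball 0 r)) u"
    and lim: "(\<lambda>k. LINT x|lebesgue_on (ball 0 r). norm (w k x - u x)) \<longlonglongrightarrow> 0"
    and \<phi>: "\<phi> \<in> BV_test (ball 0 r)"
  shows "(\<lambda>k. LINT x|lebesgue_on (ball 0 r). w k x \<bullet> row_div \<phi> x) \<longlonglongrightarrow> (LINT x|lebesgue_on (ball 0 r). u x \<bullet> row_div \<phi> x)"
proof -
  let ?M = "lebesgue_on (ball (0::real^2) r)"
  obtain e1 e2 K where e: "\<And>x. partials \<phi> x (e1 x) (e2 x)" "continuous_on UNIV e1" "continuous_on UNIV e2"
    and K: "compact K" "K \<subseteq> ball 0 r" "\<And>x. x \<notin> K ==> \<phi> x = 0 \<and> e1 x = 0 \<and> e2 x = 0"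
    and n: "\<And>x. norm (\<phi> x) \<le> 1" "continuous_on UNIV \<phi>"
    and rd: "\<And>x. row_div \<phi> x = (\<chi> i. e1 x $ i $ 1 + e2 x $ i $ 2)"
    using BV_test_data[OF \<phi>] by blast
  have rc: "continuous_on UNIV (row_div \<phi>)"
    unfolding rd[abs_def] by (intro continuous_on_vec_lambda continuous_intros e)
  have "bounded (row_div \<phi> ` K)"
    by (intro compact_imp_bounded compact_continuous_image K continuous_on_subset[OF rc]) auto
  then obtain C where C: "\<And>x. x \<in> K ==> norm (row_div \<phi> x) \<le> C" by (auto simp: bounded_iff)
  have Cb: "norm (row_div \<phi> x) \<le> max C 0" for x
    using C[of x] K(3)[of x] by (cases "x \<in> K") (auto simp: rd norm_real2)
  have rm: "row_div \<phi> \<in> borel_measurable ?M"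
    by (rule continuous_imp_measurable_on_sets_lebesgue[OF continuous_on_subset[OF rc]]) simp_all
  have int': "integrable ?M (\<lambda>x. g x \<bullet> row_div \<phi> x)" if g: "integrable ?M g" for g
  proof (rule Bochner_Integration.integrable_bound)
    show "integrable ?M (\<lambda>x. max C 0 * norm (g x))" using g by auto
    show "(\<lambda>x. g x \<bullet> row_div \<phi> x) \<in> borel_measurable ?M" using g rm by (intro borel_measurable_inner) auto
    show "AE x in ?M. norm (g x \<bullet> row_div \<phi> x) \<le> norm (max C 0 * norm (g x))"
    proof (intro AE_I2)
      fix x
      have "\<bar>g x \<bullet> row_div \<phi> x\<bar> \<le> norm (g x) * norm (row_div \<phi> x)" by (rule Cauchy_Schwarz_ineq2)
      also have "\<dots> \<le> norm (g x) * max C 0" using Cb by (intro mult_left_mono) auto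
      finally show "norm (g x \<bullet> row_div \<phi> x) \<le> norm (max C 0 * norm (g x))" by (simp add: abs_mult mult.commute)
    qed
  qed
  have "(\<lambda>k. (LINT x|?M. w k x \<bullet> row_div \<phi> x) - (LINT x|?M. u x \<bullet> row_div \<phi> x)) \<longlonglongrightarrow> 0"
  proof (rule Lim_null_comparison)
    show "(\<lambda>k. max C 0 * (LINT x|?M. norm (w k x - u x))) \<longlonglongrightarrow> 0"
      using tendsto_mult_left[OF lim, of "max C 0"] by simp
    show "\<forall>\<^sub>F k in sequentially. norm ((LINT x|?M. w k x \<bullet> row_div \<phi> x) - (LINT x|?M. u x \<bullet> row_div \<phi> x))
       \<le> max C 0 * (LINT x|?M. norm (w k x - u x))"
    proof (rule always_eventually, rule allI)
      fix k
      have "(LINT x|?M. w k x \<bullet> row_div \<phi> x) - (LINT x|?M. u x \<bullet> row_div \<phi> x) = (LINT x|?M. (w k x - u x) \<bullet> row_div \<phi> x)"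
        unfolding inner_diff_left using int' int by (intro Bochner_Integration.integral_diff[symmetric]) auto
      also have "norm \<dots> \<le> (LINT x|?M. norm ((w k x - u x) \<bullet> row_div \<phi> x))"
        by (rule integral_norm_bound)
      also have "\<dots> \<le> (LINT x|?M. max C 0 * norm (w k x - u x))"
      proof (rule integral_mono)
        show "integrable ?M (\<lambda>x. norm ((w k x - u x) \<bullet> row_div \<phi> x))"
          by (intro integrable_norm int' Bochner_Integration.integrable_diff int)
        show "integrable ?M (\<lambda>x. max C 0 * norm (w k x - u x))"
          using int(1)[of k] int(2) by auto
        fix x
        have "\<bar>(w k x - u x) \<bullet> row_div \<phi> x\<bar> \<le> norm (w k x - u x) * norm (row_div \<phi> x)" by (rule Cauchy_Schwarz_ineq2)
        also have "\<dots> \<le> norm (w k x - u x) * max C 0" using Cb by (intro mult_left_mono) auto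
        finally show "norm ((w k x - u x) \<bullet> row_div \<phi> x) \<le> max C 0 * norm (w k x - u x)" by (simp add: mult.commute)
      qed
      finally show "norm ((LINT x|?M. w k x \<bullet> row_div \<phi> x) - (LINT x|?M. u x \<bullet> row_div \<phi> x))
       \<le> max C 0 * (LINT x|?M. norm (w k x - u x))" by simp
    qed
  qed
  then show ?thesis by (simp add: LIM_zero_iff)
qed

text \<open>A supremum of functionals that are continuous in L1 is lower semicontinuous.\<close>

lemma total_variation_lsc:
  fixes w :: "nat => real^2 => real^2"
  assumes "\<And>k. integrable (lebesgue_on (ball 0 r)) (w k)" "integrable (lebesgue_on (ball 0 r)) u"
    and "(\<lambda>k. LINT x|lebesgue_on (ball 0 r). norm (w k x - u x)) \<longlonglongrightarrow> 0"
  shows "total_variation (ball 0 r) u \<le> liminf (\<lambda>k. total_variation (ball 0 r) (w k))"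
  unfolding total_variation_def[of _ u]
proof (rule SUP_least)
  fix \<phi> :: "real^2 => real^2^2" assume \<phi>: "\<phi> \<in> BV_test (ball 0 r)"
  have "(\<lambda>k. ennreal (LINT x|lebesgue_on (ball 0 r). w k x \<bullet> row_div \<phi> x)) \<longlonglongrightarrow> ennreal (LINT x|lebesgue_on (ball 0 r). u x \<bullet> row_div \<phi> x)"
    by (intro tendsto_ennrealI tendsto_test_lint assms \<phi>)
  then have "ennreal (LINT x|lebesgue_on (ball 0 r). u x \<bullet> row_div \<phi> x) = liminf (\<lambda>k. ennreal (LINT x|lebesgue_on (ball 0 r). w k x \<bullet> row_div \<phi> x))"
    by (simp add: lim_imp_Liminf)
  also have "\<dots> \<le> liminf (\<lambda>k. total_variation (ball 0 r) (w k))"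
    unfolding total_variation_def by (intro Liminf_mono always_eventually allI SUP_upper \<phi>)
  finally show "ennreal (LINT x|lebesgue_on (ball 0 r). u x \<bullet> row_div \<phi> x) \<le> liminf (\<lambda>k. total_variation (ball 0 r) (w k))" .
qed

section \<open>Variation and gradient of a continuously differentiable map\<close>

lemma continuous_zero_extension:
  fixes F :: "'a::t2_space => 'b::real_normed_vector"
  assumes "open U" "open V" "U \<union> V = UNIV" "continuous_on U F" "\<And>x. x \<in> V ==> F x = 0"
  shows "continuous_on UNIV F"
proof -
  have "continuous_on V (\<lambda>x. 0 :: 'b)" by simp
  then have "continuous_on V F"
    by (rule continuous_on_cong[THEN iffD1, rotated -1]) (use assms(5) in auto)
  from continuous_on_open_Un[OF assms(1,2,4) this] show ?thesis by (simp add: assms(3))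
qed

text \<open>The normalised gradient, regularised by \<open>\<epsilon>\<close> and cut off between
  the disks of radius \<open>s\<close> and \<open>r\<close>, nearly recovers the norm of the
  gradient but is only continuous. Its means over small squares are admissible test fields and
  converge to it pointwise under a common bound.\<close>

lemma grad_le_total_variation_aux:
  assumes w: "C1_on (ball 0 r) w" and s: "0 < s" "s < r"
  shows "disk_int s (\<lambda>x. ennreal (norm (grad w x))) \<le> total_variation (ball 0 r) w"
proof (rule ennreal_le_epsilon)
  fix e :: real assume e: "e > 0"
  define m where "m = measure lborel (ball (0::real^2) s)"
  have m: "emeasure lborel (ball (0::real^2) s) = ennreal m"
    unfolding m_def by (intro emeasure_eq_ennreal_measure) (use emeasure_bounded_finite[of "ball (0::real^2) s"] in auto)
  have m0: "m \<ge> 0" by (simp add: m_def)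
  define \<epsilon> where "\<epsilon> = e / (m + 1)"
  have \<epsilon>: "\<epsilon> > 0" using e m0 by (simp add: \<epsilon>_def)
  \<comment> \<open>The cutoff reaches 0 at radius \<open>s1\<close>. Averaging looks at points at
    distance at most \<open>s2 - s1\<close>, so the supports stay in the closed disk of radius
    \<open>s2\<close>.\<close>
  define s1 where "s1 = s + (r - s) / 3"
  define s2 where "s2 = s + 2 * (r - s) / 3"
  have ss: "s < s1" "s1 < s2" "s2 < r" using s by (auto simp: s1_def s2_def field_simps)
  let ?G = "grad w"
  have Gc: "continuous_on (ball 0 r) ?G" by (rule continuous_on_grad[OF w])
  obtain d1 d2 where d: "\<And>x. x \<in> ball 0 r ==> partials w x (d1 x) (d2 x)" "continuous_on (ball 0 r) d1" "continuous_on (ball 0 r) d2"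
    using C1_on_partials[OF w] by blast
  define \<kappa> where "\<kappa> = (\<lambda>x::real^2. cutoff ((norm x - s) / (s1 - s)))"
  have \<kappa>c: "continuous_on UNIV \<kappa>"
    unfolding \<kappa>_def using ss by (intro continuous_on_compose2[OF cutoff_continuous(2)] continuous_intros) auto
  have \<kappa>b: "0 \<le> \<kappa> x" "\<kappa> x \<le> 1" for x using cutoff_bounds by (auto simp: \<kappa>_def)
  \<comment> \<open>The minus sign compensates the one produced by integration by parts.\<close>
  define H where "H = (\<lambda>x. if x \<in> ball 0 r then - ((\<kappa> x / (norm (?G x) + \<epsilon>)) *\<^sub>R ?G x) else 0)"
  have pos: "norm (?G x) + \<epsilon> > 0" for x using \<epsilon> by (simp add: add_nonneg_pos)
  have H0: "H x = 0" if "norm x > s1" for x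
  proof -
    have "(norm x - s) / (s1 - s) \<ge> 1" using that ss by (simp add: le_divide_eq)
    then show ?thesis by (simp add: H_def \<kappa>_def cutoff_ge)
  qed
  have Hc: "continuous_on UNIV H"
  proof (rule continuous_zero_extension[of "ball 0 r" "{x. norm x > s1}"])
    show "open {x::real^2. norm x > s1}" by (intro open_Collect_less continuous_intros)
    show "ball 0 r \<union> {x::real^2. norm x > s1} = UNIV" using ss by auto
    have "continuous_on (ball 0 r) (\<lambda>x. - ((\<kappa> x / (norm (?G x) + \<epsilon>)) *\<^sub>R ?G x))"
      using pos by (intro continuous_intros Gc continuous_on_subset[OF \<kappa>c]) (auto simp: less_imp_neq[symmetric])
    then show "continuous_on (ball 0 r) H"
      by (rule continuous_on_cong[THEN iffD1, rotated -1]) (auto simp: H_def)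
  qed (use H0 in auto)
  have Hn: "norm (H x) \<le> 1" for x
  proof (cases "x \<in> ball 0 r")
    case True
    have "norm (H x) = \<kappa> x * (norm (?G x) / (norm (?G x) + \<epsilon>))"
      using True \<kappa>b[of x] pos[of x] by (simp add: H_def)
    also have "\<dots> \<le> 1 * 1"
      using \<kappa>b[of x] pos[of x] \<epsilon> by (intro mult_mono) (auto simp: divide_le_eq)
    finally show ?thesis by simp
  qed (simp add: H_def)
  define h where "h = (\<lambda>k. (s2 - s1) / 2 * inverse (real (Suc k)))"
  have h: "h k > 0" for k using ss by (simp add: h_def)
  have h2: "2 * h k \<le> s2 - s1" for k
  proof -
    have "inverse (real (Suc k)) \<le> inverse 1" by (rule le_imp_inverse_le) auto
    then have "(s2 - s1) * inverse (real (Suc k)) \<le> (s2 - s1) * 1" using ss by (intro mult_left_mono) auto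
    then show ?thesis by (simp add: h_def)
  qed
  have h0: "h \<longlonglongrightarrow> 0"
    using tendsto_mult_left[OF LIMSEQ_inverse_real_of_nat, of "(s2 - s1) / 2"] by (simp add: h_def[abs_def])
  have pt_le: "norm (pt a b) \<le> 2 * t" if "a \<in> {0..t}" "b \<in> {0..t}" for a b t
    using norm_le_l1_cart[of "pt a b"] that by (simp add: sum_2)
  define \<phi> where "\<phi> = (\<lambda>k. avg (h k) H)"
  have \<phi>0: "\<phi> k x = 0" if x: "norm x > s2" for k x
  proof -
    have "norm (\<phi> k x - 0) \<le> 0"
      unfolding \<phi>_def
    proof (rule avg_bound[OF Hc h])
      fix a b assume ab: "a \<in> {0..h k}" "b \<in> {0..h k}"
      have "norm (x + pt a b) > s1"
        using norm_diff_ineq[of x "pt a b"] pt_le[OF ab] h2[of k] x by linarith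
      then show "norm (H (x + pt a b) - 0) \<le> 0" by (simp add: H0)
    qed
    then show ?thesis by simp
  qed
  have \<phi>n: "norm (\<phi> k x) \<le> 1" for k x
    using avg_bound[OF Hc h, of k x 0 1] Hn by (simp add: \<phi>_def)
  have \<phi>t: "\<phi> k \<in> BV_test (ball 0 r)" for k
  proof -
    have sub: "closure {x. \<phi> k x \<noteq> 0} \<subseteq> cball 0 s2"
      using \<phi>0[of _ k] by (intro closure_minimal) (auto simp: not_less[symmetric])
    have "compact (closure {x. \<phi> k x \<noteq> 0})"
      using bounded_subset[OF bounded_cball sub] by (auto simp: compact_eq_bounded_closed)
    moreover have "closure {x. \<phi> k x \<noteq> 0} \<subseteq> ball 0 r" using sub ss by force
    moreover have "C1_on UNIV (\<phi> k)" unfolding \<phi>_def by (rule avg_C1[OF Hc h])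
    ultimately show ?thesis using \<phi>n by (simp add: BV_test_def)
  qed
  have \<phi>lim: "(\<lambda>k. \<phi> k x) \<longlonglongrightarrow> H x" for x
  proof (rule LIMSEQ_I)
    fix e :: real assume e: "e > 0"
    have "isCont H x" using Hc by (simp add: continuous_on_eq_continuous_at)
    then obtain \<delta> where \<delta>: "\<delta> > 0" "\<And>y. dist y x < \<delta> ==> dist (H y) (H x) < e / 2"
      using e unfolding continuous_at_eps_delta by (metis half_gt_zero)
    obtain N where N: "\<And>k. k \<ge> N ==> h k < \<delta> / 2"
      using order_tendstoD(2)[OF h0, of "\<delta> / 2"] \<delta>(1) by (auto simp: eventually_sequentially)
    have "norm (\<phi> k x - H x) < e" if k: "k \<ge> N" for k
    proof -
      have "norm (\<phi> k x - H x) \<le> e / 2"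
        unfolding \<phi>_def
      proof (rule avg_bound[OF Hc h])
        fix a b assume ab: "a \<in> {0..h k}" "b \<in> {0..h k}"
        have "dist (x + pt a b) x < \<delta>" using pt_le[OF ab] N[OF k] by (simp add: dist_norm)
        from \<delta>(2)[OF this] show "norm (H (x + pt a b) - H x) \<le> e / 2" by (simp add: dist_norm)
      qed
      then show ?thesis using e by simp
    qed
    then show "\<exists>N. \<forall>k\<ge>N. norm (\<phi> k x - H x) < e" by blast
  qed
  have cc: "cball (0::real^2) s2 \<subseteq> ball 0 r" using ss by auto
  have Gcc: "continuous_on (cball 0 s2) ?G" using Gc cc by (rule continuous_on_subset)
  have \<phi>c: "continuous_on UNIV (\<phi> k)" for k
    using avg_partials(1)[OF Hc h] unfolding \<phi>_def partials_def
    by (auto intro!: continuous_at_imp_continuous_on has_derivative_continuous)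
  let ?q = "\<lambda>h x. indicator (cball 0 s2) x *\<^sub>R - (?G x \<bullet> h x)"
  define J where "J = (LINT x|lborel. ?q H x)"
  have lim: "(\<lambda>k. LINT x|lborel. ?q (\<phi> k) x) \<longlonglongrightarrow> J"
    unfolding J_def
  proof (rule integral_dominated_convergence[where w="\<lambda>x. indicator (cball 0 s2) x *\<^sub>R norm (?G x)"])
    have 1: "integrable lborel (\<lambda>x. ?q (\<phi> k) x)" for k
      by (rule borel_integrable_compact) (auto intro!: continuous_intros Gcc continuous_on_subset[OF \<phi>c])
    have 2: "integrable lborel (\<lambda>x. ?q H x)"
      by (rule borel_integrable_compact) (auto intro!: continuous_intros Gcc continuous_on_subset[OF Hc])
    show "(\<lambda>x. ?q (\<phi> k) x) \<in> borel_measurable lborel" for k using 1 by auto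
    show "(\<lambda>x. ?q H x) \<in> borel_measurable lborel" using 2 by auto
    show "integrable lborel (\<lambda>x. indicator (cball 0 s2) x *\<^sub>R norm (?G x))"
      by (rule borel_integrable_compact) (auto intro!: continuous_intros Gcc)
    show "AE x in lborel. (\<lambda>k. ?q (\<phi> k) x) \<longlonglongrightarrow> ?q H x"
      by (intro AE_I2 tendsto_intros \<phi>lim)
    show "AE x in lborel. norm (?q (\<phi> k) x) \<le> indicator (cball 0 s2) x *\<^sub>R norm (?G x)" for k
    proof (intro AE_I2)
      fix x :: "real^2"
      have "\<bar>?G x \<bullet> \<phi> k x\<bar> \<le> norm (?G x) * norm (\<phi> k x)" by (rule Cauchy_Schwarz_ineq2)
      also have "\<dots> \<le> norm (?G x) * 1" using \<phi>n by (intro mult_left_mono) auto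
      finally show "norm (?q (\<phi> k) x) \<le> indicator (cball 0 s2) x *\<^sub>R norm (?G x)"
        by (auto simp: indicator_def)
    qed
  qed
  have "ennreal (LINT x|lborel. ?q (\<phi> k) x) \<le> total_variation (ball 0 r) w" for k
  proof -
    note I = row_div_by_parts[OF d \<phi>t[of k]]
    have "(LINT x|lborel. ?q (\<phi> k) x) = (LINT x|lborel. - (indicator (ball 0 r) x *\<^sub>R (?G x \<bullet> \<phi> k x)))"
    proof (intro Bochner_Integration.integral_cong refl)
      fix x :: "real^2"
      show "?q (\<phi> k) x = - (indicator (ball 0 r) x *\<^sub>R (?G x \<bullet> \<phi> k x))"
        using ss \<phi>0[of x k] by (cases "norm x > s2") (auto simp: indicator_def)
    qed
    also have "\<dots> = - (LINT x:ball 0 r|lborel. ?G x \<bullet> \<phi> k x)"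
      unfolding set_lebesgue_integral_def by simp
    also have "\<dots> = (LINT x|lebesgue_on (ball 0 r). w x \<bullet> row_div (\<phi> k) x)"
      using I(3) lint_lebesgue_on_lborel[OF I(1)] by simp
    finally have eq: "(LINT x|lborel. ?q (\<phi> k) x) = (LINT x|lebesgue_on (ball 0 r). w x \<bullet> row_div (\<phi> k) x)" .
    show ?thesis
      unfolding eq total_variation_def by (rule SUP_upper[OF \<phi>t])
  qed
  then have J: "ennreal J \<le> total_variation (ball 0 r) w"
    using tendsto_ennrealI[OF lim] by (intro LIMSEQ_le_const2[of "\<lambda>k. ennreal (LINT x|lborel. ?q (\<phi> k) x)"]) auto
  have GH: "- (?G x \<bullet> H x) = \<kappa> x * ((norm (?G x))\<^sup>2 / (norm (?G x) + \<epsilon>))" if "x \<in> ball 0 r" for x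
    using that by (simp add: H_def power2_norm_eq_inner)
  have GH0: "- (?G x \<bullet> H x) \<ge> 0" for x
    using GH[of x] \<kappa>b[of x] pos[of x] by (cases "x \<in> ball 0 r") (auto simp: H_def intro!: mult_nonneg_nonneg divide_nonneg_pos)
  have "disk_int s (\<lambda>x. ennreal (norm (?G x))) \<le>
      (\<integral>\<^sup>+x. ennreal (?q H x) + ennreal \<epsilon> * indicator (ball 0 s) x \<partial>lborel)"
  proof (rule nn_integral_mono)
    fix x :: "real^2"
    show "ennreal (norm (?G x)) * indicator (ball 0 s) x \<le> ennreal (?q H x) + ennreal \<epsilon> * indicator (ball 0 s) x"
    proof (cases "x \<in> ball 0 s")
      case True
      then have x: "x \<in> ball 0 r" "x \<in> cball 0 s2" using ss by auto
      have \<kappa>1: "\<kappa> x = 1" using True ss by (auto simp: \<kappa>_def intro!: cutoff_le divide_nonpos_pos)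
      have "(norm (?G x) - \<epsilon>) * (norm (?G x) + \<epsilon>) \<le> (norm (?G x))\<^sup>2" by (simp add: algebra_simps power2_eq_square)
      then have "norm (?G x) - \<epsilon> \<le> - (?G x \<bullet> H x)"
        unfolding GH[OF x(1)] \<kappa>1 using pos[of x] by (simp add: pos_le_divide_eq)
      then have "ennreal (norm (?G x)) \<le> ennreal (- (?G x \<bullet> H x) + \<epsilon>)" by (intro ennreal_leI) simp
      also have "\<dots> = ennreal (- (?G x \<bullet> H x)) + ennreal \<epsilon>" using GH0[of x] \<epsilon> by (intro ennreal_plus) auto
      finally show ?thesis using True x by simp
    qed simp
  qed
  also have "\<dots> = (\<integral>\<^sup>+x. ennreal (?q H x) \<partial>lborel) + ennreal \<epsilon> * ennreal m"
  proof -
    have 2: "(\<lambda>x. ?q H x) \<in> borel_measurable lborel"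
      by (rule borel_measurable_integrable, rule borel_integrable_compact) (auto intro!: continuous_intros Gcc continuous_on_subset[OF Hc])
    have 3: "(\<lambda>x. ennreal (?q H x)) \<in> borel_measurable lborel"
      by (rule measurable_compose[OF 2 measurable_ennreal])
    have 4: "(\<lambda>x. ennreal \<epsilon> * indicator (ball (0::real^2) s) x) \<in> borel_measurable lborel"
      by (intro borel_measurable_times_ennreal borel_measurable_const borel_measurable_indicator) auto
    show ?thesis
      unfolding nn_integral_add[OF 3 4] by (simp add: nn_integral_cmult_indicator m)
  qed
  also have "(\<integral>\<^sup>+x. ennreal (?q H x) \<partial>lborel) = ennreal J"
    unfolding J_def
  proof (rule nn_integral_eq_integral)
    show "integrable lborel (\<lambda>x. ?q H x)"
      by (rule borel_integrable_compact) (auto intro!: continuous_intros Gcc continuous_on_subset[OF Hc])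
    show "AE x in lborel. 0 \<le> ?q H x"
    proof (rule AE_I2)
      fix x :: "real^2"
      show "0 \<le> ?q H x"
        using GH0[of x] by (simp add: indicator_def del: neg_0_le_iff_le)
    qed
  qed
  also have "ennreal J + ennreal \<epsilon> * ennreal m \<le> total_variation (ball 0 r) w + ennreal e"
  proof (rule add_mono[OF J])
    have "\<epsilon> * m \<le> e" using e m0 by (simp add: \<epsilon>_def divide_le_eq algebra_simps)
    then show "ennreal \<epsilon> * ennreal m \<le> ennreal e" using \<epsilon> m0 by (simp add: ennreal_mult[symmetric] ennreal_leI)
  qed
  finally show "disk_int s (\<lambda>x. ennreal (norm (grad w x))) \<le> total_variation (ball 0 r) w + ennreal e" .
qed

lemma measurable_grad_ball:
  assumes "C1_on (ball 0 r) w"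
  shows "(\<lambda>x. indicator (ball 0 r) x *\<^sub>R grad w x) \<in> borel_fun"
  using continuous_on_grad[OF assms] by (intro borel_measurable_continuous_on_indicator) auto

text \<open>The disk is exhausted by the smaller disks of the previous estimate. Together with
  \<open>total_variation_le_grad\<close> this identifies the variation of a \<open>C1_on\<close> map
  with the integral of the norm of its gradient.\<close>

lemma grad_le_total_variation:
  assumes w: "C1_on (ball 0 r) w" and r: "r > 0"
  shows "disk_int r (\<lambda>x. ennreal (norm (grad w x))) \<le> total_variation (ball 0 r) w"
proof -
  define g where "g = (\<lambda>x. ennreal (norm (indicator (ball 0 r) x *\<^sub>R grad w x)))"
  have [measurable]: "g \<in> borel_fun"
    unfolding g_def by (rule measurable_compose[OF measurable_compose[OF measurable_grad_ball[OF w] borel_measurable_norm] measurable_ennreal])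
  define M where "M = density lborel g"
  \<comment> \<open>The denominator \<open>n + 2\<close> keeps every radius positive.\<close>
  define s where "s = (\<lambda>n. r - r / real (n + 2))"
  have s: "0 < s n" "s n < r" for n
  proof -
    have "r / real (n + 2) \<le> r / 2" by (rule divide_left_mono) (use r in auto)
    moreover have "0 < r / real (n + 2)" using r by simp
    ultimately show "0 < s n" "s n < r" using r unfolding s_def by linarith+
  qed
  have bm: "ball (0::real^2) t \<in> sets borel" for t by simp
  have M: "emeasure M (ball 0 t) = disk_int t (\<lambda>x. ennreal (norm (grad w x)))" if "t \<le> r" for t
  proof -
    have "emeasure M (ball 0 t) = (\<integral>\<^sup>+x. g x * indicator (ball 0 t) x \<partial>lborel)"
      unfolding M_def by (rule emeasure_density) simp_all
    then show ?thesis
      using that by (auto intro!: nn_integral_cong simp: g_def indicator_def)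
  qed
  have "incseq (\<lambda>n. ball (0::real^2) (s n))"
  proof (rule incseq_SucI)
    fix n
    have "r / real (Suc n + 2) \<le> r / real (n + 2)" using r by (intro divide_left_mono) auto
    then show "ball (0::real^2) (s n) \<subseteq> ball 0 (s (Suc n))" by (auto simp: s_def)
  qed
  then have "(SUP n. emeasure M (ball 0 (s n))) = emeasure M (\<Union>n. ball 0 (s n))"
    by (intro SUP_emeasure_incseq) (auto simp: M_def)
  moreover have "(\<Union>n. ball 0 (s n)) = ball (0::real^2) r"
  proof
    show "(\<Union>n. ball 0 (s n)) \<subseteq> ball (0::real^2) r" using subset_ball[OF less_imp_le[OF s(2)]] by blast
    show "ball (0::real^2) r \<subseteq> (\<Union>n. ball 0 (s n))"
    proof
      fix x :: "real^2" assume x: "x \<in> ball 0 r"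
      have "(\<lambda>n. s n) \<longlonglongrightarrow> r - 0"
        unfolding s_def by (intro tendsto_diff tendsto_const LIMSEQ_ignore_initial_segment[OF lim_const_over_n])
      then have "\<forall>\<^sub>F n in sequentially. norm x < s n" using x by (intro order_tendstoD(1)[of _ "r - 0"]) auto
      then show "x \<in> (\<Union>n. ball 0 (s n))" by (auto simp: eventually_sequentially)
    qed
  qed
  ultimately have "emeasure M (ball 0 r) = (SUP n. emeasure M (ball 0 (s n)))" by simp
  also have "\<dots> \<le> total_variation (ball 0 r) w"
    using grad_le_total_variation_aux[OF w s] M[OF less_imp_le[OF s(2)]] by (intro SUP_least) simp
  finally show ?thesis using M[OF order_refl] by simp
qed

section \<open>Integrals of functions of the angle\<close>

lemma nn_integral_polar_product:
  fixes h :: "real => ennreal" and k :: "real => ennreal"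
  assumes [measurable]: "h \<in> borel_fun" "k \<in> borel_fun"
  shows "disk_int r (\<lambda>x. h (norm x) * k (angle x)) =
    (\<integral>\<^sup>+\<rho>\<in>{0<..<r}. ennreal \<rho> * h \<rho> \<partial>lborel) * (arc_int (\<lambda>t. k t))"
proof -
  have "disk_int r (\<lambda>x. h (norm x) * k (angle x)) =
    (\<integral>\<^sup>+\<rho>\<in>{0<..<r}. (arc_int (\<lambda>t. ennreal \<rho> * (h (norm (\<rho> *\<^sub>R circ t)) * k (angle (\<rho> *\<^sub>R circ t))))) \<partial>lborel)"
    by (rule nn_integral_polar) measurable
  also have "\<dots> = (\<integral>\<^sup>+\<rho>. (ennreal \<rho> * h \<rho> * indicator {0<..<r} \<rho>) * (arc_int (\<lambda>t. k t)) \<partial>lborel)"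
  proof (rule nn_integral_cong)
    fix \<rho> :: real
    show "(arc_int (\<lambda>t. ennreal \<rho> * (h (norm (\<rho> *\<^sub>R circ t)) * k (angle (\<rho> *\<^sub>R circ t))))) * indicator {0<..<r} \<rho> =
       (ennreal \<rho> * h \<rho> * indicator {0<..<r} \<rho>) * (arc_int (\<lambda>t. k t))"
    proof (cases "\<rho> \<in> {0<..<r}")
      case True
      have "arc_int (\<lambda>t. ennreal \<rho> * (h (norm (\<rho> *\<^sub>R circ t)) * k (angle (\<rho> *\<^sub>R circ t)))) =
          (\<integral>\<^sup>+t. (ennreal \<rho> * h \<rho>) * (k t * indicator {0<..<2*pi} t) \<partial>lborel)"
        using True by (intro nn_integral_cong) (auto simp: indicator_def angle_circ mult.assoc)
      also have "\<dots> = (ennreal \<rho> * h \<rho>) * (arc_int (\<lambda>t. k t))"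
        by (rule nn_integral_cmult) measurable
      finally show ?thesis using True by simp
    qed simp
  qed
  also have "\<dots> = (\<integral>\<^sup>+\<rho>\<in>{0<..<r}. ennreal \<rho> * h \<rho> \<partial>lborel) * (arc_int (\<lambda>t. k t))"
    by (rule nn_integral_multc) measurable
  finally show ?thesis .
qed

lemma nn_integral_open_closed_interval:
  fixes k :: "real => ennreal"
  shows "(\<integral>\<^sup>+t\<in>{a<..<b}. k t \<partial>lborel) = (\<integral>\<^sup>+t\<in>{a..b}. k t \<partial>lborel)"
proof (rule nn_integral_cong_AE)
  have "AE t in lborel. t \<notin> {a, b}" by (rule AE_lborel_negligible) simp
  then show "AE t in lborel. k t * indicator {a<..<b} t = k t * indicator {a..b} t"
    by eventually_elim (auto simp: indicator_def)
qed

text \<open>Since \<open>h\<close> is nonnegative, positive and negative part of the product are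
  those of \<open>k\<close>, and the nonnegative case applies to each; finiteness of
  \<open>A\<close> permits the subtraction.\<close>

lemma lborel_integral_polar_product:
  fixes h k :: "real => real"
  assumes [measurable]: "h \<in> borel_fun" and k: "loop k" and h0: "\<And>\<rho>. h \<rho> \<ge> 0"
    and A: "(\<integral>\<^sup>+\<rho>\<in>{0<..<r}. ennreal (\<rho> * h \<rho>) \<partial>lborel) = ennreal A" "A \<ge> 0"
    and int: "set_integrable lborel (ball 0 r) (\<lambda>x::real^2. h (norm x) * k (angle x))"
  shows "(LINT x:ball (0::real^2) r|lborel. h (norm x) * k (angle x)) = A * integral {0..2*pi} k"
proof -
  have [measurable]: "k \<in> borel_fun" using loopD(1)[OF k] .
  have kint: "set_integrable lborel {0..2*pi} k" by (rule loop_integrable(2)[OF k])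
  have main: "(\<integral>\<^sup>+x. ennreal (indicator (ball (0::real^2) r) x *\<^sub>R (h (norm x) * g (angle x))) \<partial>lborel) = ennreal A * (\<integral>\<^sup>+t. ennreal (indicator {0..2*pi} t *\<^sub>R g t) \<partial>lborel)"
    if [measurable]: "g \<in> borel_fun" for g :: "real => real"
  proof -
    have "(\<integral>\<^sup>+x. ennreal (indicator (ball (0::real^2) r) x *\<^sub>R (h (norm x) * g (angle x))) \<partial>lborel) = disk_int r (\<lambda>x. ennreal (h (norm x)) * ennreal (g (angle x)))"
      using h0 by (intro nn_integral_cong) (auto simp: indicator_def ennreal_mult')
    also have "\<dots> = (\<integral>\<^sup>+\<rho>\<in>{0<..<r}. ennreal \<rho> * ennreal (h \<rho>) \<partial>lborel) * (arc_int (\<lambda>t. ennreal (g t)))"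
      by (rule nn_integral_polar_product) measurable
    also have "(\<integral>\<^sup>+\<rho>\<in>{0<..<r}. ennreal \<rho> * ennreal (h \<rho>) \<partial>lborel) = ennreal A"
      unfolding A(1)[symmetric] using h0 by (intro nn_integral_cong) (auto simp: indicator_def ennreal_mult')
    also have "arc_int (\<lambda>t. ennreal (g t)) = (\<integral>\<^sup>+t. ennreal (indicator {0..2*pi} t *\<^sub>R g t) \<partial>lborel)"
      unfolding nn_integral_open_closed_interval by (intro nn_integral_cong) (auto simp: indicator_def)
    finally show ?thesis .
  qed
  have m2: "(\<lambda>t. - k t) \<in> borel_fun" by measurable
  have "(LINT x:ball (0::real^2) r|lborel. h (norm x) * k (angle x)) =
     enn2real (\<integral>\<^sup>+x. ennreal (indicator (ball (0::real^2) r) x *\<^sub>R (h (norm x) * k (angle x))) \<partial>lborel)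
     - enn2real (\<integral>\<^sup>+x. ennreal (- (indicator (ball (0::real^2) r) x *\<^sub>R (h (norm x) * k (angle x)))) \<partial>lborel)"
    unfolding set_lebesgue_integral_def by (rule real_lebesgue_integral_def[OF int[unfolded set_integrable_def]])
  also have "\<dots> = A * (enn2real (\<integral>\<^sup>+t. ennreal (indicator {0..2*pi} t *\<^sub>R k t) \<partial>lborel)
     - enn2real (\<integral>\<^sup>+t. ennreal (- (indicator {0..2*pi} t *\<^sub>R k t)) \<partial>lborel))"
    using main[of k] main[OF m2] A(2) by (simp add: enn2real_mult right_diff_distrib)
  also have "enn2real (\<integral>\<^sup>+t. ennreal (indicator {0..2*pi} t *\<^sub>R k t) \<partial>lborel)
     - enn2real (\<integral>\<^sup>+t. ennreal (- (indicator {0..2*pi} t *\<^sub>R k t)) \<partial>lborel) = (LINT t:{0..2*pi}|lborel. k t)"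
    unfolding set_lebesgue_integral_def by (rule real_lebesgue_integral_def[OF kint[unfolded set_integrable_def], symmetric])
  also have "\<dots> = integral {0..2*pi} k" by (rule set_borel_integral_eq_integral(2)[OF kint])
  finally show ?thesis .
qed

section \<open>Differentiability of periodic functions of the angle\<close>

lemma periodic_circ_eq:
  fixes \<psi> :: "real => 'a"
  assumes "\<And>t. \<psi> (t + 2 * pi) = \<psi> t" "circ s = circ t"
  shows "\<psi> s = \<psi> t"
proof -
  have "sin t = sin s \<and> cos t = cos s" using assms(2) by (simp add: circ_conv_pt)
  then obtain n :: int where "t = s + 2 * pi * of_int n" unfolding sin_cos_eq_iff by blast
  then show ?thesis using periodic_floor[where f=\<psi>, OF assms(1), of t n] by simp
qed

text \<open>The logarithm gives a differentiable argument off the nonpositive half-line; there, the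
  argument of \<open>- y\<close> increased by \<open>pi\<close> does. Either agrees with
  \<open>angle\<close> only up to multiples of \<open>2 * pi\<close>, which is why the agreement is
  stated through \<open>circ\<close>.\<close>

lemma angle_branch:
  assumes x: "x \<noteq> (0 :: real^2)"
  obtains \<theta> S where "open S" "x \<in> S" "\<And>y. y \<in> S ==> y \<noteq> 0 \<and> circ (\<theta> y) = circ (angle y)"
    "(\<theta> has_derivative (\<lambda>z. (x $ 1 * z $ 2 - x $ 2 * z $ 1) / (norm x)\<^sup>2)) (at x)"
proof -
  define c where "c = (\<lambda>y::real^2. Complex (y $ 1) (y $ 2))"
  have cl: "bounded_linear c"
  proof -
    have "c = (\<lambda>y. of_real (y $ 1) + \<i> * of_real (y $ 2))"
      by (simp add: c_def fun_eq_iff complex_eq_iff)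
    then show ?thesis
      by (auto intro!: bounded_linear_add bounded_linear_const_mult bounded_linear_compose[OF bounded_linear_of_real] bounded_linear_vec_nth)
  qed
  have cc: "continuous_on UNIV c" by (rule linear_continuous_on[OF cl])
  have nc: "cmod (c y) = norm y" for y by (simp add: c_def norm_real2 cmod_def)
  have polar: "norm y *\<^sub>R circ (Im (Ln (c y))) = y" if "c y \<noteq> 0" for y
  proof -
    have "c y = exp (Ln (c y))" using that by simp
    also have "\<dots> = of_real (norm y) * cis (Im (Ln (c y)))"
      using that by (simp add: exp_eq_polar Re_Ln nc[symmetric])
    finally have "Complex (y $ 1) (y $ 2) = of_real (norm y) * cis (Im (Ln (c y)))" by (simp add: c_def)
    then show ?thesis by (simp add: complex_eq_iff vec_eq_iff forall_2)
  qed
  have eq: "circ t = circ (angle y)" if "norm y *\<^sub>R circ t = y" "y \<noteq> 0" for t y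
  proof -
    have "norm y *\<^sub>R circ t = norm y *\<^sub>R circ (angle y)" using that circ_angle[of y] by simp
    then show ?thesis using that(2) by simp
  qed
  have derLn: "((\<lambda>y. Im (Ln (c y))) has_derivative (\<lambda>z. (x $ 1 * z $ 2 - x $ 2 * z $ 1) / (norm x)\<^sup>2)) (at x)"
    if "c x \<notin> \<real>\<^sub>\<le>\<^sub>0" for x
  proof -
    have "(Ln has_derivative (\<lambda>h. inverse (c x) * h)) (at (c x))"
      using has_field_derivative_Ln[OF that] by (simp add: has_field_derivative_def)
    from diff_chain_at[OF bounded_linear_imp_has_derivative[OF cl] this]
    have "((\<lambda>y. Ln (c y)) has_derivative (\<lambda>z. inverse (c x) * c z)) (at x)" by (simp add: o_def)
    from bounded_linear.has_derivative[OF bounded_linear_Im this]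
    have "((\<lambda>y. Im (Ln (c y))) has_derivative (\<lambda>z. Im (inverse (c x) * c z))) (at x)" .
    also have "(\<lambda>z. Im (inverse (c x) * c z)) = (\<lambda>z. (x $ 1 * z $ 2 - x $ 2 * z $ 1) / (norm x)\<^sup>2)"
      by (simp add: fun_eq_iff c_def complex_inverse norm_real2_sq diff_divide_distrib)
    finally show ?thesis .
  qed
  have neg: "c (- y) = - c y" for y by (simp add: c_def complex_eq_iff)
  have c0: "c y = 0 \<longleftrightarrow> y = 0" for y using nc[of y] by (metis norm_eq_zero)
  show ?thesis
  proof (cases "c x \<in> \<real>\<^sub>\<le>\<^sub>0")
    case False
    show ?thesis
    proof (rule that[of "c -` (- \<real>\<^sub>\<le>\<^sub>0)" "\<lambda>y. Im (Ln (c y))"])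
      show "open (c -` (- \<real>\<^sub>\<le>\<^sub>0))" using cc by (intro open_vimage) (auto simp: open_Compl)
      show "y \<noteq> 0 \<and> circ (Im (Ln (c y))) = circ (angle y)" if "y \<in> c -` (- \<real>\<^sub>\<le>\<^sub>0)" for y
      proof -
        have "c y \<noteq> 0" using that by auto
        then show ?thesis using eq[OF polar] c0 by auto
      qed
    qed (use False derLn in auto)
  next
    case True
    have nx: "c (- x) \<notin> \<real>\<^sub>\<le>\<^sub>0"
      using True x c0[of x] unfolding neg by (auto simp: complex_nonpos_Reals_iff complex_eq_iff)
    show ?thesis
    proof (rule that[of "(\<lambda>y. c (- y)) -` (- \<real>\<^sub>\<le>\<^sub>0)" "\<lambda>y. Im (Ln (c (- y))) + pi"])
      show "open ((\<lambda>y. c (- y)) -` (- \<real>\<^sub>\<le>\<^sub>0))"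
        by (intro open_vimage continuous_on_compose2[OF cc] continuous_intros) (auto simp: open_Compl)
      show "y \<noteq> 0 \<and> circ (Im (Ln (c (- y))) + pi) = circ (angle y)" if "y \<in> (\<lambda>y. c (- y)) -` (- \<real>\<^sub>\<le>\<^sub>0)" for y
      proof -
        have cy: "c (- y) \<noteq> 0" using that by auto
        have "norm y *\<^sub>R circ (Im (Ln (c (- y))) + pi) = - (norm (- y) *\<^sub>R circ (Im (Ln (c (- y)))))"
          by (simp add: vec_eq_iff forall_2)
        then have "norm y *\<^sub>R circ (Im (Ln (c (- y))) + pi) = y" using polar[OF cy] by simp
        moreover have "y \<noteq> 0" using cy c0[of "- y"] by auto
        ultimately show ?thesis using eq by blast
      qed
      have "((\<lambda>y. - y) has_derivative (\<lambda>z. - z)) (at x)" by (auto intro!: derivative_eq_intros)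
      from diff_chain_at[OF this derLn[OF nx]]
      have "((\<lambda>y. Im (Ln (c (- y)))) has_derivative (\<lambda>z. (x $ 1 * z $ 2 - x $ 2 * z $ 1) / (norm x)\<^sup>2)) (at x)"
        by (simp add: o_def)
      then show "((\<lambda>y. Im (Ln (c (- y))) + pi) has_derivative (\<lambda>z. (x $ 1 * z $ 2 - x $ 2 * z $ 1) / (norm x)\<^sup>2)) (at x)"
        using has_derivative_add[OF _ has_derivative_const] by fastforce
    qed (use nx in auto)
  qed
qed

lemma periodic_angle_partials:
  fixes \<psi> :: "real => 'b::real_normed_vector"
  assumes \<psi>: "\<And>t. (\<psi> has_vector_derivative D t) (at t)" "\<And>t. \<psi> (t + 2 * pi) = \<psi> t" "\<And>t. D (t + 2 * pi) = D t" and x: "x \<noteq> 0"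
  shows "partials (\<lambda>x. \<psi> (angle x)) x ((- (x $ 2) / (norm x)\<^sup>2) *\<^sub>R D (angle x)) ((x $ 1 / (norm x)\<^sup>2) *\<^sub>R D (angle x))"
proof -
  obtain \<theta> S where \<theta>: "open S" "x \<in> S" "\<And>y. y \<in> S ==> y \<noteq> 0 \<and> circ (\<theta> y) = circ (angle y)"
    "(\<theta> has_derivative (\<lambda>z. (x $ 1 * z $ 2 - x $ 2 * z $ 1) / (norm x)\<^sup>2)) (at x)"
    by (rule angle_branch[OF x], rule that)
  have "D (\<theta> x) = D (angle x)" using \<theta>(2,3) by (intro periodic_circ_eq[where \<psi>=D, OF \<psi>(3)]) auto
  then have "(\<psi> has_derivative (\<lambda>t. t *\<^sub>R D (angle x))) (at (\<theta> x))"
    using \<psi>(1)[of "\<theta> x"] by (simp add: has_vector_derivative_def)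
  from diff_chain_at[OF \<theta>(4) this]
  have "((\<lambda>y. \<psi> (\<theta> y)) has_derivative (\<lambda>z. ((x $ 1 * z $ 2 - x $ 2 * z $ 1) / (norm x)\<^sup>2) *\<^sub>R D (angle x))) (at x)"
    by (simp add: o_def)
  then have "((\<lambda>y. \<psi> (angle y)) has_derivative (\<lambda>z. ((x $ 1 * z $ 2 - x $ 2 * z $ 1) / (norm x)\<^sup>2) *\<^sub>R D (angle x))) (at x)"
    by (rule has_derivative_transform_within_open[OF _ \<theta>(1,2)]) (use \<theta>(3) in \<open>auto intro: periodic_circ_eq[where \<psi>=\<psi>, OF \<psi>(2)]\<close>)
  moreover have "(\<lambda>z::real^2. ((x $ 1 * z $ 2 - x $ 2 * z $ 1) / (norm x)\<^sup>2) *\<^sub>R D (angle x)) =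
     (\<lambda>z. z $ 1 *\<^sub>R ((- (x $ 2) / (norm x)\<^sup>2) *\<^sub>R D (angle x)) + z $ 2 *\<^sub>R ((x $ 1 / (norm x)\<^sup>2) *\<^sub>R D (angle x)))"
    by (simp add: fun_eq_iff scaleR_add_left[symmetric] algebra_simps diff_divide_distrib)
  ultimately show ?thesis by (simp add: partials_def)
qed

lemma periodic_angle_continuous:
  fixes D :: "real => 'b::real_normed_vector"
  assumes D: "continuous_on UNIV D" "\<And>t. D (t + 2 * pi) = D t" and S: "0 \<notin> S"
  shows "continuous_on S (\<lambda>x. D (angle x))"
proof (rule continuous_at_imp_continuous_on, rule ballI)
  fix x assume "x \<in> S"
  then have x: "x \<noteq> 0" using S by auto
  obtain \<theta> U where \<theta>: "open U" "x \<in> U" "\<And>y. y \<in> U ==> y \<noteq> 0 \<and> circ (\<theta> y) = circ (angle y)"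
    "(\<theta> has_derivative (\<lambda>z. (x $ 1 * z $ 2 - x $ 2 * z $ 1) / (norm x)\<^sup>2)) (at x)"
    by (rule angle_branch[OF x], rule that)
  have "isCont \<theta> x" using \<theta>(4) by (rule has_derivative_continuous)
  moreover have "isCont D (\<theta> x)" using D(1) by (simp add: continuous_on_eq_continuous_at)
  ultimately have "isCont (\<lambda>y. D (\<theta> y)) x" by (rule isCont_o2)
  moreover have "\<forall>\<^sub>F y in nhds x. D (\<theta> y) = D (angle y)"
    using eventually_nhds_in_open[OF \<theta>(1,2)]
    by eventually_elim (use \<theta>(3) in \<open>auto intro: periodic_circ_eq[where \<psi>=D, OF D(2)]\<close>)
  ultimately show "isCont (\<lambda>x. D (angle x)) x" by (subst (asm) isCont_cong) auto
qed

text \<open>The test field is \<open>g(|x|\<^sup>2) / |x|\<close> times \<open>\<psi>(\<theta>) \<otimes> x\<^sup>\<bottom>\<close>. It is tangential, so only the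
  angular derivative contributes to its row divergence.\<close>

lemma angular_test_field:
  fixes \<psi> :: "real => real^2" and g g' :: "real => real"
  assumes \<psi>: "\<And>t. (\<psi> has_vector_derivative D t) (at t)" "continuous_on UNIV D" "\<And>t. \<psi> (t + 2 * pi) = \<psi> t" "\<And>t. D (t + 2 * pi) = D t" "\<And>t. norm (\<psi> t) \<le> 1"
    and g: "\<And>s. (g has_real_derivative g' s) (at s)" "continuous_on UNIV g'" "\<And>s. 0 \<le> g s \<and> g s \<le> 1"
    and supp: "0 < a" "0 < b" "b < r" "\<And>s. s \<le> a ==> g s = 0" "\<And>s. s \<ge> b\<^sup>2 ==> g s = 0"
  obtains \<phi> where "\<phi> \<in> BV_test (ball 0 r)" "\<And>x. row_div \<phi> x = (g ((norm x)\<^sup>2) / norm x) *\<^sub>R D (angle x)"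
proof -
  define m where "m = (\<lambda>x::real^2. g ((norm x)\<^sup>2) / norm x)"
  define \<phi> :: "real^2 => real^2^2" where "\<phi> = (\<lambda>x. \<chi> i j. m x * \<psi> (angle x) $ i * pt (- (x $ 2)) (x $ 1) $ j)"
  define \<mu> where "\<mu> = (\<lambda>j x::real^2. 2 * x $ j * g' ((norm x)\<^sup>2) / norm x - g ((norm x)\<^sup>2) * x $ j / norm x ^ 3)"
  have md: "partials m x (\<mu> 1 x) (\<mu> 2 x)" if x: "x \<noteq> 0" for x
  proof -
    have n0: "norm x > 0" using x by simp
    have sq: "((\<lambda>x::real^2. (norm x)\<^sup>2) has_derivative (\<lambda>z. 2 * (x \<bullet> z))) (at x)"
      unfolding power2_norm_eq_inner by (auto intro!: derivative_eq_intros simp: inner_commute)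
    have nd: "(norm has_derivative (\<lambda>z. (x \<bullet> z) / norm x)) (at x)"
      using has_derivative_norm[OF x] by (simp add: sgn_div_norm divide_inverse_commute inner_commute)
    have gd: "((\<lambda>x::real^2. g ((norm x)\<^sup>2)) has_derivative (\<lambda>z. g' ((norm x)\<^sup>2) * (2 * (x \<bullet> z)))) (at x)"
      using diff_chain_at[OF sq g(1)[unfolded has_field_derivative_def]] by (simp add: o_def)
    have "(m has_derivative (\<lambda>z. - g ((norm x)\<^sup>2) * (inverse (norm x) * ((x \<bullet> z) / norm x) * inverse (norm x)) + g' ((norm x)\<^sup>2) * (2 * (x \<bullet> z)) / norm x)) (at x)"
      unfolding m_def using n0 by (intro has_derivative_divide gd nd) auto
    moreover have "(\<lambda>z::real^2. - g ((norm x)\<^sup>2) * (inverse (norm x) * ((x \<bullet> z) / norm x) * inverse (norm x)) + g' ((norm x)\<^sup>2) * (2 * (x \<bullet> z)) / norm x) =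
       (\<lambda>z. z $ 1 *\<^sub>R \<mu> 1 x + z $ 2 *\<^sub>R \<mu> 2 x)"
      using n0 by (auto simp: fun_eq_iff \<mu>_def inner_real2 power3_eq_cube field_simps)
    ultimately show ?thesis by (simp add: partials_def)
  qed
  \<comment> \<open>The partial derivatives of the angle.\<close>
  define \<theta>' where "\<theta>' = (\<lambda>j x::real^2. (if j = (1::2) then - (x $ 2) else x $ 1) / (norm x)\<^sup>2)"
  define T where "T = (\<lambda>x::real^2. pt (- (x $ 2)) (x $ 1))"
  \<comment> \<open>The partial derivatives of \<open>\<phi>\<close> by the product rule, with value
    0 at the origin, where neither the angle nor the norm is differentiable.\<close>
  define e :: "2 => real^2 => real^2^2" where
    "e = (\<lambda>k x. \<chi> i j. if norm x = 0 then 0 else \<mu> k x * \<psi> (angle x) $ i * T x $ j + m x * (\<theta>' k x * D (angle x) $ i) * T x $ j + m x * \<psi> (angle x) $ i * T (axis k 1) $ j)"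
  have Tl: "bounded_linear T"
    unfolding T_def pt_conv_axis
    by (intro bounded_linear_add bounded_linear_scaleR_left[THEN bounded_linear_compose] bounded_linear_minus bounded_linear_vec_nth)
  \<comment> \<open>The cutoff \<open>g\<close> vanishes for small arguments, so the field is 0 in a
    disk around the origin and its singularity there is harmless.\<close>
  have near0: "g ((norm x)\<^sup>2) = 0 \<and> g' ((norm x)\<^sup>2) = 0" if "x \<in> ball 0 (sqrt a)" for x :: "real^2"
  proof -
    have lt: "(norm x)\<^sup>2 < a" using that supp(1) real_less_rsqrt[of "norm x" a] by (simp add: real_sqrt_less_iff) (metis abs_norm_cancel real_sqrt_abs real_sqrt_less_iff)
    have "((\<lambda>s. 0) has_real_derivative g' ((norm x)\<^sup>2)) (at ((norm x)\<^sup>2))"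
      by (rule has_field_derivative_transform_within_open[OF g(1), of "{..<a}"]) (use lt supp(4) in auto)
    then have "g' ((norm x)\<^sup>2) = 0" using DERIV_unique[OF _ DERIV_const] by blast
    then show ?thesis using supp(4) lt by simp
  qed
  have m0: "m x = 0 \<and> (\<forall>j. \<mu> j x = 0)" if "x \<in> ball 0 (sqrt a)" for x
    using near0[OF that] by (simp add: m_def \<mu>_def)
  have sa: "sqrt a > 0" using supp(1) by simp
  have part: "partials \<phi> x (e 1 x) (e 2 x)" for x
  proof (cases "x = 0")
    case True
    have "((\<lambda>x. 0) has_derivative (\<lambda>z::real^2. 0 :: real^2^2)) (at x)" by simp
    then have "(\<phi> has_derivative (\<lambda>z. 0)) (at x)"
    proof (rule has_derivative_transform_within_open[OF _ open_ball])
      show "x \<in> ball 0 (sqrt a)" using True sa by simp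
      show "0 = \<phi> y" if "y \<in> ball 0 (sqrt a)" for y
        using m0[OF that] by (simp add: \<phi>_def vec_eq_iff)
    qed
    moreover have "e k x = 0" for k using True by (simp add: e_def vec_eq_iff)
    ultimately show ?thesis by (simp add: partials_def)
  next
    case False
    note 1 = md[OF False, unfolded partials_def]
    note 2 = periodic_angle_partials[OF \<psi>(1,3,4) False, THEN partials_nth, unfolded partials_def]
    have 3: "((\<lambda>x. T x $ j) has_derivative (\<lambda>z. T z $ j)) (at x)" for j
      by (rule bounded_linear_imp_has_derivative[OF bounded_linear_compose[OF bounded_linear_vec_nth Tl]])
    have comp: "((\<lambda>x. m x * \<psi> (angle x) $ i * T x $ j) has_derivative (\<lambda>z. z $ 1 * (e 1 x $ i $ j) + z $ 2 * (e 2 x $ i $ j))) (at x)" for i j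
    proof -
      have D: "((\<lambda>x. m x * \<psi> (angle x) $ i * T x $ j) has_derivative
         (\<lambda>z. m x * \<psi> (angle x) $ i * T z $ j + (m x * (z $ 1 *\<^sub>R (((- (x $ 2) / (norm x)\<^sup>2) *\<^sub>R D (angle x)) $ i) + z $ 2 *\<^sub>R (((x $ 1 / (norm x)\<^sup>2) *\<^sub>R D (angle x)) $ i))
           + (z $ 1 *\<^sub>R \<mu> 1 x + z $ 2 *\<^sub>R \<mu> 2 x) * \<psi> (angle x) $ i) * T x $ j)) (at x)"
        by (rule has_derivative_mult[OF has_derivative_mult[OF 1 2] 3])
      show ?thesis
        by (rule has_derivative_eq_rhs[OF D])
           (use False exhaust_2[of j] in \<open>auto simp: fun_eq_iff e_def \<theta>'_def T_def axis_def algebra_simps\<close>)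
    qed
    have "(\<phi> has_derivative (\<lambda>z. \<chi> i j. z $ 1 * (e 1 x $ i $ j) + z $ 2 * (e 2 x $ i $ j))) (at x)"
      by (subst has_derivative_componentwise_within) (use comp[unfolded T_def] in \<open>auto simp: Basis_vec_def inner_axis \<phi>_def\<close>)
    moreover have "(\<lambda>z::real^2. \<chi> i j. z $ 1 * (e 1 x $ i $ j) + z $ 2 * (e 2 x $ i $ j)) = (\<lambda>z. z $ 1 *\<^sub>R e 1 x + z $ 2 *\<^sub>R e 2 x)"
      by (simp add: fun_eq_iff vec_eq_iff)
    ultimately show ?thesis by (simp add: partials_def)
  qed
  have \<psi>c: "continuous_on UNIV \<psi>"
    using \<psi>(1) by (auto intro!: continuous_at_imp_continuous_on has_vector_derivative_continuous)
  have gc: "continuous_on UNIV g"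
    using g(1) DERIV_isCont by (auto simp: continuous_on_eq_continuous_at)
  have ec: "continuous_on UNIV (e k)" for k
  proof (rule continuous_zero_extension[of "- {0}" "ball 0 (sqrt a)"])
    show "open (- {0::real^2})" by (rule open_Compl) simp
    show "- {0::real^2} \<union> ball 0 (sqrt a) = UNIV" using sa by auto
    have h: "continuous_on (- {0}) (\<lambda>x. \<mu> k x * \<psi> (angle x) $ i * T x $ j + m x * (\<theta>' k x * D (angle x) $ i) * T x $ j + m x * \<psi> (angle x) $ i * T (axis k 1) $ j)" for i j
    proof -
      have c\<theta>: "continuous_on (- {0}) (\<theta>' k)"
        unfolding \<theta>'_def by (cases "k = 1") (auto intro!: continuous_intros)
      have cm: "continuous_on (- {0}) m"
        unfolding m_def by (intro continuous_intros continuous_on_compose2[OF gc]) auto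
      have c\<mu>: "continuous_on (- {0}) (\<mu> k)"
        unfolding \<mu>_def by (intro continuous_intros continuous_on_compose2[OF gc] continuous_on_compose2[OF g(2)]) auto
      have cT: "continuous_on (- {0}) T" by (rule linear_continuous_on[OF Tl])
      show ?thesis
        by (intro continuous_intros c\<theta> cm c\<mu> cT periodic_angle_continuous \<psi> \<psi>c) auto
    qed
    have "continuous_on (- {0}) (\<lambda>x. \<chi> i j. \<mu> k x * \<psi> (angle x) $ i * T x $ j + m x * (\<theta>' k x * D (angle x) $ i) * T x $ j + m x * \<psi> (angle x) $ i * T (axis k 1) $ j)"
      by (intro continuous_on_vec_lambda h)
    then show "continuous_on (- {0}) (e k)"
      by (rule continuous_on_cong[THEN iffD1, rotated -1]) (auto simp: e_def)
    show "e k x = 0" if "x \<in> ball 0 (sqrt a)" for x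
      using m0[OF that] by (simp add: e_def vec_eq_iff)
  qed simp
  have nT: "norm (T x) = norm x" for x by (simp add: T_def norm_real2 add.commute)
  have n\<phi>: "norm (\<phi> x) = \<bar>m x\<bar> * norm (\<psi> (angle x)) * norm x" for x
  proof -
    have "(norm (\<phi> x))\<^sup>2 = (m x)\<^sup>2 * (norm (\<psi> (angle x)))\<^sup>2 * (norm (T x))\<^sup>2"
      unfolding norm_mat2_sq norm_real2_sq by (simp add: \<phi>_def T_def power_mult_distrib algebra_simps)
    also have "\<dots> = (\<bar>m x\<bar> * norm (\<psi> (angle x)) * norm x)\<^sup>2" by (simp add: power_mult_distrib nT)
    finally show ?thesis by (rule power2_eq_imp_eq) auto
  qed
  have n1: "norm (\<phi> x) \<le> 1" for x
  proof (cases "x = 0")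
    case False
    have "norm (\<phi> x) = g ((norm x)\<^sup>2) * norm (\<psi> (angle x))"
      unfolding n\<phi> using False g(3)[of "(norm x)\<^sup>2"] by (simp add: m_def)
    also have "\<dots> \<le> 1 * 1" using g(3) \<psi>(5) by (intro mult_mono) auto
    finally show ?thesis by simp
  qed (simp add: n\<phi>)
  have sub: "closure {x. \<phi> x \<noteq> 0} \<subseteq> cball 0 b"
  proof (rule closure_minimal)
    show "{x. \<phi> x \<noteq> 0} \<subseteq> cball 0 b"
    proof (rule subsetI, rule ccontr)
      fix x assume x: "x \<in> {x. \<phi> x \<noteq> 0}" "x \<notin> cball 0 b"
      then have "(norm x)\<^sup>2 \<ge> b\<^sup>2" using supp(2) by (intro power_mono) auto
      then have "m x = 0" using supp(5) by (simp add: m_def)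
      then show False using x(1) by (simp add: \<phi>_def vec_eq_iff)
    qed
  qed simp
  show ?thesis
  proof (rule that)
    have "compact (closure {x. \<phi> x \<noteq> 0})"
      using bounded_subset[OF bounded_cball sub] by (auto simp: compact_eq_bounded_closed)
    moreover have "closure {x. \<phi> x \<noteq> 0} \<subseteq> ball 0 r" using sub supp(3) by force
    moreover have "C1_on UNIV \<phi>" by (rule C1_onI_partials[OF part ec ec])
    ultimately show "\<phi> \<in> BV_test (ball 0 r)" using n1 by (simp add: BV_test_def)
    fix x :: "real^2"
    have "frechet_derivative \<phi> (at x) = (\<lambda>z. z $ 1 *\<^sub>R e 1 x + z $ 2 *\<^sub>R e 2 x)"
      using part[of x] unfolding partials_def by (rule frechet_derivative_at[symmetric])
    then have rd: "row_div \<phi> x $ i = e 1 x $ i $ 1 + e 2 x $ i $ 2" for i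
      by (simp add: row_div_def sum_2 axis_def)
    show "row_div \<phi> x = (g ((norm x)\<^sup>2) / norm x) *\<^sub>R D (angle x)"
    proof (cases "x = 0")
      case True
      then show ?thesis by (simp add: vec_eq_iff rd e_def)
    next
      case False
      then have n0: "norm x > 0" by simp
      have nn: "(x $ 1)\<^sup>2 + (x $ 2)\<^sup>2 = (norm x)\<^sup>2" by (simp add: norm_real2_sq)
      have "row_div \<phi> x $ i = m x * D (angle x) $ i" for i
      proof -
        have 1: "\<mu> 1 x * T x $ 1 + \<mu> 2 x * T x $ 2 = 0"
          by (simp add: \<mu>_def T_def algebra_simps)
        have 2: "\<theta>' 1 x * T x $ 1 + \<theta>' 2 x * T x $ 2 = 1"
        proof -
          have "\<theta>' 1 x * T x $ 1 + \<theta>' 2 x * T x $ 2 = ((x $ 1)\<^sup>2 + (x $ 2)\<^sup>2) / (norm x)\<^sup>2"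
            by (simp add: \<theta>'_def T_def add_divide_distrib power2_eq_square)
          then show ?thesis using n0 by (simp add: nn)
        qed
        have "row_div \<phi> x $ i = \<psi> (angle x) $ i * (\<mu> 1 x * T x $ 1 + \<mu> 2 x * T x $ 2) + m x * D (angle x) $ i * (\<theta>' 1 x * T x $ 1 + \<theta>' 2 x * T x $ 2)"
          unfolding rd e_def using n0 by (simp add: T_def axis_def algebra_simps)
        then show ?thesis unfolding 1 2 by simp
      qed
      then show ?thesis by (simp add: vec_eq_iff m_def)
    qed
  qed
qed

text \<open>In polar coordinates the pairing of \<open>f (angle x)\<close> with the tangential field
  separates into the radial integral of the cutoff and the pairing of \<open>f\<close> with
  \<open>D\<close>. The cutoff is 1 for radii between \<open>\<epsilon>\<close> and
  \<open>r - \<epsilon>\<close>, so the radial factor is at least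
  \<open>r - 2 * \<epsilon>\<close>.\<close>

lemma angular_variation_le:
  fixes f :: "real => real^2"
  assumes f: "loop f" and r: "r > 0"
  shows "ennreal r * cvf f \<le> total_variation (ball 0 r) (\<lambda>x. f (angle x))"
proof -
  let ?TV = "total_variation (ball 0 r) (\<lambda>x. f (angle x))"
  have main: "ennreal r * ennreal (LINT t|lebesgue_on {0..2 * pi}. f t \<bullet> vector_derivative \<psi> (at t)) \<le> ?TV" if \<psi>t: "\<psi> \<in> circle_test" for \<psi>
  proof -
    obtain D where \<psi>: "\<And>t. (\<psi> has_vector_derivative D t) (at t)" "continuous_on UNIV D"
      "\<And>t. vector_derivative \<psi> (at t) = D t" "loop D" "loop \<psi>" "continuous_on UNIV \<psi>" 
      "\<And>t. \<psi> (t + 2 * pi) = \<psi> t" "\<And>t. norm (\<psi> t) \<le> 1"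
      using circle_testD[OF \<psi>t] by blast
    define c where "c = loop_pair f D"
    have ceq: "(LINT t|lebesgue_on {0..2 * pi}. f t \<bullet> vector_derivative \<psi> (at t)) = c"
      unfolding \<psi>(3) c_def by (rule loop_integral_lint[OF f \<psi>(4)])
    have "ennreal ((r - 2 * \<epsilon>) * c) \<le> ?TV" if \<epsilon>: "0 < \<epsilon>" "2 * \<epsilon> < r" and c: "c \<ge> 0" for \<epsilon>
    proof -
      define a where "a = \<epsilon>"
      define b where "b = r - \<epsilon>"
      define b' where "b' = r - \<epsilon> / 2"
      have ab: "0 < a" "a < b" "b < b'" "b' < r" using \<epsilon> by (auto simp: a_def b_def b'_def)
      have bb: "b\<^sup>2 < b'\<^sup>2" using ab by (intro power_strict_mono) auto
      \<comment> \<open>As a function of the squared radius: 0 up to \<open>a\<^sup>2 / 2\<close>, 1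
        from \<open>a\<^sup>2\<close> to \<open>b\<^sup>2\<close>, and 0 again from
        \<open>b'\<^sup>2\<close> on.\<close>
      define g where "g = (\<lambda>s. (1 - cutoff (2 / a\<^sup>2 * s - 1)) * cutoff ((s - b\<^sup>2) / (b'\<^sup>2 - b\<^sup>2)))"
      define g' where "g' = (\<lambda>s. (1 - cutoff (2 / a\<^sup>2 * s - 1)) * (cutoff' ((s - b\<^sup>2) / (b'\<^sup>2 - b\<^sup>2)) * (1 / (b'\<^sup>2 - b\<^sup>2)))
         + (- (cutoff' (2 / a\<^sup>2 * s - 1) * (2 / a\<^sup>2))) * cutoff ((s - b\<^sup>2) / (b'\<^sup>2 - b\<^sup>2)))"
      have gd: "(g has_real_derivative g' s) (at s)" for s
      proof -
        have 1: "((\<lambda>s. cutoff (2 / a\<^sup>2 * s - 1)) has_real_derivative cutoff' (2 / a\<^sup>2 * s - 1) * (2 / a\<^sup>2)) (at s)"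
          using ab by (intro DERIV_chain2[OF cutoff_derivative]) (auto intro!: derivative_eq_intros simp: power2_eq_square power4_eq_xxxx)
        have 2: "((\<lambda>s. cutoff ((s - b\<^sup>2) / (b'\<^sup>2 - b\<^sup>2))) has_real_derivative cutoff' ((s - b\<^sup>2) / (b'\<^sup>2 - b\<^sup>2)) * (1 / (b'\<^sup>2 - b\<^sup>2))) (at s)"
          using bb by (intro DERIV_chain2[OF cutoff_derivative]) (auto intro!: derivative_eq_intros)
        have 3: "((\<lambda>s. 1 - cutoff (2 / a\<^sup>2 * s - 1)) has_real_derivative - (cutoff' (2 / a\<^sup>2 * s - 1) * (2 / a\<^sup>2))) (at s)"
          using DERIV_diff[OF DERIV_const 1, of 1] by simp
        show ?thesis unfolding g_def g'_def using DERIV_mult'[OF 3 2] by simp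
      qed
      have g'c: "continuous_on UNIV g'"
        unfolding g'_def using ab bb
        by (intro continuous_intros continuous_on_compose2[OF cutoff_continuous(1)] continuous_on_compose2[OF cutoff_continuous(2)]) auto
      have gb: "0 \<le> g s \<and> g s \<le> 1" for s
        using cutoff_bounds[of "2 / a\<^sup>2 * s - 1"] cutoff_bounds[of "(s - b\<^sup>2) / (b'\<^sup>2 - b\<^sup>2)"]
        unfolding g_def by (auto intro!: mult_nonneg_nonneg mult_le_one)
      have g0: "g s = 0" if "s \<le> a\<^sup>2 / 2" for s
      proof -
        have "2 / a\<^sup>2 * s - 1 \<le> 0" using that ab by (simp add: divide_le_eq)
        then show ?thesis by (simp add: g_def cutoff_le)
      qed
      have g1: "g s = 0" if "s \<ge> b'\<^sup>2" for s
      proof -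
        have "(s - b\<^sup>2) / (b'\<^sup>2 - b\<^sup>2) \<ge> 1" using that bb by (simp add: le_divide_eq)
        then show ?thesis by (simp add: g_def cutoff_ge)
      qed
      have g2: "g (\<rho>\<^sup>2) = 1" if "a \<le> \<rho>" "\<rho> \<le> b" for \<rho>
      proof -
        have "a\<^sup>2 \<le> \<rho>\<^sup>2" "\<rho>\<^sup>2 \<le> b\<^sup>2" using that ab by (auto intro!: power_mono)
        then have "2 / a\<^sup>2 * \<rho>\<^sup>2 - 1 \<ge> 1" "(\<rho>\<^sup>2 - b\<^sup>2) / (b'\<^sup>2 - b\<^sup>2) \<le> 0"
          using ab bb by (auto simp: le_divide_eq divide_le_0_iff)
        then show ?thesis by (simp add: g_def cutoff_le cutoff_ge)
      qed
      have a2: "a\<^sup>2 / 2 > 0" and b'0: "b' > 0" using ab by auto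
      obtain \<phi> where \<phi>: "\<phi> \<in> BV_test (ball 0 r)" "\<And>x. row_div \<phi> x = (g ((norm x)\<^sup>2) / norm x) *\<^sub>R D (angle x)"
        using angular_test_field[OF \<psi>(1,2,7) loopD(2)[OF \<psi>(4)] \<psi>(8) gd g'c gb a2 b'0 ab(4) g0 g1] by blast
      have "continuous_on UNIV g" using gd DERIV_isCont by (auto simp: continuous_on_eq_continuous_at)
      then have [measurable]: "g \<in> borel_fun" by (rule borel_measurable_continuous_onI)
      define h where "h = (\<lambda>\<rho>. g (\<rho>\<^sup>2) / \<bar>\<rho>\<bar>)"
      have [measurable]: "h \<in> borel_fun" unfolding h_def by measurable
      have h0: "h \<rho> \<ge> 0" for \<rho> using gb by (simp add: h_def)
      \<comment> \<open>Near 0 the factor \<open>1 / \<bar>\<rho>\<bar>\<close> is harmless since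
        \<open>g\<close> vanishes there; elsewhere
        \<open>\<bar>\<rho>\<bar> \<ge> a / 2\<close>.\<close>
      have hle: "\<bar>h \<rho>\<bar> \<le> 2 / a" for \<rho>
      proof (cases "\<bar>\<rho>\<bar> \<ge> a / 2")
        case True
        have "g (\<rho>\<^sup>2) / \<bar>\<rho>\<bar> \<le> 1 / (a / 2)" using gb True ab by (intro frac_le) auto
        then have "h \<rho> \<le> 2 / a" by (simp add: h_def)
        then show ?thesis using h0[of \<rho>] by simp
      next
        case False
        then have "\<rho>\<^sup>2 \<le> (a / 2)\<^sup>2" using ab by (intro abs_le_square_iff[THEN iffD1]) auto
        then have "\<rho>\<^sup>2 * 4 \<le> a\<^sup>2" by (simp add: power_divide)
        moreover have "0 \<le> \<rho>\<^sup>2" by simp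
        ultimately have "\<rho>\<^sup>2 \<le> a\<^sup>2 / 2" by linarith
        then show ?thesis using g0 ab by (simp add: h_def)
      qed
      define A where "A = enn2real (\<integral>\<^sup>+\<rho>\<in>{0<..<r}. ennreal (\<rho> * h \<rho>) \<partial>lborel)"
      have fin: "(\<integral>\<^sup>+\<rho>\<in>{0<..<r}. ennreal (\<rho> * h \<rho>) \<partial>lborel) \<le> ennreal r"
      proof -
        have "(\<integral>\<^sup>+\<rho>\<in>{0<..<r}. ennreal (\<rho> * h \<rho>) \<partial>lborel) \<le> (\<integral>\<^sup>+\<rho>. indicator {0<..<r} \<rho> \<partial>lborel)"
          using gb by (intro nn_integral_mono) (auto simp: indicator_def h_def ennreal_le_1)
        then show ?thesis using r by simp
      qed
      have Aeq: "(\<integral>\<^sup>+\<rho>\<in>{0<..<r}. ennreal (\<rho> * h \<rho>) \<partial>lborel) = ennreal A"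
        unfolding A_def using fin by (intro ennreal_enn2real[symmetric]) (auto intro: le_less_trans)
      have "ennreal (b - a) = (\<integral>\<^sup>+\<rho>. indicator {a..b} \<rho> \<partial>lborel)" using ab by simp
      also have "\<dots> \<le> (\<integral>\<^sup>+\<rho>\<in>{0<..<r}. ennreal (\<rho> * h \<rho>) \<partial>lborel)"
        using ab g2 by (intro nn_integral_mono) (auto simp: indicator_def h_def)
      also have "\<dots> = ennreal A" by (rule Aeq)
      finally have Age: "b - a \<le> A" using ab by (simp add: ennreal_le_iff2 A_def)
      have lk: "loop (\<lambda>t. f t \<bullet> D t)" by (rule loop_inner[OF f \<psi>(4)])
      have eq: "f (angle x) \<bullet> row_div \<phi> x = h (norm x) * (f (angle x) \<bullet> D (angle x))" for x
        unfolding \<phi>(2) by (simp add: h_def)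
      obtain B where B: "\<And>t. norm (f t \<bullet> D t) \<le> B" using loop_bound[OF lk] by blast
      have int: "set_integrable lborel (ball 0 r) (\<lambda>x::real^2. h (norm x) * (f (angle x) \<bullet> D (angle x)))"
      proof (rule bounded_borel_integrable_on(1))
        have [measurable]: "(\<lambda>t. f t \<bullet> D t) \<in> borel_fun" using loopD(1)[OF lk] .
        show "(\<lambda>x::real^2. h (norm x) * (f (angle x) \<bullet> D (angle x))) \<in> borel_fun" by measurable
        show "norm (h (norm x) * (f (angle x) \<bullet> D (angle x))) \<le> 2 / a * B" for x :: "real^2"
          unfolding norm_mult using hle B[of "angle x"] ab by (intro mult_mono) auto
      qed auto
      have "(LINT x|lebesgue_on (ball 0 r). f (angle x) \<bullet> row_div \<phi> x) = (LINT x:ball (0::real^2) r|lborel. h (norm x) * (f (angle x) \<bullet> D (angle x)))"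
        unfolding eq by (rule lint_lebesgue_on_lborel[OF int]) simp
      also have "\<dots> = A * c"
        unfolding c_def using Age ab by (intro lborel_integral_polar_product lk h0 Aeq int) auto
      finally have L: "(LINT x|lebesgue_on (ball 0 r). f (angle x) \<bullet> row_div \<phi> x) = A * c" .
      have "(r - 2 * \<epsilon>) * c \<le> A * c" using Age c by (intro mult_right_mono) (auto simp: a_def b_def)
      then have "ennreal ((r - 2 * \<epsilon>) * c) \<le> ennreal (LINT x|lebesgue_on (ball 0 r). f (angle x) \<bullet> row_div \<phi> x)"
        unfolding L by (rule ennreal_leI)
      also have "\<dots> \<le> ?TV" unfolding total_variation_def using \<phi>(1) by (rule SUP_upper)
      finally show ?thesis .
    qed
    note step = this
    show ?thesis
    proof (cases "c \<ge> 0")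
      case True
      \<comment> \<open>Here \<open>\<epsilon>\<close> is \<open>r / 2\<close> divided by
        \<open>n + 2\<close>, which keeps \<open>2 * \<epsilon> < r\<close> also for
        \<open>n = 0\<close>.\<close>
      have "(\<lambda>n. ennreal ((r - 2 * (r / 2 * inverse (real (Suc (Suc n))))) * c)) \<longlonglongrightarrow> ennreal ((r - 2 * (r / 2 * 0)) * c)"
        by (intro tendsto_ennrealI tendsto_intros LIMSEQ_Suc[OF LIMSEQ_inverse_real_of_nat])
      then have "ennreal ((r - 2 * (r / 2 * 0)) * c) \<le> ?TV"
      proof (rule LIMSEQ_le_const2)
        have "ennreal ((r - 2 * (r / 2 * inverse (real (Suc (Suc n))))) * c) \<le> ?TV" for n
        proof (rule step)
          have "inverse (real (Suc (Suc n))) < 1" by (rule inverse_less_1_iff[THEN iffD2]) auto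
          then have "r * inverse (real (Suc (Suc n))) < r * 1" using r by (rule mult_strict_left_mono)
          then show "2 * (r / 2 * inverse (real (Suc (Suc n)))) < r" by simp
        qed (use r True in auto)
        then show "\<exists>N. \<forall>n\<ge>N. ennreal ((r - 2 * (r / 2 * inverse (real (Suc (Suc n))))) * c) \<le> ?TV" by blast
      qed
      then show ?thesis unfolding ceq using r True by (simp add: ennreal_mult)
    next
      case False
      then show ?thesis unfolding ceq by (simp add: ennreal_neg)
    qed
  qed
  show ?thesis
    unfolding cvf_def SUP_mult_left_ennreal by (rule SUP_least) (rule main)
qed

section \<open>Recovery sequences\<close>

lemma norm_circ_diff_le: "norm (circ s - circ t) \<le> \<bar>s - t\<bar>"
  using abs_sin_x_le_abs_x[of "(s - t) / 2"] by (simp add: norm_circ_diff)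

lemma lipschitz_sphere_loop:
  assumes lip: "C-lipschitz_on (sphere 0 1) (\<phi> :: real^2 => real^2)"
  shows "C-lipschitz_on UNIV (\<lambda>t. \<phi> (circ t))" "loop (\<lambda>t. \<phi> (circ t))" "continuous_on UNIV (\<lambda>t. \<phi> (circ t))"
proof -
  have C: "C \<ge> 0" using lip by (rule lipschitz_on_nonneg)
  show 1: "C-lipschitz_on UNIV (\<lambda>t. \<phi> (circ t))"
  proof (rule lipschitz_onI)
    fix s t :: real
    have "dist (\<phi> (circ s)) (\<phi> (circ t)) \<le> C * dist (circ s) (circ t)"
      by (rule lipschitz_onD[OF lip]) auto
    also have "\<dots> \<le> C * dist s t"
      using C norm_circ_diff_le[of s t] by (intro mult_left_mono) (auto simp: dist_norm dist_real_def)
    finally show "dist (\<phi> (circ s)) (\<phi> (circ t)) \<le> C * dist s t" .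
  qed (rule C)
  show 2: "continuous_on UNIV (\<lambda>t. \<phi> (circ t))" by (rule lipschitz_on_continuous_on[OF 1])
  show "loop (\<lambda>t. \<phi> (circ t))" by (rule continuous_periodic_loop[OF 2]) simp
qed

section \<open>The homogeneous extension of a competitor\<close>

definition glue :: "(real^2 => real^2) => (real^2 => real^2) => real^2 => real^2" where
  "glue v \<phi> x = (if norm x < 1 then v x else \<phi> (x /\<^sub>R norm x))"

lemma normalize_lipschitz:
  fixes x y :: "'a::real_normed_vector"
  assumes "norm x \<ge> 1" "norm y \<ge> 1"
  shows "norm (x /\<^sub>R norm x - y /\<^sub>R norm y) \<le> 2 * norm (x - y)"
proof -
  have nx: "norm x > 0" "norm y > 0" using assms by linarith+
  have "x /\<^sub>R norm x - y /\<^sub>R norm y = (x - y) /\<^sub>R norm x + (inverse (norm x) - inverse (norm y)) *\<^sub>R y"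
    by (simp add: algebra_simps)
  also have "norm \<dots> \<le> norm (x - y) / norm x + \<bar>inverse (norm x) - inverse (norm y)\<bar> * norm y"
    by (rule order_trans[OF norm_triangle_ineq]) (simp add: divide_inverse_commute)
  also have "\<bar>inverse (norm x) - inverse (norm y)\<bar> * norm y = \<bar>norm y - norm x\<bar> / norm x"
  proof -
    have "inverse (norm x) - inverse (norm y) = (norm y - norm x) / (norm x * norm y)"
      using nx by (simp add: field_simps)
    then show ?thesis using nx by (simp add: abs_divide)
  qed
  also have "norm (x - y) / norm x + \<bar>norm y - norm x\<bar> / norm x \<le> norm (x - y) / 1 + norm (x - y) / 1"
    using assms norm_triangle_ineq3[of y x]
    by (intro add_mono frac_le) (auto simp: norm_minus_commute)
  finally show ?thesis by simp
qed

text \<open>Outside the disk the factor 2 comes from the radial projection to the circle. A segment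
  from inside to outside is split where it crosses the circle; there the boundary limit of
  \<open>v\<close> is the value of \<open>\<phi>\<close>.\<close>

lemma glue_lipschitz:
  assumes v: "C-lipschitz_on (ball 0 1) v" and \<phi>: "C-lipschitz_on (sphere 0 1) \<phi>"
    and bd: "\<And>x. x \<in> sphere 0 1 ==> (v \<longlongrightarrow> \<phi> x) (at x within ball 0 1)"
  shows "(2 * C)-lipschitz_on UNIV (glue v \<phi>)"
proof -
  let ?W = "glue v \<phi>"
  have C: "C \<ge> 0" using v by (rule lipschitz_on_nonneg)
  have in_in: "norm (?W x - ?W y) \<le> C * norm (x - y)" if "norm x < 1" "norm y < 1" for x y
    using lipschitz_onD[OF v, of x y] that by (simp add: glue_def dist_norm)
  have out_out: "norm (?W x - ?W y) \<le> 2 * C * norm (x - y)" if "norm x \<ge> 1" "norm y \<ge> 1" for x y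
  proof -
    have n: "norm x > 0" "norm y > 0" using that by linarith+
    have "norm (?W x - ?W y) \<le> C * norm (x /\<^sub>R norm x - y /\<^sub>R norm y)"
      using lipschitz_onD[OF \<phi>, of "x /\<^sub>R norm x" "y /\<^sub>R norm y"] that n by (simp add: glue_def dist_norm)
    also have "\<dots> \<le> C * (2 * norm (x - y))" using C normalize_lipschitz[OF that] by (intro mult_left_mono)
    finally show ?thesis by simp
  qed
  have in_sph: "norm (?W x - ?W z) \<le> C * norm (x - z)" if "norm x < 1" "norm z = 1" for x z
  proof -
    have zl: "z islimpt ball 0 1" using that islimpt_ball[of z "0::real^2" 1] by (auto simp: dist_norm)
    have "norm (v x - \<phi> z) \<le> C * norm (x - z)"
    proof (rule tendsto_le)
      show "at z within ball 0 1 \<noteq> bot" using zl by (simp add: trivial_limit_within)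
      show "((\<lambda>y. C * norm (x - y)) \<longlongrightarrow> C * norm (x - z)) (at z within ball 0 1)"
        by (intro tendsto_intros)
      show "((\<lambda>y. norm (v x - v y)) \<longlongrightarrow> norm (v x - \<phi> z)) (at z within ball 0 1)"
        by (intro tendsto_intros bd) (use that in auto)
      show "\<forall>\<^sub>F y in at z within ball 0 1. norm (v x - v y) \<le> C * norm (x - y)"
        using lipschitz_onD[OF v, of x] that by (auto simp: eventually_at_filter dist_norm)
    qed
    then show ?thesis using that by (simp add: glue_def)
  qed
  have in_out: "norm (?W x - ?W y) \<le> 2 * C * norm (x - y)" if xy: "norm x < 1" "norm y \<ge> 1" for x y
  proof -
    have "\<exists>t\<ge>0. t \<le> 1 \<and> norm (x + t *\<^sub>R (y - x)) = 1"
      using xy by (intro IVT') (auto intro!: continuous_intros)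
    then obtain t where t: "0 \<le> t" "t \<le> 1" "norm (x + t *\<^sub>R (y - x)) = 1" by blast
    define z where "z = x + t *\<^sub>R (y - x)"
    have xz: "norm (x - z) = t * norm (x - y)"
      using t by (simp add: z_def norm_minus_commute)
    have "z - y = (1 - t) *\<^sub>R (x - y)" by (simp add: z_def algebra_simps)
    then have zy: "norm (z - y) = (1 - t) * norm (x - y)" using t by simp
    have "norm (?W x - ?W y) \<le> norm (?W x - ?W z) + norm (?W z - ?W y)"
      using norm_triangle_ineq[of "?W x - ?W z" "?W z - ?W y"] by simp
    also have "\<dots> \<le> C * norm (x - z) + 2 * C * norm (z - y)"
      using t(3) xy by (intro add_mono in_sph out_out) (auto simp: z_def)
    also have "\<dots> = C * norm (x - y) * (t + 2 * (1 - t))" by (simp add: xz zy algebra_simps)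
    also have "\<dots> \<le> C * norm (x - y) * 2" using t C by (intro mult_left_mono) auto
    finally show ?thesis by (simp add: mult.commute mult.left_commute)
  qed
  show ?thesis
  proof (rule lipschitz_onI)
    fix x y :: "real^2"
    have "C * norm (x - y) \<le> 2 * C * norm (x - y)" using C by (intro mult_right_mono) auto
    then have "norm (?W x - ?W y) \<le> 2 * C * norm (x - y)"
      using in_in[of x y] out_out[of x y] in_out[of x y] in_out[of y x]
      by (cases "norm x < 1"; cases "norm y < 1") (auto simp: not_less norm_minus_commute)
    then show "dist (?W x) (?W y) \<le> 2 * C * dist x y" by (simp add: dist_norm)
  qed (use C in simp)
qed

text \<open>A limit along one fixed sequence of increments is Borel measurable; it is the derivative
  wherever there is one.\<close>

definition rderiv :: "(real => real^2) => real => real^2" where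
  "rderiv f t = lim (\<lambda>n. (f (t + inverse (Suc n)) - f t) /\<^sub>R inverse (Suc n))"

lemma rderiv_eq:
  assumes "(f has_vector_derivative D) (at t)"
  shows "rderiv f t = D"
proof -
  have *: "((\<lambda>y. norm (f y - f t - (y - t) *\<^sub>R D) / norm (y - t)) \<longlongrightarrow> 0) (at t)"
    using assms by (simp add: has_vector_derivative_def has_derivative_iff_norm)
  have "(\<lambda>k. t + inverse (real (Suc k))) \<longlonglongrightarrow> t + 0" by (intro tendsto_intros LIMSEQ_inverse_real_of_nat)
  then have "filterlim (\<lambda>k. t + inverse (real (Suc k))) (at t) sequentially"
    by (auto simp: filterlim_at simp del: of_nat_Suc)
  from filterlim_compose[OF * this]
  have z: "(\<lambda>k. norm (f (t + inverse (real (Suc k))) - f t - inverse (real (Suc k)) *\<^sub>R D) / inverse (real (Suc k))) \<longlonglongrightarrow> 0"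
    by (simp del: of_nat_Suc)
  have "(\<lambda>n. (f (t + inverse (real (Suc n))) - f t) /\<^sub>R inverse (real (Suc n)) - D) \<longlonglongrightarrow> 0"
  proof (rule Lim_null_comparison[OF _ z], rule always_eventually, rule allI)
    fix n
    have h: "inverse (real (Suc n)) > 0" by simp
    define h where "h = inverse (real (Suc n))"
    have h0: "h > 0" by (simp add: h_def)
    have "(f (t + h) - f t) /\<^sub>R h - D = (f (t + h) - f t - h *\<^sub>R D) /\<^sub>R h"
      using h0 by (simp add: scaleR_diff_right)
    then show "norm ((f (t + inverse (real (Suc n))) - f t) /\<^sub>R inverse (real (Suc n)) - D)
       \<le> norm (f (t + inverse (real (Suc n))) - f t - inverse (real (Suc n)) *\<^sub>R D) / inverse (real (Suc n))"
      unfolding h_def[symmetric] using h0 by (simp add: divide_inverse_commute)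
  qed
  then show ?thesis unfolding rderiv_def by (intro limI) (simp add: LIM_zero_iff)
qed

lemma rderiv_lipschitz:
  assumes lip: "C-lipschitz_on UNIV f"
  shows "rderiv f \<in> borel_fun" "AE t in lborel. (f has_vector_derivative rderiv f t) (at t)"
proof -
  have [measurable]: "f \<in> borel_fun"
    using lipschitz_on_continuous_on[OF lip] by (rule borel_measurable_continuous_onI)
  show "rderiv f \<in> borel_fun"
    unfolding rderiv_def[abs_def] by (intro borel_measurable_lim_metric) measurable
  have "\<exists>N. negligible N \<and> (\<forall>t. t \<notin> N \<longrightarrow> (\<exists>d. ((\<lambda>t. f t $ i) has_real_derivative d) (at t)))" for i
  proof -
    have "C-lipschitz_on UNIV (\<lambda>t. f t $ i)"
    proof (rule lipschitz_onI)
      fix x y :: real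
      have "dist (f x $ i) (f y $ i) \<le> dist (f x) (f y)" by (rule dist_vec_nth_le)
      also have "\<dots> \<le> C * dist x y" using lipschitz_onD[OF lip] by auto
      finally show "dist (f x $ i) (f y $ i) \<le> C * dist x y" .
    qed (rule lipschitz_on_nonneg[OF lip])
    from lipschitz_real_derivative[OF this] show ?thesis by metis
  qed
  then obtain N where N: "\<And>i. negligible (N i)" "\<And>i t. t \<notin> N i ==> \<exists>d. ((\<lambda>t. f t $ i) has_real_derivative d) (at t)"
    by metis
  show "AE t in lborel. (f has_vector_derivative rderiv f t) (at t)"
    using AE_lborel_negligible[OF N(1)[of 1]] AE_lborel_negligible[OF N(1)[of 2]]
  proof eventually_elim
    case (elim t)
    obtain a b where a: "((\<lambda>t. f t $ 1) has_real_derivative a) (at t)" and b: "((\<lambda>t. f t $ 2) has_real_derivative b) (at t)"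
      using N(2) elim by metis
    have "((\<lambda>t. (f t $ 1) *\<^sub>R pt 1 0 + (f t $ 2) *\<^sub>R pt 0 1) has_vector_derivative a *\<^sub>R pt 1 0 + b *\<^sub>R pt 0 1) (at t)"
      using a b by (auto intro!: derivative_eq_intros simp: has_real_derivative_iff_has_vector_derivative)
    moreover have "(\<lambda>t. (f t $ 1) *\<^sub>R pt 1 0 + (f t $ 2) *\<^sub>R pt 0 1) = f"
      by (simp add: fun_eq_iff vec_eq_iff forall_2)
    ultimately have "(f has_vector_derivative a *\<^sub>R pt 1 0 + b *\<^sub>R pt 0 1) (at t)" by simp
    then show ?case using rderiv_eq by metis
  qed
qed

lemma partials_circle_derivative:
  assumes "partials w (\<rho> *\<^sub>R circ t) d1 d2"
  shows "((\<lambda>t. w (\<rho> *\<^sub>R circ t)) has_vector_derivative \<rho> *\<^sub>R (cos t *\<^sub>R d2 - sin t *\<^sub>R d1)) (at t)"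
proof -
  have 1: "((\<lambda>t. \<rho> *\<^sub>R circ t) has_derivative (\<lambda>h. h *\<^sub>R (\<rho> *\<^sub>R pt (- sin t) (cos t)))) (at t)"
    unfolding circ_conv_pt pt_conv_axis by (auto intro!: derivative_eq_intros simp: algebra_simps fun_eq_iff)
  have "((\<lambda>t. w (\<rho> *\<^sub>R circ t)) has_derivative (\<lambda>h. (h *\<^sub>R (\<rho> *\<^sub>R pt (- sin t) (cos t))) $ 1 *\<^sub>R d1 + (h *\<^sub>R (\<rho> *\<^sub>R pt (- sin t) (cos t))) $ 2 *\<^sub>R d2)) (at t)"
    using diff_chain_at[OF 1 assms[unfolded partials_def]] by (simp add: o_def)
  moreover have "(\<lambda>h. (h *\<^sub>R (\<rho> *\<^sub>R pt (- sin t) (cos t))) $ 1 *\<^sub>R d1 + (h *\<^sub>R (\<rho> *\<^sub>R pt (- sin t) (cos t))) $ 2 *\<^sub>R d2) =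
     (\<lambda>h. h *\<^sub>R (\<rho> *\<^sub>R (cos t *\<^sub>R d2 - sin t *\<^sub>R d1)))"
    by (simp add: fun_eq_iff algebra_simps)
  ultimately show ?thesis by (simp add: has_vector_derivative_def)
qed

text \<open>Tangential and radial derivative arise from \<open>d1\<close> and \<open>d2\<close> by a
  rotation.\<close>

lemma tangential_norm_le:
  fixes d1 d2 :: "real^2"
  shows "(norm (cos t *\<^sub>R d2 - sin t *\<^sub>R d1))\<^sup>2 + (norm (cos t *\<^sub>R d1 + sin t *\<^sub>R d2))\<^sup>2 = (norm d1)\<^sup>2 + (norm d2)\<^sup>2"
proof -
  have gen: "(c * b - s * a)\<^sup>2 + (c * a + s * b)\<^sup>2 = (c\<^sup>2 + s\<^sup>2) * (a\<^sup>2 + b\<^sup>2)" for a b c s :: real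
    by (simp add: power2_eq_square algebra_simps)
  show ?thesis
    unfolding norm_real2_sq using gen[of "cos t" "d2 $ 1" "sin t" "d1 $ 1"] gen[of "cos t" "d2 $ 2" "sin t" "d1 $ 2"] by simp
qed

text \<open>The extension is constant along rays, so its radial derivative vanishes. Both partial
  derivatives are then multiples of the tangential one, which gives the norm and makes the Jacobian
  0.\<close>

lemma homogeneous_gradient:
  fixes \<phi> :: "real^2 => real^2"
  assumes x: "norm x > 1" and p: "partials (glue v \<phi>) x d1 d2"
  defines "f \<equiv> \<lambda>t. \<phi> (circ t)"
  shows "sqrt ((norm d1)\<^sup>2 + (norm d2)\<^sup>2) = norm (rderiv f (angle x)) / norm x" "d1 $ 1 * d2 $ 2 - d2 $ 1 * d1 $ 2 = 0"
proof -
  let ?\<theta> = "angle x" and ?\<rho> = "norm x"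
  have \<rho>: "?\<rho> > 0" using x by linarith
  have xc: "?\<rho> *\<^sub>R circ ?\<theta> = x" by (rule circ_angle)
  have "(\<lambda>t. glue v \<phi> (?\<rho> *\<^sub>R circ t)) = f"
    using x \<rho> by (auto simp: glue_def f_def fun_eq_iff)
  then have "(f has_vector_derivative ?\<rho> *\<^sub>R (cos ?\<theta> *\<^sub>R d2 - sin ?\<theta> *\<^sub>R d1)) (at ?\<theta>)"
    using partials_circle_derivative[of "glue v \<phi>" ?\<rho> ?\<theta> d1 d2] p xc by simp
  then have r: "rderiv f ?\<theta> = ?\<rho> *\<^sub>R (cos ?\<theta> *\<^sub>R d2 - sin ?\<theta> *\<^sub>R d1)" by (rule rderiv_eq)
  have "((\<lambda>s. s *\<^sub>R circ ?\<theta>) has_derivative (\<lambda>h. h *\<^sub>R circ ?\<theta>)) (at ?\<rho>)"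
    by (auto intro!: derivative_eq_intros)
  moreover have "(glue v \<phi> has_derivative (\<lambda>z. z $ 1 *\<^sub>R d1 + z $ 2 *\<^sub>R d2)) (at (?\<rho> *\<^sub>R circ ?\<theta>))"
    using p unfolding xc partials_def .
  ultimately have "((\<lambda>s. glue v \<phi> (s *\<^sub>R circ ?\<theta>)) has_derivative (\<lambda>h. (h *\<^sub>R circ ?\<theta>) $ 1 *\<^sub>R d1 + (h *\<^sub>R circ ?\<theta>) $ 2 *\<^sub>R d2)) (at ?\<rho>)"
    using diff_chain_at by (fastforce simp: o_def)
  then have "((\<lambda>s. f ?\<theta>) has_derivative (\<lambda>h. (h *\<^sub>R circ ?\<theta>) $ 1 *\<^sub>R d1 + (h *\<^sub>R circ ?\<theta>) $ 2 *\<^sub>R d2)) (at ?\<rho>)"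
    by (rule has_derivative_transform_within_open[of _ _ _ _ "{1<..}"]) (use x in \<open>auto simp: glue_def f_def\<close>)
  then have "(\<lambda>h. (h *\<^sub>R circ ?\<theta>) $ 1 *\<^sub>R d1 + (h *\<^sub>R circ ?\<theta>) $ 2 *\<^sub>R d2) = (\<lambda>h. 0)"
    using has_derivative_const has_derivative_unique by blast
  from fun_cong[OF this, of 1] have rad: "cos ?\<theta> *\<^sub>R d1 + sin ?\<theta> *\<^sub>R d2 = 0" by simp
  define \<tau> where "\<tau> = cos ?\<theta> *\<^sub>R d2 - sin ?\<theta> *\<^sub>R d1"
  have "(norm d1)\<^sup>2 + (norm d2)\<^sup>2 = (norm \<tau>)\<^sup>2"
    using tangential_norm_le[of ?\<theta> d2 d1] rad by (simp add: \<tau>_def)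
  then show "sqrt ((norm d1)\<^sup>2 + (norm d2)\<^sup>2) = norm (rderiv f ?\<theta>) / ?\<rho>"
    using \<rho> unfolding r \<tau>_def[symmetric] by simp
  have cs: "(cos ?\<theta>)\<^sup>2 + (sin ?\<theta>)\<^sup>2 = 1" by simp
  have "d1 = (cos ?\<theta>) *\<^sub>R (cos ?\<theta> *\<^sub>R d1 + sin ?\<theta> *\<^sub>R d2) - sin ?\<theta> *\<^sub>R \<tau>"
    using cs by (simp add: \<tau>_def algebra_simps power2_eq_square[symmetric] flip: scaleR_add_left)
  then have 1: "d1 = - (sin ?\<theta> *\<^sub>R \<tau>)" using rad by simp
  have "d2 = (sin ?\<theta>) *\<^sub>R (cos ?\<theta> *\<^sub>R d1 + sin ?\<theta> *\<^sub>R d2) + cos ?\<theta> *\<^sub>R \<tau>"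
    using cs by (simp add: \<tau>_def algebra_simps power2_eq_square[symmetric] flip: scaleR_add_left)
  then have 2: "d2 = cos ?\<theta> *\<^sub>R \<tau>" using rad by simp
  show "d1 $ 1 * d2 $ 2 - d2 $ 1 * d1 $ 2 = 0" by (subst (1 2) 1, subst (1 2) 2) simp
qed

lemma partials_bound:
  fixes w :: "real^2 => 'b::real_normed_vector"
  assumes lip: "K-lipschitz_on UNIV w" and p: "partials w x d1 d2"
  shows "norm d1 \<le> K" "norm d2 \<le> K"
proof -
  obtain a b where ab: "x = pt a b" by (metis pt_eta)
  have gen: "norm D \<le> K" if D: "(g has_vector_derivative D) (at t)" and g: "\<And>s t. norm (g s - g t) \<le> K * \<bar>s - t\<bar>"
    for g :: "real => 'b" and D t
  proof -
    have "norm D * 1 \<le> K"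
    proof (rule tendsto_upperbound)
      have "((\<lambda>y. (g y - g t) /\<^sub>R (y - t)) \<longlongrightarrow> D) (at t)"
      proof -
        have *: "((\<lambda>y. norm (g y - g t - (y - t) *\<^sub>R D) / norm (y - t)) \<longlongrightarrow> 0) (at t)"
          using D by (simp add: has_vector_derivative_def has_derivative_iff_norm)
        have "((\<lambda>y. (g y - g t) /\<^sub>R (y - t) - D) \<longlongrightarrow> 0) (at t)"
        proof (rule Lim_null_comparison[OF _ *])
          show "\<forall>\<^sub>F y in at t. norm ((g y - g t) /\<^sub>R (y - t) - D) \<le> norm (g y - g t - (y - t) *\<^sub>R D) / norm (y - t)"
          proof (rule eventually_at_filter[THEN iffD2], rule always_eventually, intro allI impI)
            fix y assume "y \<noteq> t"
            then have "(g y - g t) /\<^sub>R (y - t) - D = (g y - g t - (y - t) *\<^sub>R D) /\<^sub>R (y - t)"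
              by (simp add: scaleR_diff_right)
            then show "norm ((g y - g t) /\<^sub>R (y - t) - D) \<le> norm (g y - g t - (y - t) *\<^sub>R D) / norm (y - t)"
              by (simp add: divide_inverse_commute)
          qed
        qed
        then show ?thesis by (simp add: LIM_zero_iff)
      qed
      then show "((\<lambda>y. norm ((g y - g t) /\<^sub>R (y - t))) \<longlongrightarrow> norm D * 1) (at t)"
        unfolding mult_1_right by (rule tendsto_norm)
      show "\<forall>\<^sub>F y in at t. norm ((g y - g t) /\<^sub>R (y - t)) \<le> K"
        using g by (auto simp: eventually_at_filter divide_inverse_commute[symmetric] divide_le_eq)
    qed simp
    then show ?thesis by simp
  qed
  have l: "norm (w y - w z) \<le> K * norm (y - z)" for y z
    using lipschitz_onD[OF lip, of y z] by (simp add: dist_norm)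
  have n: "norm (pt s b - pt t b) = \<bar>s - t\<bar>" "norm (pt a s - pt a t) = \<bar>s - t\<bar>" for s t
    by (simp_all add: pt_diff norm_real2)
  show "norm d1 \<le> K"
    using l n by (intro gen[OF partials_vector_derivative(1)[OF p[unfolded ab]]]) metis
  show "norm d2 \<le> K"
    using l n by (intro gen[OF partials_vector_derivative(2)[OF p[unfolded ab]]]) metis
qed

section \<open>Changes of scale and integrals over the enlarged disk\<close>

lemma nn_integral_scale_ball:
  fixes g :: "real^2 => ennreal"
  assumes [measurable]: "g \<in> borel_fun" and c: "c > 0"
  shows "disk_int r (\<lambda>x. g (x /\<^sub>R c)) = ennreal (c\<^sup>2) * (disk_int (r / c) (\<lambda>x. g x))"
proof -
  have [measurable]: "ball (0::real^2) s \<in> sets borel" for s by simp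
  have "disk_int r (\<lambda>x. g (x /\<^sub>R c)) =
      (\<integral>\<^sup>+x. g (x /\<^sub>R c) * indicator (ball 0 r) x \<partial>density (distr lborel borel (\<lambda>x. 0 + c *\<^sub>R x)) (\<lambda>_. \<bar>c\<bar> ^ DIM(real^2)))"
    using c by (subst lborel_affine[of c 0, symmetric]) auto
  also have "\<dots> = (\<integral>\<^sup>+x. ennreal (c\<^sup>2) * (g x * indicator (ball 0 (r / c)) x) \<partial>lborel)"
  proof -
    have e: "indicator (ball 0 r) (c *\<^sub>R x) = (indicator (ball 0 (r / c)) x :: ennreal)" for x :: "real^2"
      using c by (auto simp: indicator_def pos_less_divide_eq mult.commute)
    have m: "(\<lambda>x. g (x /\<^sub>R c) * indicator (ball 0 r) x) \<in> borel_fun"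
      by measurable
    show ?thesis
      using c m by (subst nn_integral_density) (auto simp: nn_integral_distr e intro!: nn_integral_cong)
  qed
  also have "\<dots> = ennreal (c\<^sup>2) * (disk_int (r / c) (\<lambda>x. g x))"
    by (rule nn_integral_cmult) measurable
  finally show ?thesis .
qed

lemma nn_integral_lebesgue_on_lborel:
  assumes "\<Omega> \<in> sets borel"
  shows "(\<integral>\<^sup>+x. g x \<partial>lebesgue_on \<Omega>) = (\<integral>\<^sup>+x\<in>\<Omega>. g x \<partial>lborel)"
  using assms by (subst nn_integral_restrict_space) (auto simp: nn_integral_completion)

lemma emeasure_disk: "r \<ge> 0 ==> emeasure lborel (ball (0::real^2) r) = ennreal (pi * r\<^sup>2)"
  by (subst emeasure_ball) (auto simp: unit_ball_vol_2)

lemma angle_normalize: "x \<noteq> 0 ==> circ (angle x) = x /\<^sub>R norm x"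
  using circ_angle[of x] by (metis norm_eq_zero scaleR_left_imp_eq scaleR_scaleR right_inverse scaleR_one inverse_inverse_eq)

lemma AE_nonzero: "AE x in lborel. x \<noteq> (0::real^2)"
  using AE_lborel_negligible[of "{0::real^2}"] by simp

text \<open>The competitor stays in the unit disk while \<open>R\<close> is large, so its gradient
  contributes a constant independent of \<open>R\<close>. Outside, the factor
  \<open>1 / norm x\<close> cancels the density of polar coordinates and leaves \<open>R\<close>
  times the variation; the Jacobian lives in the unit disk only.\<close>

lemma glue_gradient_integrals:
  fixes v \<phi> :: "real^2 => real^2"
  assumes lip: "K-lipschitz_on UNIV (glue v \<phi>)" and \<phi>: "C-lipschitz_on (sphere 0 1) \<phi>"
    and d: "d1 \<in> borel_fun" "d2 \<in> borel_fun" "AE x in lborel. partials (glue v \<phi>) x (d1 x) (d2 x)"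
  shows "disk_int R (\<lambda>x. ennreal (sqrt ((norm (d1 x))\<^sup>2 + (norm (d2 x))\<^sup>2))) \<le>
      ennreal (2 * K * measure lborel (cball (0::real^2) 1)) + ennreal R * circle_variation \<phi>" (is ?A)
    and "disk_int R (\<lambda>x. ennreal \<bar>d1 x $ 1 * d2 x $ 2 - d2 x $ 1 * d1 x $ 2\<bar>) \<le>
      (\<integral>\<^sup>+x. ennreal \<bar>det (grad v x)\<bar> \<partial>lebesgue_on (ball 0 1))" (is ?B)
    and "AE x in lborel. norm (d1 x) \<le> K \<and> norm (d2 x) \<le> K" (is ?C)
proof -
  have K: "K \<ge> 0" using lip by (rule lipschitz_on_nonneg)
  define f where "f = (\<lambda>t. \<phi> (circ t))"
  note fl = lipschitz_sphere_loop[OF \<phi>, folded f_def]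
  show C: ?C using d(3) by eventually_elim (auto intro: partials_bound[OF lip])
  have [measurable]: "rderiv f \<in> borel_fun" by (rule rderiv_lipschitz(1)[OF fl(1)])
  have "disk_int R (\<lambda>x. ennreal (sqrt ((norm (d1 x))\<^sup>2 + (norm (d2 x))\<^sup>2))) \<le>
     (\<integral>\<^sup>+x. ennreal (2 * K) * indicator (cball 0 1) x + ennreal (1 / norm x) * ennreal (norm (rderiv f (angle x))) * indicator (ball 0 R) x \<partial>lborel)"
  proof (rule nn_integral_mono_AE, use d(3) C in eventually_elim)
    case (elim x)
    show ?case
    proof (cases "norm x > 1")
      case True
      then show ?thesis
        using homogeneous_gradient(1)[OF True elim(1)]
        by (auto simp: indicator_def f_def[symmetric] ennreal_mult[symmetric])
    next
      case False
      have "sqrt ((norm (d1 x))\<^sup>2 + (norm (d2 x))\<^sup>2) \<le> norm (d1 x) + norm (d2 x)"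
        using real_sqrt_sum_squares_triangle_ineq[of "norm (d1 x)" 0 0 "norm (d2 x)"] by simp
      also have "\<dots> \<le> 2 * K" using elim by simp
      finally have "ennreal (sqrt ((norm (d1 x))\<^sup>2 + (norm (d2 x))\<^sup>2)) \<le> ennreal (2 * K)" by (rule ennreal_leI)
      then show ?thesis using False by (auto simp: indicator_def intro: add_increasing2)
    qed
  qed
  also have "\<dots> = (\<integral>\<^sup>+x. ennreal (2 * K) * indicator (cball (0::real^2) 1) x \<partial>lborel)
     + disk_int R (\<lambda>x. ennreal (1 / norm x) * ennreal (norm (rderiv f (angle x))))"
  proof (rule nn_integral_add)
    have [measurable]: "ball (0::real^2) R \<in> sets borel" "cball (0::real^2) 1 \<in> sets borel" by simp_all
    show "(\<lambda>x. ennreal (2 * K) * indicator (cball (0::real^2) 1) x) \<in> borel_measurable lborel" by measurable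
    show "(\<lambda>x. ennreal (1 / norm x) * ennreal (norm (rderiv f (angle x))) * indicator (ball (0::real^2) R) x) \<in> borel_measurable lborel"
      by measurable
  qed
  also have "(\<integral>\<^sup>+x. ennreal (2 * K) * indicator (cball (0::real^2) 1) x \<partial>lborel) = ennreal (2 * K * measure lborel (cball (0::real^2) 1))"
  proof -
    have "emeasure lborel (cball (0::real^2) 1) = ennreal (measure lborel (cball (0::real^2) 1))"
      using emeasure_bounded_finite[of "cball (0::real^2) 1"] by (intro emeasure_eq_ennreal_measure) auto
    then show ?thesis using K by (subst nn_integral_cmult_indicator) (auto simp: ennreal_mult)
  qed
  also have "disk_int R (\<lambda>x. ennreal (1 / norm x) * ennreal (norm (rderiv f (angle x)))) =
     (\<integral>\<^sup>+\<rho>\<in>{0<..<R}. ennreal \<rho> * ennreal (1 / \<rho>) \<partial>lborel) * (arc_int (\<lambda>t. ennreal (norm (rderiv f t))))"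
    by (rule nn_integral_polar_product) measurable
  also have "(\<integral>\<^sup>+\<rho>\<in>{0<..<R}. ennreal \<rho> * ennreal (1 / \<rho>) \<partial>lborel) = (\<integral>\<^sup>+\<rho>. indicator {0<..<R} \<rho> \<partial>lborel)"
    by (intro nn_integral_cong) (auto simp: indicator_def ennreal_mult[symmetric])
  also have "\<dots> = ennreal R"
    by (cases "R \<ge> 0") (auto simp: ennreal_neg)
  also have "arc_int (\<lambda>t. ennreal (norm (rderiv f t))) \<le> circle_variation \<phi>"
    unfolding nn_integral_open_closed_interval circle_variation_eq_cvf f_def[symmetric]
    by (rule nn_integral_derivative_le_cvf[OF fl(2,3) rderiv_lipschitz(2)[OF fl(1)]])
  finally show ?A by (simp add: add_left_mono mult_left_mono)
  have "AE x in lborel. x \<notin> sphere (0::real^2) 1" by (rule AE_lborel_negligible) (rule negligible_sphere)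
  with d(3) have "AE x in lborel. ennreal \<bar>d1 x $ 1 * d2 x $ 2 - d2 x $ 1 * d1 x $ 2\<bar> * indicator (ball 0 R) x \<le> ennreal \<bar>det (grad v x)\<bar> * indicator (ball 0 1) x"
  proof eventually_elim
    case (elim x)
    show ?case
    proof (cases "norm x > 1")
      case True
      then show ?thesis using homogeneous_gradient(2)[OF True elim(1)] by simp
    next
      case False
      then have x: "x \<in> ball 0 1" using elim(2) by auto
      have "partials v x (d1 x) (d2 x)"
        unfolding partials_def
        by (rule has_derivative_transform_within_open[OF elim(1)[unfolded partials_def] open_ball x]) (simp add: glue_def)
      then show ?thesis using x by (auto simp: det_grad_partials indicator_def)
    qed
  qed
  then have "disk_int R (\<lambda>x. ennreal \<bar>d1 x $ 1 * d2 x $ 2 - d2 x $ 1 * d1 x $ 2\<bar>) \<le> disk_int 1 (\<lambda>x. ennreal \<bar>det (grad v x)\<bar>)"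
    by (rule nn_integral_mono_AE)
  then show ?B by (simp add: nn_integral_lebesgue_on_lborel)
qed

text \<open>Dominated convergence in eventual form, so that one index can meet several such bounds
  at once.\<close>

lemma nn_integral_ball_dominated:
  fixes u :: "nat => real^2 => real"
  assumes [measurable]: "\<And>k. u k \<in> borel_fun" "u' \<in> borel_fun"
    and b: "\<And>k x. 0 \<le> u k x \<and> u k x \<le> B" and lim: "AE x in lborel. (\<lambda>k. u k x) \<longlonglongrightarrow> u' x" and \<delta>: "\<delta> > 0"
  shows "\<forall>\<^sub>F k in sequentially. (disk_int R (\<lambda>x. ennreal (u k x))) \<le> disk_int R (\<lambda>x. ennreal (u' x)) + ennreal \<delta>"
proof -
  have bm [measurable]: "ball (0::real^2) R \<in> sets borel" by simp
  have B: "B \<ge> 0" using b[of 0 0] by linarith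
  have fin: "(disk_int R (\<lambda>x. ennreal B)) < \<infinity>"
    using emeasure_bounded_finite[of "ball (0::real^2) R"] by (simp add: nn_integral_cmult_indicator ennreal_mult_less_top)
  have L: "(\<lambda>k. \<integral>\<^sup>+x\<in>ball 0 R. ennreal (u k x) \<partial>lborel) \<longlonglongrightarrow> (disk_int R (\<lambda>x. ennreal (u' x)))"
  proof (rule nn_integral_dominated_convergence[where w="\<lambda>x. ennreal B * indicator (ball 0 R) x"])
    show "AE x in lborel. ennreal (u k x) * indicator (ball 0 R) x \<le> ennreal B * indicator (ball 0 R) x" for k
      using b by (intro AE_I2 mult_right_mono ennreal_leI) auto
    show "AE x in lborel. (\<lambda>k. ennreal (u k x) * indicator (ball 0 R) x) \<longlonglongrightarrow> ennreal (u' x) * indicator (ball 0 R) x"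
      using lim
    proof eventually_elim
      case (elim x)
      show ?case using tendsto_ennrealI[OF elim] by (cases "x \<in> ball 0 R") auto
    qed
  qed (use fin in measurable)
  have "disk_int R (\<lambda>x. ennreal (u' x)) \<le> disk_int R (\<lambda>x. ennreal B)"
  proof (rule tendsto_upperbound[OF L])
    show "\<forall>\<^sub>F k in sequentially. (disk_int R (\<lambda>x. ennreal (u k x))) \<le> disk_int R (\<lambda>x. ennreal B)"
      using b by (intro always_eventually allI nn_integral_mono mult_right_mono ennreal_leI) auto
  qed simp
  then have "(disk_int R (\<lambda>x. ennreal (u' x))) < \<infinity>" using fin by (rule le_less_trans)
  moreover have "X < X + ennreal \<delta>" if "X < \<infinity>" for X
    using that \<delta> by (cases X) (auto simp: ennreal_plus[symmetric] ennreal_less_iff simp del: ennreal_plus)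
  ultimately have "(disk_int R (\<lambda>x. ennreal (u' x))) < (disk_int R (\<lambda>x. ennreal (u' x))) + ennreal \<delta>"
    by blast
  from order_tendstoD(2)[OF L this] show ?thesis by eventually_elim simp
qed

lemma area_le:
  assumes "C1_on (ball 0 r) w" "r \<ge> 0"
  shows "area w (ball 0 r) \<le> ennreal (pi * r\<^sup>2) + disk_int r (\<lambda>x. ennreal (norm (grad w x))) + disk_int r (\<lambda>x. ennreal \<bar>det (grad w x)\<bar>)"
proof -
  have bm [measurable]: "ball (0::real^2) r \<in> sets borel" by simp
  define G where "G = (\<lambda>x. indicator (ball 0 r) x *\<^sub>R grad w x)"
  have Gm [measurable]: "G \<in> borel_fun" unfolding G_def by (rule measurable_grad_ball[OF assms(1)])
  have comp: "(\<lambda>x. G x $ i $ j) \<in> borel_fun" for i j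
  proof -
    have "continuous_on UNIV (\<lambda>A::real^2^2. A $ i $ j)" by (intro continuous_intros)
    from borel_measurable_continuous_onI[OF this] show ?thesis using measurable_compose[OF Gm] by blast
  qed
  have dm: "(\<lambda>x. det (G x)) \<in> borel_fun"
    unfolding det_2 using comp by (intro borel_measurable_diff borel_measurable_times)
  have m1: "(\<lambda>x. ennreal (norm (G x))) \<in> borel_fun" by measurable
  have m2: "(\<lambda>x. ennreal \<bar>det (G x)\<bar>) \<in> borel_fun" using dm by measurable
  have "area w (ball 0 r) = disk_int r (\<lambda>x. ennreal (sqrt (1 + (norm (grad w x))\<^sup>2 + (det (grad w x))\<^sup>2)))"
    unfolding area_def by (simp add: nn_integral_lebesgue_on_lborel)
  also have "\<dots> \<le> (\<integral>\<^sup>+x. (indicator (ball 0 r) x + ennreal (norm (G x))) + ennreal \<bar>det (G x)\<bar> \<partial>lborel)"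
  proof (rule nn_integral_mono)
    fix x :: "real^2"
    have "sqrt (1 + a\<^sup>2 + b\<^sup>2) \<le> 1 + \<bar>a\<bar> + \<bar>b\<bar>" for a b :: real
      by (rule real_le_lsqrt) (auto simp: power2_eq_square algebra_simps)
    from this[of "norm (grad w x)" "det (grad w x)"]
    have "ennreal (sqrt (1 + (norm (grad w x))\<^sup>2 + (det (grad w x))\<^sup>2)) \<le> ennreal (1 + norm (grad w x) + \<bar>det (grad w x)\<bar>)"
      by (intro ennreal_leI) simp
    then show "ennreal (sqrt (1 + (norm (grad w x))\<^sup>2 + (det (grad w x))\<^sup>2)) * indicator (ball 0 r) x \<le> indicator (ball 0 r) x + ennreal (norm (G x)) + ennreal \<bar>det (G x)\<bar>"
      by (cases "x \<in> ball 0 r") (auto simp: G_def)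
  qed
  also have "\<dots> = emeasure lborel (ball (0::real^2) r) + (\<integral>\<^sup>+x. ennreal (norm (G x)) \<partial>lborel) + (\<integral>\<^sup>+x. ennreal \<bar>det (G x)\<bar> \<partial>lborel)"
  proof -
    have "(\<integral>\<^sup>+x. (indicator (ball 0 r) x + ennreal (norm (G x))) + ennreal \<bar>det (G x)\<bar> \<partial>lborel) =
       (\<integral>\<^sup>+x. indicator (ball 0 r) x + ennreal (norm (G x)) \<partial>lborel) + (\<integral>\<^sup>+x. ennreal \<bar>det (G x)\<bar> \<partial>lborel)"
      using m1 m2 by (intro nn_integral_add) auto
    also have "(\<integral>\<^sup>+x. indicator (ball 0 r) x + ennreal (norm (G x)) \<partial>lborel) = emeasure lborel (ball (0::real^2) r) + (\<integral>\<^sup>+x. ennreal (norm (G x)) \<partial>lborel)"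
      using m1 by (subst nn_integral_add) auto
    finally show ?thesis .
  qed
  also have "(\<integral>\<^sup>+x. ennreal (norm (G x)) \<partial>lborel) = disk_int r (\<lambda>x. ennreal (norm (grad w x)))"
    by (intro nn_integral_cong) (auto simp: G_def indicator_def)
  also have "(\<integral>\<^sup>+x. ennreal \<bar>det (G x)\<bar> \<partial>lborel) = disk_int r (\<lambda>x. ennreal \<bar>det (grad w x)\<bar>)"
    by (intro nn_integral_cong) (auto simp: G_def indicator_def det_2)
  finally show ?thesis using emeasure_disk[OF assms(2)] by simp
qed

lemma partials_scale:
  fixes g :: "real^2 => 'b::real_normed_vector"
  assumes "partials g (x /\<^sub>R c) d1 d2"
  shows "partials (\<lambda>x. g (x /\<^sub>R c)) x (d1 /\<^sub>R c) (d2 /\<^sub>R c)"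
proof -
  have "((\<lambda>x::real^2. x /\<^sub>R c) has_derivative (\<lambda>z. z /\<^sub>R c)) (at x)" by (auto intro!: derivative_eq_intros)
  from diff_chain_at[OF this assms[unfolded partials_def]]
  have "((\<lambda>x. g (x /\<^sub>R c)) has_derivative (\<lambda>z. (z /\<^sub>R c) $ 1 *\<^sub>R d1 + (z /\<^sub>R c) $ 2 *\<^sub>R d2)) (at x)"
    by (simp add: o_def)
  moreover have "(\<lambda>z::real^2. (z /\<^sub>R c) $ 1 *\<^sub>R d1 + (z /\<^sub>R c) $ 2 *\<^sub>R d2) = (\<lambda>z. z $ 1 *\<^sub>R (d1 /\<^sub>R c) + z $ 2 *\<^sub>R (d2 /\<^sub>R c))"
    by (simp add: fun_eq_iff mult.commute)
  ultimately show ?thesis by (simp add: partials_def)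
qed

text \<open>Shrinking the competitor to the disk of radius \<open>sc\<close> and extending it 0-homogeneously keeps the
  integral of the Jacobian and makes the gradient inside that disk negligible. The average
  over a small square turns the resulting Lipschitz map into a \<open>C\<^sup>1\<close> map.\<close>

lemma recovery:
  fixes v \<phi> :: "real^2 => real^2"
  assumes \<phi>: "\<exists>C. C-lipschitz_on (sphere 0 1) \<phi>" and v: "v \<in> plateau_competitors \<phi>" and r: "r > 0" and e: "e > 0"
  obtains w where "C1_on UNIV w"
    "disk_int r (\<lambda>x. ennreal (norm (w x - \<phi> (x /\<^sub>R norm x)))) \<le> ennreal e"
    "disk_int r (\<lambda>x. ennreal (norm (grad w x))) \<le> ennreal r * circle_variation \<phi> + ennreal e"
    "area w (ball 0 r) \<le> ennreal (pi * r\<^sup>2) + ennreal r * circle_variation \<phi> +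
       (\<integral>\<^sup>+x. ennreal \<bar>det (grad v x)\<bar> \<partial>lebesgue_on (ball 0 1)) + ennreal e"
proof -
  obtain C1 where C1: "C1-lipschitz_on (sphere 0 1) \<phi>" using \<phi> by blast
  obtain C2 where C2: "C2-lipschitz_on (ball 0 1) v" and bd: "\<And>x. x \<in> sphere 0 1 ==> (v \<longlongrightarrow> \<phi> x) (at x within ball 0 1)"
    using v by (auto simp: plateau_competitors_def)
  define C where "C = max C1 C2"
  have lip1: "C-lipschitz_on (sphere 0 1) \<phi>" "C-lipschitz_on (ball 0 1) v"
    using lipschitz_on_le[OF C1, of C] lipschitz_on_le[OF C2, of C] by (auto simp: C_def)
  define W where "W = glue v \<phi>"
  define K where "K = 2 * C"
  have lip: "K-lipschitz_on UNIV W" unfolding K_def W_def by (rule glue_lipschitz[OF lip1(2,1) bd])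
  have K: "K \<ge> 0" using lip by (rule lipschitz_on_nonneg)
  have lipW: "norm (W x - W y) \<le> K * norm (x - y)" for x y
    using lipschitz_onD[OF lip, of x y] by (simp add: dist_norm)
  have Wc: "continuous_on UNIV W" by (rule lipschitz_on_continuous_on[OF lip])
  have [measurable]: "W \<in> borel_fun" by (rule borel_measurable_continuous_onI[OF Wc])
  obtain d1 d2 where d: "d1 \<in> borel_fun" "d2 \<in> borel_fun" "AE x in lborel. partials W x (d1 x) (d2 x)"
    using rademacher_partials[OF lip] by blast
  note [measurable] = d(1,2)
  define M where "M = measure lborel (cball (0::real^2) 1)"
  have M: "M \<ge> 0" by (simp add: M_def)
  have Me: "emeasure lborel (cball (0::real^2) 1) = ennreal M"
    unfolding M_def using emeasure_bounded_finite[of "cball (0::real^2) 1"] by (intro emeasure_eq_ennreal_measure) auto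
  \<comment> \<open>After shrinking by \<open>sc\<close>, the errors are
    \<open>sc * (2 * K * M + 1)\<close> for the gradient and at most \<open>sc * (1 + K * M)\<close>
    for the L1 distance; \<open>Q\<close> dominates both factors.\<close>
  define Q where "Q = 2 * K * M + K * M + 2"
  have Q: "Q > 0" using K M by (simp add: Q_def add_nonneg_pos)
  define sc where "sc = min 1 (e / (2 * Q))"
  have sc: "sc > 0" "sc \<le> 1" "sc * Q \<le> e / 2"
    using e Q by (auto simp: sc_def min_def field_simps)
  \<comment> \<open>The radius \<open>r\<close> as seen before the competitor is shrunk.\<close>
  define R where "R = r / sc"
  have R: "R > 0" using r sc by (simp add: R_def)
  define N where "N = (\<lambda>x. sqrt ((norm (d1 x))\<^sup>2 + (norm (d2 x))\<^sup>2))"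
  define J where "J = (\<lambda>x. \<bar>d1 x $ 1 * d2 x $ 2 - d2 x $ 1 * d1 x $ 2\<bar>)"
  let ?P = "\<integral>\<^sup>+x. ennreal \<bar>det (grad v x)\<bar> \<partial>lebesgue_on (ball 0 1)"
  note G = glue_gradient_integrals(1)[OF lip[unfolded W_def] lip1(1) d[unfolded W_def], of R]
    glue_gradient_integrals(2)[OF lip[unfolded W_def] lip1(1) d[unfolded W_def], of R]
  have G1: "disk_int R (\<lambda>x. ennreal (N x)) \<le> ennreal (2 * K * M) + ennreal R * circle_variation \<phi>"
    using G(1) by (simp only: N_def M_def)
  have G2: "disk_int R (\<lambda>x. ennreal (J x)) \<le> ?P"
    using G(2) by (simp only: J_def)
  define h where "h = (\<lambda>k. inverse (real (Suc k)))"
  have h: "h k > 0" for k by (simp add: h_def)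
  define S where "S = (\<lambda>k. avg (h k) W)"
  define a1 where "a1 = (\<lambda>k. avg1 (h k) W)"
  define a2 where "a2 = (\<lambda>k. avg2 (h k) W)"
  have Sp: "partials (S k) x (a1 k x) (a2 k x)" for k x
    unfolding S_def a1_def a2_def by (rule avg_partials(1)[OF Wc h])
  have ac: "continuous_on UNIV (a1 k)" "continuous_on UNIV (a2 k)" for k
    unfolding a1_def a2_def by (rule avg_partials[OF Wc h])+
  have [measurable]: "a1 k \<in> borel_fun" "a2 k \<in> borel_fun" for k
    using ac by (auto intro: borel_measurable_continuous_onI)
  have ab: "norm (a1 k x) \<le> K" "norm (a2 k x) \<le> K" for k x
    unfolding a1_def a2_def by (rule avg12_lipschitz_bound[OF lip h])+
  have Sc: "continuous_on UNIV (S k)" for k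
    using Sp unfolding partials_def by (auto intro!: continuous_at_imp_continuous_on has_derivative_continuous)
  have [measurable]: "S k \<in> borel_fun" for k
    by (rule borel_measurable_continuous_onI[OF Sc])
  define Nk where "Nk = (\<lambda>k x. sqrt ((norm (a1 k x))\<^sup>2 + (norm (a2 k x))\<^sup>2))"
  define Jk where "Jk = (\<lambda>k x. \<bar>a1 k x $ 1 * a2 k x $ 2 - a2 k x $ 1 * a1 k x $ 2\<bar>)"
  have lims: "AE x in lborel. (\<lambda>k. a1 k x) \<longlonglongrightarrow> d1 x \<and> (\<lambda>k. a2 k x) \<longlonglongrightarrow> d2 x"
    using d(3) unfolding a1_def a2_def h_def by eventually_elim (intro conjI avg12_tendsto[OF Wc])
  have Nb: "0 \<le> Nk k x \<and> Nk k x \<le> 2 * K" for k x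
    using real_sqrt_sum_squares_triangle_ineq[of "norm (a1 k x)" 0 0 "norm (a2 k x)"] ab[of k x] by (simp add: Nk_def)
  have Jb: "0 \<le> Jk k x \<and> Jk k x \<le> 2 * K * K" for k x
  proof -
    have c: "\<bar>a1 k x $ i\<bar> \<le> K" "\<bar>a2 k x $ i\<bar> \<le> K" for i
      using component_le_norm_cart[of "a1 k x" i] component_le_norm_cart[of "a2 k x" i] ab[of k x] by auto
    have "Jk k x \<le> \<bar>a1 k x $ 1 * a2 k x $ 2\<bar> + \<bar>a2 k x $ 1 * a1 k x $ 2\<bar>" unfolding Jk_def by (rule abs_triangle_ineq4)
    also have "\<dots> \<le> K * K + K * K" unfolding abs_mult using c K by (intro add_mono mult_mono) auto
    finally show ?thesis by (simp add: Jk_def)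
  qed
  have E1: "\<forall>\<^sub>F k in sequentially. (disk_int R (\<lambda>x. ennreal (Nk k x))) \<le> disk_int R (\<lambda>x. ennreal (N x)) + ennreal 1"
  proof (rule nn_integral_ball_dominated[OF _ _ Nb])
    show "AE x in lborel. (\<lambda>k. Nk k x) \<longlonglongrightarrow> N x"
      using lims unfolding Nk_def N_def by eventually_elim (intro tendsto_intros; simp)
  qed (auto simp: Nk_def N_def)
  have E2: "\<forall>\<^sub>F k in sequentially. (disk_int R (\<lambda>x. ennreal (Jk k x))) \<le> disk_int R (\<lambda>x. ennreal (J x)) + ennreal (e / 2)"
  proof (rule nn_integral_ball_dominated[OF _ _ Jb])
    show "AE x in lborel. (\<lambda>k. Jk k x) \<longlonglongrightarrow> J x"
      using lims unfolding Jk_def J_def by eventually_elim (intro tendsto_intros; simp)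
    show "Jk k \<in> borel_fun" for k unfolding Jk_def by measurable
    show "J \<in> borel_fun" unfolding J_def by measurable
  qed (use e in simp)
  \<comment> \<open>The averaged map differs from \<open>W\<close> by at most
    \<open>2 * K * h k\<close>; this makes the difference negligible on the whole disk of radius
    \<open>R\<close>.\<close>
  have E3: "\<forall>\<^sub>F k in sequentially. 2 * K * h k * (pi * R\<^sup>2) < 1"
  proof -
    have "(\<lambda>k. 2 * K * h k * (pi * R\<^sup>2)) \<longlonglongrightarrow> 2 * K * 0 * (pi * R\<^sup>2)"
      unfolding h_def by (intro tendsto_intros LIMSEQ_inverse_real_of_nat)
    then show ?thesis by (intro order_tendstoD(2)[of _ "2 * K * 0 * (pi * R\<^sup>2)"]) auto
  qed
  \<comment> \<open>The scale \<open>sc\<close>, and with it \<open>R\<close>, was fixed before, so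
    the averaging parameter can be chosen afterwards to satisfy the three conditions
    together.\<close>
  obtain k where k: "disk_int R (\<lambda>x. ennreal (Nk k x)) \<le> disk_int R (\<lambda>x. ennreal (N x)) + ennreal 1"
    "disk_int R (\<lambda>x. ennreal (Jk k x)) \<le> disk_int R (\<lambda>x. ennreal (J x)) + ennreal (e / 2)"
    "2 * K * h k * (pi * R\<^sup>2) < 1"
    using eventually_happens[OF eventually_conj[OF E1 eventually_conj[OF E2 E3]]] by auto
  define w where "w = (\<lambda>x. S k (x /\<^sub>R sc))"
  have wp: "partials w x (a1 k (x /\<^sub>R sc) /\<^sub>R sc) (a2 k (x /\<^sub>R sc) /\<^sub>R sc)" for x
    unfolding w_def by (rule partials_scale[OF Sp])
  have wC1: "C1_on UNIV w"
    by (rule C1_onI_partials[OF wp]) (intro continuous_intros continuous_on_compose2[OF ac(1)] continuous_on_compose2[OF ac(2)]; simp)+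
  have wC1': "C1_on (ball 0 r) w"
    using wC1 unfolding C1_on_def by (meson UNIV_I continuous_on_subset subset_UNIV)
  have ng: "norm (grad w x) = Nk k (x /\<^sub>R sc) / sc" for x
  proof -
    have "norm (grad w x) = sqrt (((norm (a1 k (x /\<^sub>R sc)))\<^sup>2 + (norm (a2 k (x /\<^sub>R sc)))\<^sup>2) / sc\<^sup>2)"
    proof -
      have n: "norm (a /\<^sub>R sc) = norm a / sc" for a :: "real^2"
        using sc(1) by (simp add: divide_inverse_commute)
      show ?thesis unfolding norm_grad_partials[OF wp] n by (simp only: power_divide add_divide_distrib)
    qed
    then show ?thesis using sc by (simp add: Nk_def real_sqrt_divide)
  qed
  have dg: "\<bar>det (grad w x)\<bar> = Jk k (x /\<^sub>R sc) / sc\<^sup>2" for x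
  proof -
    have "det (grad w x) = (a1 k (x /\<^sub>R sc) $ 1 * a2 k (x /\<^sub>R sc) $ 2 - a2 k (x /\<^sub>R sc) $ 1 * a1 k (x /\<^sub>R sc) $ 2) / sc\<^sup>2"
      unfolding det_grad_partials[OF wp] using sc(1) by (simp add: power2_eq_square field_simps)
    then show ?thesis by (simp add: Jk_def abs_divide)
  qed
  have gradw: "disk_int r (\<lambda>x. ennreal (norm (grad w x))) \<le> ennreal r * circle_variation \<phi> + ennreal (e / 2)"
  proof -
    have "disk_int r (\<lambda>x. ennreal (norm (grad w x))) = disk_int r (\<lambda>x. ennreal (Nk k (x /\<^sub>R sc) / sc))"
      by (simp add: ng)
    also have "\<dots> = ennreal (sc\<^sup>2) * (disk_int R (\<lambda>x. ennreal (Nk k x / sc)))"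
      unfolding R_def by (rule nn_integral_scale_ball[OF _ sc(1)]) (simp add: Nk_def)
    also have "\<dots> = (\<integral>\<^sup>+x. ennreal sc * (ennreal (Nk k x) * indicator (ball 0 R) x) \<partial>lborel)"
    proof -
      have "ennreal (sc\<^sup>2) * (ennreal (Nk k x / sc) * indicator (ball 0 R) x) = ennreal sc * (ennreal (Nk k x) * indicator (ball 0 R) x)" for x
        using sc(1) Nb[of k x] by (auto simp: indicator_def ennreal_mult[symmetric] power2_eq_square)
      moreover have "(\<lambda>x. ennreal (Nk k x / sc) * indicator (ball 0 R) x) \<in> borel_measurable lborel"
        by (intro borel_measurable_times_ennreal borel_measurable_indicator) (auto simp: Nk_def)
      ultimately show ?thesis by (simp add: nn_integral_cmult[symmetric])
    qed
    also have "\<dots> = ennreal sc * (disk_int R (\<lambda>x. ennreal (Nk k x)))"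
      by (intro nn_integral_cmult borel_measurable_times_ennreal borel_measurable_indicator) (auto simp: Nk_def)
    also have "\<dots> \<le> ennreal sc * (ennreal (2 * K * M) + ennreal R * circle_variation \<phi> + ennreal 1)"
      by (intro mult_left_mono order_trans[OF k(1)] add_right_mono G1) auto
    also have "\<dots> = ennreal sc * ennreal R * circle_variation \<phi> + ennreal sc * (ennreal (2 * K * M) + ennreal 1)"
      by (simp add: algebra_simps)
    also have "ennreal sc * ennreal R = ennreal r" using sc R by (simp add: ennreal_mult[symmetric] R_def)
    also have "ennreal sc * (ennreal (2 * K * M) + ennreal 1) = ennreal (sc * (2 * K * M + 1))"
      using K M sc by (simp add: ennreal_mult ennreal_plus)
    also have "\<dots> \<le> ennreal (e / 2)"
    proof (rule ennreal_leI)
      have "sc * (2 * K * M + 1) \<le> sc * Q" using sc K M by (intro mult_left_mono) (auto simp: Q_def)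
      then show "sc * (2 * K * M + 1) \<le> e / 2" using sc(3) by linarith
    qed
    finally show ?thesis by (simp add: add_left_mono)
  qed
  have detw: "disk_int r (\<lambda>x. ennreal \<bar>det (grad w x)\<bar>) \<le> ?P + ennreal (e / 2)"
  proof -
    have Jm: "Jk k \<in> borel_fun" unfolding Jk_def by measurable
    have "disk_int r (\<lambda>x. ennreal \<bar>det (grad w x)\<bar>) = disk_int r (\<lambda>x. ennreal (Jk k (x /\<^sub>R sc) / sc\<^sup>2))"
      by (simp add: dg)
    also have "\<dots> = ennreal (sc\<^sup>2) * (disk_int R (\<lambda>x. ennreal (Jk k x / sc\<^sup>2)))"
      unfolding R_def by (rule nn_integral_scale_ball[OF _ sc(1), where g="\<lambda>x. ennreal (Jk k x / sc\<^sup>2)"]) (use Jm in measurable)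
    also have "\<dots> = disk_int R (\<lambda>x. ennreal (Jk k x))"
    proof -
      have "ennreal (sc\<^sup>2) * (ennreal (Jk k x / sc\<^sup>2) * indicator (ball 0 R) x) = ennreal (Jk k x) * indicator (ball 0 R) x" for x
        using sc(1) Jb[of k x] by (auto simp: indicator_def ennreal_mult[symmetric])
      moreover have "(\<lambda>x. ennreal (Jk k x / sc\<^sup>2) * indicator (ball 0 R) x) \<in> borel_measurable lborel"
        using Jm by (intro borel_measurable_times_ennreal borel_measurable_indicator) auto
      ultimately show ?thesis by (simp add: nn_integral_cmult[symmetric])
    qed
    also have "\<dots> \<le> ?P + ennreal (e / 2)" using order_trans[OF k(2) add_right_mono[OF G2]] .
    finally show ?thesis .
  qed
  have L1: "disk_int r (\<lambda>x. ennreal (norm (w x - \<phi> (x /\<^sub>R norm x)))) \<le> ennreal e"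
  proof -
    define g where "g = (\<lambda>y. ennreal (norm (S k y - W (y /\<^sub>R norm y))))"
    have gm [measurable]: "g \<in> borel_fun" unfolding g_def by measurable
    have nW: "W (y /\<^sub>R norm y) = \<phi> (y /\<^sub>R norm y)" if "y \<noteq> 0" for y :: "real^2"
      using that by (simp add: W_def glue_def)
    have "disk_int r (\<lambda>x. ennreal (norm (w x - \<phi> (x /\<^sub>R norm x)))) = disk_int r (\<lambda>x. g (x /\<^sub>R sc))"
    proof (rule nn_integral_cong_AE, use AE_nonzero in eventually_elim)
      case (elim x)
      have eq: "(x /\<^sub>R sc) /\<^sub>R norm (x /\<^sub>R sc) = x /\<^sub>R norm x" using sc(1) by (simp add: field_simps)
      show ?case by (simp only: g_def w_def eq nW[OF elim])
    qed
    also have "\<dots> = ennreal (sc\<^sup>2) * (disk_int R (\<lambda>x. g x))"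
      unfolding R_def by (rule nn_integral_scale_ball[OF gm sc(1)])
    also have "disk_int R (\<lambda>x. g x) \<le> (\<integral>\<^sup>+x. ennreal (2 * K * h k) * indicator (ball (0::real^2) R) x + ennreal K * indicator (cball (0::real^2) 1) x \<partial>lborel)"
    proof (rule nn_integral_mono_AE, use AE_nonzero in eventually_elim)
      case (elim y)
      have 1: "norm (S k y - W y) \<le> 2 * K * h k"
        unfolding S_def
      proof (rule avg_bound[OF Wc h])
        fix a b assume ab: "a \<in> {0..h k}" "b \<in> {0..h k}"
        have "norm (pt a b) \<le> 2 * h k" using norm_le_l1_cart[of "pt a b"] ab by (simp add: sum_2)
        then have "K * norm (y + pt a b - y) \<le> K * (2 * h k)" using K by (intro mult_left_mono) auto
        then show "norm (W (y + pt a b) - W y) \<le> 2 * K * h k" using lipW[of "y + pt a b" y] by simp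
      qed
      \<comment> \<open>This part of the distance does not come from averaging: in the unit disk
        \<open>W\<close> is the competitor and not the homogeneous map. Its effect vanishes with the
        area of the shrunken disk.\<close>
      have 2: "norm (W y - W (y /\<^sub>R norm y)) \<le> K * indicator (cball 0 1) y"
      proof (cases "norm y < 1")
        case True
        have "y - y /\<^sub>R norm y = (norm y - 1) *\<^sub>R (y /\<^sub>R norm y)" using elim by (simp add: algebra_simps)
        then have "norm (y - y /\<^sub>R norm y) = \<bar>norm y - 1\<bar> * norm (y /\<^sub>R norm y)" by (simp only: norm_scaleR)
        moreover have "norm (y /\<^sub>R norm y) = 1" using elim by simp
        moreover have "\<bar>norm y - 1\<bar> \<le> 1" using True norm_ge_zero[of y] by (simp add: abs_if)
        ultimately have "norm (y - y /\<^sub>R norm y) \<le> 1" by simp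
        then have "K * norm (y - y /\<^sub>R norm y) \<le> K * 1" using K by (intro mult_left_mono)
        then show ?thesis using lipW[of y "y /\<^sub>R norm y"] True by simp
      next
        case False
        then have "W y = W (y /\<^sub>R norm y)" using elim by (simp add: W_def glue_def)
        then show ?thesis using K by (simp add: indicator_def)
      qed
      have "norm (S k y - W (y /\<^sub>R norm y)) \<le> 2 * K * h k + K * indicator (cball 0 1) y"
        using norm_triangle_ineq[of "S k y - W y" "W y - W (y /\<^sub>R norm y)"] 1 2 by simp
      then have "g y \<le> ennreal (2 * K * h k + K * indicator (cball 0 1) y)" unfolding g_def by (rule ennreal_leI)
      also have "\<dots> = ennreal (2 * K * h k) + ennreal K * indicator (cball 0 1) y"
        using K h[of k] by (auto simp: ennreal_plus indicator_def)
      finally show ?case by (auto simp: indicator_def split: if_splits)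
    qed
    also have "\<dots> = ennreal (2 * K * h k) * ennreal (pi * R\<^sup>2) + ennreal K * ennreal M"
    proof -
      have "(\<lambda>x. c * indicator (ball (0::real^2) R) x) \<in> borel_measurable lborel" "(\<lambda>x. c * indicator (cball (0::real^2) 1) x) \<in> borel_measurable lborel" for c :: ennreal
        by (intro borel_measurable_times_ennreal borel_measurable_indicator; simp)+
      then show ?thesis using R by (subst nn_integral_add) (auto simp: nn_integral_cmult_indicator emeasure_disk Me)
    qed
    also have "\<dots> = ennreal (2 * K * h k * (pi * R\<^sup>2) + K * M)"
      using K M h[of k] by (simp add: ennreal_mult ennreal_plus)
    also have "\<dots> \<le> ennreal (1 + K * M)" using k(3) by (intro ennreal_leI) simp
    finally have "disk_int r (\<lambda>x. ennreal (norm (w x - \<phi> (x /\<^sub>R norm x)))) \<le> ennreal (sc\<^sup>2) * ennreal (1 + K * M)"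
      by (simp add: mult_left_mono)
    also have "\<dots> = ennreal (sc\<^sup>2 * (1 + K * M))" using K M by (simp add: ennreal_mult)
    also have "\<dots> \<le> ennreal e"
    proof (rule ennreal_leI)
      have "sc\<^sup>2 \<le> sc" using sc by (simp add: power2_eq_square mult_left_le)
      then have "sc\<^sup>2 * (1 + K * M) \<le> sc * (1 + K * M)" using K M by (intro mult_right_mono) auto
      also have "\<dots> \<le> sc * Q" using sc K M by (intro mult_left_mono) (auto simp: Q_def)
      finally show "sc\<^sup>2 * (1 + K * M) \<le> e" using sc(3) e by linarith
    qed
    finally show ?thesis .
  qed
  show ?thesis
  proof (rule that[OF wC1 L1])
    show "disk_int r (\<lambda>x. ennreal (norm (grad w x))) \<le> ennreal r * circle_variation \<phi> + ennreal e"
      using e by (intro order_trans[OF gradw] add_left_mono ennreal_leI) simp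
    have "area w (ball 0 r) \<le> ennreal (pi * r\<^sup>2) + (ennreal r * circle_variation \<phi> + ennreal (e / 2)) + (?P + ennreal (e / 2))"
      by (intro order_trans[OF area_le[OF wC1' less_imp_le[OF r]]] add_mono gradw detw order_refl)
    also have "\<dots> = ennreal (pi * r\<^sup>2) + ennreal r * circle_variation \<phi> + ?P + (ennreal (e / 2) + ennreal (e / 2))"
      by (simp add: ac_simps)
    also have "ennreal (e / 2) + ennreal (e / 2) = ennreal e" using e by (simp add: ennreal_plus[symmetric] del: ennreal_plus)
    finally show "area w (ball 0 r) \<le> ennreal (pi * r\<^sup>2) + ennreal r * circle_variation \<phi> + ?P + ennreal e" .
  qed
qed

text \<open>The 1-homogeneous extension serves where any competitor will do: in
  \<open>total_variation_angular\<close>, and when \<open>plateau \<phi>\<close> is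
  infinite.\<close>

lemma conic_competitor:
  fixes \<phi> :: "real^2 => real^2"
  assumes \<phi>: "C-lipschitz_on (sphere 0 1) \<phi>"
  shows "(\<lambda>x. norm x *\<^sub>R \<phi> (x /\<^sub>R norm x)) \<in> plateau_competitors \<phi>"
proof -
  let ?v = "\<lambda>x. norm x *\<^sub>R \<phi> (x /\<^sub>R norm x)"
  have C: "C \<ge> 0" using \<phi> by (rule lipschitz_on_nonneg)
  obtain M where M: "\<And>t. norm (\<phi> (circ t)) \<le> M" "M \<ge> 0"
    using loop_bound[OF lipschitz_sphere_loop(2)[OF \<phi>]] by blast
  have Mb: "norm (\<phi> (x /\<^sub>R norm x)) \<le> M" if "x \<noteq> 0" for x
    using M(1)[of "angle x"] angle_normalize[OF that] by simp
  have main: "norm (?v x - ?v y) \<le> (M + 2 * C) * norm (x - y)" if xy: "x \<noteq> 0" "y \<noteq> 0" for x y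
  proof -
    have "?v x - ?v y = (norm x - norm y) *\<^sub>R \<phi> (y /\<^sub>R norm y) + norm x *\<^sub>R (\<phi> (x /\<^sub>R norm x) - \<phi> (y /\<^sub>R norm y))"
      by (simp add: algebra_simps)
    also have "norm \<dots> \<le> \<bar>norm x - norm y\<bar> * M + norm x * (C * norm (x /\<^sub>R norm x - y /\<^sub>R norm y))"
    proof (rule order_trans[OF norm_triangle_ineq], rule add_mono)
      show "norm ((norm x - norm y) *\<^sub>R \<phi> (y /\<^sub>R norm y)) \<le> \<bar>norm x - norm y\<bar> * M"
        using Mb[OF xy(2)] by (simp add: mult_left_mono)
      have "dist (\<phi> (x /\<^sub>R norm x)) (\<phi> (y /\<^sub>R norm y)) \<le> C * dist (x /\<^sub>R norm x) (y /\<^sub>R norm y)"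
        using xy by (intro lipschitz_onD[OF \<phi>]) auto
      then show "norm (norm x *\<^sub>R (\<phi> (x /\<^sub>R norm x) - \<phi> (y /\<^sub>R norm y))) \<le> norm x * (C * norm (x /\<^sub>R norm x - y /\<^sub>R norm y))"
        by (simp add: dist_norm mult_left_mono)
    qed
    also have "norm x * (C * norm (x /\<^sub>R norm x - y /\<^sub>R norm y)) = C * norm (norm x *\<^sub>R (x /\<^sub>R norm x - y /\<^sub>R norm y))"
      by simp
    also have "norm x *\<^sub>R (x /\<^sub>R norm x - y /\<^sub>R norm y) = (x - y) + (norm y - norm x) *\<^sub>R (y /\<^sub>R norm y)"
      using xy by (simp add: algebra_simps)
    also have "norm \<dots> \<le> norm (x - y) + \<bar>norm y - norm x\<bar>"
    proof -
      have "norm ((norm y - norm x) *\<^sub>R (y /\<^sub>R norm y)) = \<bar>norm y - norm x\<bar> * norm (y /\<^sub>R norm y)" by (rule norm_scaleR)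
      also have "norm (y /\<^sub>R norm y) = 1" using xy by simp
      finally show ?thesis using norm_triangle_ineq[of "x - y" "(norm y - norm x) *\<^sub>R (y /\<^sub>R norm y)"] by simp
    qed
    also have "\<dots> \<le> 2 * norm (x - y)"
      using norm_triangle_ineq3[of y x] by (simp add: norm_minus_commute)
    finally have "norm (?v x - ?v y) \<le> \<bar>norm x - norm y\<bar> * M + C * (2 * norm (x - y))"
      using C by (simp add: mult_left_mono)
    moreover have "\<bar>norm x - norm y\<bar> * M \<le> norm (x - y) * M"
      using norm_triangle_ineq3[of x y] M by (intro mult_right_mono)
    ultimately show ?thesis by (simp add: algebra_simps)
  qed
  have zero: "norm (?v x) \<le> (M + 2 * C) * norm x" if "x \<noteq> 0" for x
  proof -
    have "norm x * norm (\<phi> (x /\<^sub>R norm x)) \<le> norm x * (M + 2 * C)"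
      using Mb[OF that] C by (intro mult_left_mono) auto
    then show ?thesis by (simp add: mult.commute)
  qed
  have lip: "norm (?v x - ?v y) \<le> (M + 2 * C) * norm (x - y)" for x y
    using main[of x y] zero[of x] zero[of y] by (cases "x = 0"; cases "y = 0") auto
  have L: "(M + 2 * C)-lipschitz_on UNIV ?v"
    using lip M C by (intro lipschitz_onI) (auto simp: dist_norm)
  show ?thesis
    unfolding plateau_competitors_def
  proof (intro CollectI conjI ballI)
    show "\<exists>C. C-lipschitz_on (ball 0 1) ?v"
      using lipschitz_on_subset[OF L, of "ball 0 1"] by blast
    fix x :: "real^2" assume x: "x \<in> sphere 0 1"
    have "continuous_on UNIV ?v" by (rule lipschitz_on_continuous_on[OF L])
    then have "(?v \<longlongrightarrow> ?v x) (at x within ball 0 1)"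
      by (auto simp: continuous_on_def intro: tendsto_within_subset)
    then show "(?v \<longlongrightarrow> \<phi> x) (at x within ball 0 1)" using x by simp
  qed
qed

section \<open>Sequences of recovery maps\<close>

lemma loop_nn_integral:
  fixes g :: "real => real"
  assumes g: "loop g" "\<And>t. g t \<ge> 0"
  shows "(\<integral>\<^sup>+t\<in>{0..2*pi}. ennreal (g t) \<partial>lborel) = ennreal (integral {0..2*pi} g)"
proof -
  note i = loop_integrable(2)[OF g(1), of 0 "2*pi"]
  have "(\<integral>\<^sup>+t\<in>{0..2*pi}. ennreal (g t) \<partial>lborel) = (\<integral>\<^sup>+t. ennreal (indicator {0..2*pi} t *\<^sub>R g t) \<partial>lborel)"
    by (intro nn_integral_cong) (auto simp: indicator_def)
  also have "\<dots> = ennreal (LINT t:{0..2*pi}|lborel. g t)"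
    unfolding set_lebesgue_integral_def using i g(2)
    by (intro nn_integral_eq_integral) (auto simp: set_integrable_def indicator_def)
  finally show ?thesis using set_borel_integral_eq_integral(2)[OF i] by simp
qed

lemma angular_nn_integral_le:
  fixes g :: "real => real"
  assumes g: "loop g" "\<And>t. g t \<ge> 0" and r: "r > 0"
  shows "disk_int r (\<lambda>x. ennreal (g (angle x))) \<le> ennreal (r\<^sup>2 * integral {0..2*pi} g)"
proof -
  have [measurable]: "g \<in> borel_fun" using loopD(1)[OF g(1)] .
  have "disk_int r (\<lambda>x. ennreal (g (angle x))) = disk_int r (\<lambda>x. 1 * ennreal (g (angle x)))"
    by simp
  also have "\<dots> = (\<integral>\<^sup>+\<rho>\<in>{0<..<r}. ennreal \<rho> * 1 \<partial>lborel) * (arc_int (\<lambda>t. ennreal (g t)))"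
    using nn_integral_polar_product[of "\<lambda>_. 1" "\<lambda>t. ennreal (g t)" r] by simp
  also have "(\<integral>\<^sup>+\<rho>\<in>{0<..<r}. ennreal \<rho> * 1 \<partial>lborel) \<le> (\<integral>\<^sup>+\<rho>. ennreal r * indicator {0<..<r} \<rho> \<partial>lborel)"
    by (intro nn_integral_mono) (auto simp: indicator_def ennreal_leI)
  also have "\<dots> = ennreal (r\<^sup>2)" using r by (subst nn_integral_cmult_indicator) (auto simp: ennreal_mult[symmetric] power2_eq_square)
  also have "arc_int (\<lambda>t. ennreal (g t)) = ennreal (integral {0..2*pi} g)"
    unfolding nn_integral_open_closed_interval by (rule loop_nn_integral[OF g])
  also have "ennreal (r\<^sup>2) * ennreal (integral {0..2*pi} g) = ennreal (r\<^sup>2 * integral {0..2*pi} g)"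
    by (simp add: ennreal_mult')
  finally show ?thesis by (simp add: mult_right_mono)
qed

lemma angular_integrable:
  fixes f :: "real => real^2"
  assumes "loop f"
  shows "set_integrable lborel (ball (0::real^2) r) (\<lambda>x. f (angle x))"
proof -
  have [measurable]: "f \<in> borel_fun" using loopD(1)[OF assms] .
  obtain B where B: "\<And>t. norm (f t) \<le> B" using loop_bound[OF assms] by blast
  show ?thesis by (rule bounded_borel_integrable_on(1)[OF _ _ _ B]) auto
qed

text \<open>The variation of \<open>\<phi> k\<close> enters the bounds as it is, so the lemma serves
  twice: with Steklov averages for the total variation of the limit, and with strictly convergent
  loops for the upper bound.\<close>

lemma recovery_sequence:
  fixes f :: "real => real^2" and \<phi> v :: "nat => real^2 => real^2"
  assumes f: "loop f" and \<phi>: "\<And>k. \<exists>C. C-lipschitz_on (sphere 0 1) (\<phi> k)" and v: "\<And>k. v k \<in> plateau_competitors (\<phi> k)"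
    and lim: "(\<lambda>k. integral {0..2*pi} (\<lambda>t. norm (\<phi> k (circ t) - f t))) \<longlonglongrightarrow> 0" and r: "r > 0"
  obtains w where "\<And>k. C1_on UNIV (w k)" "\<And>k. integrable (lebesgue_on (ball 0 r)) (w k)"
    "(\<lambda>k. LINT x|lebesgue_on (ball 0 r). norm (w k x - f (angle x))) \<longlonglongrightarrow> 0"
    "\<And>k. total_variation (ball 0 r) (w k) \<le> ennreal r * circle_variation (\<phi> k) + ennreal (inverse (Suc k))"
    "\<And>k. area (w k) (ball 0 r) \<le> ennreal (pi * r\<^sup>2) + ennreal r * circle_variation (\<phi> k) +
       (\<integral>\<^sup>+x. ennreal \<bar>det (grad (v k) x)\<bar> \<partial>lebesgue_on (ball 0 1)) + ennreal (inverse (Suc k))"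
proof -
  define P where "P = (\<lambda>k w. C1_on UNIV w \<and>
    (disk_int r (\<lambda>x. ennreal (norm (w x - \<phi> k (x /\<^sub>R norm x))))) \<le> ennreal (inverse (Suc k)) \<and>
    (disk_int r (\<lambda>x. ennreal (norm (grad w x)))) \<le> ennreal r * circle_variation (\<phi> k) + ennreal (inverse (Suc k)) \<and>
    area w (ball 0 r) \<le> ennreal (pi * r\<^sup>2) + ennreal r * circle_variation (\<phi> k) +
       (\<integral>\<^sup>+x. ennreal \<bar>det (grad (v k) x)\<bar> \<partial>lebesgue_on (ball 0 1)) + ennreal (inverse (Suc k)))"
  have "\<exists>w. P k w" for k
  proof -
    have "inverse (real (Suc k)) > 0" by simp
    from recovery[OF \<phi>[of k] v[of k] r this] show ?thesis unfolding P_def by blast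
  qed
  then have "\<forall>k. \<exists>w. P k w" by blast
  from choice[OF this] obtain w where Pw: "\<forall>k. P k (w k)" ..
  have w: "C1_on UNIV (w k)"
    "disk_int r (\<lambda>x. ennreal (norm (w k x - \<phi> k (x /\<^sub>R norm x)))) \<le> ennreal (inverse (Suc k))"
    "disk_int r (\<lambda>x. ennreal (norm (grad (w k) x))) \<le> ennreal r * circle_variation (\<phi> k) + ennreal (inverse (Suc k))"
    "area (w k) (ball 0 r) \<le> ennreal (pi * r\<^sup>2) + ennreal r * circle_variation (\<phi> k) +
       (\<integral>\<^sup>+x. ennreal \<bar>det (grad (v k) x)\<bar> \<partial>lebesgue_on (ball 0 1)) + ennreal (inverse (Suc k))" for k
    using Pw[rule_format, of k] unfolding P_def by blast+
  have wC1: "C1_on (ball 0 r) (w k)" for k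
    using w(1)[of k] unfolding C1_on_def by (meson UNIV_I continuous_on_subset subset_UNIV)
  have wc: "continuous_on UNIV (w k)" for k
    using w(1)[of k] unfolding C1_on_def by (blast intro: continuous_at_imp_continuous_on has_derivative_continuous)
  have [measurable]: "w k \<in> borel_fun" for k by (rule borel_measurable_continuous_onI[OF wc])
  have [measurable]: "f \<in> borel_fun" using loopD(1)[OF f] .
  have bm [measurable]: "ball (0::real^2) r \<in> sets borel" by simp
  have si: "set_integrable lborel (ball 0 r) (w k)" for k
  proof -
    have "set_integrable lborel (cball 0 r) (w k)"
      unfolding set_integrable_def by (rule borel_integrable_compact) (auto intro: continuous_on_subset[OF wc])
    then show ?thesis by (rule set_integrable_subset) auto
  qed
  have di: "set_integrable lborel (ball 0 r) (\<lambda>x. norm (w k x - f (angle x)))" for k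
    by (intro set_integrable_norm set_integral_diff(1) si angular_integrable f)
  have gl: "loop (\<lambda>t. \<phi> k (circ t))" for k
    using \<phi>[of k] lipschitz_sphere_loop(2) by blast
  define I where "I = (\<lambda>k. integral {0..2*pi} (\<lambda>t. norm (\<phi> k (circ t) - f t)))"
  have I0: "I k \<ge> 0" for k
    unfolding I_def by (intro Henstock_Kurzweil_Integration.integral_nonneg loop_integrable(1) loop_norm_diff(1) gl f) auto
  have L: "(LINT x|lebesgue_on (ball 0 r). norm (w k x - f (angle x))) \<le> inverse (real (Suc k)) + r\<^sup>2 * I k" for k
  proof -
    have gk [measurable]: "(\<lambda>t. \<phi> k (circ t)) \<in> borel_fun" using loopD(1)[OF gl] .
    have "ennreal (LINT x|lebesgue_on (ball 0 r). norm (w k x - f (angle x))) = ennreal (LINT x:ball 0 r|lborel. norm (w k x - f (angle x)))"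
      using lint_lebesgue_on_lborel[OF di bm] by simp
    also have "\<dots> = (\<integral>\<^sup>+x. ennreal (indicator (ball 0 r) x *\<^sub>R norm (w k x - f (angle x))) \<partial>lborel)"
      unfolding set_lebesgue_integral_def using di[of k] by (intro nn_integral_eq_integral[symmetric]) (auto simp: set_integrable_def)
    also have "\<dots> \<le> (\<integral>\<^sup>+x. ennreal (norm (w k x - \<phi> k (circ (angle x)))) * indicator (ball 0 r) x + ennreal (norm (\<phi> k (circ (angle x)) - f (angle x))) * indicator (ball 0 r) x \<partial>lborel)"
    proof (rule nn_integral_mono)
      fix x :: "real^2"
      have "ennreal (norm (w k x - f (angle x))) \<le> ennreal (norm (w k x - \<phi> k (circ (angle x))) + norm (\<phi> k (circ (angle x)) - f (angle x)))"
        using norm_triangle_ineq[of "w k x - \<phi> k (circ (angle x))" "\<phi> k (circ (angle x)) - f (angle x)"] by (intro ennreal_leI) simp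
      then show "ennreal (indicator (ball 0 r) x *\<^sub>R norm (w k x - f (angle x))) \<le> ennreal (norm (w k x - \<phi> k (circ (angle x)))) * indicator (ball 0 r) x + ennreal (norm (\<phi> k (circ (angle x)) - f (angle x))) * indicator (ball 0 r) x"
        by (auto simp: indicator_def)
    qed
    also have "\<dots> = disk_int r (\<lambda>x. ennreal (norm (w k x - \<phi> k (circ (angle x))))) + disk_int r (\<lambda>x. ennreal (norm (\<phi> k (circ (angle x)) - f (angle x))))"
    proof (rule nn_integral_add)
      have "(\<lambda>x. (\<lambda>t. \<phi> k (circ t)) (angle x)) \<in> borel_fun" by measurable
      then have [measurable]: "(\<lambda>x. \<phi> k (circ (angle x))) \<in> borel_fun" by simp
      show "(\<lambda>x. ennreal (norm (w k x - \<phi> k (circ (angle x)))) * indicator (ball 0 r) x) \<in> borel_measurable lborel" by measurable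
      show "(\<lambda>x. ennreal (norm (\<phi> k (circ (angle x)) - f (angle x))) * indicator (ball 0 r) x) \<in> borel_measurable lborel" by measurable
    qed
    also have "disk_int r (\<lambda>x. ennreal (norm (w k x - \<phi> k (circ (angle x))))) = disk_int r (\<lambda>x. ennreal (norm (w k x - \<phi> k (x /\<^sub>R norm x))))"
      by (rule nn_integral_cong_AE, use AE_nonzero in eventually_elim) (simp add: angle_normalize)
    also have "\<dots> \<le> ennreal (inverse (Suc k))" by (rule w(2))
    also have "disk_int r (\<lambda>x. ennreal (norm (\<phi> k (circ (angle x)) - f (angle x)))) \<le> ennreal (r\<^sup>2 * I k)"
      unfolding I_def by (rule angular_nn_integral_le[OF loop_norm_diff(1)[OF gl f] norm_ge_zero r])
    also have "ennreal (inverse (Suc k)) + ennreal (r\<^sup>2 * I k) = ennreal (inverse (Suc k) + r\<^sup>2 * I k)"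
      using I0[of k] by (intro ennreal_plus[symmetric]) auto
    finally have "ennreal (LINT x|lebesgue_on (ball 0 r). norm (w k x - f (angle x))) \<le> ennreal (inverse (Suc k) + r\<^sup>2 * I k)"
      by (simp add: add_mono)
    then show ?thesis using I0[of k] by (subst (asm) ennreal_le_iff) (auto simp del: of_nat_Suc)
  qed
  have L0: "(\<lambda>k. LINT x|lebesgue_on (ball 0 r). norm (w k x - f (angle x))) \<longlonglongrightarrow> 0"
  proof (rule tendsto_sandwich[OF _ _ tendsto_const])
    show "\<forall>\<^sub>F k in sequentially. 0 \<le> (LINT x|lebesgue_on (ball 0 r). norm (w k x - f (angle x)))"
      by (intro always_eventually allI integral_nonneg_AE AE_I2) simp
    show "\<forall>\<^sub>F k in sequentially. (LINT x|lebesgue_on (ball 0 r). norm (w k x - f (angle x))) \<le> inverse (real (Suc k)) + r\<^sup>2 * I k"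
      using L by (intro always_eventually allI)
    have "(\<lambda>k. inverse (real (Suc k)) + r\<^sup>2 * I k) \<longlonglongrightarrow> 0 + r\<^sup>2 * 0"
      unfolding I_def by (intro tendsto_intros LIMSEQ_inverse_real_of_nat lim)
    then show "(\<lambda>k. inverse (real (Suc k)) + r\<^sup>2 * I k) \<longlonglongrightarrow> 0" by simp
  qed
  show ?thesis
  proof (rule that[OF w(1) lint_eq_integral(1)[OF si bm] L0 _ w(4)])
    show "total_variation (ball 0 r) (w k) \<le> ennreal r * circle_variation (\<phi> k) + ennreal (inverse (Suc k))" for k
      by (rule order_trans[OF total_variation_le_grad[OF wC1] w(3)])
  qed
qed

section \<open>Total variation of a function of the angle\<close>

lemma tendsto_ennreal_upper:
  fixes c :: "nat => ennreal"
  assumes "c \<longlonglongrightarrow> l"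
  shows "(\<lambda>k. ennreal r * c k + ennreal (inverse (Suc k))) \<longlonglongrightarrow> ennreal r * l"
proof -
  have "(\<lambda>k. ennreal r * c k + ennreal (inverse (Suc k))) \<longlonglongrightarrow> ennreal r * l + ennreal 0"
    by (intro tendsto_add tendsto_ennrealI LIMSEQ_inverse_real_of_nat ennreal_tendsto_cmult assms) simp
  then show ?thesis by simp
qed

lemma cvf_angle_circ:
  assumes "\<And>t. g (t + 2 * pi) = g t"
  shows "circle_variation (\<lambda>x. g (angle x)) = cvf g"
proof -
  have "g (angle (circ t)) = g t" for t
    using circ_angle[of "circ t"] by (intro periodic_circ_eq[where \<psi>=g, OF assms]) simp
  then show ?thesis by (simp add: circle_variation_eq_cvf)
qed

text \<open>For the upper estimate, the recovery maps of the Steklov averages have variation at most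
  \<open>ennreal r * cvf f\<close> up to a vanishing error, and total variation is lower
  semicontinuous in L1.\<close>

lemma total_variation_angular:
  fixes f :: "real => real^2"
  assumes f: "loop f" and r: "r > 0"
  shows "total_variation (ball 0 r) (\<lambda>x. f (angle x)) = ennreal r * cvf f"
proof (rule antisym[OF _ angular_variation_le[OF f r]])
  define g where "g = (\<lambda>k. steklov (inverse (Suc k)) f)"
  define \<phi> where "\<phi> = (\<lambda>k x. g k (angle x))"
  obtain B where B: "\<And>t. norm (f t) \<le> B" using loop_bound[OF f] by blast
  have gl: "loop (g k)" for k unfolding g_def by (rule steklov_loop[OF f inverse_Suc_le(2)])
  have lip: "\<exists>C. C-lipschitz_on (sphere 0 1) (\<phi> k)" for k
    unfolding \<phi>_def using lipschitz_loop_sphere[OF steklov_lipschitz[OF f B inverse_Suc_le(2)[of k]]] loopD(2)[OF gl[of k]]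
    unfolding g_def by blast
  have cv: "circle_variation (\<phi> k) \<le> cvf f" for k
    unfolding \<phi>_def cvf_angle_circ[of "g k", OF loopD(2)[OF gl]] unfolding g_def
    by (rule cvf_steklov_le[OF f inverse_Suc_le(2,1)])
  have eq: "\<phi> k (circ t) = g k t" for k t
    unfolding \<phi>_def using circ_angle[of "circ t"] by (intro periodic_circ_eq[where \<psi>="g k", OF loopD(2)[OF gl]]) simp
  have lim: "(\<lambda>k. integral {0..2*pi} (\<lambda>t. norm (\<phi> k (circ t) - f t))) \<longlonglongrightarrow> 0"
    unfolding eq unfolding g_def by (rule steklov_L1[OF f])
  define v where "v = (\<lambda>k x. norm x *\<^sub>R \<phi> k (x /\<^sub>R norm x))"
  have v: "v k \<in> plateau_competitors (\<phi> k)" for k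
    using lip[of k] conic_competitor unfolding v_def by blast
  obtain w where w: "\<And>k. C1_on UNIV (w k)" "\<And>k. integrable (lebesgue_on (ball 0 r)) (w k)"
    "(\<lambda>k. LINT x|lebesgue_on (ball 0 r). norm (w k x - f (angle x))) \<longlonglongrightarrow> 0"
    "\<And>k. total_variation (ball 0 r) (w k) \<le> ennreal r * circle_variation (\<phi> k) + ennreal (inverse (Suc k))"
    "\<And>k. area (w k) (ball 0 r) \<le> ennreal (pi * r\<^sup>2) + ennreal r * circle_variation (\<phi> k) +
       (\<integral>\<^sup>+x. ennreal \<bar>det (grad (v k) x)\<bar> \<partial>lebesgue_on (ball 0 1)) + ennreal (inverse (Suc k))"
    by (rule recovery_sequence[OF f lip v lim r], rule that)
  have "total_variation (ball 0 r) (\<lambda>x. f (angle x)) \<le> liminf (\<lambda>k. total_variation (ball 0 r) (w k))"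
    by (rule total_variation_lsc[OF w(2) lint_eq_integral(1)[OF angular_integrable[OF f]] w(3)]) simp
  also have "\<dots> \<le> liminf (\<lambda>k. ennreal r * cvf f + ennreal (inverse (Suc k)))"
    by (intro Liminf_mono always_eventually allI order_trans[OF w(4)] add_right_mono mult_left_mono cv) simp
  also have "\<dots> = ennreal r * cvf f"
    by (rule lim_imp_Liminf[OF _ tendsto_ennreal_upper[OF tendsto_const]]) simp
  finally show "total_variation (ball 0 r) (\<lambda>x. f (angle x)) \<le> ennreal r * cvf f" .
qed

section \<open>Changes on null sets\<close>

lemma AE_angle:
  assumes "AE t in lborel. t \<in> {0..2*pi} \<longrightarrow> Q t"
  shows "AE x in lborel. x \<in> ball (0::real^2) r \<longrightarrow> Q (angle x)"
proof -
  obtain N where N: "N \<in> null_sets lborel" "\<And>t. t \<notin> N ==> t \<in> {0..2*pi} \<longrightarrow> Q t"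
    using assms by (auto elim!: AE_E3)
  have Nm [measurable]: "N \<in> sets borel" using N(1) by (auto simp: null_sets_def)
  have bm [measurable]: "ball (0::real^2) r \<in> sets borel" by simp
  have "disk_int r (\<lambda>x. 1 * indicator N (angle x)) = (\<integral>\<^sup>+\<rho>\<in>{0<..<r}. ennreal \<rho> * 1 \<partial>lborel) * (arc_int (\<lambda>t. indicator N t))"
    by (rule nn_integral_polar_product) measurable
  also have "arc_int (\<lambda>t. indicator N t) = 0"
  proof -
    have "arc_int (\<lambda>t. indicator N t) \<le> (\<integral>\<^sup>+t. indicator N t \<partial>lborel)"
      by (intro nn_integral_mono) (auto simp: indicator_def)
    also have "\<dots> = 0" using N(1) by (simp add: null_sets_def)
    finally show ?thesis by simp
  qed
  finally have "disk_int r (\<lambda>x. 1 * indicator N (angle x)) = 0" by simp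
  moreover have "(\<lambda>x. 1 * indicator N (angle x) * indicator (ball (0::real^2) r) x :: ennreal) \<in> borel_measurable lborel"
    by measurable
  ultimately have "AE x in lborel. 1 * indicator N (angle x) * indicator (ball (0::real^2) r) x = (0::ennreal)"
    by (subst (asm) nn_integral_0_iff_AE) auto
  then show ?thesis
  proof eventually_elim
    case (elim x)
    then show ?case using N(2)[of "angle x"] angle_bounds[of x] by (auto simp: indicator_def split: if_splits)
  qed
qed

lemma integrable_cong_AE_lebesgue_on:
  fixes F G :: "'a::euclidean_space => 'b::euclidean_space"
  assumes S: "S \<in> sets borel" and eq: "AE x in lebesgue_on S. F x = G x" and F: "integrable (lebesgue_on S) F"
  shows "integrable (lebesgue_on S) G"
proof -
  have "AE x in lebesgue. x \<in> S \<longrightarrow> F x = G x"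
    using eq S by (subst (asm) AE_restrict_space_iff) auto
  then obtain N where N: "N \<in> null_sets lebesgue" "\<And>x. x \<notin> N ==> x \<in> S \<longrightarrow> F x = G x"
    by (auto elim!: AE_E3)
  have "F absolutely_integrable_on S"
    using F S unfolding set_integrable_def by (subst (asm) integrable_restrict_space) auto
  then have "G absolutely_integrable_on S"
    by (rule absolutely_integrable_spike[where S=N]) (use N in \<open>auto simp: negligible_iff_null_sets\<close>)
  then show ?thesis
    using S unfolding set_integrable_def by (subst integrable_restrict_space) auto
qed

text \<open>If one side is not integrable, neither is the other, and both integrals have the default
  value 0.\<close>

lemma lint_cong_AE_lebesgue_on:
  fixes F G :: "'a::euclidean_space => 'b::euclidean_space"
  assumes S: "S \<in> sets borel" and eq: "AE x in lebesgue_on S. F x = G x"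
  shows "(LINT x|lebesgue_on S. F x) = (LINT x|lebesgue_on S. G x)"
proof (cases "integrable (lebesgue_on S) F")
  case True
  then show ?thesis using integrable_cong_AE_lebesgue_on[OF S eq True] eq by (intro integral_cong_AE) auto
next
  case False
  have "AE x in lebesgue_on S. G x = F x" using eq by eventually_elim simp
  then have "\<not> integrable (lebesgue_on S) G" using False integrable_cong_AE_lebesgue_on[OF S] by blast
  then show ?thesis using False by (simp add: not_integrable_integral_eq)
qed

text \<open>The limit map enters only through its integrability, its variation and its L1 distance
  to the approximating maps, and none of these sees null sets.\<close>

lemma relaxed_area_cong:
  assumes eq: "AE x in lebesgue_on (ball 0 r). u x = u' x"
  shows "relaxed_area u (ball 0 r) = relaxed_area u' (ball 0 r)"
proof -
  have eq': "AE x in lebesgue_on (ball 0 r). u' x = u x" using eq by eventually_elim simp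
  have b: "ball (0::real^2) r \<in> sets borel" by simp
  have tv: "total_variation (ball 0 r) u = total_variation (ball 0 r) u'"
    unfolding total_variation_def
    by (intro SUP_cong refl arg_cong[where f=ennreal] lint_cong_AE_lebesgue_on[OF b], use eq in eventually_elim) simp
  have i: "integrable (lebesgue_on (ball 0 r)) u \<longleftrightarrow> integrable (lebesgue_on (ball 0 r)) u'"
    using integrable_cong_AE_lebesgue_on[OF b] eq eq' by blast
  have l: "(LINT x|lebesgue_on (ball 0 r). norm (w k x - u x)) = (LINT x|lebesgue_on (ball 0 r). norm (w k x - u' x))" for w :: "nat => real^2 => real^2" and k
    by (intro lint_cong_AE_lebesgue_on[OF b], use eq in eventually_elim) simp
  show ?thesis unfolding relaxed_area_def strict_BV_conv_def BV_def l by (simp add: tv i)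
qed

lemma circle_variation_cong:
  assumes eq: "AE t in lebesgue_on {0..2*pi}. \<gamma> (circ t) = \<gamma>' (circ t)"
  shows "circle_variation \<gamma> = circle_variation \<gamma>'"
  unfolding circle_variation_def
  by (intro SUP_cong refl arg_cong[where f=ennreal] lint_cong_AE_lebesgue_on, simp, use eq in eventually_elim) simp

lemma relaxed_plateau_cong:
  assumes eq: "AE t in lebesgue_on {0..2*pi}. \<gamma> (circ t) = \<gamma>' (circ t)"
  shows "relaxed_plateau \<gamma> = relaxed_plateau \<gamma>'"
proof -
  have eq': "AE t in lebesgue_on {0..2*pi}. \<gamma>' (circ t) = \<gamma> (circ t)" using eq by eventually_elim simp
  have b: "{0..2*pi} \<in> sets borel" by simp
  have i: "integrable (lebesgue_on {0..2*pi}) (\<lambda>t. \<gamma> (circ t)) \<longleftrightarrow> integrable (lebesgue_on {0..2*pi}) (\<lambda>t. \<gamma>' (circ t))"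
    using integrable_cong_AE_lebesgue_on[OF b eq] integrable_cong_AE_lebesgue_on[OF b eq'] by blast
  have l: "(LINT t|lebesgue_on {0..2*pi}. norm (\<phi> k (circ t) - \<gamma> (circ t))) = (LINT t|lebesgue_on {0..2*pi}. norm (\<phi> k (circ t) - \<gamma>' (circ t)))" for \<phi> :: "nat => real^2 => real^2" and k
    by (intro lint_cong_AE_lebesgue_on[OF b], use eq in eventually_elim) simp
  show ?thesis unfolding relaxed_plateau_def circle_strict_conv_def circle_BV_def l
    by (simp add: i circle_variation_cong[OF eq])
qed

section \<open>The upper bound\<close>

lemma liminf_add_tendsto_le:
  fixes a p :: "nat => ennreal"
  assumes "a \<longlonglongrightarrow> a0"
  shows "liminf (\<lambda>k. a k + p k) \<le> a0 + liminf p"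
proof -
  obtain s where s: "strict_mono s" "(p \<circ> s) \<longlonglongrightarrow> liminf p" using liminf_subseq_lim by blast
  have "(\<lambda>k. a (s k) + p (s k)) \<longlonglongrightarrow> a0 + liminf p"
    using s(2) LIMSEQ_subseq_LIMSEQ[OF assms s(1)] by (intro tendsto_add) (auto simp: o_def)
  then have "liminf ((\<lambda>k. a k + p k) \<circ> s) = a0 + liminf p"
    by (intro lim_imp_Liminf) (auto simp: o_def)
  then show ?thesis using liminf_subseq_mono[OF s(1), of "\<lambda>k. a k + p k"] by simp
qed

lemma angular_circ:
  assumes "loop f"
  shows "f (angle (circ t)) = f t"
  using circ_angle[of "circ t"] by (intro periodic_circ_eq[where \<psi>=f, OF loopD(2)[OF assms]]) simp

text \<open>The infimum need not be attained; if it is infinite, any competitor satisfies the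
  bound.\<close>

lemma plateau_almost_attained:
  assumes lip: "\<exists>C. C-lipschitz_on (sphere 0 1) \<phi>" and e: "e > 0"
  shows "\<exists>v\<in>plateau_competitors \<phi>. (\<integral>\<^sup>+x. ennreal \<bar>det (grad v x)\<bar> \<partial>lebesgue_on (ball 0 1)) \<le> plateau \<phi> + ennreal e"
proof (cases "plateau \<phi>")
  case (real p)
  then have "plateau \<phi> < plateau \<phi> + ennreal e"
    using e by (auto simp: ennreal_plus[symmetric] ennreal_lessI simp del: ennreal_plus)
  then obtain v where "v \<in> plateau_competitors \<phi>" "(\<integral>\<^sup>+x. ennreal \<bar>det (grad v x)\<bar> \<partial>lebesgue_on (ball 0 1)) < plateau \<phi> + ennreal e"
    unfolding plateau_def[of \<phi>] INF_less_iff by blast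
  then show ?thesis by (intro bexI[of _ v]) auto
next
  case top
  then show ?thesis using lip conic_competitor by fastforce
qed

text \<open>Strict convergence of the recovery maps comes from two sides: their variations are at
  most a sequence tending to the variation of the limit, and lower semicontinuity gives the reverse.
  They are thus admissible in \<open>relaxed_area\<close>, and their areas carry the
  estimate.\<close>

lemma relaxed_area_le:
  fixes f :: "real => real^2"
  assumes f: "loop f" and fin: "cvf f < \<infinity>" and r: "r > 0"
  shows "relaxed_area (\<lambda>x. f (angle x)) (ball 0 r) \<le>
    ennreal (pi * r\<^sup>2) + ennreal r * cvf f + relaxed_plateau (\<lambda>x. f (angle x))"
proof -
  let ?F = "\<lambda>x. f (angle x)"
  let ?A = "ennreal (pi * r\<^sup>2) + ennreal r * cvf f"
  have cF: "circle_variation ?F = cvf f" by (rule cvf_angle_circ[where g=f, OF loopD(2)[OF f]])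
  have iF: "integrable (lebesgue_on (ball 0 r)) ?F"
    by (rule lint_eq_integral(1)[OF angular_integrable[OF f]]) simp
  have step: "relaxed_area ?F (ball 0 r) \<le> ?A + liminf (\<lambda>k. plateau (\<phi> k))"
    if lip: "\<And>k. \<exists>C. C-lipschitz_on (sphere 0 1) (\<phi> k)" and conv: "circle_strict_conv \<phi> ?F" for \<phi>
  proof -
    have cb: "circle_variation (\<phi> k) < \<infinity>" for k
      using conv by (simp add: circle_strict_conv_def circle_BV_def)
    have cv: "(\<lambda>k. circle_variation (\<phi> k)) \<longlonglongrightarrow> cvf f"
      using conv by (simp add: circle_strict_conv_def cF)
    have "(LINT t|lebesgue_on {0..2*pi}. norm (\<phi> k (circ t) - ?F (circ t))) = integral {0..2*pi} (\<lambda>t. norm (\<phi> k (circ t) - f t))" for k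
    proof -
      obtain C where C: "C-lipschitz_on (sphere 0 1) (\<phi> k)" using lip by blast
      show ?thesis unfolding angular_circ[OF f]
        by (rule lint_eq_integral(2)[OF loop_integrable(2)[OF loop_norm_diff(1)[OF lipschitz_sphere_loop(2)[OF C] f]]]) simp
    qed
    then have lim: "(\<lambda>k. integral {0..2*pi} (\<lambda>t. norm (\<phi> k (circ t) - f t))) \<longlonglongrightarrow> 0"
      using conv by (simp add: circle_strict_conv_def)
    have "\<forall>k. \<exists>v. v \<in> plateau_competitors (\<phi> k) \<and> (\<integral>\<^sup>+x. ennreal \<bar>det (grad v x)\<bar> \<partial>lebesgue_on (ball 0 1)) \<le> plateau (\<phi> k) + ennreal (inverse (Suc k))"
      using plateau_almost_attained[OF lip] by (simp add: Bex_def del: of_nat_Suc)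
    from choice[OF this] obtain v where v: "\<And>k. v k \<in> plateau_competitors (\<phi> k)"
      "\<And>k. (\<integral>\<^sup>+x. ennreal \<bar>det (grad (v k) x)\<bar> \<partial>lebesgue_on (ball 0 1)) \<le> plateau (\<phi> k) + ennreal (inverse (Suc k))"
      by blast
    obtain w where w: "\<And>k. C1_on UNIV (w k)" "\<And>k. integrable (lebesgue_on (ball 0 r)) (w k)"
      "(\<lambda>k. LINT x|lebesgue_on (ball 0 r). norm (w k x - ?F x)) \<longlonglongrightarrow> 0"
      "\<And>k. total_variation (ball 0 r) (w k) \<le> ennreal r * circle_variation (\<phi> k) + ennreal (inverse (Suc k))"
      "\<And>k. area (w k) (ball 0 r) \<le> ennreal (pi * r\<^sup>2) + ennreal r * circle_variation (\<phi> k) +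
         (\<integral>\<^sup>+x. ennreal \<bar>det (grad (v k) x)\<bar> \<partial>lebesgue_on (ball 0 1)) + ennreal (inverse (Suc k))"
      by (rule recovery_sequence[OF f lip v(1) lim r], rule that)
    note tF = total_variation_angular[OF f r]
    have up: "(\<lambda>k. ennreal r * circle_variation (\<phi> k) + ennreal (inverse (Suc k))) \<longlonglongrightarrow> total_variation (ball 0 r) ?F"
      unfolding tF by (rule tendsto_ennreal_upper[OF cv])
    have lo: "total_variation (ball 0 r) ?F \<le> liminf (\<lambda>k. total_variation (ball 0 r) (w k))"
      by (rule total_variation_lsc[OF w(2) iF w(3)])
    have hi: "limsup (\<lambda>k. total_variation (ball 0 r) (w k)) \<le> total_variation (ball 0 r) ?F"
    proof -
      have "limsup (\<lambda>k. total_variation (ball 0 r) (w k)) \<le> limsup (\<lambda>k. ennreal r * circle_variation (\<phi> k) + ennreal (inverse (Suc k)))"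
        by (intro Limsup_mono always_eventually allI w(4))
      also have "\<dots> = total_variation (ball 0 r) ?F" by (rule lim_imp_Limsup[OF _ up]) simp
      finally show ?thesis .
    qed
    have tv: "(\<lambda>k. total_variation (ball 0 r) (w k)) \<longlonglongrightarrow> total_variation (ball 0 r) ?F"
      using lo hi Liminf_le_Limsup[of sequentially "\<lambda>k. total_variation (ball 0 r) (w k)"]
      by (subst tendsto_iff_Liminf_eq_Limsup) auto
    have wBV: "w k \<in> BV (ball 0 r)" for k
    proof -
      have "ennreal r * circle_variation (\<phi> k) + ennreal (inverse (Suc k)) < \<infinity>"
        using cb[of k] by (simp add: ennreal_mult_less_top)
      from order_le_less_trans[OF w(4) this] show ?thesis using w(2) by (simp add: BV_def)
    qed
    have FBV: "?F \<in> BV (ball 0 r)"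
      using iF fin by (simp add: BV_def tF ennreal_mult_less_top)
    have wC1: "C1_on (ball 0 r) (w k)" for k
      using w(1)[of k] unfolding C1_on_def by (meson UNIV_I continuous_on_subset subset_UNIV)
    have "relaxed_area ?F (ball 0 r) \<le> liminf (\<lambda>k. area (w k) (ball 0 r))"
      unfolding relaxed_area_def by (rule INF_lower) (use wC1 wBV FBV w(3) tv in \<open>simp add: strict_BV_conv_def\<close>)
    also have "\<dots> \<le> liminf (\<lambda>k. (ennreal (pi * r\<^sup>2) + ennreal r * circle_variation (\<phi> k) + ennreal (inverse (Suc k)) + ennreal (inverse (Suc k))) + plateau (\<phi> k))"
    proof (intro Liminf_mono always_eventually allI)
      fix k
      show "area (w k) (ball 0 r) \<le> (ennreal (pi * r\<^sup>2) + ennreal r * circle_variation (\<phi> k) + ennreal (inverse (Suc k)) + ennreal (inverse (Suc k))) + plateau (\<phi> k)"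
        by (rule order_trans[OF w(5)], rule order_trans[OF add_right_mono[OF add_left_mono[OF v(2)]]]) (simp add: ac_simps)
    qed
    also have "\<dots> \<le> (ennreal (pi * r\<^sup>2) + ennreal r * cvf f + ennreal 0 + ennreal 0) + liminf (\<lambda>k. plateau (\<phi> k))"
      by (intro liminf_add_tendsto_le tendsto_add tendsto_const tendsto_ennrealI LIMSEQ_inverse_real_of_nat ennreal_tendsto_cmult cv) simp
    finally show ?thesis by simp
  qed
  show ?thesis
  proof (rule ennreal_le_epsilon)
    fix e :: real assume fin': "?A + relaxed_plateau ?F < top" and e: "e > 0"
    then obtain p where p: "relaxed_plateau ?F = ennreal p" "p \<ge> 0" by (cases "relaxed_plateau ?F") auto
    have "relaxed_plateau ?F < relaxed_plateau ?F + ennreal e"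
      using e p by (auto simp: ennreal_plus[symmetric] ennreal_lessI simp del: ennreal_plus)
    then obtain \<phi> where \<phi>: "\<And>k. \<exists>C. C-lipschitz_on (sphere 0 1) (\<phi> k)" "circle_strict_conv \<phi> ?F"
      "liminf (\<lambda>k. plateau (\<phi> k)) < relaxed_plateau ?F + ennreal e"
      unfolding relaxed_plateau_def[of ?F] INF_less_iff by blast
    have "relaxed_area ?F (ball 0 r) \<le> ?A + liminf (\<lambda>k. plateau (\<phi> k))" by (rule step[OF \<phi>(1,2)])
    also have "\<dots> \<le> ?A + (relaxed_plateau ?F + ennreal e)" using \<phi>(3) by (intro add_left_mono) simp
    finally show "relaxed_area ?F (ball 0 r) \<le> ?A + relaxed_plateau ?F + ennreal e" by (simp add: ac_simps)
  qed
qed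

section \<open>Traces on circles and integrals over annuli\<close>

lemma ball_measurable_pieces:
  assumes w: "C1_on (ball 0 r) w"
  shows "(\<lambda>z. ennreal (norm (grad w z)) * indicator (ball 0 r) z) \<in> borel_fun"
    "(\<lambda>z. ennreal \<bar>det (grad w z)\<bar> * indicator (ball 0 r) z) \<in> borel_fun"
    "loop f ==> (\<lambda>z. ennreal (norm (w z - f (angle z))) * indicator (ball 0 r) z) \<in> borel_fun"
proof -
  have bm [measurable]: "ball (0::real^2) r \<in> sets borel" by simp
  have [measurable]: "(\<lambda>x. indicator (ball 0 r) x *\<^sub>R grad w x) \<in> borel_fun" by (rule measurable_grad_ball[OF w])
  have "(\<lambda>z. ennreal (norm (grad w z)) * indicator (ball 0 r) z) = (\<lambda>z. ennreal (norm (indicator (ball 0 r) z *\<^sub>R grad w z)))"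
    by (auto simp: indicator_def fun_eq_iff)
  also have "\<dots> \<in> borel_fun" by measurable
  finally show "(\<lambda>z. ennreal (norm (grad w z)) * indicator (ball 0 r) z) \<in> borel_fun" .
  have "continuous_on (ball 0 r) (\<lambda>z. det (grad w z))"
    unfolding det_2 by (intro continuous_intros continuous_on_grad[OF w])
  then have [measurable]: "(\<lambda>x. indicator (ball 0 r) x *\<^sub>R det (grad w x)) \<in> borel_fun"
    by (intro borel_measurable_continuous_on_indicator bm)
  have "(\<lambda>z. ennreal \<bar>det (grad w z)\<bar> * indicator (ball 0 r) z) = (\<lambda>z. ennreal \<bar>indicator (ball 0 r) z *\<^sub>R det (grad w z)\<bar>)"
    by (auto simp: indicator_def fun_eq_iff)
  also have "\<dots> \<in> borel_fun" by measurable
  finally show "(\<lambda>z. ennreal \<bar>det (grad w z)\<bar> * indicator (ball 0 r) z) \<in> borel_fun" .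
  assume "loop f"
  then have [measurable]: "f \<in> borel_fun" by (rule loopD(1))
  have "continuous_on (ball 0 r) w"
    using w unfolding C1_on_def by (blast intro: continuous_at_imp_continuous_on has_derivative_continuous)
  then have [measurable]: "(\<lambda>x. indicator (ball 0 r) x *\<^sub>R w x) \<in> borel_fun"
    by (intro borel_measurable_continuous_on_indicator bm)
  have "(\<lambda>z. ennreal (norm (w z - f (angle z))) * indicator (ball 0 r) z) = (\<lambda>z. ennreal (norm (indicator (ball 0 r) z *\<^sub>R w z - f (angle z))) * indicator (ball 0 r) z)"
    by (auto simp: indicator_def fun_eq_iff)
  also have "\<dots> \<in> borel_fun" by measurable
  finally show "(\<lambda>z. ennreal (norm (w z - f (angle z))) * indicator (ball 0 r) z) \<in> borel_fun" .
qed

lemma circle_restriction: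
  fixes w :: "real^2 => real^2"
  assumes w: "C1_on (ball 0 r) w" and \<rho>: "0 < \<rho>" "\<rho> < r"
  obtains g' where "\<And>t. ((\<lambda>t. w (\<rho> *\<^sub>R circ t)) has_vector_derivative g' t) (at t)" "continuous_on UNIV g'"
    "loop g'" "loop (\<lambda>t. w (\<rho> *\<^sub>R circ t))" "\<And>t. norm (g' t) \<le> \<rho> * norm (grad w (\<rho> *\<^sub>R circ t))"
proof -
  obtain d1 d2 where d: "\<And>x. x \<in> ball 0 r ==> partials w x (d1 x) (d2 x)" "continuous_on (ball 0 r) d1" "continuous_on (ball 0 r) d2"
    by (rule C1_on_partials[OF w], rule that)
  have inb: "\<rho> *\<^sub>R circ t \<in> ball 0 r" for t using \<rho> by simp
  define g' where "g' = (\<lambda>t. \<rho> *\<^sub>R (cos t *\<^sub>R d2 (\<rho> *\<^sub>R circ t) - sin t *\<^sub>R d1 (\<rho> *\<^sub>R circ t)))"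
  have der: "((\<lambda>t. w (\<rho> *\<^sub>R circ t)) has_vector_derivative g' t) (at t)" for t
    unfolding g'_def by (rule partials_circle_derivative[OF d(1)[OF inb]])
  have cc: "continuous_on UNIV (\<lambda>t. \<rho> *\<^sub>R circ t)" by (intro continuous_intros)
  have c1: "continuous_on UNIV (\<lambda>t. d1 (\<rho> *\<^sub>R circ t))" by (rule continuous_on_compose2[OF d(2) cc]) (use inb in auto)
  have c2: "continuous_on UNIV (\<lambda>t. d2 (\<rho> *\<^sub>R circ t))" by (rule continuous_on_compose2[OF d(3) cc]) (use inb in auto)
  have cg': "continuous_on UNIV g'" unfolding g'_def by (intro continuous_intros c1 c2)
  have cg: "continuous_on UNIV (\<lambda>t. w (\<rho> *\<^sub>R circ t))"
    using der by (blast intro: continuous_at_imp_continuous_on has_vector_derivative_continuous)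
  have le: "norm (g' t) \<le> \<rho> * norm (grad w (\<rho> *\<^sub>R circ t))" for t
  proof -
    let ?a = "d1 (\<rho> *\<^sub>R circ t)" and ?b = "d2 (\<rho> *\<^sub>R circ t)"
    have "(norm (cos t *\<^sub>R ?b - sin t *\<^sub>R ?a))\<^sup>2 \<le> (norm ?a)\<^sup>2 + (norm ?b)\<^sup>2"
      using tangential_norm_le[of t ?b ?a] zero_le_power2[of "norm (cos t *\<^sub>R ?a + sin t *\<^sub>R ?b)"] by linarith
    then have "norm (cos t *\<^sub>R ?b - sin t *\<^sub>R ?a) \<le> norm (grad w (\<rho> *\<^sub>R circ t))"
      unfolding norm_grad_partials[OF d(1)[OF inb]] by (rule real_le_rsqrt)
    then show ?thesis unfolding g'_def using \<rho> by simp
  qed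
  have "g' (t + 2 * pi) = g' t" for t unfolding g'_def by simp
  then have "loop g'" by (rule continuous_periodic_loop[OF cg'])
  moreover have "loop (\<lambda>t. w (\<rho> *\<^sub>R circ t))" by (rule continuous_periodic_loop[OF cg]) simp
  ultimately show ?thesis using that[OF der cg' _ _ le] by blast
qed

text \<open>The loop \<open>f\<close> is replaced by the trace of \<open>w\<close>, at the cost of
  \<open>B\<close> times their distance, and then integration by parts moves the derivative to the
  trace. That derivative is at most \<open>\<rho>\<close> times the norm of the gradient and counts
  only on \<open>Z\<close>, off which \<open>\<psi>\<close> vanishes.\<close>

lemma test_le_circle_integral:
  fixes w :: "real^2 => real^2"
  assumes w: "C1_on (ball 0 r) w" and \<rho>: "0 < \<rho>" "\<rho> < r" and f: "loop f"
    and \<psi>: "\<And>t. (\<psi> has_vector_derivative D t) (at t)" "\<And>t. \<psi> (t + 2 * pi) = \<psi> t" "\<And>t. norm (\<psi> t) \<le> 1" "loop \<psi>" "loop D"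
    and Z: "\<And>t. t \<in> {0..2*pi} - Z ==> \<psi> t = 0" and B: "\<And>t. norm (D t) \<le> B"
  shows "ennreal (loop_pair f D) \<le>
    arc_int (\<lambda>t. ennreal (\<rho> * norm (grad w (\<rho> *\<^sub>R circ t))) * indicator Z t + ennreal (B * norm (w (\<rho> *\<^sub>R circ t) - f t)))"
proof -
  let ?g = "\<lambda>t. w (\<rho> *\<^sub>R circ t)"
  obtain g' where g': "\<And>t. (?g has_vector_derivative g' t) (at t)" "continuous_on UNIV g'"
    "loop g'" "loop ?g" "\<And>t. norm (g' t) \<le> \<rho> * norm (grad w (\<rho> *\<^sub>R circ t))"
    by (rule circle_restriction[OF w \<rho>], rule that)
  have B0: "B \<ge> 0" using B[of 0] norm_ge_zero order_trans by blast
  have parts: "loop_pair ?g D = - loop_pair g' \<psi>"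
    by (rule loop_integral_by_parts[OF g'(1) _ \<psi>(1,2) g'(4,3) \<psi>(4,5)]) simp
  note i1 = loop_integrable(1)[OF loop_inner[OF f \<psi>(5)], of 0 "2*pi"]
  note i2 = loop_integrable(1)[OF loop_inner[OF g'(4) \<psi>(5)], of 0 "2*pi"]
  note i3 = loop_integrable(1)[OF loop_inner[OF g'(3) \<psi>(4)], of 0 "2*pi"]
  have c\<psi>: "continuous_on UNIV \<psi>"
    using \<psi>(1) by (blast intro: continuous_at_imp_continuous_on has_vector_derivative_continuous)
  define K where "K = (\<lambda>t. B * norm (?g t - f t) + norm (g' t) * norm (\<psi> t))"
  have K1: "loop (\<lambda>t. B *\<^sub>R norm (?g t - f t))" by (intro loop_scaleR loop_norm_diff(1) g' f)
  have K2: "loop (\<lambda>t. norm (g' t) * norm (\<psi> t))"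
    by (rule continuous_periodic_loop) (use g'(2) c\<psi> loopD(2)[OF g'(3)] \<psi>(2) in \<open>auto intro!: continuous_intros\<close>)
  have Kl: "loop K"
  proof -
    have "loop (\<lambda>t. B *\<^sub>R norm (?g t - f t) - - 1 *\<^sub>R (norm (g' t) * norm (\<psi> t)))"
      by (intro loop_norm_diff(2)[OF K1 loop_scaleR[OF K2]])
    then show ?thesis by (simp add: K_def)
  qed
  have K0: "K t \<ge> 0" for t using B0 by (simp add: K_def)
  have "loop_pair f D = integral {0..2*pi} (\<lambda>t. f t \<bullet> D t - ?g t \<bullet> D t - g' t \<bullet> \<psi> t)"
    using i1 i2 i3 parts by (simp add: HK_integral_diff HK_integrable_diff)
  also have "\<dots> \<le> integral {0..2*pi} K"
  proof (rule integral_le)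
    show "(\<lambda>t. f t \<bullet> D t - ?g t \<bullet> D t - g' t \<bullet> \<psi> t) integrable_on {0..2*pi}"
      by (intro HK_integrable_diff i1 i2 i3)
    show "K integrable_on {0..2*pi}" by (rule loop_integrable(1)[OF Kl])
    fix t
    have "f t \<bullet> D t - ?g t \<bullet> D t = (f t - ?g t) \<bullet> D t" by (simp add: inner_diff_left)
    also have "\<dots> \<le> norm (f t - ?g t) * norm (D t)" by (rule norm_cauchy_schwarz)
    also have "\<dots> \<le> norm (f t - ?g t) * B" by (intro mult_left_mono B) simp
    finally have 1: "f t \<bullet> D t - ?g t \<bullet> D t \<le> B * norm (?g t - f t)" by (simp add: norm_minus_commute mult.commute)
    have 2: "- (g' t \<bullet> \<psi> t) \<le> norm (g' t) * norm (\<psi> t)"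
      using Cauchy_Schwarz_ineq2[of "g' t" "\<psi> t"] by linarith
    show "f t \<bullet> D t - ?g t \<bullet> D t - g' t \<bullet> \<psi> t \<le> K t" unfolding K_def using 1 2 by linarith
  qed
  finally have "ennreal (loop_pair f D) \<le> ennreal (integral {0..2*pi} K)" by (rule ennreal_leI)
  also have "\<dots> = arc_int (\<lambda>t. ennreal (K t))"
    unfolding nn_integral_open_closed_interval by (rule loop_nn_integral[OF Kl K0, symmetric])
  also have "\<dots> \<le> arc_int (\<lambda>t. ennreal (\<rho> * norm (grad w (\<rho> *\<^sub>R circ t))) * indicator Z t + ennreal (B * norm (?g t - f t)))"
  proof (rule nn_integral_mono)
    fix t
    show "ennreal (K t) * indicator {0<..<2*pi} t \<le> (ennreal (\<rho> * norm (grad w (\<rho> *\<^sub>R circ t))) * indicator Z t + ennreal (B * norm (?g t - f t))) * indicator {0<..<2*pi} t"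
    proof (cases "t \<in> {0<..<2*pi}")
      case True
      have "ennreal (norm (g' t) * norm (\<psi> t)) \<le> ennreal (\<rho> * norm (grad w (\<rho> *\<^sub>R circ t))) * indicator Z t"
      proof (cases "t \<in> Z")
        case tZ: True
        have "norm (g' t) * norm (\<psi> t) \<le> norm (g' t) * 1" by (intro mult_left_mono \<psi>(3)) simp
        also have "\<dots> \<le> \<rho> * norm (grad w (\<rho> *\<^sub>R circ t))" using g'(5)[of t] by simp
        finally show ?thesis using tZ by (simp add: ennreal_leI)
      next
        case False
        then show ?thesis using Z[of t] True by simp
      qed
      moreover have "ennreal (K t) = ennreal (norm (g' t) * norm (\<psi> t)) + ennreal (B * norm (?g t - f t))"
        unfolding K_def using B0 by (simp add: ennreal_plus[symmetric] add.commute del: ennreal_plus)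
      ultimately show ?thesis using True by (simp add: add_right_mono)
    qed simp
  qed
  finally show ?thesis .
qed

text \<open>The factor \<open>\<rho>\<close> of the gradient term is the density of polar
  coordinates. The distance term does not carry it, and supplying it costs
  \<open>1 / norm z\<close>, which is at most \<open>1 / a\<close> in the annulus.\<close>

lemma polar_annulus:
  fixes w :: "real^2 => real^2"
  assumes w: "C1_on (ball 0 r) w" and ab: "0 < a" "b \<le> r" and B: "B \<ge> 0" and f: "loop f" and Z [measurable]: "Z \<in> sets borel"
  shows "(\<integral>\<^sup>+\<rho>\<in>{a<..<b}. (arc_int (\<lambda>t. ennreal (\<rho> * norm (grad w (\<rho> *\<^sub>R circ t))) * indicator Z t + ennreal (B * norm (w (\<rho> *\<^sub>R circ t) - f t)))) \<partial>lborel)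
    \<le> disk_int r (\<lambda>z. ennreal (norm (grad w z)) * indicator Z (angle z) * indicator {a<..<b} (norm z))
      + ennreal (B / a) * (disk_int r (\<lambda>z. ennreal (norm (w z - f (angle z)))))"
proof -
  let ?G = "\<lambda>z. ennreal (norm (grad w z)) * indicator (ball 0 r) z"
  let ?M = "\<lambda>z. ennreal (norm (w z - f (angle z))) * indicator (ball 0 r) z"
  note [measurable] = ball_measurable_pieces(1)[OF w] ball_measurable_pieces(3)[OF w f]
  define h where "h = (\<lambda>z::real^2. (?G z * indicator Z (angle z) + ennreal (B / norm z) * ?M z) * indicator {a<..<b} (norm z))"
  have hm: "h \<in> borel_fun" unfolding h_def by measurable
  have "(\<integral>\<^sup>+\<rho>\<in>{a<..<b}. (arc_int (\<lambda>t. ennreal (\<rho> * norm (grad w (\<rho> *\<^sub>R circ t))) * indicator Z t + ennreal (B * norm (w (\<rho> *\<^sub>R circ t) - f t)))) \<partial>lborel)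
    \<le> (\<integral>\<^sup>+\<rho>\<in>{0<..<r}. (arc_int (\<lambda>t. ennreal \<rho> * h (\<rho> *\<^sub>R circ t))) \<partial>lborel)"
  proof (rule nn_integral_mono)
    fix \<rho> :: real
    show "(arc_int (\<lambda>t. ennreal (\<rho> * norm (grad w (\<rho> *\<^sub>R circ t))) * indicator Z t + ennreal (B * norm (w (\<rho> *\<^sub>R circ t) - f t)))) * indicator {a<..<b} \<rho>
      \<le> (arc_int (\<lambda>t. ennreal \<rho> * h (\<rho> *\<^sub>R circ t))) * indicator {0<..<r} \<rho>"
    proof (cases "\<rho> \<in> {a<..<b}")
      case True
      then have \<rho>: "0 < \<rho>" "\<rho> < r" "a < \<rho>" "\<rho> < b" using ab by auto
      have "(ennreal (\<rho> * norm (grad w (\<rho> *\<^sub>R circ t))) * indicator Z t + ennreal (B * norm (w (\<rho> *\<^sub>R circ t) - f t))) * indicator {0<..<2*pi} t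
        \<le> ennreal \<rho> * h (\<rho> *\<^sub>R circ t) * indicator {0<..<2*pi} t" for t
      proof (cases "t \<in> {0<..<2*pi}")
        case t: True
        have an: "angle (\<rho> *\<^sub>R circ t) = t" by (rule angle_circ) (use t \<rho> in auto)
        have nr: "norm (\<rho> *\<^sub>R circ t) = \<rho>" using \<rho> by simp
        have e1: "ennreal (\<rho> * norm (grad w (\<rho> *\<^sub>R circ t))) = ennreal \<rho> * ennreal (norm (grad w (\<rho> *\<^sub>R circ t)))"
          using \<rho> by (intro ennreal_mult) auto
        have e2: "ennreal (B * norm (w (\<rho> *\<^sub>R circ t) - f t)) = ennreal \<rho> * (ennreal (B / \<rho>) * ennreal (norm (w (\<rho> *\<^sub>R circ t) - f t)))"
          using \<rho> B by (simp add: ennreal_mult[symmetric])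
        have "h (\<rho> *\<^sub>R circ t) = ennreal (norm (grad w (\<rho> *\<^sub>R circ t))) * indicator Z t + ennreal (B / \<rho>) * ennreal (norm (w (\<rho> *\<^sub>R circ t) - f t))"
          unfolding h_def an nr using True \<rho> by simp
        then show ?thesis unfolding e1 e2 using t by (simp add: distrib_left mult.assoc)
      qed simp
      then show ?thesis using True \<rho> by (simp add: nn_integral_mono)
    qed simp
  qed
  also have "\<dots> = disk_int r (\<lambda>z. h z)" by (rule nn_integral_polar[OF hm, symmetric])
  also have "\<dots> \<le> (\<integral>\<^sup>+z. ?G z * indicator Z (angle z) * indicator {a<..<b} (norm z) + ennreal (B / a) * ?M z \<partial>lborel)"
  proof (rule nn_integral_mono)
    fix z :: "real^2"
    show "h z * indicator (ball 0 r) z \<le> ?G z * indicator Z (angle z) * indicator {a<..<b} (norm z) + ennreal (B / a) * ?M z"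
    proof (cases "norm z \<in> {a<..<b}")
      case True
      then have "norm z * a > 0" using ab by (intro mult_pos_pos) auto
      then have "ennreal (B / norm z) * ?M z \<le> ennreal (B / a) * ?M z"
        using True ab B by (intro mult_right_mono ennreal_leI divide_left_mono) auto
      then show ?thesis unfolding h_def using True by (auto simp: indicator_def add_left_mono)
    qed (simp add: h_def)
  qed
  also have "\<dots> = (\<integral>\<^sup>+z. ?G z * indicator Z (angle z) * indicator {a<..<b} (norm z) \<partial>lborel) + ennreal (B / a) * (\<integral>\<^sup>+z. ?M z \<partial>lborel)"
    by (subst nn_integral_add, measurable, subst nn_integral_cmult, measurable)
  also have "(\<integral>\<^sup>+z. ?G z * indicator Z (angle z) * indicator {a<..<b} (norm z) \<partial>lborel) = disk_int r (\<lambda>z. ennreal (norm (grad w z)) * indicator Z (angle z) * indicator {a<..<b} (norm z))"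
    by (intro nn_integral_cong) (simp add: ac_simps)
  finally show ?thesis .
qed

text \<open>Up to the L1 error, each circle in the annulus contributes at least \<open>c\<close>.
  This is used with all angles to measure the mass of annuli, and with a thin set of angles for the
  area.\<close>

lemma test_le_annulus:
  fixes w :: "real^2 => real^2"
  assumes w: "C1_on (ball 0 r) w" and ab: "0 < a" "a \<le> b" "b \<le> r" and f: "loop f"
    and \<psi>: "\<And>t. (\<psi> has_vector_derivative D t) (at t)" "\<And>t. \<psi> (t + 2 * pi) = \<psi> t" "\<And>t. norm (\<psi> t) \<le> 1" "loop \<psi>" "loop D"
    and Z: "Z \<in> sets borel" "\<And>t. t \<in> {0..2*pi} - Z ==> \<psi> t = 0" and B: "\<And>t. norm (D t) \<le> B"
    and c: "c \<le> loop_pair f D"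
  shows "ennreal ((b - a) * c) \<le> disk_int r (\<lambda>z. ennreal (norm (grad w z)) * indicator Z (angle z) * indicator {a<..<b} (norm z))
      + ennreal (B / a) * (disk_int r (\<lambda>z. ennreal (norm (w z - f (angle z)))))"
proof -
  have B0: "B \<ge> 0" using B[of 0] norm_ge_zero order_trans by blast
  have "ennreal ((b - a) * c) = ennreal c * ennreal (b - a)" unfolding mult.commute[of "ennreal c"] by (rule ennreal_mult') (use ab in simp)
  also have "\<dots> = (\<integral>\<^sup>+\<rho>. ennreal c * indicator {a<..<b} \<rho> \<partial>lborel)"
    using ab by (subst nn_integral_cmult_indicator) auto
  also have "\<dots> \<le> (\<integral>\<^sup>+\<rho>\<in>{a<..<b}. (arc_int (\<lambda>t. ennreal (\<rho> * norm (grad w (\<rho> *\<^sub>R circ t))) * indicator Z t + ennreal (B * norm (w (\<rho> *\<^sub>R circ t) - f t)))) \<partial>lborel)"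
  proof (rule nn_integral_mono)
    fix \<rho> :: real
    show "ennreal c * indicator {a<..<b} \<rho> \<le> (arc_int (\<lambda>t. ennreal (\<rho> * norm (grad w (\<rho> *\<^sub>R circ t))) * indicator Z t + ennreal (B * norm (w (\<rho> *\<^sub>R circ t) - f t)))) * indicator {a<..<b} \<rho>"
    proof (cases "\<rho> \<in> {a<..<b}")
      case True
      then have \<rho>: "0 < \<rho>" "\<rho> < r" using ab by auto
      show ?thesis using order_trans[OF ennreal_leI[OF c] test_le_circle_integral[OF w \<rho> f \<psi> Z(2) B]] True by simp
    qed simp
  qed
  also note polar_annulus[OF w ab(1,3) B0 f Z(1)]
  finally show ?thesis .
qed

text \<open>The small disk and the parts of the annulus over \<open>Z\<close> and over its
  complement are disjoint, and on each of them the area integrand dominates one of the three terms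
  under its root. The angles off \<open>Z\<close> have measure at least
  \<open>2 * pi - \<epsilon>\<close>, and the radii contribute the factor
  \<open>(r\<^sup>2 - \<delta>\<^sup>2) / 2\<close>.\<close>

lemma disk_annulus_area_ge:
  fixes w :: "real^2 => real^2"
  assumes w: "C1_on (ball 0 r) w" and \<delta>: "0 < \<delta>" "\<delta> < r" and Z [measurable]: "Z \<in> sets borel" and Ze: "emeasure lborel Z \<le> ennreal \<epsilon>" and \<epsilon>: "\<epsilon> > 0"
  shows "ennreal ((r\<^sup>2 - \<delta>\<^sup>2) / 2 * (2 * pi - \<epsilon>)) +
    disk_int r (\<lambda>z. ennreal (norm (grad w z)) * indicator Z (angle z) * indicator {\<delta><..<r} (norm z)) +
    disk_int \<delta> (\<lambda>z. ennreal \<bar>det (grad w z)\<bar>) \<le> area w (ball 0 r)"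
proof -
  let ?I = "\<lambda>z::real^2. indicator (ball 0 r) z :: ennreal"
  have bm [measurable]: "ball (0::real^2) \<delta> \<in> sets borel" by simp
  have bm2 [measurable]: "ball (0::real^2) r \<in> sets borel" by simp
  note [measurable] = ball_measurable_pieces(1,2)[OF w]
  define T1 where "T1 = (\<lambda>z::real^2. indicator {\<delta><..<r} (norm z) * indicator (- Z) (angle z) * ?I z)"
  define T2 where "T2 = (\<lambda>z::real^2. (ennreal (norm (grad w z)) * ?I z) * (indicator Z (angle z) * indicator {\<delta><..<r} (norm z)))"
  define T3 where "T3 = (\<lambda>z::real^2. (ennreal \<bar>det (grad w z)\<bar> * ?I z) * indicator (ball 0 \<delta>) z)"
  have [measurable]: "T1 \<in> borel_fun" "T2 \<in> borel_fun" "T3 \<in> borel_fun"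
    unfolding T1_def T2_def T3_def by measurable
  have "ennreal (2 * pi) = emeasure lborel {0<..<2*pi}" by simp
  also have "\<dots> \<le> emeasure lborel (({0<..<2*pi} - Z) \<union> Z)" by (intro emeasure_mono) auto
  also have "\<dots> \<le> emeasure lborel ({0<..<2*pi} - Z) + emeasure lborel Z" by (intro emeasure_subadditive) auto
  also have "\<dots> \<le> emeasure lborel ({0<..<2*pi} - Z) + ennreal \<epsilon>" by (intro add_left_mono Ze)
  finally have "ennreal (2 * pi) - ennreal \<epsilon> \<le> emeasure lborel ({0<..<2*pi} - Z)"
    by (simp add: ennreal_minus_le_iff add.commute)
  then have Zc: "ennreal (2 * pi - \<epsilon>) \<le> emeasure lborel ({0<..<2*pi} - Z)"
    using \<epsilon> by (simp add: ennreal_minus)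
  have rad: "(\<integral>\<^sup>+\<rho>\<in>{0<..<r}. ennreal \<rho> * indicator {\<delta><..<r} \<rho> \<partial>lborel) = ennreal ((r\<^sup>2 - \<delta>\<^sup>2) / 2)"
  proof -
    have "(\<integral>\<^sup>+\<rho>\<in>{0<..<r}. ennreal \<rho> * indicator {\<delta><..<r} \<rho> \<partial>lborel) = (\<integral>\<^sup>+\<rho>\<in>{\<delta><..<r}. ennreal \<rho> \<partial>lborel)"
      using \<delta> by (intro nn_integral_cong) (auto simp: indicator_def)
    also have "\<dots> = (\<integral>\<^sup>+\<rho>\<in>{\<delta>..r}. ennreal \<rho> \<partial>lborel)" by (rule nn_integral_open_closed_interval)
    also have "\<dots> = ennreal (r\<^sup>2 / 2 - \<delta>\<^sup>2 / 2)"
      using \<delta> by (intro nn_integral_FTC_Icc[where F="\<lambda>x. x\<^sup>2 / 2"]) (auto intro!: derivative_eq_intros simp: has_real_derivative_iff_has_vector_derivative[symmetric])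
    finally show ?thesis by (simp add: diff_divide_distrib)
  qed
  have "ennreal ((r\<^sup>2 - \<delta>\<^sup>2) / 2 * (2 * pi - \<epsilon>)) = ennreal ((r\<^sup>2 - \<delta>\<^sup>2) / 2) * ennreal (2 * pi - \<epsilon>)"
    using \<delta> by (intro ennreal_mult') simp
  also have "\<dots> \<le> ennreal ((r\<^sup>2 - \<delta>\<^sup>2) / 2) * (arc_int (\<lambda>t. indicator (- Z) t))"
  proof (rule mult_left_mono)
    have "arc_int (\<lambda>t. indicator (- Z) t) = (\<integral>\<^sup>+t. indicator ({0<..<2*pi} - Z) t \<partial>lborel)"
      by (intro nn_integral_cong) (auto simp: indicator_def)
    then show "ennreal (2 * pi - \<epsilon>) \<le> arc_int (\<lambda>t. indicator (- Z) t)" using Zc by simp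
  qed simp
  also have "\<dots> = (\<integral>\<^sup>+z. T1 z \<partial>lborel)"
    unfolding T1_def rad[symmetric] by (rule nn_integral_polar_product[symmetric]) measurable
  finally have A1: "ennreal ((r\<^sup>2 - \<delta>\<^sup>2) / 2 * (2 * pi - \<epsilon>)) \<le> (\<integral>\<^sup>+z. T1 z \<partial>lborel)" .
  have A2: "disk_int r (\<lambda>z. ennreal (norm (grad w z)) * indicator Z (angle z) * indicator {\<delta><..<r} (norm z)) = (\<integral>\<^sup>+z. T2 z \<partial>lborel)"
    unfolding T2_def by (intro nn_integral_cong) (simp add: ac_simps)
  have A3: "disk_int \<delta> (\<lambda>z. ennreal \<bar>det (grad w z)\<bar>) = (\<integral>\<^sup>+z. T3 z \<partial>lborel)"
    unfolding T3_def using \<delta> by (intro nn_integral_cong) (auto simp: indicator_def)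
  have "(\<integral>\<^sup>+z. T1 z \<partial>lborel) + (\<integral>\<^sup>+z. T2 z \<partial>lborel) + (\<integral>\<^sup>+z. T3 z \<partial>lborel) = (\<integral>\<^sup>+z. T1 z + T2 z + T3 z \<partial>lborel)"
    by (subst nn_integral_add, measurable, subst nn_integral_add, measurable)
  also have "\<dots> \<le> disk_int r (\<lambda>z. ennreal (sqrt (1 + (norm (grad w z))\<^sup>2 + (det (grad w z))\<^sup>2)))"
  proof (rule nn_integral_mono)
    fix z :: "real^2"
    let ?s = "sqrt (1 + (norm (grad w z))\<^sup>2 + (det (grad w z))\<^sup>2)"
    have "1 \<le> ?s" by simp
    then have s1: "1 \<le> ennreal ?s" by (metis ennreal_1 ennreal_leI)
    have s2: "ennreal (norm (grad w z)) \<le> ennreal ?s" by (intro ennreal_leI real_le_rsqrt) simp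
    have s3: "ennreal \<bar>det (grad w z)\<bar> \<le> ennreal ?s" by (intro ennreal_leI real_le_rsqrt) simp
    consider "z \<notin> ball 0 r" | "z \<in> ball 0 \<delta>" | "z \<in> ball 0 r" "z \<notin> ball 0 \<delta>" by blast
    then show "T1 z + T2 z + T3 z \<le> ennreal ?s * ?I z"
    proof cases
      case 1
      then show ?thesis by (simp add: T1_def T2_def T3_def)
    next
      case 2
      then show ?thesis using s3 \<delta> by (simp add: T1_def T2_def T3_def)
    next
      case 3
      then show ?thesis using s1 s2 by (cases "angle z \<in> Z"; cases "norm z = \<delta>") (auto simp: T1_def T2_def T3_def indicator_def)
    qed
  qed
  also have "\<dots> = area w (ball 0 r)"
    unfolding area_def by (rule nn_integral_lebesgue_on_lborel[symmetric]) simp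
  finally have "(\<integral>\<^sup>+z. T1 z \<partial>lborel) + (\<integral>\<^sup>+z. T2 z \<partial>lborel) + (\<integral>\<^sup>+z. T3 z \<partial>lborel) \<le> area w (ball 0 r)" .
  then show ?thesis unfolding A2 A3 by (rule order_trans[rotated]) (intro add_right_mono A1)
qed

section \<open>Choice of a good circle\<close>

lemma C1_on_lipschitz_cball:
  fixes w :: "real^2 => real^2"
  assumes w: "C1_on (ball 0 r) w" and \<rho>: "\<rho> < r"
  obtains C where "C-lipschitz_on (cball 0 \<rho>) w"
proof -
  obtain f' :: "real^2 => (real^2) \<Rightarrow>\<^sub>L (real^2)" where f': "\<And>x. x \<in> ball 0 r ==> (w has_derivative blinfun_apply (f' x)) (at x)" "continuous_on (ball 0 r) f'"
    using w unfolding C1_on_def by blast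
  have sub: "cball (0::real^2) \<rho> \<subseteq> ball 0 r" using \<rho> by auto
  have "compact (f' ` cball 0 \<rho>)" by (intro compact_continuous_image continuous_on_subset[OF f'(2) sub]) simp
  then obtain C where C: "C > 0" "\<And>x. x \<in> cball 0 \<rho> ==> norm (f' x) \<le> C"
    using compact_imp_bounded bounded_pos by (metis imageI)
  have "C-lipschitz_on (cball 0 \<rho>) w"
  proof (rule bounded_derivative_imp_lipschitz)
    show "(w has_derivative blinfun_apply (f' x)) (at x within cball 0 \<rho>)" if "x \<in> cball 0 \<rho>" for x
      using f'(1) sub that by (blast intro: has_derivative_at_withinI)
    show "onorm (blinfun_apply (f' x)) \<le> C" if "x \<in> cball 0 \<rho>" for x
      using C(2)[OF that] by (simp add: norm_blinfun.rep_eq)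
  qed (use C in auto)
  then show ?thesis by (rule that)
qed

text \<open>The dilated map is itself a competitor for its boundary values, and the integral of the
  absolute Jacobian is invariant under dilations of the domain.\<close>

lemma plateau_dilation_le:
  fixes w :: "real^2 => real^2"
  assumes w: "C1_on (ball 0 r) w" and \<rho>: "0 < \<rho>" "\<rho> < r"
  shows "\<exists>C. C-lipschitz_on (sphere 0 1) (\<lambda>x. w (\<rho> *\<^sub>R x))"
    and "plateau (\<lambda>x. w (\<rho> *\<^sub>R x)) \<le> disk_int \<rho> (\<lambda>z. ennreal \<bar>det (grad w z)\<bar>)"
proof -
  let ?v = "\<lambda>x. w (\<rho> *\<^sub>R x)"
  obtain C where C: "C-lipschitz_on (cball 0 \<rho>) w" by (rule C1_on_lipschitz_cball[OF w \<rho>(2)])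
  have L: "(C * \<rho>)-lipschitz_on (cball 0 1) ?v"
  proof (rule lipschitz_onI)
    fix x y :: "real^2" assume xy: "x \<in> cball 0 1" "y \<in> cball 0 1"
    have "dist (w (\<rho> *\<^sub>R x)) (w (\<rho> *\<^sub>R y)) \<le> C * dist (\<rho> *\<^sub>R x) (\<rho> *\<^sub>R y)"
      by (rule lipschitz_onD[OF C]) (use xy \<rho> in \<open>auto simp: mult_left_le\<close>)
    also have "dist (\<rho> *\<^sub>R x) (\<rho> *\<^sub>R y) = \<rho> * dist x y" using \<rho> by (simp add: dist_norm scaleR_diff_right[symmetric])
    finally show "dist (?v x) (?v y) \<le> C * \<rho> * dist x y" by (simp add: mult.assoc)
  qed (use lipschitz_on_nonneg[OF C] \<rho> in simp)
  show "\<exists>C. C-lipschitz_on (sphere 0 1) ?v"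
    using lipschitz_on_subset[OF L, of "sphere 0 1"] by auto
  have comp: "?v \<in> plateau_competitors ?v"
    unfolding plateau_competitors_def
  proof (intro CollectI conjI ballI)
    show "\<exists>C. C-lipschitz_on (ball 0 1) ?v"
      using lipschitz_on_subset[OF L, of "ball 0 1"] by auto
    fix x :: "real^2" assume "x \<in> sphere 0 1"
    then have "(?v \<longlongrightarrow> ?v x) (at x within cball 0 1)"
      using lipschitz_on_continuous_on[OF L] unfolding continuous_on_def by auto
    then show "(?v \<longlongrightarrow> ?v x) (at x within ball 0 1)" by (rule tendsto_within_subset) auto
  qed
  define g where "g = (\<lambda>z. ennreal \<bar>det (grad w z)\<bar> * indicator (ball 0 r) z)"
  have g [measurable]: "g \<in> borel_fun" unfolding g_def by (rule ball_measurable_pieces(2)[OF w])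
  have bm [measurable]: "ball (0::real^2) 1 \<in> sets borel" by simp
  obtain d1 d2 where d: "\<And>x. x \<in> ball 0 r ==> partials w x (d1 x) (d2 x)"
    by (rule C1_on_partials[OF w], rule that)
  have "plateau ?v \<le> (\<integral>\<^sup>+z. ennreal \<bar>det (grad ?v z)\<bar> \<partial>lebesgue_on (ball 0 1))"
    unfolding plateau_def by (rule INF_lower[OF comp])
  also have "\<dots> = disk_int 1 (\<lambda>z. ennreal \<bar>det (grad ?v z)\<bar>)"
    by (rule nn_integral_lebesgue_on_lborel) simp
  also have "\<dots> = (\<integral>\<^sup>+z. ennreal (\<rho>\<^sup>2) * (g (z /\<^sub>R (1 / \<rho>)) * indicator (ball 0 1) z) \<partial>lborel)"
  proof (rule nn_integral_cong)
    fix z :: "real^2"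
    show "ennreal \<bar>det (grad ?v z)\<bar> * indicator (ball 0 1) z = ennreal (\<rho>\<^sup>2) * (g (z /\<^sub>R (1 / \<rho>)) * indicator (ball 0 1) z)"
    proof (cases "z \<in> ball 0 1")
      case True
      then have "\<rho> * norm z < r * 1" using \<rho> by (intro mult_strict_mono') auto
      then have inb: "\<rho> *\<^sub>R z \<in> ball 0 r" using \<rho> by simp
      then have p: "partials w (z /\<^sub>R (1 / \<rho>)) (d1 (\<rho> *\<^sub>R z)) (d2 (\<rho> *\<^sub>R z))" using d[OF inb] \<rho> by simp
      have eq: "(\<lambda>x. w (x /\<^sub>R (1 / \<rho>))) = ?v" using \<rho> by simp
      have "det (grad ?v z) = \<rho>\<^sup>2 * det (grad w (\<rho> *\<^sub>R z))"
        by (simp add: det_grad_partials[OF partials_scale[OF p], unfolded eq] det_grad_partials[OF d[OF inb]] power2_eq_square algebra_simps)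
      then show ?thesis using True inb \<rho> by (simp add: g_def abs_mult ennreal_mult')
    qed simp
  qed
  also have "\<dots> = ennreal (\<rho>\<^sup>2) * (disk_int 1 (\<lambda>z. g (z /\<^sub>R (1 / \<rho>))))"
    by (rule nn_integral_cmult) measurable
  also have "disk_int 1 (\<lambda>z. g (z /\<^sub>R (1 / \<rho>))) = ennreal ((1 / \<rho>)\<^sup>2) * (disk_int (1 / (1 / \<rho>)) (\<lambda>z. g z))"
    by (rule nn_integral_scale_ball[OF g]) (use \<rho> in simp)
  also have "ennreal (\<rho>\<^sup>2) * \<dots> = disk_int \<rho> (\<lambda>z. g z)"
    using \<rho> by (simp add: mult.assoc[symmetric] ennreal_mult[symmetric] power_divide)
  also have "\<dots> \<le> disk_int \<rho> (\<lambda>z. ennreal \<bar>det (grad w z)\<bar>)"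
    by (intro nn_integral_mono) (auto simp: g_def indicator_def)
  finally show "plateau ?v \<le> disk_int \<rho> (\<lambda>z. ennreal \<bar>det (grad w z)\<bar>)" .
qed

text \<open>The margin \<open>e\<close> makes the contradiction strict: were the bound violated at
  every radius, the integral would be at least \<open>K + e * (b - a)\<close>.\<close>

lemma exists_le_average:
  fixes h :: "real => ennreal"
  assumes ab: "a < b" and le: "(\<integral>\<^sup>+\<rho>\<in>{a<..<b}. h \<rho> \<partial>lborel) \<le> ennreal K" and K: "K \<ge> 0" and e: "e > 0"
  obtains \<rho> where "a < \<rho>" "\<rho> < b" "h \<rho> \<le> ennreal (K / (b - a) + e)"
proof (cases "\<exists>\<rho>\<in>{a<..<b}. h \<rho> \<le> ennreal (K / (b - a) + e)")
  case True
  then show ?thesis using that by auto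
next
  case False
  have "ennreal ((K / (b - a) + e) * (b - a)) = ennreal (K / (b - a) + e) * ennreal (b - a)"
    using ab K e by (intro ennreal_mult) auto
  also have "\<dots> = (\<integral>\<^sup>+\<rho>. ennreal (K / (b - a) + e) * indicator {a<..<b} \<rho> \<partial>lborel)"
    using ab by (subst nn_integral_cmult_indicator) auto
  also have "\<dots> \<le> (\<integral>\<^sup>+\<rho>\<in>{a<..<b}. h \<rho> \<partial>lborel)"
    using False by (intro nn_integral_mono) (auto simp: indicator_def not_le less_imp_le)
  finally have "ennreal ((K / (b - a) + e) * (b - a)) \<le> ennreal K" using le by simp
  then have "(K / (b - a) + e) * (b - a) \<le> K" using K by (simp add: ennreal_le_iff)
  moreover have "(K / (b - a) + e) * (b - a) = K + e * (b - a)" using ab by (simp add: field_simps)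
  moreover have "e * (b - a) > 0" using ab e by (intro mult_pos_pos) auto
  ultimately show ?thesis by linarith
qed

text \<open>A single averaged quantity \<open>J\<close> dominates both the variation of the trace
  and \<open>M\<close> times its distance to \<open>f\<close>, so one radius is good for both. The
  radii range over an interval of length \<open>\<delta>/2\<close>, hence the divisor.\<close>

lemma good_circle:
  fixes w :: "real^2 => real^2"
  assumes w: "C1_on (ball 0 r) w" and \<delta>: "0 < \<delta>" "\<delta> < r" and f: "loop f" and M: "M \<ge> 0" and K: "K \<ge> 0" and e: "e > 0"
    and le: "disk_int r (\<lambda>z. ennreal (norm (grad w z)) * indicator {\<delta>/2<..<\<delta>} (norm z))
      + ennreal (M / (\<delta>/2)) * (disk_int r (\<lambda>z. ennreal (norm (w z - f (angle z))))) \<le> ennreal K"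
  obtains \<rho> where "\<delta>/2 < \<rho>" "\<rho> < \<delta>" "cvf (\<lambda>t. w (\<rho> *\<^sub>R circ t)) \<le> ennreal (K / (\<delta>/2) + e)"
    "M * integral {0..2*pi} (\<lambda>t. norm (w (\<rho> *\<^sub>R circ t) - f t)) \<le> K / (\<delta>/2) + e"
proof -
  define J where "J = (\<lambda>\<rho>. \<integral>\<^sup>+t\<in>{0<..<2*pi}. (ennreal (\<rho> * norm (grad w (\<rho> *\<^sub>R circ t))) * indicator UNIV t + ennreal (M * norm (w (\<rho> *\<^sub>R circ t) - f t))) \<partial>lborel)"
  have "(\<integral>\<^sup>+\<rho>\<in>{\<delta>/2<..<\<delta>}. J \<rho> \<partial>lborel) \<le> ennreal K"
    unfolding J_def by (rule order_trans[OF polar_annulus[OF w _ _ M f, of "\<delta>/2" \<delta> UNIV]]) (use \<delta> le in auto)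
  moreover have "\<delta>/2 < \<delta>" using \<delta> by simp
  ultimately obtain \<rho> where \<rho>: "\<delta>/2 < \<rho>" "\<rho> < \<delta>" "J \<rho> \<le> ennreal (K / (\<delta> - \<delta>/2) + e)"
    using exists_le_average[OF _ _ K e] by blast
  have J: "J \<rho> \<le> ennreal (K / (\<delta>/2) + e)" using \<rho>(3) by (simp add: field_simps)
  have \<rho>r: "0 < \<rho>" "\<rho> < r" using \<rho> \<delta> by auto
  let ?g = "\<lambda>t. w (\<rho> *\<^sub>R circ t)"
  obtain g' where gl: "loop ?g" by (rule circle_restriction[OF w \<rho>r], rule that)
  have "cvf ?g \<le> J \<rho>"
  proof (rule cvf_least[OF gl])
    fix \<psi> D :: "real => real^2" assume \<psi>: "\<And>t. (\<psi> has_vector_derivative D t) (at t)" "loop D" "loop \<psi>" "\<And>t. \<psi> (t + 2 * pi) = \<psi> t" "\<And>t. norm (\<psi> t) \<le> 1"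
    obtain B where B: "\<And>t. norm (D t) \<le> B" using loop_bound[OF \<psi>(2)] by blast
    \<comment> \<open>With the trace itself in the role of \<open>f\<close> the distance term
      vanishes, whatever the bound \<open>B\<close> of the derivative of the test function.\<close>
    have "ennreal (loop_pair ?g D) \<le> arc_int (\<lambda>t. ennreal (\<rho> * norm (grad w (\<rho> *\<^sub>R circ t))) * indicator UNIV t + ennreal (B * norm (w (\<rho> *\<^sub>R circ t) - ?g t)))"
      by (rule test_le_circle_integral[OF w \<rho>r gl \<psi>(1,4,5,3,2) _ B]) simp
    also have "\<dots> \<le> J \<rho>" unfolding J_def by (intro nn_integral_mono) (auto simp: indicator_def)
    finally show "ennreal (loop_pair ?g D) \<le> J \<rho>" .
  qed
  then have 1: "cvf ?g \<le> ennreal (K / (\<delta>/2) + e)" using J by simp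
  have lM: "loop (\<lambda>t. M *\<^sub>R norm (?g t - f t))" by (intro loop_scaleR loop_norm_diff(1) gl f)
  have "ennreal (integral {0..2*pi} (\<lambda>t. M *\<^sub>R norm (?g t - f t))) = arc_int (\<lambda>t. ennreal (M *\<^sub>R norm (?g t - f t)))"
    unfolding nn_integral_open_closed_interval using M by (intro loop_nn_integral[OF lM, symmetric]) simp
  also have "\<dots> \<le> J \<rho>" unfolding J_def by (intro nn_integral_mono) (auto simp: indicator_def)
  also note J
  finally have "ennreal (integral {0..2*pi} (\<lambda>t. M *\<^sub>R norm (?g t - f t))) \<le> ennreal (K / (\<delta>/2) + e)" .
  moreover have "K / (\<delta>/2) + e \<ge> 0" using K e \<delta> by simp
  ultimately have "integral {0..2*pi} (\<lambda>t. M *\<^sub>R norm (?g t - f t)) \<le> K / (\<delta>/2) + e"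
    by (simp only: ennreal_le_iff)
  then have 2: "M * integral {0..2*pi} (\<lambda>t. norm (?g t - f t)) \<le> K / (\<delta>/2) + e" by simp
  show ?thesis by (rule that[OF \<rho>(1,2) 1 2])
qed

section \<open>Concentration of the variation and the lower bound\<close>

lemma ennreal_add_subadditive: "ennreal (x + y) \<le> ennreal x + ennreal y"
proof (cases "x \<ge> 0 \<and> y \<ge> 0")
  case True
  then show ?thesis by simp
next
  case False
  then have "x + y \<le> x \<or> x + y \<le> y" by linarith
  then show ?thesis
    by (metis add.commute add_increasing2 ennreal_leI order_trans zero_le order_refl)
qed

text \<open>For \<open>L = 0\<close> the number \<open>c\<close> is negative,
  \<open>ennreal c\<close> is not below \<open>cvf f\<close>, and the zero function serves instead.
  This allows \<open>c = L - e\<close> without a case distinction later.\<close>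

lemma concentrated_test_real:
  fixes f :: "real => real^2"
  assumes f: "loop f" "finite (range f)" and L: "cvf f = ennreal L" "L \<ge> 0" and c: "c < L" and \<epsilon>: "\<epsilon> > 0"
  obtains \<psi> D Z where "\<And>t. (\<psi> has_vector_derivative D t) (at t)"
    "\<And>t. \<psi> (t + 2 * pi) = \<psi> t" "\<And>t. norm (\<psi> t) \<le> 1" "loop \<psi>" "loop D"
    "Z \<in> sets borel" "emeasure lborel Z \<le> ennreal \<epsilon>" "\<And>t. t \<in> {0..2*pi} - Z ==> \<psi> t = 0"
    "c \<le> loop_pair f D"
proof (cases "L = 0")
  case True
  have l0: "loop (\<lambda>_. 0 :: real^2)" by (rule loop_const)
  show ?thesis by (rule that[of "\<lambda>_. 0" "\<lambda>_. 0" "{}"]) (use c True l0 in auto)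
next
  case False
  have fin: "cvf f \<noteq> \<infinity>" using L by simp
  have lt: "ennreal c < cvf f" using L c False by (auto intro: ennreal_lessI)
  obtain \<psi> D Z where t: "\<And>t. (\<psi> has_vector_derivative D t) (at t)" "continuous_on UNIV D"
    "\<And>t. \<psi> (t + 2 * pi) = \<psi> t" "\<And>t. norm (\<psi> t) \<le> 1" "loop \<psi>" "loop D"
    "Z \<in> sets borel" "Z \<subseteq> {0..2*pi}" "emeasure lborel Z \<le> ennreal \<epsilon>" "\<And>t. t \<in> {0..2*pi} - Z ==> \<psi> t = 0"
    "c \<le> loop_pair f D"
    by (rule concentrated_test[OF f fin lt \<epsilon>], rule that)
  show ?thesis by (rule that[OF t(1,3-7,9-11)])
qed

text \<open>The derivative of a test function is bounded, so each pairing is continuous for L1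
  convergence, and the supremum is lower semicontinuous.\<close>

lemma cvf_lsc:
  fixes f :: "real => real^2" and g :: "nat => real => real^2"
  assumes f: "loop f" and g: "\<And>k. loop (g k)" and lim: "(\<lambda>k. integral {0..2*pi} (\<lambda>t. norm (g k t - f t))) \<longlonglongrightarrow> 0"
  shows "cvf f \<le> liminf (\<lambda>k. cvf (g k))"
proof (rule cvf_least[OF f])
  fix \<psi> D :: "real => real^2"
  assume \<psi>: "\<And>t. (\<psi> has_vector_derivative D t) (at t)" "continuous_on UNIV D" "loop D" "\<And>t. \<psi> (t + 2 * pi) = \<psi> t" "\<And>t. norm (\<psi> t) \<le> 1"
  obtain B where B: "\<And>t. norm (D t) \<le> B" using loop_bound[OF \<psi>(3)] by blast
  let ?I = "\<lambda>h. loop_pair h D"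
  have d: "norm (?I (g k) - ?I f) \<le> B * integral {0..2*pi} (\<lambda>t. norm (g k t - f t))" for k
  proof -
    note i1 = loop_integrable(1)[OF loop_inner[OF g \<psi>(3)], of k 0 "2*pi"]
    note i2 = loop_integrable(1)[OF loop_inner[OF f \<psi>(3)], of 0 "2*pi"]
    note i3 = loop_integrable(1)[OF loop_norm_diff(1)[OF g f], of k 0 "2*pi"]
    have "?I (g k) - ?I f = integral {0..2*pi} (\<lambda>t. g k t \<bullet> D t - f t \<bullet> D t)"
      by (rule HK_integral_diff[OF i1 i2, symmetric])
    also have "norm \<dots> \<le> integral {0..2*pi} (\<lambda>t. B * norm (g k t - f t))"
    proof (rule integral_norm_bound_integral)
      show "(\<lambda>t. g k t \<bullet> D t - f t \<bullet> D t) integrable_on {0..2*pi}" by (rule HK_integrable_diff[OF i1 i2])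
      show "(\<lambda>t. B * norm (g k t - f t)) integrable_on {0..2*pi}" using integrable_cmul[OF i3, of B] by simp
      fix t
      have "norm (g k t \<bullet> D t - f t \<bullet> D t) \<le> norm (g k t - f t) * norm (D t)"
        using Cauchy_Schwarz_ineq2[of "g k t - f t" "D t"] by (simp add: inner_diff_left)
      also have "\<dots> \<le> norm (g k t - f t) * B" by (intro mult_left_mono B) simp
      finally show "norm (g k t \<bullet> D t - f t \<bullet> D t) \<le> B * norm (g k t - f t)" by (simp add: mult.commute)
    qed
    finally show ?thesis by simp
  qed
  have "(\<lambda>k. ?I (g k) - ?I f) \<longlonglongrightarrow> 0"
    by (rule Lim_null_comparison[OF always_eventually[OF allI[OF d]]]) (use tendsto_mult_right_zero[OF lim] in simp)
  then have "(\<lambda>k. ?I (g k)) \<longlonglongrightarrow> ?I f" by (simp add: LIM_zero_iff)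
  then have "ennreal (?I f) = liminf (\<lambda>k. ennreal (?I (g k)))"
    by (intro lim_imp_Liminf[symmetric] tendsto_ennrealI) simp
  also have "\<dots> \<le> liminf (\<lambda>k. cvf (g k))"
    by (intro Liminf_mono always_eventually allI cvf_upper[OF g \<psi>(1,2,4,5)])
  finally show "ennreal (?I f) \<le> liminf (\<lambda>k. cvf (g k))" .
qed

text \<open>The annuli of radii \<open>e\<close> to \<open>\<delta>/2\<close> and
  \<open>\<delta>\<close> to \<open>r\<close> carry asymptotically almost \<open>L\<close> per unit
  of radius, while the total tends to \<open>r * L\<close>. What remains for the annulus between
  them is therefore at most about \<open>\<delta> / 2 * L\<close>.\<close>

lemma annulus_concentration:
  fixes w :: "nat => real^2 => real^2" and A G :: "nat => real"
  assumes w: "\<And>k. C1_on (ball 0 r) (w k)" and f: "loop f" "finite (range f)" and L: "cvf f = ennreal L" "L \<ge> 0"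
    and A: "\<And>k. (disk_int r (\<lambda>z. ennreal (norm (w k z - f (angle z))))) = ennreal (A k)" "\<And>k. A k \<ge> 0" "A \<longlonglongrightarrow> 0"
    and G: "\<And>k. (disk_int r (\<lambda>z. ennreal (norm (grad (w k) z)))) = ennreal (G k)" "\<And>k. G k \<ge> 0" "G \<longlonglongrightarrow> r * L"
    and \<delta>: "0 < \<delta>" "\<delta> < r"
    and E: "\<And>k. (disk_int r (\<lambda>z. ennreal (norm (grad (w k) z)) * indicator {\<delta>/2<..<\<delta>} (norm z))) = ennreal (E k)" "\<And>k. E k \<ge> 0"
    and z: "\<delta> / 2 * L < z"
  shows "\<forall>\<^sub>F k in sequentially. E k < z"
proof -
  define \<eta> where "\<eta> = z - \<delta> / 2 * L"
  have \<eta>: "\<eta> > 0" using z by (simp add: \<eta>_def)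
  \<comment> \<open>The number \<open>e\<close> is both the defect of the test function and the
    inner radius that keeps the distance term away from the origin. Half of \<open>\<eta>\<close>
    pays for it, the other half for the errors that vanish with \<open>k\<close>.\<close>
  have "((\<lambda>e. (r - \<delta>) * (L - e) + (\<delta>/2 - e) * (L - e)) \<longlongrightarrow> (r - \<delta>) * (L - 0) + (\<delta>/2 - 0) * (L - 0)) (at_right 0)"
    by (intro tendsto_intros)
  then have "\<forall>\<^sub>F e in at_right 0. (r - \<delta>) * (L - e) + (\<delta>/2 - e) * (L - e) > (r - \<delta>) * L + \<delta>/2 * L - \<eta>/2"
    using \<eta> by (intro order_tendstoD(1)) (auto simp: algebra_simps)
  moreover have "\<forall>\<^sub>F e in at_right 0. e \<in> {0<..<\<delta>/2}" by (rule eventually_at_right_real) (use \<delta> in simp)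
  ultimately have "\<forall>\<^sub>F e in at_right 0. (r - \<delta>) * (L - e) + (\<delta>/2 - e) * (L - e) > (r - \<delta>) * L + \<delta>/2 * L - \<eta>/2 \<and> e \<in> {0<..<\<delta>/2}"
    by (rule eventually_conj)
  then obtain e where e: "(r - \<delta>) * (L - e) + (\<delta>/2 - e) * (L - e) > (r - \<delta>) * L + \<delta>/2 * L - \<eta>/2" "0 < e" "e < \<delta>/2"
    using eventually_happens[of _ "at_right (0::real)"] by fastforce
  have ce: "L - e < L" using e by simp
  obtain \<psi> D Z where \<psi>: "\<And>t. (\<psi> has_vector_derivative D t) (at t)"
    "\<And>t. \<psi> (t + 2 * pi) = \<psi> t" "\<And>t. norm (\<psi> t) \<le> 1" "loop \<psi>" "loop D"
    "Z \<in> sets borel" "emeasure lborel Z \<le> ennreal 1" "\<And>t. t \<in> {0..2*pi} - Z ==> \<psi> t = 0"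
    "L - e \<le> loop_pair f D"
    by (rule concentrated_test_real[OF f L ce zero_less_one], rule that)
  obtain B where B: "\<And>t. norm (D t) \<le> B" "B \<ge> 0" using loop_bound[OF \<psi>(5)] by blast
  define R where "R = (\<lambda>k. G k + (B / \<delta> * A k + B / e * A k))"
  have R0: "R k \<ge> 0" for k unfolding R_def using B A(2) G(2) \<delta> e by (intro add_nonneg_nonneg) auto
  have key: "(r - \<delta>) * (L - e) + (\<delta>/2 - e) * (L - e) + E k \<le> R k" for k
  proof -
    let ?S = "\<lambda>a b. \<integral>\<^sup>+z\<in>ball 0 r. (ennreal (norm (grad (w k) z)) * indicator UNIV (angle z) * indicator {a<..<b} (norm z)) \<partial>lborel"
    have T: "ennreal ((b - a) * (L - e)) \<le> ?S a b + ennreal (B / a * A k)" if "0 < a" "a \<le> b" "b \<le> r" for a b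
    proof -
      have "ennreal (B / a * A k) = ennreal (B / a) * ennreal (A k)" using that B A(2) by (intro ennreal_mult) auto
      then show ?thesis unfolding A(1)[symmetric]
        by (simp only:) (rule test_le_annulus[OF w that f(1) \<psi>(1-5) _ _ B(1) \<psi>(9)], auto)
    qed
    have [measurable]: "(\<lambda>z. ennreal (norm (grad (w k) z)) * indicator (ball 0 r) z) \<in> borel_fun"
      by (rule ball_measurable_pieces(1)[OF w])
    define T where "T = (\<lambda>a b z::real^2. (ennreal (norm (grad (w k) z)) * indicator (ball 0 r) z) * indicator {a<..<b} (norm z))"
    have [measurable]: "T a b \<in> borel_fun" for a b unfolding T_def by measurable
    have ST: "?S a b = (\<integral>\<^sup>+z. T a b z \<partial>lborel)" for a b
      unfolding T_def by (intro nn_integral_cong) (simp add: ac_simps)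
    have ET: "ennreal (E k) = (\<integral>\<^sup>+z. T (\<delta>/2) \<delta> z \<partial>lborel)"
      unfolding E(1)[symmetric] T_def by (intro nn_integral_cong) (simp add: ac_simps)
    have "(\<integral>\<^sup>+z. T \<delta> r z \<partial>lborel) + (\<integral>\<^sup>+z. T e (\<delta>/2) z \<partial>lborel) + (\<integral>\<^sup>+z. T (\<delta>/2) \<delta> z \<partial>lborel) = (\<integral>\<^sup>+z. T \<delta> r z + T e (\<delta>/2) z + T (\<delta>/2) \<delta> z \<partial>lborel)"
      by (subst nn_integral_add, measurable, subst nn_integral_add, measurable)
    also have "\<dots> \<le> ennreal (G k)"
      unfolding G(1)[symmetric] using \<delta> by (intro nn_integral_mono) (auto simp: T_def indicator_def)
    finally have tot: "?S \<delta> r + ?S e (\<delta>/2) + ennreal (E k) \<le> ennreal (G k)" unfolding ST ET .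
    have "ennreal ((r - \<delta>) * (L - e) + (\<delta>/2 - e) * (L - e) + E k) \<le> ennreal ((r - \<delta>) * (L - e)) + ennreal ((\<delta>/2 - e) * (L - e)) + ennreal (E k)"
      by (intro order_trans[OF ennreal_add_subadditive] add_right_mono ennreal_add_subadditive)
    also have "\<dots> \<le> (?S \<delta> r + ennreal (B / \<delta> * A k)) + (?S e (\<delta>/2) + ennreal (B / e * A k)) + ennreal (E k)"
      by (intro add_mono T order_refl) (use \<delta> e in auto)
    also have "\<dots> = (?S \<delta> r + ?S e (\<delta>/2) + ennreal (E k)) + (ennreal (B / \<delta> * A k) + ennreal (B / e * A k))"
      by (simp only: ac_simps)
    also have "\<dots> \<le> ennreal (G k) + (ennreal (B / \<delta> * A k) + ennreal (B / e * A k))" by (intro add_right_mono tot)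
    also have "\<dots> = ennreal (R k)" unfolding R_def using B A(2) G(2) \<delta> e by simp
    finally show ?thesis using R0[of k] by (simp add: ennreal_le_iff)
  qed
  have "R \<longlonglongrightarrow> r * L + (B / \<delta> * 0 + B / e * 0)" unfolding R_def by (intro tendsto_intros A(3) G(3))
  then have "\<forall>\<^sub>F k in sequentially. R k < r * L + \<eta>/2" using \<eta> by (intro order_tendstoD(2)) auto
  then show ?thesis
  proof eventually_elim
    case (elim k)
    have "E k < r * L + \<eta>/2 - ((r - \<delta>) * L + \<delta>/2 * L - \<eta>/2)" using elim key[of k] e(1) by linarith
    also have "\<dots> = z" by (simp add: \<eta>_def algebra_simps)
    finally show ?case .
  qed
qed

text \<open>The traces on good circles of radius between \<open>\<delta>/2\<close> and
  \<open>\<delta>\<close>, dilated to the unit circle, form a sequence admissible in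
  \<open>relaxed_plateau\<close>; each has a \<open>plateau\<close> value at most the Jacobian
  integral over the disk that its circle bounds.\<close>

lemma relaxed_plateau_le_disk:
  fixes w :: "nat => real^2 => real^2" and A G :: "nat => real"
  assumes w: "\<And>k. C1_on (ball 0 r) (w k)" and f: "loop f" "finite (range f)" and L: "cvf f = ennreal L" "L \<ge> 0"
    and A: "\<And>k. (disk_int r (\<lambda>z. ennreal (norm (w k z - f (angle z))))) = ennreal (A k)" "\<And>k. A k \<ge> 0" "A \<longlonglongrightarrow> 0"
    and G: "\<And>k. (disk_int r (\<lambda>z. ennreal (norm (grad (w k) z)))) = ennreal (G k)" "\<And>k. G k \<ge> 0" "G \<longlonglongrightarrow> r * L"
    and \<delta>: "0 < \<delta>" "\<delta> < r"
  shows "relaxed_plateau (\<lambda>x. f (angle x)) \<le> liminf (\<lambda>k. \<integral>\<^sup>+z\<in>ball 0 \<delta>. ennreal \<bar>det (grad (w k) z)\<bar> \<partial>lborel)"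
proof -
  define E where "E = (\<lambda>k. enn2real (disk_int r (\<lambda>z. ennreal (norm (grad (w k) z)) * indicator {\<delta>/2<..<\<delta>} (norm z))))"
  have Eeq: "disk_int r (\<lambda>z. ennreal (norm (grad (w k) z)) * indicator {\<delta>/2<..<\<delta>} (norm z)) = ennreal (E k)" for k
  proof -
    have "disk_int r (\<lambda>z. ennreal (norm (grad (w k) z)) * indicator {\<delta>/2<..<\<delta>} (norm z)) \<le> ennreal (G k)"
      unfolding G(1)[symmetric] by (intro nn_integral_mono) (auto simp: indicator_def)
    from order_le_less_trans[OF this ennreal_less_top] show ?thesis unfolding E_def by (rule ennreal_enn2real[symmetric])
  qed
  have E0: "E k \<ge> 0" for k by (simp add: E_def)
  have Elim: "\<forall>\<^sub>F k in sequentially. E k < z" if "\<delta> / 2 * L < z" for z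
    by (rule annulus_concentration[OF w f L A G \<delta> Eeq E0 that])
  \<comment> \<open>Essentially the square root of the L1 error, with
    \<open>inverse (real (Suc k))\<close> added to keep it positive. The weight
    \<open>M k = 1 / al k\<close> tends to infinity while \<open>M k * A k \<le> al k\<close> tends
    to 0.\<close>
  define al where "al = (\<lambda>k. sqrt (A k + inverse (real (Suc k))))"
  have al0: "al k > 0" for k unfolding al_def using A(2)[of k] by (simp add: add_nonneg_pos del: of_nat_Suc)
  have "al \<longlonglongrightarrow> sqrt (0 + 0)" unfolding al_def by (intro tendsto_intros A(3) LIMSEQ_inverse_real_of_nat)
  then have all: "al \<longlonglongrightarrow> 0" by simp
  define M where "M = (\<lambda>k. 1 / al k)"
  have M0: "M k \<ge> 0" for k unfolding M_def using al0[of k] by simp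
  have MA: "M k * A k \<le> al k" for k
  proof -
    have "al k * al k = A k + inverse (real (Suc k))" unfolding al_def using A(2)[of k] by (simp del: of_nat_Suc)
    then have "A k \<le> al k * al k" by (simp del: of_nat_Suc)
    then show ?thesis unfolding M_def using al0[of k] by (simp add: pos_divide_le_eq)
  qed
  define K where "K = (\<lambda>k. E k + M k / (\<delta>/2) * A k)"
  have K0: "K k \<ge> 0" for k unfolding K_def using E0 M0 A(2) \<delta> by (intro add_nonneg_nonneg mult_nonneg_nonneg) auto
  \<comment> \<open>The common bound for variation and weighted distance on the good circle. Its
    upper limit is at most \<open>L\<close>, because the annulus has width \<open>\<delta>/2\<close>
    and carries at most about \<open>\<delta> / 2 * L\<close>.\<close>
  define U where "U = (\<lambda>k. K k / (\<delta>/2) + inverse (real (Suc k)))"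
  have Ulim: "\<forall>\<^sub>F k in sequentially. U k < z" if z: "L < z" for z
  proof -
    have "(\<lambda>k. al k / (\<delta>/2) / (\<delta>/2) + inverse (real (Suc k))) \<longlonglongrightarrow> 0 / (\<delta>/2) / (\<delta>/2) + 0"
      by (intro tendsto_intros all LIMSEQ_inverse_real_of_nat) (use \<delta> in auto)
    then have "\<forall>\<^sub>F k in sequentially. al k / (\<delta>/2) / (\<delta>/2) + inverse (real (Suc k)) < (z - L) / 2"
      using z by (intro order_tendstoD(2)) auto
    moreover have "\<forall>\<^sub>F k in sequentially. E k < \<delta> / 2 * ((L + z) / 2)"
      by (rule Elim) (use \<delta> z in \<open>intro mult_strict_left_mono, auto\<close>)
    ultimately show ?thesis
    proof eventually_elim
      case (elim k)
      have "U k = E k / (\<delta>/2) + M k * A k / (\<delta>/2) / (\<delta>/2) + inverse (real (Suc k))"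
        unfolding U_def K_def by (simp add: add_divide_distrib del: of_nat_Suc)
      moreover have "E k / (\<delta>/2) < (L + z) / 2" using elim(2) \<delta> by (subst pos_divide_less_eq) (auto simp: mult.commute)
      moreover have "M k * A k / (\<delta>/2) / (\<delta>/2) \<le> al k / (\<delta>/2) / (\<delta>/2)" using MA[of k] \<delta> by (intro divide_right_mono) auto
      moreover have "(L + z) / 2 + (z - L) / 2 = z" by (simp add: field_simps)
      ultimately show "U k < z" using elim(1) by linarith
    qed
  qed
  define P where "P = (\<lambda>k \<rho>. \<delta>/2 < \<rho> \<and> \<rho> < \<delta> \<and> cvf (\<lambda>t. w k (\<rho> *\<^sub>R circ t)) \<le> ennreal (U k) \<and>
    M k * integral {0..2*pi} (\<lambda>t. norm (w k (\<rho> *\<^sub>R circ t) - f t)) \<le> U k)"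
  have "\<exists>\<rho>. P k \<rho>" for k
  proof -
    have e: "inverse (real (Suc k)) > 0" by simp
    have "disk_int r (\<lambda>z. ennreal (norm (grad (w k) z)) * indicator {\<delta>/2<..<\<delta>} (norm z))
      + ennreal (M k / (\<delta>/2)) * (disk_int r (\<lambda>z. ennreal (norm (w k z - f (angle z))))) \<le> ennreal (K k)"
    proof -
      have "ennreal (M k / (\<delta>/2)) * ennreal (A k) = ennreal (M k / (\<delta>/2) * A k)"
        using M0 A(2) \<delta> by (intro ennreal_mult[symmetric]) auto
      moreover have "ennreal (E k) + ennreal (M k / (\<delta>/2) * A k) = ennreal (K k)"
        unfolding K_def using M0[of k] A(2)[of k] E0[of k] \<delta> by (intro ennreal_plus[symmetric]) auto
      ultimately show ?thesis unfolding Eeq A(1) by simp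
    qed
    from good_circle[OF w \<delta> f(1) M0 K0 e this] show ?thesis unfolding P_def U_def by blast
  qed
  then have "\<forall>k. \<exists>\<rho>. P k \<rho>" by blast
  from choice[OF this] obtain \<rho> where P: "\<forall>k. P k (\<rho> k)" ..
  have \<rho>: "\<delta>/2 < \<rho> k" "\<rho> k < \<delta>" "cvf (\<lambda>t. w k (\<rho> k *\<^sub>R circ t)) \<le> ennreal (U k)"
    "M k * integral {0..2*pi} (\<lambda>t. norm (w k (\<rho> k *\<^sub>R circ t) - f t)) \<le> U k" for k
    using P[rule_format, of k] unfolding P_def by blast+
  have \<rho>r: "0 < \<rho> k" "\<rho> k < r" for k using \<rho>(1,2)[of k] \<delta> by auto
  define \<phi> where "\<phi> = (\<lambda>k x. w k (\<rho> k *\<^sub>R x))"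
  have lip: "\<exists>C. C-lipschitz_on (sphere 0 1) (\<phi> k)" for k
    unfolding \<phi>_def by (rule plateau_dilation_le(1)[OF w \<rho>r])
  have gl: "loop (\<lambda>t. \<phi> k (circ t))" for k using lip[of k] lipschitz_sphere_loop(2) by blast
  define I where "I = (\<lambda>k. integral {0..2*pi} (\<lambda>t. norm (\<phi> k (circ t) - f t)))"
  have I0: "I k \<ge> 0" for k
    unfolding I_def by (intro Henstock_Kurzweil_Integration.integral_nonneg loop_integrable(1) loop_norm_diff(1) gl f) auto
  \<comment> \<open>The weighted distance is eventually at most \<open>L + 1\<close>, and dividing
    by the weight multiplies this bound by \<open>al k\<close>.\<close>
  have "I \<longlonglongrightarrow> 0"
  proof (rule tendsto_sandwich[OF _ _ tendsto_const])
    show "\<forall>\<^sub>F k in sequentially. 0 \<le> I k" using I0 by simp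
    have "\<forall>\<^sub>F k in sequentially. U k < L + 1" by (rule Ulim) simp
    then show "\<forall>\<^sub>F k in sequentially. I k \<le> (L + 1) * al k"
    proof eventually_elim
      case (elim k)
      have "I k / al k \<le> L + 1" using \<rho>(4)[of k] elim unfolding I_def \<phi>_def M_def by simp
      then show ?case using al0[of k] by (simp add: pos_divide_le_eq)
    qed
    show "(\<lambda>k. (L + 1) * al k) \<longlonglongrightarrow> 0" using tendsto_mult_right_zero[OF all] by simp
  qed
  then have Ilim: "(\<lambda>k. integral {0..2*pi} (\<lambda>t. norm (\<phi> k (circ t) - f t))) \<longlonglongrightarrow> 0" unfolding I_def .
  let ?F = "\<lambda>x. f (angle x)"
  have cF: "circle_variation ?F = cvf f" by (rule cvf_angle_circ[where g=f, OF loopD(2)[OF f(1)]])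
  have cU: "circle_variation (\<phi> k) \<le> ennreal (U k)" for k
    unfolding circle_variation_eq_cvf \<phi>_def by (rule \<rho>(3))
  \<comment> \<open>Lower semicontinuity bounds the variations from below, the choice of the radii
    from above.\<close>
  have cv: "(\<lambda>k. circle_variation (\<phi> k)) \<longlonglongrightarrow> cvf f"
  proof (rule order_tendstoI)
    fix y assume "y < cvf f"
    also have "cvf f \<le> liminf (\<lambda>k. cvf (\<lambda>t. \<phi> k (circ t)))" by (rule cvf_lsc[OF f(1) gl Ilim])
    finally show "\<forall>\<^sub>F k in sequentially. y < circle_variation (\<phi> k)"
      unfolding circle_variation_eq_cvf by (rule less_LiminfD)
  next
    fix y assume "cvf f < y"
    then obtain z where z: "cvf f < z" "z < y" using dense by blast
    then obtain z' where z': "z = ennreal z'" "z' \<ge> 0" by (cases z) auto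
    then have "L < z'" using z L by (simp add: ennreal_less_iff)
    from Ulim[OF this] show "\<forall>\<^sub>F k in sequentially. circle_variation (\<phi> k) < y"
    proof eventually_elim
      case (elim k)
      have "circle_variation (\<phi> k) \<le> ennreal z'" using order_trans[OF cU ennreal_leI[of "U k" z']] elim by simp
      then show ?case using z z' by simp
    qed
  qed
  have mem: "\<phi> k \<in> circle_BV" for k
    using lint_eq_integral(1)[OF loop_integrable(2)[OF gl]] order_le_less_trans[OF cU ennreal_less_top]
    by (simp add: circle_BV_def)
  have memF: "?F \<in> circle_BV"
    using lint_eq_integral(1)[OF loop_integrable(2)[OF f(1)]] L by (simp add: circle_BV_def angular_circ[OF f(1)] cF)
  have "(LINT t|lebesgue_on {0..2*pi}. norm (\<phi> k (circ t) - ?F (circ t))) = I k" for k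
    unfolding angular_circ[OF f(1)] I_def
    by (rule lint_eq_integral(2)[OF loop_integrable(2)[OF loop_norm_diff(1)[OF gl f(1)]]]) simp
  then have strict: "circle_strict_conv \<phi> ?F"
    unfolding circle_strict_conv_def using mem memF cv \<open>I \<longlonglongrightarrow> 0\<close> by (simp add: cF)
  have "relaxed_plateau ?F \<le> liminf (\<lambda>k. plateau (\<phi> k))"
    unfolding relaxed_plateau_def by (rule INF_lower) (use lip strict in simp)
  also have "\<dots> \<le> liminf (\<lambda>k. \<integral>\<^sup>+z\<in>ball 0 \<delta>. ennreal \<bar>det (grad (w k) z)\<bar> \<partial>lborel)"
  proof (intro Liminf_mono always_eventually allI)
    fix k
    have "plateau (\<phi> k) \<le> disk_int (\<rho> k) (\<lambda>z. ennreal \<bar>det (grad (w k) z)\<bar>)"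
      unfolding \<phi>_def by (rule plateau_dilation_le(2)[OF w \<rho>r])
    also have "\<dots> \<le> disk_int \<delta> (\<lambda>z. ennreal \<bar>det (grad (w k) z)\<bar>)"
      using \<rho>(2)[of k] by (intro nn_integral_mono) (auto simp: indicator_def)
    finally show "plateau (\<phi> k) \<le> disk_int \<delta> (\<lambda>z. ennreal \<bar>det (grad (w k) z)\<bar>)" .
  qed
  finally show ?thesis .
qed

lemma liminf_const_add:
  fixes p :: "nat => ennreal"
  shows "liminf (\<lambda>k. c + p k) = c + liminf p"
  by (rule Liminf_compose_continuous_mono[where f="\<lambda>y. c + y"])
     (auto intro!: continuous_intros monoI add_left_mono)

text \<open>One parameter \<open>e\<close> is at once the radius of the small disk, the measure of
  the set of angles and the defect of the test function. For fixed \<open>e\<close> the L1 error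
  carries the factor \<open>B / e\<close>, so \<open>k\<close> tends to infinity first and
  \<open>e\<close> to 0 afterwards.\<close>

lemma relaxed_area_ge:
  fixes f :: "real => real^2"
  assumes f: "loop f" "finite (range f)" and L: "cvf f = ennreal L" "L \<ge> 0" and r: "r > 0"
  shows "ennreal (pi * r\<^sup>2) + ennreal r * cvf f + relaxed_plateau (\<lambda>x. f (angle x)) \<le> relaxed_area (\<lambda>x. f (angle x)) (ball 0 r)"
  unfolding relaxed_area_def
proof (rule INF_greatest)
  let ?F = "\<lambda>x. f (angle x)"
  fix w assume "w \<in> {w. (\<forall>k. C1_on (ball 0 r) (w k)) \<and> strict_BV_conv (ball 0 r) w ?F}"
  then have w: "C1_on (ball 0 r) (w k)" and wi: "integrable (lebesgue_on (ball 0 r)) (w k)"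
    and wt: "total_variation (ball 0 r) (w k) < \<infinity>" and Fi: "integrable (lebesgue_on (ball 0 r)) ?F"
    and l1: "(\<lambda>k. LINT x|lebesgue_on (ball 0 r). norm (w k x - ?F x)) \<longlonglongrightarrow> 0"
    and tv: "(\<lambda>k. total_variation (ball 0 r) (w k)) \<longlonglongrightarrow> total_variation (ball 0 r) ?F" for k
    by (auto simp: strict_BV_conv_def BV_def)
  define A where "A = (\<lambda>k. LINT x|lebesgue_on (ball 0 r). norm (w k x - ?F x))"
  have A0: "A k \<ge> 0" for k unfolding A_def by simp
  have A: "disk_int r (\<lambda>z. ennreal (norm (w k z - f (angle z)))) = ennreal (A k)" for k
  proof -
    have "disk_int r (\<lambda>z. ennreal (norm (w k z - f (angle z)))) = (\<integral>\<^sup>+z. ennreal (norm (w k z - f (angle z))) \<partial>lebesgue_on (ball 0 r))"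
      by (rule nn_integral_lebesgue_on_lborel[symmetric]) simp
    also have "\<dots> = ennreal (A k)" unfolding A_def
      by (rule nn_integral_eq_integral) (use wi[of k] Fi in auto)
    finally show ?thesis .
  qed
  have Al: "A \<longlonglongrightarrow> 0" unfolding A_def by (rule l1)
  define G where "G = (\<lambda>k. enn2real (total_variation (ball 0 r) (w k)))"
  have G0: "G k \<ge> 0" for k by (simp add: G_def)
  \<comment> \<open>For \<open>C1_on\<close> maps variation and gradient integral coincide, so
    strict convergence becomes convergence of the gradient integrals.\<close>
  have G: "disk_int r (\<lambda>z. ennreal (norm (grad (w k) z))) = ennreal (G k)" for k
    using antisym[OF grad_le_total_variation[OF w r] total_variation_le_grad[OF w]] wt[of k] by (simp add: G_def)
  have "total_variation (ball 0 r) ?F = ennreal (r * L)"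
    using total_variation_angular[OF f(1) r] L r by (simp add: ennreal_mult)
  then have Gl: "G \<longlonglongrightarrow> r * L"
    unfolding G_def using tv L r by (intro tendsto_enn2real) auto
  let ?X = "liminf (\<lambda>k. area (w k) (ball 0 r))"
  have step: "ennreal ((r\<^sup>2 - e\<^sup>2) / 2 * (2 * pi - e)) + ennreal ((r - e) * (L - e)) + relaxed_plateau ?F \<le> ?X" if e: "0 < e" "e < r" for e
  proof -
    let ?D = "\<lambda>k. \<integral>\<^sup>+z\<in>ball 0 e. ennreal \<bar>det (grad (w k) z)\<bar> \<partial>lborel"
    let ?c = "ennreal ((r\<^sup>2 - e\<^sup>2) / 2 * (2 * pi - e)) + ennreal ((r - e) * (L - e))"
    have ce: "L - e < L" using e by simp
    obtain \<psi> D Z where \<psi>: "\<And>t. (\<psi> has_vector_derivative D t) (at t)"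
      "\<And>t. \<psi> (t + 2 * pi) = \<psi> t" "\<And>t. norm (\<psi> t) \<le> 1" "loop \<psi>" "loop D"
      "Z \<in> sets borel" "emeasure lborel Z \<le> ennreal e" "\<And>t. t \<in> {0..2*pi} - Z ==> \<psi> t = 0"
      "L - e \<le> loop_pair f D"
      by (rule concentrated_test_real[OF f L ce e(1)], rule that)
    obtain B where B: "\<And>t. norm (D t) \<le> B" "B \<ge> 0" using loop_bound[OF \<psi>(5)] by blast
    have key: "?c + ?D k \<le> ennreal (B / e * A k) + area (w k) (ball 0 r)" for k
    proof -
      let ?S = "\<integral>\<^sup>+z\<in>ball 0 r. (ennreal (norm (grad (w k) z)) * indicator Z (angle z) * indicator {e<..<r} (norm z)) \<partial>lborel"
      have "ennreal ((r - e) * (L - e)) \<le> ?S + ennreal (B / e) * ennreal (A k)"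
        using test_le_annulus[OF w e(1) less_imp_le[OF e(2)] order_refl f(1) \<psi>(1-6) \<psi>(8) B(1) \<psi>(9)] unfolding A .
      also have "ennreal (B / e) * ennreal (A k) = ennreal (B / e * A k)"
        using B A0 e by (intro ennreal_mult[symmetric]) auto
      finally have 1: "ennreal ((r - e) * (L - e)) \<le> ?S + ennreal (B / e * A k)" .
      have "?c + ?D k \<le> ennreal ((r\<^sup>2 - e\<^sup>2) / 2 * (2 * pi - e)) + (?S + ennreal (B / e * A k)) + ?D k"
        by (intro add_right_mono add_left_mono 1)
      also have "\<dots> = ennreal (B / e * A k) + (ennreal ((r\<^sup>2 - e\<^sup>2) / 2 * (2 * pi - e)) + ?S + ?D k)"
        by (simp only: ac_simps)
      also have "\<dots> \<le> ennreal (B / e * A k) + area (w k) (ball 0 r)"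
        by (intro add_left_mono disk_annulus_area_ge[OF w e \<psi>(6,7) e(1)])
      finally show ?thesis .
    qed
    have "?c + relaxed_plateau ?F \<le> ?c + liminf ?D"
      by (intro add_left_mono relaxed_plateau_le_disk[OF w f L A A0 Al G G0 Gl e])
    also have "\<dots> = liminf (\<lambda>k. ?c + ?D k)" by (rule liminf_const_add[symmetric])
    also have "\<dots> \<le> liminf (\<lambda>k. ennreal (B / e * A k) + area (w k) (ball 0 r))"
      by (intro Liminf_mono always_eventually allI key)
    also have "\<dots> \<le> ennreal 0 + ?X"
      by (intro liminf_add_tendsto_le tendsto_ennrealI tendsto_mult_right_zero Al)
    finally show ?thesis by simp
  qed
  have "((\<lambda>e. ennreal ((r\<^sup>2 - e\<^sup>2) / 2 * (2 * pi - e)) + ennreal ((r - e) * (L - e)) + relaxed_plateau ?F) \<longlongrightarrow>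
    ennreal ((r\<^sup>2 - 0\<^sup>2) / 2 * (2 * pi - 0)) + ennreal ((r - 0) * (L - 0)) + relaxed_plateau ?F) (at_right 0)"
    by (intro tendsto_add tendsto_const tendsto_ennrealI tendsto_intros) auto
  moreover have "\<forall>\<^sub>F e in at_right 0. ennreal ((r\<^sup>2 - e\<^sup>2) / 2 * (2 * pi - e)) + ennreal ((r - e) * (L - e)) + relaxed_plateau ?F \<le> ?X"
    using eventually_at_right_real[OF r] by eventually_elim (rule step, auto)
  ultimately have "ennreal ((r\<^sup>2 - 0\<^sup>2) / 2 * (2 * pi - 0)) + ennreal ((r - 0) * (L - 0)) + relaxed_plateau ?F \<le> ?X"
    by (rule tendsto_upperbound) simp
  then show "ennreal (pi * r\<^sup>2) + ennreal r * cvf f + relaxed_plateau ?F \<le> ?X"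
    using L r by (simp add: ennreal_mult mult.commute)
qed

theorem theorem4p4:
  fixes n :: nat and \<alpha> :: "nat \<Rightarrow> real^2" and \<gamma> u :: "real^2 \<Rightarrow> real^2" and r :: real
  assumes "\<gamma> \<in> circle_BV"
    and "AE t in lebesgue_on {0..2 * pi}. \<gamma> (circ t) \<in> \<alpha> ` {1..n}"
    and "finite (circle_jump_points \<gamma>)"
    and "r > 0"
    and "AE x in lebesgue_on (ball 0 r). u x = \<gamma> (x /\<^sub>R norm x)"
  shows "relaxed_area u (ball 0 r) =
           ennreal (pi * r\<^sup>2) + ennreal r * circle_variation \<gamma> + relaxed_plateau \<gamma>"
proof -
  have int: "integrable (lebesgue_on {0..2*pi}) (\<lambda>t. \<gamma> (circ t))" and bv: "circle_variation \<gamma> < \<infinity>"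
    using assms(1) by (auto simp: circle_BV_def)
  have V: "finite (\<alpha> ` {1..n})" by simp
  obtain f where f: "loop f" "range f \<subseteq> insert 0 (\<alpha> ` {1..n})" "AE t in lborel. t \<in> {0..2*pi} \<longrightarrow> \<gamma> (circ t) = f t"
    by (rule loop_representative[OF int V assms(2)], rule that)
  have fr: "finite (range f)" using f(2) V by (meson finite_insert finite_subset)
  let ?F = "\<lambda>x. f (angle x)"
  have eqc: "AE t in lebesgue_on {0..2*pi}. \<gamma> (circ t) = ?F (circ t)"
    unfolding angular_circ[OF f(1)] using f(3) by (subst AE_restrict_space_iff) (auto intro: AE_completion)
  \<comment> \<open>Off the origin \<open>x /\<^sub>R norm x\<close> is
    \<open>circ (angle x)\<close>, and a null set of angles gives a null set in the disk.\<close>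
  have "AE x in lborel. x \<in> ball (0::real^2) r \<longrightarrow> \<gamma> (x /\<^sub>R norm x) = ?F x"
    using AE_angle[OF f(3), of r] AE_nonzero by eventually_elim (simp add: angle_normalize)
  then have "AE x in lebesgue_on (ball 0 r). \<gamma> (x /\<^sub>R norm x) = ?F x"
    by (subst AE_restrict_space_iff) (auto intro: AE_completion)
  then have equ: "AE x in lebesgue_on (ball 0 r). u x = ?F x"
    using assms(5) by eventually_elim simp
  have cF: "circle_variation \<gamma> = cvf f"
    using circle_variation_cong[OF eqc] cvf_angle_circ[where g=f, OF loopD(2)[OF f(1)]] by simp
  then have fin: "cvf f < \<infinity>" using bv by simp
  then obtain L where L: "cvf f = ennreal L" "L \<ge> 0" by (cases "cvf f") auto
  show ?thesis
    unfolding relaxed_area_cong[OF equ] relaxed_plateau_cong[OF eqc] cF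
    by (rule antisym[OF relaxed_area_le[OF f(1) fin assms(4)] relaxed_area_ge[OF f(1) fr L assms(4)]])
qed

end
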